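(* Let $X$ be a Krull scheme with generic point $\xi$, constant sheaf of rational functions $\mathcal{K}$, and essential valuations $\nu_Y:\mathcal{K}^*\to\imath_Y(\mathbb{Z})$ for the prime divisors $Y\in X$. Let $K$ be an abelian group and $\mathcal{R}$ a $K$-graded sheaf of rings on $X$. Then $\mathcal{R}$ is isomorphic to a Cox sheaf on $X$ if and only if the following hold: (i) the constant sheaf $\mathcal{S}$ assigning $\mathcal{R}_{\xi}$ is $K$-simple with $\deg_K(\mathcal{S}^+)=K$ and $\mathcal{S}_0=\mathcal{K}$; (ii) $\mathcal{R}$ is a $K$-Krull sheaf in $\mathcal{S}$ defined by discrete $K$-valuations $\{\mu_Y\}_Y$, $\mu_Y:\mathcal{S}^+\to\imath_Y(\mathbb{Z})$, indexed by the prime divisors $Y$ of $X$, which restrict to $\{\nu_Y\}_Y$ on $\mathcal{K}^*$; in particular $\mathcal{R}_0=\mathcal{O}_X$; (iii) $\mathrm{div}_K:=\sum_Y\mu_Y:\mathcal{S}^+\to\mathrm{WDiv}$ is surjective and $\mathrm{div}_{K,X}:\mathcal{S}(X)^+\to\mathrm{WDiv}(X)$ has kernel $\mathcal{R}(X)^{+,*}=\mathcal{R}(X)_0^*$. In this case, the required $\mathrm{Cl}(X)$-grading is provided by the natural isomorphism $K\to\mathrm{Cl}(X)$, $\deg_K(f)\mapsto[\mathrm{div}_{K,X}(f)]$ (for $f\in\mathcal{S}(X)^+$).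
   Context: Graded rings. Rings are commutative with $1$; grading groups are abelian and written additively. For a $K$-graded ring $R=\bigoplus_{w\in K}R_w$, $R^+$ is the set of non-zero homogeneous elements, $R^{+,*}$ the group of homogeneous units, $R_0^*$ the group of units of $R_0$, and $\deg_K(f)$ the degree of $f\in R^+$. A morphism of graded rings $R'\to R$ (graded by $K'$, $K$) is a ring homomorphism $\phi$ together with an accompanying group homomorphism $\psi:K'\to K$ such that $\phi(R'_{w})\subseteq R_{\psi(w)}$. $R\ne 0$ is $K$-simple if every element of $R^+$ is a unit. A discrete $K$-valuation on a $K$-simple ring $S$ is a surjective group homomorphism $\nu:S^+\to\mathbb{Z}$ with $\nu(a+b)\ge\min\{\nu(a),\nu(b)\}$ for all $a,b\in S_w\setminus 0$ with $a+b\ne0$, $w\in K$. Krull schemes. A Krull scheme is an integral scheme with a finite cover by spectra of Krull rings. A prime divisor is a point $Y\in X$ with one-codimensional closure; $\mathcal{O}_{X,Y}$ is then a discrete valuation ring of the function field $\mathcal{K}(X)$ with valuation $\nu_{Y,X}$. $\imath_Y(\mathbb{Z})$ is the skyscraper sheaf with sections $\mathbb{Z}$ over $U$ if $Y\in U$ and $0$ otherwise; $\nu_Y:\mathcal{K}^*\to\imath_Y(\mathbb{Z})$ is given by $\nu_{Y,X}$ if $Y\in U$ and by $0$ otherwise. $\mathrm{WDiv}:=\bigoplus_Y\imath_Y(\mathbb{Z})$ is the presheaf of Weil divisors, $\mathrm{div}:=\sum_Y\nu_Y:\mathcal{K}^*\to\mathrm{WDiv}$, and $\mathrm{Cl}$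 is the cokernel presheaf of $\mathrm{div}$. $pr_Y:\mathrm{WDiv}\to\imath_Y(\mathbb{Z})$ is the projection. Open sets are non-empty where relevant. Graded sheaves. A $K$-graded sheaf of rings $\mathcal{F}$ is a sheaf of $K$-graded rings with degree-preserving restriction maps; $\mathcal{F}_w(U)=\mathcal{F}(U)_w$; $\mathcal{F}^+(U)=\mathcal{F}(U)^+$. Morphisms of graded sheaves are accompanied by one group homomorphism of the grading groups. A discrete value sheaf is a sheaf of abelian groups $\mathcal{Z}$ with values in $\{0,\mathbb{Z}\}$ such that $U\mapsto\mathcal{Z}(U)_{\ge0}$ is a subsheaf. A discrete $K$-valuation on a sheaf $\mathcal{S}$ of $K$-simple rings is a morphism $\nu:\mathcal{S}^+\to\mathcal{Z}$ to a discrete value sheaf such that each $\nu_U$ is surjective and either a discrete $K$-valuation or zero; its $K$-valuation sheaf $\mathcal{S}_\nu\subseteq\mathcal{S}$ is the graded subsheaf of rings generated by $\nu^{-1}(\mathcal{Z}_{\ge0})$. A $K$-Krull sheaf in $\mathcal{S}$ defined by $\{\nu_j\}_{j\in J}$ is an intersection $\mathcal{R}=\bigcap_{j}\mathcal{S}_{\nu_j}$ such that for every $U$ and $f\in\mathcal{R}(U)^+$ only finitely many $\nu_{j,U}(f)$ are non-zero. In the theorem $\mathcal{R}$ is regarded as a subsheaf of $\mathcal{S}$ through the canonical map $\mathcal{R}(U)\to\mathcal{R}_\xi$, and the equality $\mathcal{S}_0=\mathcal{K}$ is understood as an identification via an isomorphism of sheaves of rings, used in (ii). Cox sheaves. For a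 subgroup $L\le\mathrm{WDiv}(X)$ the divisorial $\mathcal{O}_X$-algebra is the $L$-graded sheaf $\mathcal{O}_X(L)=\bigoplus_{D\in L}\mathcal{O}_X(D)\cdot\chi^D\subseteq\mathcal{K}[L]$, where $\mathcal{O}_X(D)(U)=\{f\in\mathcal{K}(U);\ f=0\text{ or }\mathrm{div}_U(f)+D_{|U}\ge0\}$. A component-wise isomorphic epimorphism (CIE) of graded presheaves is a morphism $\pi:\mathcal{F}\to\mathcal{G}$ whose accompanying group homomorphism $\psi:L\to K$ is surjective and which restricts to isomorphisms $\mathcal{F}_w\to\mathcal{G}_{\psi(w)}$ for all $w\in L$. A Cox sheaf on $X$ is a $\mathrm{Cl}(X)$-graded sheaf of rings $\mathcal{R}$ for which there is a CIE $\pi:\mathcal{O}_X(\mathrm{WDiv}(X))\to\mathcal{R}$ accompanied by the canonical map $\mathrm{WDiv}(X)\to\mathrm{Cl}(X)$. "Isomorphic to a Cox sheaf" means isomorphic as a graded sheaf of rings, with an accompanying isomorphism $K\cong\mathrm{Cl}(X)$. *)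

theory Defs
  imports
    "HOL-Library.Extended_Nat"
    "HOL-Analysis.Abstract_Topology"
    "HOL-Algebra.QuotRing"
    "HOL-Algebra.Subrings"
    "HOL-Algebra.Product_Groups"
begin

section \<open>Sheaves\<close>

definition presheaf_on ::
  "'p topology \<Rightarrow> ('p set \<Rightarrow> 'a set) \<Rightarrow> ('p set \<Rightarrow> 'p set \<Rightarrow> 'a \<Rightarrow> 'a) \<Rightarrow> bool"
  where
  "presheaf_on X F \<rho> \<longleftrightarrow>
     (\<forall>U V. openin X U \<and> openin X V \<and> V \<subseteq> U \<longrightarrow> \<rho> U V \<in> F U \<rightarrow> F V) \<and>
     (\<forall>U s. openin X U \<and> s \<in> F U \<longrightarrow> \<rho> U U s = s) \<and>
     (\<forall>U V W s. openin X U \<and> openin X V \<and> openin X W \<and> W \<subseteq> V \<and> V \<subseteq> U \<and> s \<in> F U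
        \<longrightarrow> \<rho> V W (\<rho> U V s) = \<rho> U W s)"

text \<open>A cover is a set of open sets; the empty cover forces exactly one section over \<open>{}\<close>.\<close>

definition sheaf_on ::
  "'p topology \<Rightarrow> ('p set \<Rightarrow> 'a set) \<Rightarrow> ('p set \<Rightarrow> 'p set \<Rightarrow> 'a \<Rightarrow> 'a) \<Rightarrow> bool"
  where
  "sheaf_on X F \<rho> \<longleftrightarrow> presheaf_on X F \<rho> \<and>
     (\<forall>C s. (\<forall>U\<in>C. openin X U \<and> s U \<in> F U) \<and>
            (\<forall>U\<in>C. \<forall>V\<in>C. \<rho> U (U \<inter> V) (s U) = \<rho> V (U \<inter> V) (s V))
        \<longrightarrow> (\<exists>!t. t \<in> F (\<Union>C) \<and> (\<forall>U\<in>C. \<rho> (\<Union>C) U t = s U)))"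

record ('p, 'a) ring_presheaf =
  sect :: "'p set \<Rightarrow> 'a ring"
  restr :: "'p set \<Rightarrow> 'p set \<Rightarrow> 'a \<Rightarrow> 'a"

definition ring_presheaf_on :: "'p topology \<Rightarrow> ('p, 'a, 'm) ring_presheaf_scheme \<Rightarrow> bool" where
  "ring_presheaf_on X F \<longleftrightarrow>
     presheaf_on X (\<lambda>U. carrier (sect F U)) (restr F) \<and>
     (\<forall>U. openin X U \<longrightarrow> cring (sect F U)) \<and>
     (\<forall>U V. openin X U \<and> openin X V \<and> V \<subseteq> U \<longrightarrow> restr F U V \<in> ring_hom (sect F U) (sect F V))"

definition ring_sheaf_on :: "'p topology \<Rightarrow> ('p, 'a, 'm) ring_presheaf_scheme \<Rightarrow> bool" where
  "ring_sheaf_on X F \<longleftrightarrow>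
     ring_presheaf_on X F \<and> sheaf_on X (\<lambda>U. carrier (sect F U)) (restr F)"

definition ring_sheaf_iso ::
  "'p topology \<Rightarrow> ('p, 'a, 'm) ring_presheaf_scheme \<Rightarrow> ('p, 'b, 'n) ring_presheaf_scheme
     \<Rightarrow> ('p set \<Rightarrow> 'a \<Rightarrow> 'b) \<Rightarrow> bool" where
  "ring_sheaf_iso X F G \<theta> \<longleftrightarrow>
     (\<forall>U. openin X U \<longrightarrow> \<theta> U \<in> ring_iso (sect F U) (sect G U)) \<and>
     (\<forall>U V s. openin X U \<and> openin X V \<and> V \<subseteq> U \<and> s \<in> carrier (sect F U)
        \<longrightarrow> \<theta> V (restr F U V s) = restr G U V (\<theta> U s))"

subsection \<open>Stalks\<close>

definition germ ::
  "'p topology \<Rightarrow> ('p, 'a, 'm) ring_presheaf_scheme \<Rightarrow> 'p \<Rightarrow> 'p set \<Rightarrow> 'a \<Rightarrow> ('p set \<times> 'a) set" where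
  "germ X F x U s =
     {(V, t). openin X V \<and> x \<in> V \<and> t \<in> carrier (sect F V) \<and>
        (\<exists>W. openin X W \<and> x \<in> W \<and> W \<subseteq> U \<inter> V \<and> restr F U W s = restr F V W t)}"

definition stalk ::
  "'p topology \<Rightarrow> ('p, 'a, 'm) ring_presheaf_scheme \<Rightarrow> 'p \<Rightarrow> ('p set \<times> 'a) set ring" where
  "stalk X F x =
     \<lparr>carrier = {germ X F x U s | U s. openin X U \<and> x \<in> U \<and> s \<in> carrier (sect F U)},
      mult = (\<lambda>c d. \<Union>(U, s)\<in>c. \<Union>(V, t)\<in>d. germ X F x (U \<inter> V)
        (restr F U (U \<inter> V) s \<otimes>\<^bsub>sect F (U \<inter> V)\<^esub> restr F V (U \<inter> V) t)),
      one = germ X F x (topspace X) \<one>\<^bsub>sect F (topspace X)\<^esub>,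
      zero = germ X F x (topspace X) \<zero>\<^bsub>sect F (topspace X)\<^esub>,
      add = (\<lambda>c d. \<Union>(U, s)\<in>c. \<Union>(V, t)\<in>d. germ X F x (U \<inter> V)
        (restr F U (U \<inter> V) s \<oplus>\<^bsub>sect F (U \<inter> V)\<^esub> restr F V (U \<inter> V) t))\<rparr>"

text \<open>The map \<open>F\<^sub>y \<rightarrow> F\<^sub>x\<close> between stalks for \<open>y\<close> in the closure of \<open>x\<close>.\<close>

definition cospecialization ::
  "'p topology \<Rightarrow> ('p, 'a, 'm) ring_presheaf_scheme \<Rightarrow> 'p
     \<Rightarrow> ('p set \<times> 'a) set \<Rightarrow> ('p set \<times> 'a) set" where
  "cospecialization X F x c = (\<Union>(U, s)\<in>c. germ X F x U s)"

section \<open>Localization, fraction fields and spectra\<close>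

text \<open>\<open>loc_frac A M a s\<close> is the fraction \<open>a / s\<close>, an equivalence class of pairs. Operations on classes are
  written as unions over representatives, as for cosets.\<close>

definition loc_frac :: "('r, 'm) ring_scheme \<Rightarrow> 'r set \<Rightarrow> 'r \<Rightarrow> 'r \<Rightarrow> ('r \<times> 'r) set" where
  "loc_frac A M a s =
     {(b, t). b \<in> carrier A \<and> t \<in> M \<and> (\<exists>u\<in>M. u \<otimes>\<^bsub>A\<^esub> (a \<otimes>\<^bsub>A\<^esub> t) = u \<otimes>\<^bsub>A\<^esub> (b \<otimes>\<^bsub>A\<^esub> s))}"

definition localization :: "('r, 'm) ring_scheme \<Rightarrow> 'r set \<Rightarrow> ('r \<times> 'r) set ring" where
  "localization A M =
     \<lparr>carrier = {loc_frac A M a s | a s. a \<in> carrier A \<and> s \<in> M},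
      mult = (\<lambda>c d. \<Union>(a, s)\<in>c. \<Union>(b, t)\<in>d. loc_frac A M (a \<otimes>\<^bsub>A\<^esub> b) (s \<otimes>\<^bsub>A\<^esub> t)),
      one = loc_frac A M \<one>\<^bsub>A\<^esub> \<one>\<^bsub>A\<^esub>,
      zero = loc_frac A M \<zero>\<^bsub>A\<^esub> \<one>\<^bsub>A\<^esub>,
      add = (\<lambda>c d. \<Union>(a, s)\<in>c. \<Union>(b, t)\<in>d.
        loc_frac A M ((a \<otimes>\<^bsub>A\<^esub> t) \<oplus>\<^bsub>A\<^esub> (b \<otimes>\<^bsub>A\<^esub> s)) (s \<otimes>\<^bsub>A\<^esub> t))\<rparr>"

definition fraction_field :: "('r, 'm) ring_scheme \<Rightarrow> ('r \<times> 'r) set ring" where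
  "fraction_field A = localization A (carrier A - {\<zero>\<^bsub>A\<^esub>})"

definition Spec :: "('r, 'm) ring_scheme \<Rightarrow> 'r set topology" where
  "Spec A = topology_generated_by {{P. primeideal P A \<and> f \<notin> P} | f. f \<in> carrier A}"

definition Spec_sheaf ::
  "('r, 'm) ring_scheme \<Rightarrow> ('r set, 'r set \<Rightarrow> ('r \<times> 'r) set) ring_presheaf" where
  "Spec_sheaf A =
    (let loc = (\<lambda>P. localization A (carrier A - P)) in
     \<lparr>sect = (\<lambda>U.
        \<lparr>carrier = {\<sigma> \<in> \<Pi>\<^sub>E P\<in>U. carrier (loc P).
           \<forall>P\<in>U. \<exists>V a f. openin (Spec A) V \<and> P \<in> V \<and> V \<subseteq> U \<and> a \<in> carrier A \<and> f \<in> carrier A \<and>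
             (\<forall>Q\<in>V. f \<notin> Q \<and> \<sigma> Q = loc_frac A (carrier A - Q) a f)},
         mult = (\<lambda>\<sigma> \<tau>. \<lambda>P\<in>U. \<sigma> P \<otimes>\<^bsub>loc P\<^esub> \<tau> P),
         one = (\<lambda>P\<in>U. \<one>\<^bsub>loc P\<^esub>),
         zero = (\<lambda>P\<in>U. \<zero>\<^bsub>loc P\<^esub>),
         add = (\<lambda>\<sigma> \<tau>. \<lambda>P\<in>U. \<sigma> P \<oplus>\<^bsub>loc P\<^esub> \<tau> P)\<rparr>),
      restr = (\<lambda>U V \<sigma>. restrict \<sigma> V)\<rparr>)"

section \<open>Krull schemes\<close>

definition ringed_space_iso ::
  "'p topology \<Rightarrow> ('p, 'a, 'm) ring_presheaf_scheme
     \<Rightarrow> 'q topology \<Rightarrow> ('q, 'b, 'n) ring_presheaf_scheme \<Rightarrow> bool" where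
  "ringed_space_iso X F Y G \<longleftrightarrow>
     (\<exists>h \<phi>. homeomorphic_map X Y h \<and>
        (\<forall>V. openin Y V \<longrightarrow> \<phi> V \<in> ring_iso (sect G V) (sect F {x \<in> topspace X. h x \<in> V})) \<and>
        (\<forall>V W s. openin Y V \<and> openin Y W \<and> W \<subseteq> V \<and> s \<in> carrier (sect G V) \<longrightarrow>
           \<phi> W (restr G V W s) =
           restr F {x \<in> topspace X. h x \<in> V} {x \<in> topspace X. h x \<in> W} (\<phi> V s)))"

text \<open>If an open \<open>U\<close> is isomorphic to \<open>Spec A\<close> then \<open>A \<cong> \<O>(U)\<close>, so it is no restriction that
  \<open>A\<close> ranges over rings on the type of sections of \<open>\<O>\<close>. A space with an open cover by spectra is
  automatically locally ringed, and so are the isomorphisms.\<close>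

definition scheme :: "'p topology \<Rightarrow> ('p, 'r) ring_presheaf \<Rightarrow> bool" where
  "scheme X \<O> \<longleftrightarrow> ring_sheaf_on X \<O> \<and>
     (\<forall>x\<in>topspace X. \<exists>U (A :: 'r ring). openin X U \<and> x \<in> U \<and> cring A \<and>
        ringed_space_iso (subtopology X U) \<O> (Spec A) (Spec_sheaf A))"

definition integral_scheme :: "'p topology \<Rightarrow> ('p, 'r) ring_presheaf \<Rightarrow> bool" where
  "integral_scheme X \<O> \<longleftrightarrow> scheme X \<O> \<and> topspace X \<noteq> {} \<and>
     (\<forall>U. openin X U \<and> U \<noteq> {} \<longrightarrow> domain (sect \<O> U))"

definition discrete_valuation :: "('f, 'm) ring_scheme \<Rightarrow> ('f \<Rightarrow> int) \<Rightarrow> bool" where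
  "discrete_valuation F v \<longleftrightarrow> v \<in> epi (mult_of F) integer_group \<and>
     (\<forall>a\<in>carrier (mult_of F). \<forall>b\<in>carrier (mult_of F).
        a \<oplus>\<^bsub>F\<^esub> b \<noteq> \<zero>\<^bsub>F\<^esub> \<longrightarrow> min (v a) (v b) \<le> v (a \<oplus>\<^bsub>F\<^esub> b))"

definition valuation_ring :: "('f, 'm) ring_scheme \<Rightarrow> ('f \<Rightarrow> int) \<Rightarrow> 'f set" where
  "valuation_ring F v = {f \<in> carrier F. f = \<zero>\<^bsub>F\<^esub> \<or> 0 \<le> v f}"

definition krull_ring :: "('r, 'm) ring_scheme \<Rightarrow> bool" where
  "krull_ring A \<longleftrightarrow> domain A \<and>
     (\<exists>\<V>. (\<forall>v\<in>\<V>. discrete_valuation (fraction_field A) v) \<and>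
        (\<lambda>a. loc_frac A (carrier A - {\<zero>\<^bsub>A\<^esub>}) a \<one>\<^bsub>A\<^esub>) ` carrier A =
          carrier (fraction_field A) \<inter> (\<Inter>v\<in>\<V>. valuation_ring (fraction_field A) v) \<and>
        (\<forall>f\<in>carrier (mult_of (fraction_field A)). finite {v \<in> \<V>. v f \<noteq> 0}))"

definition krull_scheme :: "'p topology \<Rightarrow> ('p, 'r) ring_presheaf \<Rightarrow> bool" where
  "krull_scheme X \<O> \<longleftrightarrow> integral_scheme X \<O> \<and>
     (\<exists>C. finite C \<and> (\<forall>U\<in>C. openin X U) \<and> \<Union>C = topspace X \<and>
        (\<forall>U\<in>C. \<exists>A :: 'r ring. krull_ring A \<and>
           ringed_space_iso (subtopology X U) \<O> (Spec A) (Spec_sheaf A)))"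

definition generic_point :: "'p topology \<Rightarrow> 'p" where
  "generic_point X = (THE x. x \<in> topspace X \<and> X closure_of {x} = topspace X)"

definition irreducible_closed :: "'p topology \<Rightarrow> 'p set \<Rightarrow> bool" where
  "irreducible_closed X Z \<longleftrightarrow> closedin X Z \<and> Z \<noteq> {} \<and>
     (\<forall>A B. closedin X A \<and> closedin X B \<and> Z \<subseteq> A \<union> B \<longrightarrow> Z \<subseteq> A \<or> Z \<subseteq> B)"

definition codimension :: "'p topology \<Rightarrow> 'p set \<Rightarrow> enat" where
  "codimension X Z =
     Sup {enat n | n. \<exists>c. c 0 = Z \<and> (\<forall>i\<le>n. irreducible_closed X (c i)) \<and> (\<forall>i<n. c i \<subset> c (Suc i))}"

definition prime_divisors :: "'p topology \<Rightarrow> 'p set" where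
  "prime_divisors X = {Y \<in> topspace X. codimension X (X closure_of {Y}) = 1}"

subsection \<open>Constant sheaves and rational functions\<close>

text \<open>On an irreducible space the constant sheaf of \<open>Q\<close> has sections \<open>Q\<close> over every non-empty open
  set and the zero ring over the empty one.\<close>

definition const_sect :: "'a ring \<Rightarrow> 'p set \<Rightarrow> 'a ring" where
  "const_sect Q U = (if U = {} then Q\<lparr>carrier := {\<zero>\<^bsub>Q\<^esub>}, one := \<zero>\<^bsub>Q\<^esub>\<rparr> else Q)"

definition const_restr :: "'a ring \<Rightarrow> 'p set \<Rightarrow> 'p set \<Rightarrow> 'a \<Rightarrow> 'a" where
  "const_restr Q U V f = (if V = {} then \<zero>\<^bsub>Q\<^esub> else f)"

definition function_field ::
  "'p topology \<Rightarrow> ('p, 'r) ring_presheaf \<Rightarrow> ('p set \<times> 'r) set ring" where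
  "function_field X \<O> = stalk X \<O> (generic_point X)"

definition rational_sheaf ::
  "'p topology \<Rightarrow> ('p, 'r) ring_presheaf \<Rightarrow> ('p, ('p set \<times> 'r) set) ring_presheaf" where
  "rational_sheaf X \<O> =
     \<lparr>sect = const_sect (function_field X \<O>), restr = const_restr (function_field X \<O>)\<rparr>"

text \<open>The canonical map from a sheaf to the constant sheaf of its generic stalk.\<close>

definition to_generic ::
  "'p topology \<Rightarrow> ('p, 'a, 'm) ring_presheaf_scheme \<Rightarrow> 'p set \<Rightarrow> 'a \<Rightarrow> ('p set \<times> 'a) set" where
  "to_generic X F U s =
     (if U = {} then \<zero>\<^bsub>stalk X F (generic_point X)\<^esub> else germ X F (generic_point X) U s)"

text \<open>The valuation of the function field with valuation ring \<open>\<O>\<^bsub>X,Y\<^esub>\<close>; it is determined by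
  that ring on all non-zero rational functions.\<close>

definition essential_valuation ::
  "'p topology \<Rightarrow> ('p, 'r) ring_presheaf \<Rightarrow> 'p \<Rightarrow> ('p set \<times> 'r) set \<Rightarrow> int" where
  "essential_valuation X \<O> Y =
     (SOME v. discrete_valuation (function_field X \<O>) v \<and>
        valuation_ring (function_field X \<O>) v =
          cospecialization X \<O> (generic_point X) ` carrier (stalk X \<O> Y))"

definition sheaf_valuation ::
  "'p topology \<Rightarrow> ('p, 'r) ring_presheaf \<Rightarrow> 'p \<Rightarrow> 'p set \<Rightarrow> ('p set \<times> 'r) set \<Rightarrow> int" where
  "sheaf_valuation X \<O> Y U f = (if Y \<in> U then essential_valuation X \<O> Y f else 0)"

subsection \<open>Weil divisors and divisor class groups\<close>

record 'p value_presheaf =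
  vsect :: "'p set \<Rightarrow> int monoid"
  vrestr :: "'p set \<Rightarrow> 'p set \<Rightarrow> int \<Rightarrow> int"

definition skyscraper :: "'p \<Rightarrow> 'p value_presheaf" where
  "skyscraper Y =
     \<lparr>vsect = (\<lambda>U. if Y \<in> U then integer_group else singleton_group 0),
      vrestr = (\<lambda>U V z. if Y \<in> V then z else 0)\<rparr>"

definition WDiv :: "'p topology \<Rightarrow> 'p set \<Rightarrow> ('p \<Rightarrow> int) monoid" where
  "WDiv X U = sum_group (prime_divisors X) (\<lambda>Y. vsect (skyscraper Y) U)"

definition WDiv_restr :: "'p topology \<Rightarrow> 'p set \<Rightarrow> 'p set \<Rightarrow> ('p \<Rightarrow> int) \<Rightarrow> 'p \<Rightarrow> int" where
  "WDiv_restr X U V D = (\<lambda>Y\<in>prime_divisors X. vrestr (skyscraper Y) U V (D Y))"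

text \<open>The sum of a family of maps \<open>\<mu>\<^sub>Y\<close> into the skyscraper sheaves, as a map into their direct sum.\<close>

definition divisor_map ::
  "'p topology \<Rightarrow> ('p \<Rightarrow> 'p set \<Rightarrow> 'a \<Rightarrow> int) \<Rightarrow> 'p set \<Rightarrow> 'a \<Rightarrow> 'p \<Rightarrow> int" where
  "divisor_map X \<mu> U f = (\<lambda>Y\<in>prime_divisors X. \<mu> Y U f)"

abbreviation div_sheaf ::
  "'p topology \<Rightarrow> ('p, 'r) ring_presheaf \<Rightarrow> 'p set \<Rightarrow> ('p set \<times> 'r) set \<Rightarrow> 'p \<Rightarrow> int" where
  "div_sheaf X \<O> \<equiv> divisor_map X (sheaf_valuation X \<O>)"

definition principal_divisors ::
  "'p topology \<Rightarrow> ('p, 'r) ring_presheaf \<Rightarrow> 'p set \<Rightarrow> ('p \<Rightarrow> int) set" where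
  "principal_divisors X \<O> U = div_sheaf X \<O> U ` carrier (mult_of (sect (rational_sheaf X \<O>) U))"

definition Cl ::
  "'p topology \<Rightarrow> ('p, 'r) ring_presheaf \<Rightarrow> 'p set \<Rightarrow> ('p \<Rightarrow> int) set monoid" where
  "Cl X \<O> U = WDiv X U Mod principal_divisors X \<O> U"

definition divisor_class ::
  "'p topology \<Rightarrow> ('p, 'r) ring_presheaf \<Rightarrow> 'p set \<Rightarrow> ('p \<Rightarrow> int) \<Rightarrow> ('p \<Rightarrow> int) set" where
  "divisor_class X \<O> U D = principal_divisors X \<O> U #>\<^bsub>WDiv X U\<^esub> D"

section \<open>Graded rings and graded sheaves\<close>

text \<open>Grading groups are commutative groups in the multiplicative notation of the library, so
  \<open>\<one>\<^bsub>K\<^esub>\<close> is degree zero. \<open>decomposition K A S a c\<close>: \<open>a\<close> is the sum of the finitely many non-zero values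
  of the family \<open>c\<close> with \<open>c w \<in> S w\<close>.\<close>

definition decomposition ::
  "('k, 'n) monoid_scheme \<Rightarrow> ('a, 'm) ring_scheme \<Rightarrow> ('k \<Rightarrow> 'a set) \<Rightarrow> 'a \<Rightarrow> ('k \<Rightarrow> 'a) \<Rightarrow> bool" where
  "decomposition K A S a c \<longleftrightarrow> c \<in> (\<Pi>\<^sub>E w\<in>carrier K. S w) \<and>
     finite {w \<in> carrier K. c w \<noteq> \<zero>\<^bsub>A\<^esub>} \<and>
     a = finsum A c {w \<in> carrier K. c w \<noteq> \<zero>\<^bsub>A\<^esub>}"

definition graded_ring ::
  "('k, 'n) monoid_scheme \<Rightarrow> ('a, 'm) ring_scheme \<Rightarrow> ('k \<Rightarrow> 'a set) \<Rightarrow> bool" where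
  "graded_ring K A G \<longleftrightarrow> comm_group K \<and> cring A \<and>
     (\<forall>w\<in>carrier K. additive_subgroup (G w) A) \<and>
     (\<forall>a\<in>carrier A. \<exists>!c. decomposition K A G a c) \<and>
     (\<forall>v\<in>carrier K. \<forall>w\<in>carrier K. \<forall>a\<in>G v. \<forall>b\<in>G w. a \<otimes>\<^bsub>A\<^esub> b \<in> G (v \<otimes>\<^bsub>K\<^esub> w))"

definition homog ::
  "('k, 'n) monoid_scheme \<Rightarrow> ('a, 'm) ring_scheme \<Rightarrow> ('k \<Rightarrow> 'a set) \<Rightarrow> 'a set" where
  "homog K A G = (\<Union>w\<in>carrier K. G w) - {\<zero>\<^bsub>A\<^esub>}"

definition homog_monoid ::
  "('k, 'n) monoid_scheme \<Rightarrow> ('a, 'm) ring_scheme \<Rightarrow> ('k \<Rightarrow> 'a set) \<Rightarrow> 'a monoid" where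
  "homog_monoid K A G = \<lparr>carrier = homog K A G, mult = mult A, one = \<one>\<^bsub>A\<^esub>\<rparr>"

definition hdeg :: "('k, 'n) monoid_scheme \<Rightarrow> ('k \<Rightarrow> 'a set) \<Rightarrow> 'a \<Rightarrow> 'k" where
  "hdeg K G f = (THE w. w \<in> carrier K \<and> f \<in> G w)"

definition graded_simple ::
  "('k, 'n) monoid_scheme \<Rightarrow> ('a, 'm) ring_scheme \<Rightarrow> ('k \<Rightarrow> 'a set) \<Rightarrow> bool" where
  "graded_simple K A G \<longleftrightarrow>
     graded_ring K A G \<and> carrier A \<noteq> {\<zero>\<^bsub>A\<^esub>} \<and> homog K A G \<subseteq> Units A"

definition graded_valuation ::
  "('k, 'n) monoid_scheme \<Rightarrow> ('a, 'm) ring_scheme \<Rightarrow> ('k \<Rightarrow> 'a set) \<Rightarrow> ('a \<Rightarrow> int) \<Rightarrow> bool" where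
  "graded_valuation K A G v \<longleftrightarrow> v \<in> epi (homog_monoid K A G) integer_group \<and>
     (\<forall>w\<in>carrier K. \<forall>a\<in>G w - {\<zero>\<^bsub>A\<^esub>}. \<forall>b\<in>G w - {\<zero>\<^bsub>A\<^esub>}.
        a \<oplus>\<^bsub>A\<^esub> b \<noteq> \<zero>\<^bsub>A\<^esub> \<longrightarrow> min (v a) (v b) \<le> v (a \<oplus>\<^bsub>A\<^esub> b))"

record ('p, 'a, 'k) graded_presheaf = "('p, 'a) ring_presheaf" +
  hcomp :: "'p set \<Rightarrow> 'k \<Rightarrow> 'a set"

definition graded_presheaf_on ::
  "'p topology \<Rightarrow> ('k, 'n) monoid_scheme \<Rightarrow> ('p, 'a, 'k) graded_presheaf \<Rightarrow> bool" where
  "graded_presheaf_on X K F \<longleftrightarrow> ring_presheaf_on X F \<and>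
     (\<forall>U. openin X U \<longrightarrow> graded_ring K (sect F U) (hcomp F U)) \<and>
     (\<forall>U V w. openin X U \<and> openin X V \<and> V \<subseteq> U \<and> w \<in> carrier K
        \<longrightarrow> restr F U V ` hcomp F U w \<subseteq> hcomp F V w)"

definition graded_sheaf_on ::
  "'p topology \<Rightarrow> ('k, 'n) monoid_scheme \<Rightarrow> ('p, 'a, 'k) graded_presheaf \<Rightarrow> bool" where
  "graded_sheaf_on X K F \<longleftrightarrow> graded_presheaf_on X K F \<and> ring_sheaf_on X F"

abbreviation hsect ::
  "('k, 'n) monoid_scheme \<Rightarrow> ('p, 'a, 'k) graded_presheaf \<Rightarrow> 'p set \<Rightarrow> 'a set" where
  "hsect K F U \<equiv> homog K (sect F U) (hcomp F U)"

abbreviation hsect_monoid ::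
  "('k, 'n) monoid_scheme \<Rightarrow> ('p, 'a, 'k) graded_presheaf \<Rightarrow> 'p set \<Rightarrow> 'a monoid" where
  "hsect_monoid K F U \<equiv> homog_monoid K (sect F U) (hcomp F U)"

definition graded_morphism ::
  "'p topology \<Rightarrow> ('k, 'n) monoid_scheme \<Rightarrow> ('p, 'a, 'k) graded_presheaf
     \<Rightarrow> ('l, 'o) monoid_scheme \<Rightarrow> ('p, 'b, 'l) graded_presheaf
     \<Rightarrow> ('k \<Rightarrow> 'l) \<Rightarrow> ('p set \<Rightarrow> 'a \<Rightarrow> 'b) \<Rightarrow> bool" where
  "graded_morphism X K F L G \<psi> \<pi> \<longleftrightarrow> \<psi> \<in> hom K L \<and>
     (\<forall>U. openin X U \<longrightarrow> \<pi> U \<in> ring_hom (sect F U) (sect G U)) \<and>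
     (\<forall>U w. openin X U \<and> w \<in> carrier K \<longrightarrow> \<pi> U ` hcomp F U w \<subseteq> hcomp G U (\<psi> w)) \<and>
     (\<forall>U V s. openin X U \<and> openin X V \<and> V \<subseteq> U \<and> s \<in> carrier (sect F U)
        \<longrightarrow> \<pi> V (restr F U V s) = restr G U V (\<pi> U s))"

definition graded_isomorphism ::
  "'p topology \<Rightarrow> ('k, 'n) monoid_scheme \<Rightarrow> ('p, 'a, 'k) graded_presheaf
     \<Rightarrow> ('l, 'o) monoid_scheme \<Rightarrow> ('p, 'b, 'l) graded_presheaf
     \<Rightarrow> ('k \<Rightarrow> 'l) \<Rightarrow> ('p set \<Rightarrow> 'a \<Rightarrow> 'b) \<Rightarrow> bool" where
  "graded_isomorphism X K F L G \<psi> \<pi> \<longleftrightarrow> graded_morphism X K F L G \<psi> \<pi> \<and> \<psi> \<in> iso K L \<and>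
     (\<forall>U. openin X U \<longrightarrow> \<pi> U \<in> ring_iso (sect F U) (sect G U)) \<and>
     (\<forall>U w. openin X U \<and> w \<in> carrier K \<longrightarrow> \<pi> U ` hcomp F U w = hcomp G U (\<psi> w))"

text \<open>\<open>cie\<close>: component-wise isomorphic epimorphism of graded presheaves.\<close>

definition cie ::
  "'p topology \<Rightarrow> ('k, 'n) monoid_scheme \<Rightarrow> ('p, 'a, 'k) graded_presheaf
     \<Rightarrow> ('l, 'o) monoid_scheme \<Rightarrow> ('p, 'b, 'l) graded_presheaf
     \<Rightarrow> ('k \<Rightarrow> 'l) \<Rightarrow> ('p set \<Rightarrow> 'a \<Rightarrow> 'b) \<Rightarrow> bool" where
  "cie X K F L G \<psi> \<pi> \<longleftrightarrow> graded_morphism X K F L G \<psi> \<pi> \<and> \<psi> \<in> epi K L \<and>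
     (\<forall>U w. openin X U \<and> w \<in> carrier K
        \<longrightarrow> bij_betw (\<pi> U) (hcomp F U w) (hcomp G U (\<psi> w)))"

definition degree_zero_part ::
  "('k, 'n) monoid_scheme \<Rightarrow> ('p, 'a, 'k) graded_presheaf \<Rightarrow> ('p, 'a) ring_presheaf" where
  "degree_zero_part K F =
     \<lparr>sect = (\<lambda>U. (sect F U)\<lparr>carrier := hcomp F U \<one>\<^bsub>K\<^esub>\<rparr>), restr = restr F\<rparr>"

definition regrade ::
  "('k, 'n) monoid_scheme \<Rightarrow> ('k \<Rightarrow> 'l) \<Rightarrow> ('p, 'a, 'k) graded_presheaf
     \<Rightarrow> ('p, 'a, 'l) graded_presheaf" where
  "regrade K \<psi> F =
     \<lparr>sect = sect F, restr = restr F, hcomp = (\<lambda>U c. hcomp F U (inv_into (carrier K) \<psi> c))\<rparr>"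

text \<open>The constant graded sheaf of the generic stalk, whose component of degree \<open>w\<close> consists of the
  germs of sections of degree \<open>w\<close>.\<close>

definition generic_sheaf ::
  "'p topology \<Rightarrow> ('p, 'a, 'k) graded_presheaf \<Rightarrow> ('p, ('p set \<times> 'a) set, 'k) graded_presheaf" where
  "generic_sheaf X F =
    (let \<xi> = generic_point X; Q = stalk X F \<xi> in
     \<lparr>sect = const_sect Q, restr = const_restr Q,
      hcomp = (\<lambda>U w. if U = {} then {\<zero>\<^bsub>Q\<^esub>}
        else {germ X F \<xi> V s | V s. openin X V \<and> \<xi> \<in> V \<and> s \<in> hcomp F V w})\<rparr>)"

section \<open>Krull sheaves\<close>

definition vnonneg :: "'p value_presheaf \<Rightarrow> 'p set \<Rightarrow> int set" where
  "vnonneg Z U = {z \<in> carrier (vsect Z U). 0 \<le> z}"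

definition discrete_value_sheaf :: "'p topology \<Rightarrow> 'p value_presheaf \<Rightarrow> bool" where
  "discrete_value_sheaf X Z \<longleftrightarrow>
     sheaf_on X (\<lambda>U. carrier (vsect Z U)) (vrestr Z) \<and>
     (\<forall>U. openin X U \<longrightarrow> vsect Z U \<in> {singleton_group 0, integer_group}) \<and>
     (\<forall>U V. openin X U \<and> openin X V \<and> V \<subseteq> U \<longrightarrow> vrestr Z U V \<in> hom (vsect Z U) (vsect Z V)) \<and>
     sheaf_on X (vnonneg Z) (vrestr Z)"

text \<open>Over the empty set there are no non-zero homogeneous sections, so all conditions refer to
  non-empty open sets.\<close>

definition sheaf_graded_valuation ::
  "'p topology \<Rightarrow> ('k, 'n) monoid_scheme \<Rightarrow> ('p, 'a, 'k) graded_presheaf \<Rightarrow> 'p value_presheaf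
     \<Rightarrow> ('p set \<Rightarrow> 'a \<Rightarrow> int) \<Rightarrow> bool" where
  "sheaf_graded_valuation X K S Z \<nu> \<longleftrightarrow>
     graded_sheaf_on X K S \<and> discrete_value_sheaf X Z \<and>
     (\<forall>U. openin X U \<and> U \<noteq> {} \<longrightarrow>
        graded_simple K (sect S U) (hcomp S U) \<and>
        \<nu> U \<in> epi (hsect_monoid K S U) (vsect Z U) \<and>
        (graded_valuation K (sect S U) (hcomp S U) (\<nu> U) \<or> (\<forall>f\<in>hsect K S U. \<nu> U f = 0))) \<and>
     (\<forall>U V f. openin X U \<and> openin X V \<and> V \<subseteq> U \<and> V \<noteq> {} \<and> f \<in> hsect K S U
        \<longrightarrow> \<nu> V (restr S U V f) = vrestr Z U V (\<nu> U f))"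

definition graded_subsheaf ::
  "'p topology \<Rightarrow> ('k, 'n) monoid_scheme \<Rightarrow> ('p, 'a, 'k) graded_presheaf \<Rightarrow> ('p set \<Rightarrow> 'a set)
     \<Rightarrow> bool" where
  "graded_subsheaf X K S T \<longleftrightarrow>
     (\<forall>U. openin X U \<longrightarrow> subring (T U) (sect S U) \<and>
        (\<forall>t\<in>T U. \<exists>c. decomposition K (sect S U) (\<lambda>w. hcomp S U w \<inter> T U) t c)) \<and>
     sheaf_on X T (restr S)"

text \<open>The graded subsheaf of rings generated by \<open>\<nu>\<^sup>-\<^sup>1(Z\<^bsub>\<ge>0\<^esub>)\<close>.\<close>

definition valuation_sheaf ::
  "'p topology \<Rightarrow> ('k, 'n) monoid_scheme \<Rightarrow> ('p, 'a, 'k) graded_presheaf \<Rightarrow> 'p value_presheaf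
     \<Rightarrow> ('p set \<Rightarrow> 'a \<Rightarrow> int) \<Rightarrow> 'p set \<Rightarrow> 'a set" where
  "valuation_sheaf X K S Z \<nu> U =
     {f \<in> carrier (sect S U). \<forall>T. graded_subsheaf X K S T \<and>
        (\<forall>V. openin X V \<longrightarrow> {g \<in> hsect K S V. \<nu> V g \<in> vnonneg Z V} \<subseteq> T V) \<longrightarrow> f \<in> T U}"

text \<open>\<open>T\<close> is the \<open>K\<close>-Krull sheaf in \<open>S\<close> defined by \<open>\<nu>\<^sub>j : S\<^sup>+ \<rightarrow> Z\<^sub>j\<close>, \<open>j \<in> J\<close>.\<close>

definition krull_subsheaf ::
  "'p topology \<Rightarrow> ('k, 'n) monoid_scheme \<Rightarrow> ('p, 'a, 'k) graded_presheaf \<Rightarrow> 'j set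
     \<Rightarrow> ('j \<Rightarrow> 'p value_presheaf) \<Rightarrow> ('j \<Rightarrow> 'p set \<Rightarrow> 'a \<Rightarrow> int) \<Rightarrow> ('p set \<Rightarrow> 'a set) \<Rightarrow> bool" where
  "krull_subsheaf X K S J Z \<nu> T \<longleftrightarrow>
     (\<forall>j\<in>J. sheaf_graded_valuation X K S (Z j) (\<nu> j)) \<and>
     (\<forall>U. openin X U \<longrightarrow>
        T U = carrier (sect S U) \<inter> (\<Inter>j\<in>J. valuation_sheaf X K S (Z j) (\<nu> j) U)) \<and>
     (\<forall>U. openin X U \<and> U \<noteq> {} \<longrightarrow> (\<forall>f\<in>T U \<inter> hsect K S U. finite {j \<in> J. \<nu> j U f \<noteq> 0}))"

section \<open>Cox sheaves\<close>

text \<open>The group algebra \<open>F[L]\<close>: finitely supported functions on \<open>L\<close> with convolution.\<close>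

definition group_algebra ::
  "('a, 'm) ring_scheme \<Rightarrow> ('l, 'n) monoid_scheme \<Rightarrow> ('l \<Rightarrow> 'a) ring" where
  "group_algebra F L =
     \<lparr>carrier = {p \<in> carrier L \<rightarrow>\<^sub>E carrier F. finite {l \<in> carrier L. p l \<noteq> \<zero>\<^bsub>F\<^esub>}},
      mult = (\<lambda>p q. \<lambda>l\<in>carrier L.
        \<Oplus>\<^bsub>F\<^esub>m\<in>{m \<in> carrier L. p m \<noteq> \<zero>\<^bsub>F\<^esub>}. p m \<otimes>\<^bsub>F\<^esub> q (inv\<^bsub>L\<^esub> m \<otimes>\<^bsub>L\<^esub> l)),
      one = (\<lambda>l\<in>carrier L. if l = \<one>\<^bsub>L\<^esub> then \<one>\<^bsub>F\<^esub> else \<zero>\<^bsub>F\<^esub>),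
      zero = (\<lambda>l\<in>carrier L. \<zero>\<^bsub>F\<^esub>),
      add = (\<lambda>p q. \<lambda>l\<in>carrier L. p l \<oplus>\<^bsub>F\<^esub> q l)\<rparr>"

definition divisor_sections ::
  "'p topology \<Rightarrow> ('p, 'r) ring_presheaf \<Rightarrow> ('p \<Rightarrow> int) \<Rightarrow> 'p set \<Rightarrow> ('p set \<times> 'r) set set" where
  "divisor_sections X \<O> D U =
     {f \<in> carrier (sect (rational_sheaf X \<O>) U). f = \<zero>\<^bsub>sect (rational_sheaf X \<O>) U\<^esub> \<or>
        (\<forall>Y\<in>prime_divisors X.
           0 \<le> (div_sheaf X \<O> U f \<otimes>\<^bsub>WDiv X U\<^esub> WDiv_restr X (topspace X) U D) Y)}"

text \<open>The divisorial algebra \<open>\<O>\<^sub>X(L)\<close> of a subgroup \<open>L\<close> of \<open>WDiv(X)\<close>; an element of the group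
  algebra is identified with the family of its coefficients.\<close>

definition divisorial_algebra ::
  "'p topology \<Rightarrow> ('p, 'r) ring_presheaf \<Rightarrow> ('p \<Rightarrow> int) set
     \<Rightarrow> ('p, ('p \<Rightarrow> int) \<Rightarrow> ('p set \<times> 'r) set, 'p \<Rightarrow> int) graded_presheaf" where
  "divisorial_algebra X \<O> L =
    (let \<K> = rational_sheaf X \<O>;
         \<A> = (\<lambda>U. group_algebra (sect \<K> U) ((WDiv X (topspace X))\<lparr>carrier := L\<rparr>));
         \<S> = (\<lambda>U. {p \<in> carrier (\<A> U). \<forall>D\<in>L. p D \<in> divisor_sections X \<O> D U}) in
     \<lparr>sect = (\<lambda>U. (\<A> U)\<lparr>carrier := \<S> U\<rparr>),
      restr = (\<lambda>U V p. \<lambda>D\<in>L. restr \<K> U V (p D)),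
      hcomp = (\<lambda>U D. {p \<in> \<S> U. \<forall>E\<in>L. E \<noteq> D \<longrightarrow> p E = \<zero>\<^bsub>sect \<K> U\<^esub>})\<rparr>)"

definition cox_sheaf ::
  "'p topology \<Rightarrow> ('p, 'r) ring_presheaf \<Rightarrow> ('p, 'a, ('p \<Rightarrow> int) set) graded_presheaf \<Rightarrow> bool" where
  "cox_sheaf X \<O> R \<longleftrightarrow> graded_sheaf_on X (Cl X \<O> (topspace X)) R \<and>
     (\<exists>\<pi>. cie X (WDiv X (topspace X))
            (divisorial_algebra X \<O> (carrier (WDiv X (topspace X))))
            (Cl X \<O> (topspace X)) R (divisor_class X \<O> (topspace X)) \<pi>)"

text \<open>A Cox sheaf isomorphic to \<open>R\<close> can be transported to the type of sections of \<open>R\<close>.\<close>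

definition isomorphic_to_cox_sheaf ::
  "'p topology \<Rightarrow> ('p, 'r) ring_presheaf \<Rightarrow> ('k, 'n) monoid_scheme
     \<Rightarrow> ('p, 'a, 'k) graded_presheaf \<Rightarrow> bool" where
  "isomorphic_to_cox_sheaf X \<O> K R \<longleftrightarrow>
     (\<exists>(R' :: ('p, 'a, ('p \<Rightarrow> int) set) graded_presheaf) \<psi> \<pi>.
        cox_sheaf X \<O> R' \<and> graded_isomorphism X K R (Cl X \<O> (topspace X)) R' \<psi> \<pi>)"

section \<open>The characterizing conditions\<close>

text \<open>\<open>\<theta>\<close> is the isomorphism of sheaves of rings identifying \<open>\<K>\<close> with \<open>\<S>\<^sub>0\<close>.\<close>

definition cox_generic_condition ::
  "'p topology \<Rightarrow> ('p, 'r) ring_presheaf \<Rightarrow> ('k, 'n) monoid_scheme \<Rightarrow> ('p, 'a, 'k) graded_presheaf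
     \<Rightarrow> ('p set \<Rightarrow> ('p set \<times> 'r) set \<Rightarrow> ('p set \<times> 'a) set) \<Rightarrow> bool" where
  "cox_generic_condition X \<O> K R \<theta> \<longleftrightarrow>
    (let S = generic_sheaf X R in
      (\<forall>U. openin X U \<and> U \<noteq> {} \<longrightarrow>
         graded_simple K (sect S U) (hcomp S U) \<and>
         hdeg K (hcomp S U) ` hsect K S U = carrier K) \<and>
      ring_sheaf_iso X (rational_sheaf X \<O>) (degree_zero_part K S) \<theta>)"

definition cox_krull_condition ::
  "'p topology \<Rightarrow> ('p, 'r) ring_presheaf \<Rightarrow> ('k, 'n) monoid_scheme \<Rightarrow> ('p, 'a, 'k) graded_presheaf
     \<Rightarrow> ('p set \<Rightarrow> ('p set \<times> 'r) set \<Rightarrow> ('p set \<times> 'a) set)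
     \<Rightarrow> ('p \<Rightarrow> 'p set \<Rightarrow> ('p set \<times> 'a) set \<Rightarrow> int) \<Rightarrow> bool" where
  "cox_krull_condition X \<O> K R \<theta> \<mu> \<longleftrightarrow>
     (\<forall>U. openin X U \<longrightarrow> inj_on (to_generic X R U) (carrier (sect R U))) \<and>
     krull_subsheaf X K (generic_sheaf X R) (prime_divisors X) skyscraper \<mu>
       (\<lambda>U. to_generic X R U ` carrier (sect R U)) \<and>
     (\<forall>Y\<in>prime_divisors X. \<forall>U. openin X U \<and> U \<noteq> {} \<longrightarrow>
        (\<forall>f\<in>carrier (mult_of (sect (rational_sheaf X \<O>) U)).
           \<mu> Y U (\<theta> U f) = sheaf_valuation X \<O> Y U f))"

definition cox_divisor_condition ::
  "'p topology \<Rightarrow> ('k, 'n) monoid_scheme \<Rightarrow> ('p, 'a, 'k) graded_presheaf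
     \<Rightarrow> ('p \<Rightarrow> 'p set \<Rightarrow> ('p set \<times> 'a) set \<Rightarrow> int) \<Rightarrow> bool" where
  "cox_divisor_condition X K R \<mu> \<longleftrightarrow>
    (let S = generic_sheaf X R; X0 = topspace X in
      (\<forall>U. openin X U \<and> U \<noteq> {} \<longrightarrow>
         divisor_map X \<mu> U ` hsect K S U = carrier (WDiv X U)) \<and>
      kernel (hsect_monoid K S X0) (WDiv X X0) (divisor_map X \<mu> X0) =
        to_generic X R X0 ` (hsect K R X0 \<inter> Units (sect R X0)) \<and>
      hsect K R X0 \<inter> Units (sect R X0) = Units (sect (degree_zero_part K R) X0))"

definition degree_zero_is_structure_sheaf ::
  "'p topology \<Rightarrow> ('p, 'r) ring_presheaf \<Rightarrow> ('k, 'n) monoid_scheme \<Rightarrow> ('p, 'a, 'k) graded_presheaf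
     \<Rightarrow> ('p set \<Rightarrow> ('p set \<times> 'r) set \<Rightarrow> ('p set \<times> 'a) set) \<Rightarrow> bool" where
  "degree_zero_is_structure_sheaf X \<O> K R \<theta> \<longleftrightarrow>
     (\<forall>U. openin X U \<longrightarrow>
        to_generic X R U ` carrier (sect (degree_zero_part K R) U) =
        \<theta> U ` to_generic X \<O> U ` carrier (sect \<O> U))"

end

theory Submission
  imports Defs
begin

text \<open>On an affine chart the prime divisors are the height one primes of a Krull ring, whose
  localizations are exactly its essential valuation rings; so \<open>\<O>(U)\<close> consists of the rational functions
  that are non-negative along all \<open>Y \<in> U\<close>, and any finite set of prime divisors is the set of prime
  divisors missing from some open set.
  Given the \<open>\<mu>\<^sub>Y\<close>, choose homogeneous \<open>\<tau>\<^sub>Y\<close> with divisor \<open>Y\<close>. Multiplicativity gives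
  \<open>\<sigma> : WDiv(X) \<rightarrow> \<S>\<^sup>+\<close> with \<open>div\<^sub>K (\<sigma> D) = D\<close>, and \<open>f \<chi>\<^sup>D \<mapsto> f \<sigma>(D)\<close> is a component-wise isomorphic
  epimorphism, because two homogeneous elements of the same degree differ by a rational function.
  Conversely, every homogeneous rational section of a Cox sheaf is the image of a monomial \<open>f \<chi>\<^sup>D\<close>, and
  \<open>\<mu>\<^sub>Y(f \<chi>\<^sup>D) := \<nu>\<^sub>Y(f) + D(Y)\<close> is well defined since \<open>f \<chi>\<^sup>D \<mapsto> 1\<close> forces \<open>div(f) + D = 0\<close>.\<close>

section \<open>Discrete valuations and families defining Krull rings\<close>

text \<open>Two notions of divisor have to be reconciled. A Krull ring comes with some family of
  discrete valuations, which may be redundant: several members may share a centre, and a centre need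
  not have height one. A prime divisor is a point whose closure has codimension one, measured by
  chains of closed sets of the whole space. The bridge is that the localization at a prime P is cut
  out by the valuations with centre inside P, finite character supplying a common denominator for
  the others. A minimality argument then shows that the height one primes alone suffice. The other
  obstacle is that a monomial f chi^D is a section only where the poles of f are bounded by D. Since
  the exceptions can be avoided on a non-empty open set, and any two such sets meet, its germ at the
  generic point exists and is well defined for all f and D. This makes the generic stalk of a Cox
  sheaf computable. In the opposite direction, the kernel in (iii) is what makes K -> Cl(X)
  injective: an element with divisor zero is a unit of R(X) and therefore has degree zero.\<close>

locale discretely_valued_field = field F for F (structure) +
  fixes v
  assumes dv: "discrete_valuation F v"
begin

lemma val_mult [simp]:
  assumes "x \<in> carrier F" "x \<noteq> \<zero>" "y \<in> carrier F" "y \<noteq> \<zero>"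
  shows "v (x \<otimes> y) = v x + v y"
  using dv assms by (auto simp: discrete_valuation_def epi_def hom_def)

lemma val_one [simp]: "v \<one> = 0"
  using val_mult[of \<one> \<one>] by simp

lemma val_inv [simp]:
  assumes "x \<in> carrier F" "x \<noteq> \<zero>"
  shows "v (inv x) = - v x"
proof -
  have "inv x \<in> carrier F" "inv x \<noteq> \<zero>" "x \<otimes> inv x = \<one>"
    using assms field_Units Units_inv_Units[of x] by (auto simp: Units_r_inv)
  then show ?thesis using val_mult[of x "inv x"] assms by simp
qed

lemma val_add:
  assumes "x \<in> carrier F" "x \<noteq> \<zero>" "y \<in> carrier F" "y \<noteq> \<zero>" "x \<oplus> y \<noteq> \<zero>"
  shows "min (v x) (v y) \<le> v (x \<oplus> y)"
  using dv assms by (auto simp: discrete_valuation_def)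

text \<open>The integers have no 2-torsion, so (-1)^2 = 1 forces the value of -1 to be 0.\<close>

lemma val_minus [simp]:
  assumes "x \<in> carrier F" "x \<noteq> \<zero>"
  shows "v (\<ominus> x) = v x"
proof -
  have n: "\<ominus> \<one> \<noteq> \<zero>" using minus_equality by fastforce
  have "v (\<ominus> \<one> \<otimes> \<ominus> \<one>) = v (\<ominus> \<one>) + v (\<ominus> \<one>)" by (rule val_mult) (use n in auto)
  moreover have "\<ominus> \<one> \<otimes> \<ominus> \<one> = \<one>" using l_minus r_minus by simp
  ultimately have "v (\<ominus> \<one>) = 0" by simp
  moreover have "\<ominus> x = \<ominus> \<one> \<otimes> x" using assms l_minus by simp
  ultimately show ?thesis using val_mult[of "\<ominus> \<one>" x] n assms by simp
qed

text \<open>Writing x = (x + y) + (-y), a value of x + y above v x would give both summands, and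
  hence x itself, a value greater than v x.\<close>

lemma val_add_strict:
  assumes "x \<in> carrier F" "x \<noteq> \<zero>" "y \<in> carrier F" "y \<noteq> \<zero>" "v x < v y"
  shows "x \<oplus> y \<noteq> \<zero>" "v (x \<oplus> y) = v x"
proof -
  show nz: "x \<oplus> y \<noteq> \<zero>"
  proof
    assume "x \<oplus> y = \<zero>"
    then have "x = \<ominus> y" using assms minus_equality by metis
    then show False using assms by simp
  qed
  have "min (v (x \<oplus> y)) (v (\<ominus> y)) \<le> v ((x \<oplus> y) \<oplus> \<ominus> y)"
  proof (rule val_add)
    show "\<ominus> y \<noteq> \<zero>" using assms(3,4) by (metis minus_minus minus_zero)
    show "x \<oplus> y \<oplus> \<ominus> y \<noteq> \<zero>" using assms a_assoc r_neg by simp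
  qed (use assms nz in auto)
  moreover have "(x \<oplus> y) \<oplus> \<ominus> y = x" using assms a_assoc r_neg by simp
  ultimately show "v (x \<oplus> y) = v x" using val_add[OF assms(1-4) nz] assms by simp
qed

lemma val_pow [simp]:
  assumes "x \<in> carrier F" "x \<noteq> \<zero>"
  shows "x [^] (n::nat) \<noteq> \<zero>" "v (x [^] n) = int n * v x"
proof -
  have "x [^] n \<noteq> \<zero> \<and> v (x [^] n) = int n * v x"
  proof (induction n)
    case (Suc n)
    then show ?case using assms integral by (auto simp: algebra_simps)
  qed auto
  then show "x [^] n \<noteq> \<zero>" "v (x [^] n) = int n * v x" by auto
qed

lemma val_surj: "\<exists>x\<in>carrier F - {\<zero>}. v x = n"
  using dv by (auto simp: discrete_valuation_def epi_def integer_group_def image_iff) (metis UNIV_I image_iff Diff_iff singletonI)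

end

section \<open>Centres and localizations for a family of valuations defining a Krull ring\<close>

definition center :: "('r, 'm) ring_scheme \<Rightarrow> ('f, 'n) ring_scheme \<Rightarrow> ('r \<Rightarrow> 'f) \<Rightarrow> ('f \<Rightarrow> int) \<Rightarrow> 'r set" where
  "center A F j v = {a \<in> carrier A. a = \<zero>\<^bsub>A\<^esub> \<or> 0 < v (j a)}"

definition height_one :: "('r, 'm) ring_scheme \<Rightarrow> 'r set \<Rightarrow> bool" where
  "height_one A P \<longleftrightarrow> primeideal P A \<and> P \<noteq> {\<zero>\<^bsub>A\<^esub>} \<and> (\<forall>Q. primeideal Q A \<and> Q \<subset> P \<longrightarrow> Q = {\<zero>\<^bsub>A\<^esub>})"

text \<open>The localization at P as a subset of F. Denominators are cleared, so that membership is
  an equation between products and needs no inverses in F.\<close>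

definition fractions_at :: "('r, 'm) ring_scheme \<Rightarrow> ('f, 'n) ring_scheme \<Rightarrow> ('r \<Rightarrow> 'f) \<Rightarrow> 'r set \<Rightarrow> 'f set" where
  "fractions_at A F j P = {x \<in> carrier F. \<exists>a\<in>carrier A. \<exists>s\<in>carrier A - P. x \<otimes>\<^bsub>F\<^esub> j s = j a}"

text \<open>A is kept apart from its image in F because ring elements and classes of fractions have
  different types. The family \<open>V\<close> is arbitrary: its members need not be essential, and
  distinct members may have the same centre.\<close>

locale krull_family =
  A: domain A + F: field F for A :: "('r, 'm) ring_scheme" (structure) and F :: "('f, 'n) ring_scheme" (structure) +
  fixes j :: "'r \<Rightarrow> 'f" and V :: "('f \<Rightarrow> int) set"
  assumes j_hom: "j \<in> ring_hom A F"
    and j_inj: "inj_on j (carrier A)"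
    and frac: "x \<in> carrier F \<Longrightarrow> \<exists>a\<in>carrier A. \<exists>s\<in>carrier A - {\<zero>\<^bsub>A\<^esub>}. x \<otimes>\<^bsub>F\<^esub> j s = j a"
    and val: "v \<in> V \<Longrightarrow> discrete_valuation F v"
    and defines_A: "j ` carrier A = carrier F \<inter> (\<Inter>v\<in>V. valuation_ring F v)"
    and fin: "x \<in> carrier F \<Longrightarrow> x \<noteq> \<zero>\<^bsub>F\<^esub> \<Longrightarrow> finite {v \<in> V. v x \<noteq> 0}"
begin

abbreviation ctr where "ctr \<equiv> center A F j"
abbreviation loc where "loc \<equiv> fractions_at A F j"

lemma V_field: "v \<in> V \<Longrightarrow> discretely_valued_field F v"
  using val by (intro discretely_valued_field.intro) (auto simp: discretely_valued_field_axioms_def F.field_axioms)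

lemma j_closed [simp]: "a \<in> carrier A \<Longrightarrow> j a \<in> carrier F"
  and j_add [simp]: "a \<in> carrier A \<Longrightarrow> b \<in> carrier A \<Longrightarrow> j (a \<oplus>\<^bsub>A\<^esub> b) = j a \<oplus>\<^bsub>F\<^esub> j b"
  and j_mult [simp]: "a \<in> carrier A \<Longrightarrow> b \<in> carrier A \<Longrightarrow> j (a \<otimes>\<^bsub>A\<^esub> b) = j a \<otimes>\<^bsub>F\<^esub> j b"
  and j_one [simp]: "j \<one>\<^bsub>A\<^esub> = \<one>\<^bsub>F\<^esub>"
  using j_hom by (auto simp: ring_hom_def)

lemma j_zero [simp]: "j \<zero>\<^bsub>A\<^esub> = \<zero>\<^bsub>F\<^esub>"
  using ring_hom_zero[OF j_hom A.ring_axioms F.ring_axioms] .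

lemma j_eq_zero [simp]: "a \<in> carrier A \<Longrightarrow> j a = \<zero>\<^bsub>F\<^esub> \<longleftrightarrow> a = \<zero>\<^bsub>A\<^esub>"
  using j_inj j_zero by (metis A.zero_closed inj_onD)

lemma val_j_nonneg:
  assumes "v \<in> V" "a \<in> carrier A" "a \<noteq> \<zero>\<^bsub>A\<^esub>"
  shows "0 \<le> v (j a)"
proof -
  have "j a \<in> valuation_ring F v" using defines_A assms by blast
  then show ?thesis using assms by (simp add: valuation_ring_def)
qed

lemma in_A_iff: "x \<in> j ` carrier A \<longleftrightarrow> x \<in> carrier F \<and> (x = \<zero>\<^bsub>F\<^esub> \<or> (\<forall>v\<in>V. 0 \<le> v x))"
  unfolding defines_A by (auto simp: valuation_ring_def)

lemma center_mem: "a \<in> ctr v \<longleftrightarrow> a \<in> carrier A \<and> (a = \<zero>\<^bsub>A\<^esub> \<or> 0 < v (j a))"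
  by (auto simp: center_def)

lemma center_prime:
  assumes v: "v \<in> V"
  shows "primeideal (ctr v) A"
proof -
  interpret v: discretely_valued_field F v using V_field[OF v] .
  have 1: "\<one>\<^bsub>A\<^esub> \<notin> ctr v" by (simp add: center_mem)
  have add: "a \<oplus>\<^bsub>A\<^esub> b \<in> ctr v" if "a \<in> ctr v" "b \<in> ctr v" for a b
  proof (cases "a = \<zero>\<^bsub>A\<^esub> \<or> b = \<zero>\<^bsub>A\<^esub> \<or> a \<oplus>\<^bsub>A\<^esub> b = \<zero>\<^bsub>A\<^esub>")
    case True then show ?thesis using that by (auto simp: center_mem)
  next
    case False
    then have "j a \<oplus>\<^bsub>F\<^esub> j b \<noteq> \<zero>\<^bsub>F\<^esub>" using that j_eq_zero[of "a \<oplus>\<^bsub>A\<^esub> b"] by (auto simp: center_mem)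
    then show ?thesis using False that v.val_add[of "j a" "j b"] by (auto simp: center_mem)
  qed
  have mul: "x \<otimes>\<^bsub>A\<^esub> a \<in> ctr v" if "a \<in> ctr v" "x \<in> carrier A" for a x
  proof (cases "a = \<zero>\<^bsub>A\<^esub> \<or> x = \<zero>\<^bsub>A\<^esub>")
    case True then show ?thesis using that by (auto simp: center_mem)
  next
    case False
    then show ?thesis using that val_j_nonneg[OF v, of x] by (auto simp: center_mem)
  qed
  have neg: "\<ominus>\<^bsub>A\<^esub> a \<in> ctr v" if "a \<in> ctr v" for a
  proof -
    have "\<ominus>\<^bsub>A\<^esub> a = (\<ominus>\<^bsub>A\<^esub> \<one>\<^bsub>A\<^esub>) \<otimes>\<^bsub>A\<^esub> a" using that A.l_minus by (simp add: center_mem)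
    then show ?thesis using mul[OF that, of "\<ominus>\<^bsub>A\<^esub> \<one>\<^bsub>A\<^esub>"] by simp
  qed
  have "ideal (ctr v) A"
  proof (rule idealI)
    have "\<zero>\<^bsub>A\<^esub> \<in> ctr v" by (simp add: center_mem)
    then show "subgroup (ctr v) (add_monoid A)"
      by (intro A.add.subgroupI) (use add neg in \<open>auto simp: center_def a_inv_def[symmetric]\<close>)
    show "a \<otimes>\<^bsub>A\<^esub> x \<in> ctr v" if "a \<in> ctr v" "x \<in> carrier A" for a x
      using mul[OF that] A.m_comm[of x a] that by (simp add: center_mem)
  qed (use mul A.ring_axioms in auto)
  then show ?thesis
  proof (rule primeidealI)
    show "carrier A \<noteq> ctr v" using 1 by blast
    fix a b assume ab: "a \<in> carrier A" "b \<in> carrier A" "a \<otimes>\<^bsub>A\<^esub> b \<in> ctr v"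
    show "a \<in> ctr v \<or> b \<in> ctr v"
    proof (cases "a = \<zero>\<^bsub>A\<^esub> \<or> b = \<zero>\<^bsub>A\<^esub>")
      case False
      then have "a \<otimes>\<^bsub>A\<^esub> b \<noteq> \<zero>\<^bsub>A\<^esub>" using ab A.integral by blast
      then show ?thesis using ab False v.val_mult[of "j a" "j b"] by (auto simp: center_mem)
    qed (auto simp: center_mem)
  qed (use A.is_cring in auto)
qed

text \<open>Values on A are never negative, so outside the centre only the value 0 is left.\<close>

lemma not_center: "v \<in> V \<Longrightarrow> s \<in> carrier A \<Longrightarrow> s \<notin> ctr v \<Longrightarrow> s \<noteq> \<zero>\<^bsub>A\<^esub> \<and> v (j s) = 0"
  using val_j_nonneg[of v s] by (force simp: center_mem)

text \<open>Surjectivity of v gives some x = a / s of value 1, and then v (j a) = 1 + v (j s) is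
  positive.\<close>

lemma center_ne:
  assumes v: "v \<in> V" shows "ctr v \<noteq> {\<zero>\<^bsub>A\<^esub>}"
proof -
  interpret v: discretely_valued_field F v using V_field[OF v] .
  obtain x where x: "x \<in> carrier F" "x \<noteq> \<zero>\<^bsub>F\<^esub>" "v x = 1" using v.val_surj[of 1] by blast
  obtain a s where as: "a \<in> carrier A" "s \<in> carrier A" "s \<noteq> \<zero>\<^bsub>A\<^esub>" "x \<otimes>\<^bsub>F\<^esub> j s = j a"
    using frac[OF x(1)] by blast
  have "a \<noteq> \<zero>\<^bsub>A\<^esub>" using as x F.integral[of x "j s"] by auto
  moreover have "v (j a) = 1 + v (j s)" using as x v.val_mult[of x "j s"] by simp
  ultimately have "a \<in> ctr v" using as val_j_nonneg[OF v, of s] by (auto simp: center_mem)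
  then show ?thesis using \<open>a \<noteq> \<zero>\<^bsub>A\<^esub>\<close> by blast
qed

lemma prime_mult: "primeideal P A \<Longrightarrow> a \<in> carrier A - P \<Longrightarrow> b \<in> carrier A - P \<Longrightarrow> a \<otimes>\<^bsub>A\<^esub> b \<in> carrier A - P"
  by (auto dest: primeideal.I_prime)

lemma prime_one: "primeideal P A \<Longrightarrow> \<one>\<^bsub>A\<^esub> \<in> carrier A - P"
  using A.one_closed ideal.one_imp_carrier primeideal.I_notcarr primeideal.axioms(1) by fastforce

lemma prime_zero: "primeideal P A \<Longrightarrow> \<zero>\<^bsub>A\<^esub> \<in> P"
  by (simp add: additive_subgroup.zero_closed ideal.axioms(1) primeideal.axioms(1))

lemma prime_pow:
  assumes P: "primeideal P A" and s: "s \<in> carrier A - P" shows "s [^]\<^bsub>A\<^esub> (n::nat) \<in> carrier A - P"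
proof (induction n)
  case 0 then show ?case using prime_one[OF P] by simp
next
  case (Suc n) then show ?case using prime_mult[OF P Suc s] by simp
qed

lemma j_pow: "s \<in> carrier A \<Longrightarrow> j (s [^]\<^bsub>A\<^esub> (n::nat)) = j s [^]\<^bsub>F\<^esub> n"
  by (induction n) auto

text \<open>A valuation whose centre is not inside P is positive on some t outside P. Multiplying by
  a high power of t raises this value as far as required, lowers no other value of the family and
  stays outside the prime P; finitely many valuations are treated in turn.\<close>

lemma common_denominator:
  assumes P: "primeideal P A" and S: "finite S" "S \<subseteq> V" "\<And>v. v \<in> S \<Longrightarrow> \<not> ctr v \<subseteq> P"
  shows "\<exists>s\<in>carrier A - P. \<forall>v\<in>S. n v \<le> v (j s)"
  using S
proof (induction S)
  case empty then show ?case using prime_one[OF P] by blast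
next
  case (insert u S)
  then obtain s where s: "s \<in> carrier A - P" "\<forall>v\<in>S. n v \<le> v (j s)" by auto
  obtain t where t: "t \<in> ctr u" "t \<notin> P" using insert.prems by blast
  have t': "t \<in> carrier A - P" "t \<noteq> \<zero>\<^bsub>A\<^esub>" "0 < u (j t)" using t prime_zero[OF P] by (auto simp: center_mem)
  define r where "r = s \<otimes>\<^bsub>A\<^esub> t [^]\<^bsub>A\<^esub> nat (n u)"
  have r: "r \<in> carrier A - P" unfolding r_def by (intro prime_mult[OF P] prime_pow[OF P] s t')
  have s0: "s \<noteq> \<zero>\<^bsub>A\<^esub>" using s prime_zero[OF P] by blast
  have eq: "v (j r) = v (j s) + int (nat (n u)) * v (j t)" if "v \<in> V" for v
  proof -
    interpret v: discretely_valued_field F v using V_field[OF that] .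
    show ?thesis using s t' s0 j_eq_zero[of s] j_eq_zero[of t] v.val_mult[of "j s" "j t [^]\<^bsub>F\<^esub> nat (n u)"] v.val_pow[of "j t" "nat (n u)"]
      by (auto simp: r_def j_pow)
  qed
  have "n v \<le> v (j r)" if "v \<in> insert u S" for v
  proof (cases "v \<in> S")
    case True
    have "v \<in> V" using that insert by auto
    then have "0 \<le> int (nat (n u)) * v (j t)" using val_j_nonneg[of v t] t' by auto
    then show ?thesis using eq[OF \<open>v \<in> V\<close>] s(2) True by fastforce
  next
    case False
    have vu: "v = u" "u \<in> V" using that False insert by auto
    have "int (nat (n u)) * 1 \<le> int (nat (n u)) * u (j t)" using t' by (intro mult_left_mono) auto
    then show ?thesis using vu eq[OF vu(2)] val_j_nonneg[OF vu(2), of s] s(1) s0 by auto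
  qed
  then show ?case using r by blast
qed

text \<open>Valuations with centre inside P take the value 0 on all denominators, so they stay
  non-negative on the localization. The remaining valuations impose nothing: only finitely many are
  negative on x, and \<open>common_denominator\<close> removes these poles with an s outside P, so
  that x s lies in A.\<close>

lemma loc_iff:
  assumes P: "primeideal P A"
  shows "x \<in> loc P \<longleftrightarrow> x \<in> carrier F \<and> (x = \<zero>\<^bsub>F\<^esub> \<or> (\<forall>v\<in>V. ctr v \<subseteq> P \<longrightarrow> 0 \<le> v x))"
proof
  assume "x \<in> loc P"
  then obtain a s where as: "x \<in> carrier F" "a \<in> carrier A" "s \<in> carrier A - P" "x \<otimes>\<^bsub>F\<^esub> j s = j a"
    by (auto simp: fractions_at_def)
  have "0 \<le> v x" if v: "v \<in> V" "ctr v \<subseteq> P" and x0: "x \<noteq> \<zero>\<^bsub>F\<^esub>" for v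
  proof -
    interpret v: discretely_valued_field F v using V_field[OF v(1)] .
    have s: "s \<noteq> \<zero>\<^bsub>A\<^esub>" "v (j s) = 0" using not_center[OF v(1), of s] as v by auto
    have "a \<noteq> \<zero>\<^bsub>A\<^esub>" using as x0 s F.integral[of x "j s"] by auto
    then have "0 \<le> v (j a)" using val_j_nonneg[OF v(1)] as by blast
    then show ?thesis using as s x0 v.val_mult[of x "j s"] by auto
  qed
  then show "x \<in> carrier F \<and> (x = \<zero>\<^bsub>F\<^esub> \<or> (\<forall>v\<in>V. ctr v \<subseteq> P \<longrightarrow> 0 \<le> v x))" using as by blast
next
  assume x: "x \<in> carrier F \<and> (x = \<zero>\<^bsub>F\<^esub> \<or> (\<forall>v\<in>V. ctr v \<subseteq> P \<longrightarrow> 0 \<le> v x))"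
  show "x \<in> loc P"
  proof (cases "x = \<zero>\<^bsub>F\<^esub>")
    case True
    then have "x \<otimes>\<^bsub>F\<^esub> j \<one>\<^bsub>A\<^esub> = j \<zero>\<^bsub>A\<^esub>" by simp
    then show ?thesis using prime_one[OF P] x A.zero_closed unfolding fractions_at_def by blast
  next
    case False
    define S where "S = {v \<in> V. v x < 0}"
    have "finite S" by (rule finite_subset[OF _ fin[of x]]) (use x False in \<open>auto simp: S_def\<close>)
    then obtain s where s: "s \<in> carrier A - P" "\<forall>v\<in>S. - v x \<le> v (j s)"
      using common_denominator[OF P, of S "\<lambda>v. - v x"] x False by (force simp: S_def)
    have s0: "s \<noteq> \<zero>\<^bsub>A\<^esub>" using s prime_zero[OF P] by blast
    have "0 \<le> v (x \<otimes>\<^bsub>F\<^esub> j s)" if "v \<in> V" for v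
    proof -
      interpret v: discretely_valued_field F v using V_field[OF that] .
      have "v (x \<otimes>\<^bsub>F\<^esub> j s) = v x + v (j s)" using v.val_mult[of x "j s"] x False s s0 by auto
      moreover have "0 \<le> v (j s)" using val_j_nonneg[OF that] s s0 by auto
      ultimately show ?thesis using s(2) that by (cases "v x < 0") (auto simp: S_def)
    qed
    then have "x \<otimes>\<^bsub>F\<^esub> j s \<in> j ` carrier A" using x s in_A_iff by auto
    then show ?thesis using x s by (auto simp: fractions_at_def)
  qed
qed

text \<open>If no centre were inside P, \<open>loc_iff\<close> would put every element of F into the
  localization at P. But the inverse of a non-zero p in P cannot be there: written as a / s, it
  would give s = p a in P.\<close>

lemma center_below_prime:
  assumes P: "primeideal P A" "P \<noteq> {\<zero>\<^bsub>A\<^esub>}"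
  shows "\<exists>v\<in>V. ctr v \<subseteq> P"
proof (rule ccontr)
  assume no: "\<not> (\<exists>v\<in>V. ctr v \<subseteq> P)"
  have "P \<subseteq> carrier A"
    using P(1) by (simp add: additive_subgroup.a_subset ideal.axioms(1) primeideal.axioms(1))
  then obtain p where p: "p \<in> P" "p \<noteq> \<zero>\<^bsub>A\<^esub>" "p \<in> carrier A" using P prime_zero[OF P(1)] by blast
  have u: "j p \<in> Units F" using p F.field_Units by auto
  then have "inv\<^bsub>F\<^esub> (j p) \<in> loc P" using no loc_iff[OF P(1)] by auto
  then obtain a s where as: "a \<in> carrier A" "s \<in> carrier A - P" "inv\<^bsub>F\<^esub> (j p) \<otimes>\<^bsub>F\<^esub> j s = j a"
    by (auto simp: fractions_at_def)
  have "j s = (j p \<otimes>\<^bsub>F\<^esub> inv\<^bsub>F\<^esub> (j p)) \<otimes>\<^bsub>F\<^esub> j s" using u as by simp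
  also have "\<dots> = j (p \<otimes>\<^bsub>A\<^esub> a)" using u as p F.m_assoc[of "j p" "inv\<^bsub>F\<^esub> (j p)" "j s"] by (simp del: F.Units_r_inv)
  finally have "s = p \<otimes>\<^bsub>A\<^esub> a" using j_inj as p by (meson A.m_closed DiffD1 inj_onD)
  then have "s \<in> P" using P(1) p as by (simp add: ideal.I_r_closed primeideal.axioms(1))
  then show False using as by blast
qed

text \<open>Two valuations of the family with the same centre of height one have the same ring: otherwise
  \<open>y = 1 / (1 + z\<^sup>N c)\<close>, with \<open>v z \<ge> 0 > w z\<close> and \<open>c\<close> in the centre, lies in the localization,
  is a unit for \<open>v\<close>, and is in the maximal ideal for \<open>w\<close>.\<close>

lemma valuation_ring_unique:
  assumes P: "height_one A P" and v: "v \<in> V" "ctr v = P" and w: "w \<in> V" "ctr w = P"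
    and z: "z \<in> carrier F" "z \<noteq> \<zero>\<^bsub>F\<^esub>" "0 \<le> v z"
  shows "0 \<le> w z"
proof (rule ccontr)
  assume wz: "\<not> 0 \<le> w z"
  have P': "primeideal P A" "P \<noteq> {\<zero>\<^bsub>A\<^esub>}" using P by (auto simp: height_one_def)
  then obtain c where c: "c \<in> P" "c \<noteq> \<zero>\<^bsub>A\<^esub>" using prime_zero by blast
  then have cA: "c \<in> carrier A" using v(2) center_mem by blast
  have below: "ctr u = P" if "u \<in> V" "ctr u \<subseteq> P" for u
    using that P center_prime center_ne by (metis height_one_def psubsetI)
  \<comment> \<open>All valuations with centre P, not just v and w, have to be controlled for y to
    lie in the localization. They are finitely many because each is positive on c.\<close>
  define W where "W = {u \<in> V. ctr u = P}"
  have "W \<subseteq> {u \<in> V. u (j c) \<noteq> 0}" using c by (auto simp: W_def center_mem)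
  then have finW: "finite W" using fin[of "j c"] c cA finite_subset by auto
  have cpos: "0 < u (j c)" if "u \<in> W" for u using that c by (auto simp: W_def center_mem)
  \<comment> \<open>N exceeds u (j c) for all u in W. Hence z^N c is negative at u exactly when z
    is, and positive otherwise; the value 0, at which 1 + z^N c might cancel, never occurs.\<close>
  define N where "N = nat (Max ((\<lambda>u. u (j c)) ` W)) + 1"
  have N: "u (j c) < int N" if "u \<in> W" for u
  proof -
    have "u (j c) \<le> Max ((\<lambda>u. u (j c)) ` W)" using finW that by simp
    then show ?thesis by (simp add: N_def)
  qed
  define z' where "z' = z [^]\<^bsub>F\<^esub> N \<otimes>\<^bsub>F\<^esub> j c"
  have uz': "u z' = int N * u z + u (j c)" and z'0: "z' \<in> carrier F" "z' \<noteq> \<zero>\<^bsub>F\<^esub>" if "u \<in> V" for u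
  proof -
    interpret u: discretely_valued_field F u using V_field[OF that] .
    show "u z' = int N * u z + u (j c)" "z' \<in> carrier F"
      using z c cA u.val_mult[of "z [^]\<^bsub>F\<^esub> N" "j c"] by (auto simp: z'_def)
    show "z' \<noteq> \<zero>\<^bsub>F\<^esub>" using z c cA F.integral[of "z [^]\<^bsub>F\<^esub> N" "j c"] u.val_pow(1)[of z N] by (auto simp: z'_def)
  qed
  have vW: "v \<in> W" "w \<in> W" using v w by (auto simp: W_def)
  have vz': "0 < v z'" using uz'[OF v(1)] z cpos[OF vW(1)] by (simp add: add_nonneg_pos)
  have neg: "int N * u z + u (j c) < 0" if "u \<in> W" "u z < 0" for u
  proof -
    have "int N * u z \<le> int N * (-1)" using that by (intro mult_left_mono) auto
    then show ?thesis using N[OF that(1)] by simp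
  qed
  have wz': "w z' < 0" using uz'[OF w(1)] neg[OF vW(2)] wz by simp
  define y where "y = inv\<^bsub>F\<^esub> (\<one>\<^bsub>F\<^esub> \<oplus>\<^bsub>F\<^esub> z')"
  interpret v: discretely_valued_field F v using V_field[OF v(1)] .
  interpret w: discretely_valued_field F w using V_field[OF w(1)] .
  note z'0 = z'0[OF v(1)]
  have nz: "\<one>\<^bsub>F\<^esub> \<oplus>\<^bsub>F\<^esub> z' \<noteq> \<zero>\<^bsub>F\<^esub>" and v1: "v (\<one>\<^bsub>F\<^esub> \<oplus>\<^bsub>F\<^esub> z') = 0"
    using v.val_add_strict[of "\<one>\<^bsub>F\<^esub>" z'] z'0 vz' by auto
  have un: "\<one>\<^bsub>F\<^esub> \<oplus>\<^bsub>F\<^esub> z' \<in> Units F" using nz z'0 F.field_Units by auto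
  have y: "y \<in> carrier F" "y \<noteq> \<zero>\<^bsub>F\<^esub>" using F.Units_inv_Units[OF un] F.field_Units by (auto simp: y_def)
  have vy: "v y = 0" using v1 nz z'0 by (simp add: y_def)
  have uneg: "0 < u y" if "u \<in> V" "u z' < 0" for u
  proof -
    interpret u: discretely_valued_field F u using V_field[OF that(1)] .
    have "u (\<one>\<^bsub>F\<^esub> \<oplus>\<^bsub>F\<^esub> z') = u z'"
      using u.val_add_strict(2)[of z' "\<one>\<^bsub>F\<^esub>"] z'0 that F.a_comm[of z' "\<one>\<^bsub>F\<^esub>"] by simp
    then show ?thesis using nz z'0 that by (simp add: y_def)
  qed
  \<comment> \<open>Where z' has a pole, 1 + z' has the same pole and its inverse y is positive;
    where z' is positive, 1 + z' has value 0.\<close>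
  have "0 \<le> u y" if "u \<in> W" for u
  proof -
    have uV: "u \<in> V" using that by (simp add: W_def)
    interpret u: discretely_valued_field F u using V_field[OF uV] .
    show ?thesis
    proof (cases "u z < 0")
      case True then show ?thesis using uneg[OF uV] uz'[OF uV] neg[OF that] by simp
    next
      case False
      then have "0 < u z'" using uz'[OF uV] cpos[OF that] by (simp add: add_nonneg_pos)
      then have "u (\<one>\<^bsub>F\<^esub> \<oplus>\<^bsub>F\<^esub> z') = 0" using u.val_add_strict[of "\<one>\<^bsub>F\<^esub>" z'] z'0 by auto
      then show ?thesis using nz z'0 by (simp add: y_def)
    qed
  qed
  then have "y \<in> loc P" using y below loc_iff[OF P'(1)] by (auto simp: W_def)
  \<comment> \<open>Write y = a / s. The numerator has the values of y, since s has value 0 for both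
    v and w. So a lies in the centre of w but not in that of v, although both centres are P.\<close>
  then obtain a s where as: "a \<in> carrier A" "s \<in> carrier A - P" "y \<otimes>\<^bsub>F\<^esub> j s = j a"
    by (auto simp: fractions_at_def)
  have s: "s \<noteq> \<zero>\<^bsub>A\<^esub>" "v (j s) = 0" "w (j s) = 0"
    using not_center[OF v(1), of s] not_center[OF w(1), of s] as v w by auto
  have "w (j a) = w y" "v (j a) = 0" using as s y vy v.val_mult[of y "j s"] w.val_mult[of y "j s"] by auto
  then have "a \<in> ctr w" using uneg[OF w(1) wz'] as by (simp add: center_mem)
  moreover have "a \<notin> ctr v" using \<open>v (j a) = 0\<close> as s y F.integral[of y "j s"] by (auto simp: center_mem)
  ultimately show False using v w by simp
qed

text \<open>Centres are non-zero primes, so a centre inside P equals P. By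
  \<open>valuation_ring_unique\<close> all these valuations have the same ring, and a single one of
  them expresses the whole condition of \<open>loc_iff\<close>.\<close>

lemma height_one_valuation:
  assumes P: "height_one A P"
  shows "\<exists>v\<in>V. ctr v = P \<and> valuation_ring F v = loc P"
proof -
  have P': "primeideal P A" "P \<noteq> {\<zero>\<^bsub>A\<^esub>}" using P by (auto simp: height_one_def)
  have below: "ctr u = P" if "u \<in> V" "ctr u \<subseteq> P" for u
    using that P center_prime center_ne by (metis height_one_def psubsetI)
  obtain v where v: "v \<in> V" "ctr v \<subseteq> P" using center_below_prime[OF P'] by blast
  have "x \<in> valuation_ring F v \<longleftrightarrow> x \<in> loc P" for x
    using valuation_ring_unique[OF P v(1) below[OF v]] below v loc_iff[OF P'(1), of x]
    by (auto simp: valuation_ring_def)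
  then show ?thesis using v below by blast
qed

text \<open>Each such P is recovered as the centre of a member of \<open>V\<close> that is negative
  on x, and only finitely many members are non-zero on x.\<close>

lemma height_one_loc_finite:
  assumes x: "x \<in> carrier F"
  shows "finite {P. height_one A P \<and> x \<notin> loc P}"
proof (cases "x = \<zero>\<^bsub>F\<^esub>")
  case True
  then have "{P. height_one A P \<and> x \<notin> loc P} = {}" using loc_iff x by (auto simp: height_one_def)
  then show ?thesis by (metis finite.emptyI)
next
  case False
  have "{P. height_one A P \<and> x \<notin> loc P} \<subseteq> ctr ` {v \<in> V. v x \<noteq> 0}"
  proof
    fix P assume "P \<in> {P. height_one A P \<and> x \<notin> loc P}"
    then obtain v where "v \<in> V" "ctr v = P" "valuation_ring F v = loc P" "x \<notin> loc P" using height_one_valuation by blast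
    then show "P \<in> ctr ` {v \<in> V. v x \<noteq> 0}" using x by (auto simp: valuation_ring_def)
  qed
  then show ?thesis using fin[OF x False] finite_surj by blast
qed

text \<open>If the centre \<open>M\<close> of \<open>w\<close> is not of height one, then it is the centre of no valuation that is
  negative on an element \<open>y\<close> with \<open>M y\<close> contained in the localization at \<open>M\<close>.\<close>

lemma center_height_one:
  assumes w: "w \<in> V" and y: "y \<in> carrier F" "y \<noteq> \<zero>\<^bsub>F\<^esub>" "w y < 0"
    and My: "\<And>m. m \<in> ctr w \<Longrightarrow> y \<otimes>\<^bsub>F\<^esub> j m \<in> loc (ctr w)"
  shows "height_one A (ctr w)"
proof (rule ccontr)
  define M where "M = ctr w"
  assume "\<not> height_one A (ctr w)"
  then obtain Q where Q: "primeideal Q A" "Q \<subset> M" "Q \<noteq> {\<zero>\<^bsub>A\<^esub>}"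
    using center_prime[OF w] center_ne[OF w] by (auto simp: height_one_def M_def)
  interpret w: discretely_valued_field F w using V_field[OF w] .
  interpret Q: primeideal Q A by fact
  have M: "primeideal M A" using center_prime[OF w] by (simp add: M_def)
  have MA: "M \<subseteq> carrier A" by (auto simp: M_def center_mem)
  \<comment> \<open>Multiplication by y lowers values: y m is a fraction a / s with w (j a) < w (j
    m), because y has negative value and s has value 0.\<close>
  have frc: "\<exists>a\<in>carrier A. \<exists>s\<in>carrier A - M. y \<otimes>\<^bsub>F\<^esub> j m \<otimes>\<^bsub>F\<^esub> j s = j a \<and> a \<noteq> \<zero>\<^bsub>A\<^esub> \<and> w (j a) < w (j m)"
    if m: "m \<in> M" "m \<noteq> \<zero>\<^bsub>A\<^esub>" for m
  proof -
    obtain a s where as: "a \<in> carrier A" "s \<in> carrier A - M" "y \<otimes>\<^bsub>F\<^esub> j m \<otimes>\<^bsub>F\<^esub> j s = j a"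
      using My[of m] m by (auto simp: fractions_at_def M_def)
    have s: "s \<noteq> \<zero>\<^bsub>A\<^esub>" "w (j s) = 0" using not_center[OF w, of s] as by (auto simp: M_def)
    have m0: "j m \<in> carrier F" "j m \<noteq> \<zero>\<^bsub>F\<^esub>" using m MA by auto
    have ym: "y \<otimes>\<^bsub>F\<^esub> j m \<noteq> \<zero>\<^bsub>F\<^esub>" using y m0 F.integral by blast
    have "w (j a) = w y + w (j m)" using y m0 s as w.val_mult[of "y \<otimes>\<^bsub>F\<^esub> j m" "j s"] ym by auto
    moreover have "a \<noteq> \<zero>\<^bsub>A\<^esub>" using F.integral[of "y \<otimes>\<^bsub>F\<^esub> j m" "j s"] ym y m0 s as by auto
    ultimately show ?thesis using as y by auto
  qed
  have min: "\<exists>m\<in>I. m \<noteq> \<zero>\<^bsub>A\<^esub> \<and> (\<forall>b\<in>I. b \<noteq> \<zero>\<^bsub>A\<^esub> \<longrightarrow> w (j m) \<le> w (j b))" if I: "I \<subseteq> M" "I \<noteq> {\<zero>\<^bsub>A\<^esub>}" "\<zero>\<^bsub>A\<^esub> \<in> I" for I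
  proof -
    obtain m0 where m0: "m0 \<in> I \<and> m0 \<noteq> \<zero>\<^bsub>A\<^esub>" using I by blast
    obtain m where m: "m \<in> I \<and> m \<noteq> \<zero>\<^bsub>A\<^esub>" "\<forall>b. b \<in> I \<and> b \<noteq> \<zero>\<^bsub>A\<^esub> \<longrightarrow> nat (w (j m)) \<le> nat (w (j b))"
      using ex_has_least_nat[of "\<lambda>m. m \<in> I \<and> m \<noteq> \<zero>\<^bsub>A\<^esub>" m0 "\<lambda>m. nat (w (j m))"] m0 by blast
    have "w (j m) \<le> w (j b)" if "b \<in> I" "b \<noteq> \<zero>\<^bsub>A\<^esub>" for b
      using m(2) that I(1) val_j_nonneg[OF w, of b] MA by (smt (verit) eq_nat_nat_iff nat_le_eq_zle subsetD)
    then show ?thesis using m by blast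
  qed
  obtain m where m: "m \<in> M" "m \<noteq> \<zero>\<^bsub>A\<^esub>" "\<forall>b\<in>M. b \<noteq> \<zero>\<^bsub>A\<^esub> \<longrightarrow> w (j m) \<le> w (j b)"
    using min[of M] prime_zero[OF M] center_ne[OF w] by (auto simp: M_def)
  obtain q where q: "q \<in> Q" "q \<noteq> \<zero>\<^bsub>A\<^esub>" "\<forall>b\<in>Q. b \<noteq> \<zero>\<^bsub>A\<^esub> \<longrightarrow> w (j q) \<le> w (j b)"
    using min[of Q] prime_zero[OF Q(1)] Q by auto
  obtain a s where as: "a \<in> carrier A" "s \<in> carrier A - M" "y \<otimes>\<^bsub>F\<^esub> j m \<otimes>\<^bsub>F\<^esub> j s = j a" "a \<noteq> \<zero>\<^bsub>A\<^esub>" "w (j a) < w (j m)"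
    using frc[OF m(1,2)] by blast
  \<comment> \<open>m has least value among the non-zero elements of M, and a has a smaller
    one.\<close>
  have aM: "a \<notin> M" using m(3) as by force
  \<comment> \<open>From y n = b / t and y m = a / s, cross multiplication eliminates y.\<close>
  have key: "b \<otimes>\<^bsub>A\<^esub> (m \<otimes>\<^bsub>A\<^esub> s) = n \<otimes>\<^bsub>A\<^esub> (t \<otimes>\<^bsub>A\<^esub> a)"
    if "n \<in> M" "b \<in> carrier A" "t \<in> carrier A" "y \<otimes>\<^bsub>F\<^esub> j n \<otimes>\<^bsub>F\<^esub> j t = j b" for n b t
  proof -
    have c: "j n \<in> carrier F" "j t \<in> carrier F" "j m \<in> carrier F" "j s \<in> carrier F" using that MA as m by auto
    have "j (b \<otimes>\<^bsub>A\<^esub> (m \<otimes>\<^bsub>A\<^esub> s)) = y \<otimes>\<^bsub>F\<^esub> j n \<otimes>\<^bsub>F\<^esub> j t \<otimes>\<^bsub>F\<^esub> (j m \<otimes>\<^bsub>F\<^esub> j s)"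
      using that MA as m by (subst that(4)) auto
    also have "\<dots> = j n \<otimes>\<^bsub>F\<^esub> (j t \<otimes>\<^bsub>F\<^esub> (y \<otimes>\<^bsub>F\<^esub> j m \<otimes>\<^bsub>F\<^esub> j s))"
      using c y by (simp add: F.m_ac)
    also have "\<dots> = j (n \<otimes>\<^bsub>A\<^esub> (t \<otimes>\<^bsub>A\<^esub> a))" using that MA as m by (subst as(3)) auto
    finally show ?thesis using j_inj that MA as m by (meson A.m_closed DiffD1 inj_onD subsetD)
  qed
  have sQ: "s \<notin> Q" "a \<notin> Q" using as aM Q by auto
  \<comment> \<open>If m is outside Q, the cross relation for n = q puts b into Q, although b has a
    smaller value than q, which is least in Q. If m is in Q, the relation puts n t a into Q for
    every n in M, with t and a outside Q, so M would be contained in Q.\<close>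
  show False
  proof (cases "m \<in> Q")
    case False
    obtain b t where bt: "b \<in> carrier A" "t \<in> carrier A - M" "y \<otimes>\<^bsub>F\<^esub> j q \<otimes>\<^bsub>F\<^esub> j t = j b" "b \<noteq> \<zero>\<^bsub>A\<^esub>" "w (j b) < w (j q)"
      using frc[of q] q Q by blast
    have "q \<in> M" using q(1) Q(2) by blast
    then have "b \<otimes>\<^bsub>A\<^esub> (m \<otimes>\<^bsub>A\<^esub> s) = q \<otimes>\<^bsub>A\<^esub> (t \<otimes>\<^bsub>A\<^esub> a)" using key bt by simp
    then have "b \<otimes>\<^bsub>A\<^esub> (m \<otimes>\<^bsub>A\<^esub> s) \<in> Q" using Q.I_r_closed[OF q(1), of "t \<otimes>\<^bsub>A\<^esub> a"] bt as by simp
    then have "b \<in> Q" using Q.I_prime[of b "m \<otimes>\<^bsub>A\<^esub> s"] Q.I_prime[of m s] False sQ bt m MA as by auto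
    then show False using q(3) bt by force
  next
    case True
    have "n \<in> Q" if n: "n \<in> M" for n
    proof (cases "n = \<zero>\<^bsub>A\<^esub>")
      case True then show ?thesis using prime_zero[OF Q(1)] by simp
    next
      case False
      obtain b t where bt: "b \<in> carrier A" "t \<in> carrier A - M" "y \<otimes>\<^bsub>F\<^esub> j n \<otimes>\<^bsub>F\<^esub> j t = j b"
        using frc[OF n False] by blast
      have "m \<otimes>\<^bsub>A\<^esub> s \<in> Q" using \<open>m \<in> Q\<close> as by (auto intro: Q.I_r_closed)
      then have "n \<otimes>\<^bsub>A\<^esub> (t \<otimes>\<^bsub>A\<^esub> a) \<in> Q" using key[of n b t] n bt Q.I_l_closed[of "m \<otimes>\<^bsub>A\<^esub> s" b] by auto
      moreover have "t \<notin> Q" using bt Q by blast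
      ultimately show "n \<in> Q" using Q.I_prime[of n "t \<otimes>\<^bsub>A\<^esub> a"] Q.I_prime[of t a] sQ n MA bt as by auto
    qed
    then show False using Q by blast
  qed
qed

text \<open>Among the centres inside P of valuations negative on x, take a minimal one, M. If M has
  height one, \<open>h1\<close> applies to it and contradicts x being outside the localization at M.
  To obtain height one, x is multiplied by some b such that x b is still outside that localization
  but every further multiple by an element of M is inside; this is the situation of
  \<open>center_height_one\<close>.\<close>

lemma loc_height_one:
  assumes P: "primeideal P A" and x: "x \<in> carrier F"
    and h1: "\<And>Q. height_one A Q \<Longrightarrow> Q \<subseteq> P \<Longrightarrow> x \<in> loc Q"
  shows "x \<in> loc P"
proof (rule ccontr)
  assume "x \<notin> loc P"
  then have x0: "x \<noteq> \<zero>\<^bsub>F\<^esub>" and ex: "\<exists>v\<in>V. ctr v \<subseteq> P \<and> v x < 0" using loc_iff[OF P, of x] x by auto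
  define B where "B = {v \<in> V. ctr v \<subseteq> P \<and> v x < 0}"
  have finB: "finite B" by (rule finite_subset[OF _ fin[OF x x0]]) (auto simp: B_def)
  have "ctr ` B \<noteq> {}" "finite (ctr ` B)" using ex finB by (auto simp: B_def)
  then obtain M where M: "M \<in> ctr ` B" "\<And>N. N \<in> ctr ` B \<Longrightarrow> N \<subseteq> M \<Longrightarrow> M = N"
    using finite_has_minimal[OF \<open>finite (ctr ` B)\<close> \<open>ctr ` B \<noteq> {}\<close>] by metis
  obtain w0 where w0: "w0 \<in> B" "ctr w0 = M" using M by auto
  have MP: "primeideal M A" "M \<subseteq> P" using w0 center_prime by (auto simp: B_def)
  have xM: "x \<notin> loc M" using loc_iff[OF MP(1), of x] x0 w0 by (auto simp: B_def)
  define W where "W = {w \<in> B. ctr w = M}"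
  have finW: "finite W" using finB by (simp add: W_def)
  \<comment> \<open>\<open>size b\<close> is the total pole order of x b over the valuations with
    centre M that are negative on x. A factor from M lowers it as long as a pole is left, so an
    element of least size cannot be multiplied further without entering the localization.\<close>
  define size where "size b = (\<Sum>w\<in>W. nat (- w (x \<otimes>\<^bsub>F\<^esub> j b)))" for b
  define good where "good b \<longleftrightarrow> b \<in> carrier A \<and> b \<noteq> \<zero>\<^bsub>A\<^esub> \<and> x \<otimes>\<^bsub>F\<^esub> j b \<notin> loc M" for b
  have "good \<one>\<^bsub>A\<^esub>" using xM x by (simp add: good_def)
  then obtain b where b: "good b" and bmin: "\<And>c. good c \<Longrightarrow> size b \<le> size c"
    using ex_has_least_nat[of good "\<one>\<^bsub>A\<^esub>" size] by blast
  have bA: "b \<in> carrier A" "b \<noteq> \<zero>\<^bsub>A\<^esub>" using b by (auto simp: good_def)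
  have xj: "v (x \<otimes>\<^bsub>F\<^esub> j c) = v x + v (j c)" "x \<otimes>\<^bsub>F\<^esub> j c \<noteq> \<zero>\<^bsub>F\<^esub>" "0 \<le> v (j c)" if "v \<in> V" "c \<in> carrier A" "c \<noteq> \<zero>\<^bsub>A\<^esub>" for v c
  proof -
    interpret v: discretely_valued_field F v using V_field[OF that(1)] .
    show "v (x \<otimes>\<^bsub>F\<^esub> j c) = v x + v (j c)" using v.val_mult[of x "j c"] x x0 that by auto
    show "x \<otimes>\<^bsub>F\<^esub> j c \<noteq> \<zero>\<^bsub>F\<^esub>" using F.integral[of x "j c"] x x0 that by auto
    show "0 \<le> v (j c)" using val_j_nonneg that by blast
  qed
  have "x \<otimes>\<^bsub>F\<^esub> j b \<notin> loc M" using b by (simp add: good_def)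
  then obtain w where w: "w \<in> V" "ctr w \<subseteq> M" "w (x \<otimes>\<^bsub>F\<^esub> j b) < 0"
    using loc_iff[OF MP(1), of "x \<otimes>\<^bsub>F\<^esub> j b"] x bA by force
  \<comment> \<open>The value of j b is non-negative, so w is already negative on x. Thus w is in
    \<open>B\<close>, and minimality of M forces its centre to be M.\<close>
  have "w x < 0" using xj[OF w(1) bA] w(3) by simp
  then have wB: "w \<in> B" using w MP(2) by (auto simp: B_def)
  then have wM: "ctr w = M" using M(2) w(2) by blast
  have "height_one A (ctr w)"
  proof (rule center_height_one[OF w(1), of "x \<otimes>\<^bsub>F\<^esub> j b"])
    show "x \<otimes>\<^bsub>F\<^esub> j b \<in> carrier F" "x \<otimes>\<^bsub>F\<^esub> j b \<noteq> \<zero>\<^bsub>F\<^esub>" "w (x \<otimes>\<^bsub>F\<^esub> j b) < 0"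
      using x bA xj[OF w(1) bA] w by auto
    fix m assume m: "m \<in> ctr w"
    have mA: "m \<in> carrier A" using m by (simp add: center_mem)
    show "x \<otimes>\<^bsub>F\<^esub> j b \<otimes>\<^bsub>F\<^esub> j m \<in> loc (ctr w)"
    proof (rule ccontr)
      assume n: "x \<otimes>\<^bsub>F\<^esub> j b \<otimes>\<^bsub>F\<^esub> j m \<notin> loc (ctr w)"
      have eq: "x \<otimes>\<^bsub>F\<^esub> j b \<otimes>\<^bsub>F\<^esub> j m = x \<otimes>\<^bsub>F\<^esub> j (b \<otimes>\<^bsub>A\<^esub> m)" using x bA mA by (simp add: F.m_assoc)
      have m0: "m \<noteq> \<zero>\<^bsub>A\<^esub>" using n x bA loc_iff[OF MP(1)] by (auto simp: wM)
      have bm0: "b \<otimes>\<^bsub>A\<^esub> m \<noteq> \<zero>\<^bsub>A\<^esub>" using m0 bA mA A.integral by blast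
      have "good (b \<otimes>\<^bsub>A\<^esub> m)" using n eq wM bA mA bm0 by (simp add: good_def)
      then have le: "size b \<le> size (b \<otimes>\<^bsub>A\<^esub> m)" by (rule bmin)
      have wadd: "u (x \<otimes>\<^bsub>F\<^esub> j (b \<otimes>\<^bsub>A\<^esub> m)) = u (x \<otimes>\<^bsub>F\<^esub> j b) + u (j m)" if "u \<in> V" for u
      proof -
        interpret u: discretely_valued_field F u using V_field[OF that] .
        show ?thesis using eq u.val_mult[of "x \<otimes>\<^bsub>F\<^esub> j b" "j m"] x bA mA m0 xj(2)[OF that bA] by auto
      qed
      have "size (b \<otimes>\<^bsub>A\<^esub> m) < size b"
        unfolding size_def
      proof (rule sum_strict_mono_ex1[OF finW])
        show "\<forall>u\<in>W. nat (- u (x \<otimes>\<^bsub>F\<^esub> j (b \<otimes>\<^bsub>A\<^esub> m))) \<le> nat (- u (x \<otimes>\<^bsub>F\<^esub> j b))"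
        proof
          fix u assume "u \<in> W"
          then have "u \<in> V" by (simp add: W_def B_def)
          then show "nat (- u (x \<otimes>\<^bsub>F\<^esub> j (b \<otimes>\<^bsub>A\<^esub> m))) \<le> nat (- u (x \<otimes>\<^bsub>F\<^esub> j b))"
            using wadd[of u] xj(3)[OF _ mA m0, of u] by simp
        qed
        have "0 < w (j m)" using m m0 by (simp add: center_mem)
        then show "\<exists>u\<in>W. nat (- u (x \<otimes>\<^bsub>F\<^esub> j (b \<otimes>\<^bsub>A\<^esub> m))) < nat (- u (x \<otimes>\<^bsub>F\<^esub> j b))"
          using wadd[OF w(1)] w(3) wB wM by (intro bexI[of _ w]) (auto simp: W_def)
      qed
      then show False using le by simp
    qed
  qed
  then show False using h1[of M] xM wM MP(2) by simp
qed

end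

section \<open>Stalks\<close>

locale pointed_ring_presheaf =
  fixes X :: "'p topology" and F :: "('p, 'a, 'm) ring_presheaf_scheme" and x :: 'p
  assumes presheaf: "ring_presheaf_on X F" and point: "x \<in> topspace X"
begin

definition nbhd where "nbhd U \<longleftrightarrow> openin X U \<and> x \<in> U"
abbreviation R where "R U \<equiv> sect F U"
abbreviation r where "r U V \<equiv> restr F U V"
abbreviation g where "g U s \<equiv> germ X F x U s"
abbreviation S where "S \<equiv> stalk X F x"

lemma nbhd_Int: "nbhd U \<Longrightarrow> nbhd V \<Longrightarrow> nbhd (U \<inter> V)"
  by (auto simp: nbhd_def)

lemma nbhd_topspace: "nbhd (topspace X)"
  using point by (simp add: nbhd_def)

lemma sect_cring: "openin X U \<Longrightarrow> cring (R U)"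
  using presheaf by (auto simp: ring_presheaf_on_def)

lemma r_hom: "openin X U \<Longrightarrow> openin X V \<Longrightarrow> V \<subseteq> U \<Longrightarrow> r U V \<in> ring_hom (R U) (R V)"
  using presheaf by (auto simp: ring_presheaf_on_def)

lemma r_closed: "openin X U \<Longrightarrow> openin X V \<Longrightarrow> V \<subseteq> U \<Longrightarrow> s \<in> carrier (R U) \<Longrightarrow> r U V s \<in> carrier (R V)"
  using r_hom[of U V] by (rule ring_hom_closed)

lemma r_id: "openin X U \<Longrightarrow> s \<in> carrier (R U) \<Longrightarrow> r U U s = s"
  using presheaf by (auto simp: ring_presheaf_on_def presheaf_on_def)

lemma r_comp: "openin X U \<Longrightarrow> openin X V \<Longrightarrow> openin X W \<Longrightarrow> W \<subseteq> V \<Longrightarrow> V \<subseteq> U \<Longrightarrow> s \<in> carrier (R U)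
  \<Longrightarrow> r V W (r U V s) = r U W s"
  using presheaf by (auto simp: ring_presheaf_on_def presheaf_on_def)

lemma germ_mem:
  "(V, t) \<in> g U s \<longleftrightarrow> nbhd V \<and> t \<in> carrier (R V) \<and> (\<exists>W. nbhd W \<and> W \<subseteq> U \<inter> V \<and> r U W s = r V W t)"
  by (auto simp: germ_def nbhd_def)

lemma germ_self: "nbhd U \<Longrightarrow> s \<in> carrier (R U) \<Longrightarrow> (U, s) \<in> g U s"
  unfolding germ_mem by auto

lemma germ_eqI:
  assumes "nbhd U" "s \<in> carrier (R U)" "nbhd V" "t \<in> carrier (R V)" "nbhd W" "W \<subseteq> U \<inter> V" "r U W s = r V W t"
  shows "g U s = g V t"
proof -
  have sub: "g U s \<subseteq> g V t" if "nbhd U" "s \<in> carrier (R U)" "nbhd V" "t \<in> carrier (R V)" "r U W s = r V W t" "W \<subseteq> U \<inter> V" for U s V t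
  proof
    fix p assume "p \<in> g U s"
    then obtain V' t' W' where p: "p = (V', t')" "nbhd V'" "t' \<in> carrier (R V')" "nbhd W'" "W' \<subseteq> U \<inter> V'" "r U W' s = r V' W' t'"
      by (cases p) (auto simp: germ_mem)
    have o: "openin X U" "openin X V" "openin X W" "openin X V'" "openin X W'" "openin X (W \<inter> W')" using that p assms by (auto simp: nbhd_def)
    have "r V (W \<inter> W') t = r W (W \<inter> W') (r V W t)" using o that by (subst r_comp) auto
    also have "\<dots> = r W (W \<inter> W') (r U W s)" using that by simp
    also have "\<dots> = r U (W \<inter> W') s" using o that by (subst r_comp) auto
    also have "\<dots> = r W' (W \<inter> W') (r U W' s)" using o that p by (subst r_comp) auto
    also have "\<dots> = r V' (W \<inter> W') t'" using o that p by (simp, subst r_comp) auto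
    finally show "p \<in> g V t" using p that nbhd_Int[OF assms(5) p(4)] by (auto simp: germ_mem)
  qed
  show ?thesis using sub[OF assms(1-4) assms(7) assms(6)] sub[OF assms(3,4) assms(1,2) assms(7)[symmetric]] assms(6) by auto
qed

lemma germ_eq_iff:
  assumes "nbhd U" "s \<in> carrier (R U)" "nbhd V" "t \<in> carrier (R V)"
  shows "g U s = g V t \<longleftrightarrow> (\<exists>W. nbhd W \<and> W \<subseteq> U \<inter> V \<and> r U W s = r V W t)"
  using germ_eqI[OF assms] germ_self[OF assms(3,4)] germ_mem[of V t U s] by auto

lemma germ_restr:
  assumes "nbhd U" "s \<in> carrier (R U)" "nbhd V" "V \<subseteq> U"
  shows "g V (r U V s) = g U s"
  by (rule germ_eqI[of _ _ _ _ V]) (use assms in \<open>auto simp: nbhd_def r_closed r_id\<close>)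

lemma stalk_carrier: "c \<in> carrier S \<longleftrightarrow> (\<exists>U s. nbhd U \<and> s \<in> carrier (R U) \<and> c = g U s)"
  by (auto simp: stalk_def nbhd_def)

lemma germ_closed [simp]: "nbhd U \<Longrightarrow> s \<in> carrier (R U) \<Longrightarrow> g U s \<in> carrier S"
  by (auto simp: stalk_carrier)

text \<open>The stalk operations are unions over all pairs of representatives. Restriction to a
  common smaller neighbourhood shows that all members of the union are the same germ, provided that
  the operation commutes with restriction. Stating this for an abstract \<open>f\<close> covers
  addition and multiplication at once.\<close>

lemma germ_op:
  assumes U: "nbhd U" "s \<in> carrier (R U)" and V: "nbhd V" "t \<in> carrier (R V)"
    and clos: "\<And>W a b. nbhd W \<Longrightarrow> a \<in> carrier (R W) \<Longrightarrow> b \<in> carrier (R W) \<Longrightarrow> f W a b \<in> carrier (R W)"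
    and nat: "\<And>W W' a b. nbhd W \<Longrightarrow> nbhd W' \<Longrightarrow> W' \<subseteq> W \<Longrightarrow> a \<in> carrier (R W) \<Longrightarrow> b \<in> carrier (R W)
      \<Longrightarrow> r W W' (f W a b) = f W' (r W W' a) (r W W' b)"
  shows "(\<Union>(U', s')\<in>g U s. \<Union>(V', t')\<in>g V t. g (U' \<inter> V') (f (U' \<inter> V') (r U' (U' \<inter> V') s') (r V' (U' \<inter> V') t')))
    = g (U \<inter> V) (f (U \<inter> V) (r U (U \<inter> V) s) (r V (U \<inter> V) t))" (is "?L = ?R")
proof -
  have eq: "g (U' \<inter> V') (f (U' \<inter> V') (r U' (U' \<inter> V') s') (r V' (U' \<inter> V') t')) = ?R"
    if p1: "(U', s') \<in> g U s" and p2: "(V', t') \<in> g V t" for U' s' V' t'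
  proof -
    have U': "nbhd U'" "s' \<in> carrier (R U')" and V': "nbhd V'" "t' \<in> carrier (R V')" using p1 p2 by (auto simp: germ_mem)
    obtain A where A: "nbhd A" "A \<subseteq> U \<inter> U'" "r U A s = r U' A s'" using p1 unfolding germ_mem by metis
    obtain B where B: "nbhd B" "B \<subseteq> V \<inter> V'" "r V B t = r V' B t'" using p2 unfolding germ_mem by metis
    have n: "nbhd (A \<inter> B)" "nbhd (U \<inter> V)" "nbhd (U' \<inter> V')" using A B U V U' V' by (auto intro: nbhd_Int)
    have o: "openin X U" "openin X V" "openin X U'" "openin X V'" "openin X A" "openin X B" "openin X (A \<inter> B)" "openin X (U \<inter> V)" "openin X (U' \<inter> V')"
      using n A B U V U' V' by (auto simp: nbhd_def)
    have sub: "A \<inter> B \<subseteq> U" "A \<inter> B \<subseteq> V" "A \<inter> B \<subseteq> U'" "A \<inter> B \<subseteq> V'" "A \<inter> B \<subseteq> U \<inter> V" "A \<inter> B \<subseteq> U' \<inter> V'" using A B by auto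
    have s: "r U (A \<inter> B) s = r U' (A \<inter> B) s'"
      using A B o U U' r_comp[of U A "A \<inter> B" s] r_comp[of U' A "A \<inter> B" s'] by auto
    have t: "r V (A \<inter> B) t = r V' (A \<inter> B) t'"
      using A B o V V' r_comp[of V B "A \<inter> B" t] r_comp[of V' B "A \<inter> B" t'] by auto
    have c: "r U (U \<inter> V) s \<in> carrier (R (U \<inter> V))" "r V (U \<inter> V) t \<in> carrier (R (U \<inter> V))"
      "r U' (U' \<inter> V') s' \<in> carrier (R (U' \<inter> V'))" "r V' (U' \<inter> V') t' \<in> carrier (R (U' \<inter> V'))"
      using U V U' V' o by (auto intro!: r_closed)
    have "r (U' \<inter> V') (A \<inter> B) (f (U' \<inter> V') (r U' (U' \<inter> V') s') (r V' (U' \<inter> V') t'))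
        = f (A \<inter> B) (r U' (A \<inter> B) s') (r V' (A \<inter> B) t')"
      using nat[OF n(3) n(1) sub(6) c(3,4)] r_comp[of U' "U' \<inter> V'" "A \<inter> B" s'] r_comp[of V' "U' \<inter> V'" "A \<inter> B" t'] o sub U' V' by simp
    also have "\<dots> = r (U \<inter> V) (A \<inter> B) (f (U \<inter> V) (r U (U \<inter> V) s) (r V (U \<inter> V) t))"
      using nat[OF n(2) n(1) sub(5) c(1,2)] r_comp[of U "U \<inter> V" "A \<inter> B" s] r_comp[of V "U \<inter> V" "A \<inter> B" t] o sub U V s t by simp
    finally show ?thesis
      using sub by (intro germ_eqI[OF n(3) clos[OF n(3) c(3,4)] n(2) clos[OF n(2) c(1,2)] n(1)]) auto
  qed
  have "?L = (\<Union>(U', s')\<in>g U s. \<Union>(V', t')\<in>g V t. ?R)" using eq by fastforce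
  also have "\<dots> = ?R" using germ_self[OF U] germ_self[OF V] by blast
  finally show ?thesis .
qed

lemma germ_add':
  assumes "nbhd U" "s \<in> carrier (R U)" "nbhd V" "t \<in> carrier (R V)"
  shows "g U s \<oplus>\<^bsub>S\<^esub> g V t = g (U \<inter> V) (r U (U \<inter> V) s \<oplus>\<^bsub>R (U \<inter> V)\<^esub> r V (U \<inter> V) t)"
  unfolding stalk_def ring.simps
  by (rule germ_op[OF assms])
    (auto simp: nbhd_def ring_hom_add[OF r_hom] intro!: ring.ring_simprules cring.axioms(1) sect_cring)

lemma germ_mult':
  assumes "nbhd U" "s \<in> carrier (R U)" "nbhd V" "t \<in> carrier (R V)"
  shows "g U s \<otimes>\<^bsub>S\<^esub> g V t = g (U \<inter> V) (r U (U \<inter> V) s \<otimes>\<^bsub>R (U \<inter> V)\<^esub> r V (U \<inter> V) t)"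
  unfolding stalk_def monoid.simps
  by (rule germ_op[OF assms])
    (auto simp: nbhd_def ring_hom_mult[OF r_hom] intro!: ring.ring_simprules cring.axioms(1) sect_cring)

lemma germ_add: "nbhd U \<Longrightarrow> s \<in> carrier (R U) \<Longrightarrow> t \<in> carrier (R U) \<Longrightarrow> g U s \<oplus>\<^bsub>S\<^esub> g U t = g U (s \<oplus>\<^bsub>R U\<^esub> t)"
  using germ_add'[of U s U t] r_id by (simp add: nbhd_def)

lemma germ_mult: "nbhd U \<Longrightarrow> s \<in> carrier (R U) \<Longrightarrow> t \<in> carrier (R U) \<Longrightarrow> g U s \<otimes>\<^bsub>S\<^esub> g U t = g U (s \<otimes>\<^bsub>R U\<^esub> t)"
  using germ_mult'[of U s U t] r_id by (simp add: nbhd_def)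

lemma germ_one: assumes "nbhd U" shows "g U \<one>\<^bsub>R U\<^esub> = \<one>\<^bsub>S\<^esub>"
proof -
  have o: "openin X U" "openin X (topspace X)" "U \<subseteq> topspace X" using assms by (auto simp: nbhd_def openin_subset)
  interpret U: cring "R U" using sect_cring[OF o(1)] .
  interpret T: cring "R (topspace X)" using sect_cring[OF o(2)] .
  have "g U (r (topspace X) U \<one>\<^bsub>R (topspace X)\<^esub>) = g (topspace X) \<one>\<^bsub>R (topspace X)\<^esub>"
    using germ_restr[OF nbhd_topspace _ assms o(3)] by simp
  then show ?thesis using ring_hom_one[OF r_hom[OF o(2,1,3)]] by (simp add: stalk_def)
qed

lemma germ_zero: assumes "nbhd U" shows "g U \<zero>\<^bsub>R U\<^esub> = \<zero>\<^bsub>S\<^esub>"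
proof -
  have o: "openin X U" "openin X (topspace X)" "U \<subseteq> topspace X" using assms by (auto simp: nbhd_def openin_subset)
  interpret U: cring "R U" using sect_cring[OF o(1)] .
  interpret T: cring "R (topspace X)" using sect_cring[OF o(2)] .
  have "g U (r (topspace X) U \<zero>\<^bsub>R (topspace X)\<^esub>) = g (topspace X) \<zero>\<^bsub>R (topspace X)\<^esub>"
    using germ_restr[OF nbhd_topspace _ assms o(3)] by simp
  then show ?thesis using ring_hom_zero[OF r_hom[OF o(2,1,3)] T.ring_axioms U.ring_axioms] by (simp add: stalk_def)
qed

text \<open>Finitely many neighbourhoods can be intersected. Identities between germs thereby reduce
  to identities in one ring of sections.\<close>

lemma common_nbhd:
  assumes "finite I" "\<And>i. i \<in> I \<Longrightarrow> c i \<in> carrier S"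
  shows "\<exists>U s. nbhd U \<and> (\<forall>i\<in>I. s i \<in> carrier (R U) \<and> c i = g U (s i))"
  using assms
proof (induction I)
  case empty then show ?case using nbhd_topspace by blast
next
  case (insert i I)
  then obtain U s where U: "nbhd U" "\<forall>i\<in>I. s i \<in> carrier (R U) \<and> c i = g U (s i)" by auto
  obtain V t where V: "nbhd V" "t \<in> carrier (R V)" "c i = g V t" using insert.prems[of i] stalk_carrier by auto
  have n: "nbhd (U \<inter> V)" using U V nbhd_Int by blast
  have o: "openin X U" "openin X V" "openin X (U \<inter> V)" using U V n by (auto simp: nbhd_def)
  have 1: "r V (U \<inter> V) t \<in> carrier (R (U \<inter> V))" "g V t = g (U \<inter> V) (r V (U \<inter> V) t)"
    using V n o r_closed germ_restr by auto
  have 2: "r U (U \<inter> V) (s k) \<in> carrier (R (U \<inter> V))" "c k = g (U \<inter> V) (r U (U \<inter> V) (s k))" if "k \<in> I" for k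
    using U n o that r_closed germ_restr by auto
  show ?case
    by (rule exI[of _ "U \<inter> V"], rule exI[of _ "\<lambda>k. if k = i then r V (U \<inter> V) t else r U (U \<inter> V) (s k)"])
      (use n V 1 2 in auto)
qed

lemma common3:
  assumes "a \<in> carrier S" "b \<in> carrier S" "c \<in> carrier S"
  obtains U s t u where "nbhd U" "s \<in> carrier (R U)" "t \<in> carrier (R U)" "u \<in> carrier (R U)"
    "a = g U s" "b = g U t" "c = g U u"
proof -
  have "\<exists>U s. nbhd U \<and> (\<forall>i\<in>{0,1,2::nat}. s i \<in> carrier (R U) \<and> (if i = 0 then a else if i = 1 then b else c) = g U (s i))"
    by (rule common_nbhd) (use assms in auto)
  then show thesis using that by auto
qed

lemma stalk_cring: "cring S"
proof -
  have R: "cring (R U)" if "nbhd U" for U using that sect_cring by (simp add: nbhd_def)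
  note [simp] = germ_add germ_mult
  have one: "\<one>\<^bsub>S\<^esub> \<in> carrier S" and zero: "\<zero>\<^bsub>S\<^esub> \<in> carrier S"
    using nbhd_topspace cring.cring_simprules(2,6)[OF R[OF nbhd_topspace]] germ_closed[OF nbhd_topspace] germ_one[OF nbhd_topspace] germ_zero[OF nbhd_topspace] by metis+
  show ?thesis
  proof (intro cringI abelian_groupI comm_monoidI)
    show "\<one>\<^bsub>S\<^esub> \<in> carrier S" "\<zero>\<^bsub>S\<^esub> \<in> carrier S" by (rule one zero)+
  next
    fix a b assume ab: "a \<in> carrier S" "b \<in> carrier S"
    obtain U s t where U: "nbhd U" "s \<in> carrier (R U)" "t \<in> carrier (R U)" "a = g U s" "b = g U t"
      using common3[OF ab ab(2)] by metis
    interpret U: cring "R U" using R[OF U(1)] .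
    show "a \<oplus>\<^bsub>S\<^esub> b \<in> carrier S" "a \<otimes>\<^bsub>S\<^esub> b \<in> carrier S"
      "a \<oplus>\<^bsub>S\<^esub> b = b \<oplus>\<^bsub>S\<^esub> a" "a \<otimes>\<^bsub>S\<^esub> b = b \<otimes>\<^bsub>S\<^esub> a"
      using U by (auto simp: U.a_comm U.m_comm)
    show "\<zero>\<^bsub>S\<^esub> \<oplus>\<^bsub>S\<^esub> a = a" "\<one>\<^bsub>S\<^esub> \<otimes>\<^bsub>S\<^esub> a = a" using U germ_one[OF U(1)] germ_zero[OF U(1)]
      by (metis U.l_zero U.zero_closed germ_add, metis U.l_one U.one_closed germ_mult)
    have "g U (\<ominus>\<^bsub>R U\<^esub> s) \<oplus>\<^bsub>S\<^esub> a = \<zero>\<^bsub>S\<^esub>" using U germ_zero[OF U(1)] germ_add[OF U(1), of "\<ominus>\<^bsub>R U\<^esub> s" s] by (simp add: U.l_neg)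
    then show "\<exists>y\<in>carrier S. y \<oplus>\<^bsub>S\<^esub> a = \<zero>\<^bsub>S\<^esub>"
      by (rule bexI) (simp add: U)
  next
    fix a b c assume ab: "a \<in> carrier S" "b \<in> carrier S" "c \<in> carrier S"
    obtain U s t u where U: "nbhd U" "s \<in> carrier (R U)" "t \<in> carrier (R U)" "u \<in> carrier (R U)" "a = g U s" "b = g U t" "c = g U u"
      using common3[OF ab] by metis
    interpret U: cring "R U" using R[OF U(1)] .
    show "a \<oplus>\<^bsub>S\<^esub> b \<oplus>\<^bsub>S\<^esub> c = a \<oplus>\<^bsub>S\<^esub> (b \<oplus>\<^bsub>S\<^esub> c)"
      "a \<otimes>\<^bsub>S\<^esub> b \<otimes>\<^bsub>S\<^esub> c = a \<otimes>\<^bsub>S\<^esub> (b \<otimes>\<^bsub>S\<^esub> c)"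
      "(a \<oplus>\<^bsub>S\<^esub> b) \<otimes>\<^bsub>S\<^esub> c = a \<otimes>\<^bsub>S\<^esub> c \<oplus>\<^bsub>S\<^esub> b \<otimes>\<^bsub>S\<^esub> c"
      using U by (simp_all add: U.a_assoc U.m_assoc U.l_distr)
  qed
qed

sublocale S: cring S by (rule stalk_cring)

lemma germ_hom: "nbhd U \<Longrightarrow> g U \<in> ring_hom (R U) S"
  by (auto simp: ring_hom_def germ_add germ_mult germ_one)

lemma germ_finsum:
  assumes "nbhd U" "finite I" "\<And>i. i \<in> I \<Longrightarrow> s i \<in> carrier (R U)"
  shows "g U (finsum (R U) s I) = finsum S (\<lambda>i. g U (s i)) I"
proof -
  interpret U: cring "R U" using sect_cring assms by (simp add: nbhd_def)
  interpret h: ring_hom_cring "R U" S "g U"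
    using germ_hom[OF assms(1)] by unfold_locales
  show ?thesis using assms h.hom_finsum[of s I] by (simp add: Pi_def comp_def)
qed

lemma germ_eq_zero:
  assumes "nbhd U" "s \<in> carrier (R U)"
  shows "g U s = \<zero>\<^bsub>S\<^esub> \<longleftrightarrow> (\<exists>W. nbhd W \<and> W \<subseteq> U \<and> r U W s = \<zero>\<^bsub>R W\<^esub>)"
proof -
  have o: "openin X U" using assms by (simp add: nbhd_def)
  interpret U: cring "R U" using sect_cring[OF o] .
  have z: "r U W \<zero>\<^bsub>R U\<^esub> = \<zero>\<^bsub>R W\<^esub>" if "nbhd W" "W \<subseteq> U" for W
    using ring_hom_zero[OF r_hom U.ring_axioms] that o sect_cring[of W] cring.axioms(1) by (auto simp: nbhd_def)
  show ?thesis using germ_eq_iff[OF assms assms(1), of "\<zero>\<^bsub>R U\<^esub>"] germ_zero[OF assms(1)] z by auto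
qed

end

section \<open>Spectra of integral domains\<close>

context domain
begin

abbreviation (input) nonzero where "nonzero \<equiv> carrier R - {\<zero>}"
abbreviation fr where "fr \<equiv> loc_frac R (carrier R - {\<zero>})"

text \<open>In a domain the auxiliary factor in the definition of a fraction cancels, as M avoids
  zero.\<close>

lemma loc_frac_mem:
  assumes M: "M \<subseteq> carrier R - {\<zero>}" "M \<noteq> {}" and a: "a \<in> carrier R" "s \<in> M"
  shows "(b, t) \<in> loc_frac R M a s \<longleftrightarrow> b \<in> carrier R \<and> t \<in> M \<and> a \<otimes> t = b \<otimes> s"
proof -
  have "u \<otimes> (a \<otimes> t) = u \<otimes> (b \<otimes> s) \<longleftrightarrow> a \<otimes> t = b \<otimes> s" if "u \<in> M" "b \<in> carrier R" "t \<in> M" for u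
    using that M a m_lcancel[of u "a \<otimes> t" "b \<otimes> s"] by (auto simp: subset_iff)
  then show ?thesis using M(2) by (auto simp: loc_frac_def)
qed

text \<open>This is transitivity of cross multiplication: the denominator s of the middle fraction
  is non-zero and cancels.\<close>

lemma frac_cross:
  assumes "a \<in> carrier R" "b \<in> carrier R" "c \<in> carrier R" "s \<in> carrier R" "t \<in> carrier R" "u \<in> carrier R"
    and "s \<noteq> \<zero>" "a \<otimes> s = b \<otimes> t" "c \<otimes> s = b \<otimes> u"
  shows "a \<otimes> u = c \<otimes> t"
proof -
  have "s \<otimes> (a \<otimes> u) = (a \<otimes> s) \<otimes> u" using assms(1-6) by (simp add: m_ac)
  also have "\<dots> = (b \<otimes> t) \<otimes> u" using assms(8) by simp
  also have "\<dots> = (b \<otimes> u) \<otimes> t" using assms(1-6) by (simp add: m_ac)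
  also have "\<dots> = (c \<otimes> s) \<otimes> t" using assms(9) by simp
  also have "\<dots> = s \<otimes> (c \<otimes> t)" using assms(1-6) by (simp add: m_ac)
  finally show ?thesis using assms m_lcancel[of s "a \<otimes> u" "c \<otimes> t"] by simp
qed

lemma loc_frac_eq_iff:
  assumes M: "M \<subseteq> carrier R - {\<zero>}" and a: "a \<in> carrier R" "s \<in> M" and b: "b \<in> carrier R" "t \<in> M"
  shows "loc_frac R M a s = loc_frac R M b t \<longleftrightarrow> a \<otimes> t = b \<otimes> s"
proof -
  have ne: "M \<noteq> {}" using a by blast
  have sub: "loc_frac R M a s \<subseteq> loc_frac R M b t" if q: "a \<otimes> t = b \<otimes> s" "a \<in> carrier R" "s \<in> M" "b \<in> carrier R" "t \<in> M" for a s b t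
  proof
    fix p assume "p \<in> loc_frac R M a s"
    then obtain c u where p: "p = (c, u)" "c \<in> carrier R" "u \<in> M" "a \<otimes> u = c \<otimes> s"
      using loc_frac_mem[OF M ne q(2,3)] by (cases p) auto
    have "b \<otimes> u = c \<otimes> t"
      by (rule frac_cross[of b a c s t u]) (use q p M in auto)
    then show "p \<in> loc_frac R M b t" using p loc_frac_mem[OF M ne q(4,5)] by simp
  qed
  have "(a, s) \<in> loc_frac R M a s" using a loc_frac_mem[OF M ne a] by simp
  then show ?thesis
    using sub[OF _ a b] sub[OF _ b a] loc_frac_mem[OF M ne b, of a s] by (metis subset_antisym)
qed

lemma fr_eq_iff:
  "a \<in> carrier R \<Longrightarrow> s \<in> nonzero \<Longrightarrow> b \<in> carrier R \<Longrightarrow> t \<in> nonzero \<Longrightarrow> fr a s = fr b t \<longleftrightarrow> a \<otimes> t = b \<otimes> s"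
  by (rule loc_frac_eq_iff) auto

lemma fr_carrier: "x \<in> carrier (fraction_field R) \<longleftrightarrow> (\<exists>a\<in>carrier R. \<exists>s\<in>nonzero. x = fr a s)"
  by (auto simp: fraction_field_def localization_def)

lemma fr_closed [simp]: "a \<in> carrier R \<Longrightarrow> s \<in> nonzero \<Longrightarrow> fr a s \<in> carrier (fraction_field R)"
  by (auto simp: fr_carrier)

lemma nonzero_mult: "s \<in> nonzero \<Longrightarrow> t \<in> nonzero \<Longrightarrow> s \<otimes> t \<in> nonzero"
  using integral by auto

text \<open>As for stalks, an operation given by a union over representatives collapses to a single
  value once it is independent of them.\<close>

lemma loc_op:
  assumes M: "M \<subseteq> nonzero" and a: "a \<in> carrier R" "s \<in> M" and b: "b \<in> carrier R" "t \<in> M"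
    and eq: "\<And>a' s' b' t'. a' \<in> carrier R \<Longrightarrow> s' \<in> M \<Longrightarrow> b' \<in> carrier R \<Longrightarrow> t' \<in> M
      \<Longrightarrow> a \<otimes> s' = a' \<otimes> s \<Longrightarrow> b \<otimes> t' = b' \<otimes> t \<Longrightarrow> f a' s' b' t' = f a s b t"
  shows "(\<Union>(a', s')\<in>loc_frac R M a s. \<Union>(b', t')\<in>loc_frac R M b t. f a' s' b' t') = f a s b t"
proof -
  have ne: "M \<noteq> {}" using a by blast
  have "f a' s' b' t' = f a s b t" if "(a', s') \<in> loc_frac R M a s" "(b', t') \<in> loc_frac R M b t" for a' s' b' t'
    using that loc_frac_mem[OF M ne a] loc_frac_mem[OF M ne b] by (intro eq) auto
  then have "(\<Union>(a', s')\<in>loc_frac R M a s. \<Union>(b', t')\<in>loc_frac R M b t. f a' s' b' t')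
      = (\<Union>(a', s')\<in>loc_frac R M a s. \<Union>(b', t')\<in>loc_frac R M b t. f a s b t)"
    by fastforce
  also have "(a, s) \<in> loc_frac R M a s" "(b, t) \<in> loc_frac R M b t"
    using loc_frac_mem[OF M ne a] loc_frac_mem[OF M ne b] a b by auto
  then have "(\<Union>(a', s')\<in>loc_frac R M a s. \<Union>(b', t')\<in>loc_frac R M b t. f a s b t) = f a s b t" by blast
  finally show ?thesis .
qed

lemma loc_frac_mult:
  assumes M: "M \<subseteq> nonzero" "\<And>s t. s \<in> M \<Longrightarrow> t \<in> M \<Longrightarrow> s \<otimes> t \<in> M"
    and a: "a \<in> carrier R" "s \<in> M" and b: "b \<in> carrier R" "t \<in> M"
  shows "loc_frac R M a s \<otimes>\<^bsub>localization R M\<^esub> loc_frac R M b t = loc_frac R M (a \<otimes> b) (s \<otimes> t)"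
  unfolding localization_def monoid.simps
proof (rule loc_op[OF M(1) a b])
  fix a' s' b' t' assume h: "a' \<in> carrier R" "s' \<in> M" "b' \<in> carrier R" "t' \<in> M" "a \<otimes> s' = a' \<otimes> s" "b \<otimes> t' = b' \<otimes> t"
  have c: "s \<in> carrier R" "t \<in> carrier R" "s' \<in> carrier R" "t' \<in> carrier R" using M(1) a b h(2,4) by auto
  have "(a' \<otimes> b') \<otimes> (s \<otimes> t) = (a' \<otimes> s) \<otimes> (b' \<otimes> t)" using h(1,3) a(1) b(1) c by (simp add: m_ac)
  also have "\<dots> = (a \<otimes> s') \<otimes> (b \<otimes> t')" by (simp only: h(5,6))
  also have "\<dots> = (a \<otimes> b) \<otimes> (s' \<otimes> t')" using h(1,3) a(1) b(1) c by (simp add: m_ac)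
  finally show "loc_frac R M (a' \<otimes> b') (s' \<otimes> t') = loc_frac R M (a \<otimes> b) (s \<otimes> t)"
    using h(1-4) a b M by (subst loc_frac_eq_iff) auto
qed

lemma loc_frac_add:
  assumes M: "M \<subseteq> nonzero" "\<And>s t. s \<in> M \<Longrightarrow> t \<in> M \<Longrightarrow> s \<otimes> t \<in> M"
    and a: "a \<in> carrier R" "s \<in> M" and b: "b \<in> carrier R" "t \<in> M"
  shows "loc_frac R M a s \<oplus>\<^bsub>localization R M\<^esub> loc_frac R M b t = loc_frac R M (a \<otimes> t \<oplus> b \<otimes> s) (s \<otimes> t)"
  unfolding localization_def ring.simps
proof (rule loc_op[OF M(1) a b])
  fix a' s' b' t' assume h: "a' \<in> carrier R" "s' \<in> M" "b' \<in> carrier R" "t' \<in> M" "a \<otimes> s' = a' \<otimes> s" "b \<otimes> t' = b' \<otimes> t"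
  have c: "s \<in> carrier R" "t \<in> carrier R" "s' \<in> carrier R" "t' \<in> carrier R" using M(1) a b h(2,4) by auto
  have "(a' \<otimes> t' \<oplus> b' \<otimes> s') \<otimes> (s \<otimes> t) = (a' \<otimes> s) \<otimes> (t' \<otimes> t) \<oplus> (b' \<otimes> t) \<otimes> (s' \<otimes> s)"
    using h(1,3) a(1) b(1) c by (simp add: m_ac l_distr r_distr)
  also have "\<dots> = (a \<otimes> s') \<otimes> (t' \<otimes> t) \<oplus> (b \<otimes> t') \<otimes> (s' \<otimes> s)" by (simp only: h(5,6))
  also have "\<dots> = (a \<otimes> t \<oplus> b \<otimes> s) \<otimes> (s' \<otimes> t')" using h(1,3) a(1) b(1) c by (simp add: m_ac l_distr r_distr)
  finally show "loc_frac R M (a' \<otimes> t' \<oplus> b' \<otimes> s') (s' \<otimes> t') = loc_frac R M (a \<otimes> t \<oplus> b \<otimes> s) (s \<otimes> t)"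
    using h(1-4) a b c M by (subst loc_frac_eq_iff) auto
qed

lemma fr_mult:
  assumes a: "a \<in> carrier R" "s \<in> nonzero" and b: "b \<in> carrier R" "t \<in> nonzero"
  shows "fr a s \<otimes>\<^bsub>fraction_field R\<^esub> fr b t = fr (a \<otimes> b) (s \<otimes> t)"
  unfolding fraction_field_def by (rule loc_frac_mult[OF subset_refl nonzero_mult a b])

lemma fr_add:
  assumes a: "a \<in> carrier R" "s \<in> nonzero" and b: "b \<in> carrier R" "t \<in> nonzero"
  shows "fr a s \<oplus>\<^bsub>fraction_field R\<^esub> fr b t = fr (a \<otimes> t \<oplus> b \<otimes> s) (s \<otimes> t)"
  unfolding fraction_field_def by (rule loc_frac_add[OF subset_refl nonzero_mult a b])

lemma fr_one: "\<one>\<^bsub>fraction_field R\<^esub> = fr \<one> \<one>" and fr_zero: "\<zero>\<^bsub>fraction_field R\<^esub> = fr \<zero> \<one>"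
  by (auto simp: fraction_field_def localization_def)

lemma fr_eq_zero: "a \<in> carrier R \<Longrightarrow> s \<in> nonzero \<Longrightarrow> fr a s = \<zero>\<^bsub>fraction_field R\<^esub> \<longleftrightarrow> a = \<zero>"
  unfolding fr_zero by (subst fr_eq_iff) auto

lemma fraction_field_field: "field (fraction_field R)"
proof -
  have m: "s \<otimes> t \<noteq> \<zero>" if "s \<in> carrier R" "s \<noteq> \<zero>" "t \<in> carrier R" "t \<noteq> \<zero>" for s t using that integral by blast
  let ?Q = "fraction_field R"
  have one: "\<one>\<^bsub>?Q\<^esub> \<in> carrier ?Q" and zero: "\<zero>\<^bsub>?Q\<^esub> \<in> carrier ?Q" by (auto simp: fr_one fr_zero)
  have ex: "\<exists>a s. x = fr a s \<and> a \<in> carrier R \<and> s \<in> carrier R \<and> s \<noteq> \<zero>" if "x \<in> carrier ?Q" for x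
    using that unfolding fr_carrier by blast
  have "cring ?Q"
  proof (intro cringI abelian_groupI comm_monoidI one zero)
    fix x y assume "x \<in> carrier ?Q" "y \<in> carrier ?Q"
    then obtain a s where x: "x = fr a s" "a \<in> carrier R" "s \<in> carrier R" "s \<noteq> \<zero>" using ex by metis
    obtain b t where y: "y = fr b t" "b \<in> carrier R" "t \<in> carrier R" "t \<noteq> \<zero>" using ex[of y] \<open>y \<in> carrier ?Q\<close> by metis
    show "x \<oplus>\<^bsub>?Q\<^esub> y \<in> carrier ?Q" "x \<otimes>\<^bsub>?Q\<^esub> y \<in> carrier ?Q"
      using x y by (auto simp: fr_add fr_mult m intro!: fr_closed)
    show "x \<oplus>\<^bsub>?Q\<^esub> y = y \<oplus>\<^bsub>?Q\<^esub> x" "x \<otimes>\<^bsub>?Q\<^esub> y = y \<otimes>\<^bsub>?Q\<^esub> x"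
      using x y by (auto simp: fr_add fr_mult m_comm a_comm)
    show "\<zero>\<^bsub>?Q\<^esub> \<oplus>\<^bsub>?Q\<^esub> x = x" "\<one>\<^bsub>?Q\<^esub> \<otimes>\<^bsub>?Q\<^esub> x = x"
      using x by (auto simp: fr_add fr_mult fr_one fr_zero)
    have "fr (\<ominus> a) s \<oplus>\<^bsub>?Q\<^esub> x = \<zero>\<^bsub>?Q\<^esub>"
      using x by (simp add: fr_add fr_eq_zero m l_minus l_neg)
    moreover have "fr (\<ominus> a) s \<in> carrier ?Q" using x by auto
    ultimately show "\<exists>y\<in>carrier ?Q. y \<oplus>\<^bsub>?Q\<^esub> x = \<zero>\<^bsub>?Q\<^esub>" by blast
  next
    fix x y z assume "x \<in> carrier ?Q" "y \<in> carrier ?Q" "z \<in> carrier ?Q"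
    then obtain a s where x: "x = fr a s" "a \<in> carrier R" "s \<in> carrier R" "s \<noteq> \<zero>" using ex by metis
    obtain b t where y: "y = fr b t" "b \<in> carrier R" "t \<in> carrier R" "t \<noteq> \<zero>" using ex[of y] \<open>y \<in> carrier ?Q\<close> by metis
    obtain c u where z: "z = fr c u" "c \<in> carrier R" "u \<in> carrier R" "u \<noteq> \<zero>" using ex[of z] \<open>z \<in> carrier ?Q\<close> by metis
    show "x \<otimes>\<^bsub>?Q\<^esub> y \<otimes>\<^bsub>?Q\<^esub> z = x \<otimes>\<^bsub>?Q\<^esub> (y \<otimes>\<^bsub>?Q\<^esub> z)"
      using x y z by (simp add: fr_mult m m_assoc)
    show "x \<oplus>\<^bsub>?Q\<^esub> y \<oplus>\<^bsub>?Q\<^esub> z = x \<oplus>\<^bsub>?Q\<^esub> (y \<oplus>\<^bsub>?Q\<^esub> z)"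
      using x y z by (simp add: fr_add m fr_eq_iff, algebra)
    show "(x \<oplus>\<^bsub>?Q\<^esub> y) \<otimes>\<^bsub>?Q\<^esub> z = x \<otimes>\<^bsub>?Q\<^esub> z \<oplus>\<^bsub>?Q\<^esub> y \<otimes>\<^bsub>?Q\<^esub> z"
      using x y z by (simp add: fr_add fr_mult m fr_eq_iff, algebra)
  qed
  then show ?thesis
  proof (rule cring.cring_fieldI2)
    show "\<zero>\<^bsub>?Q\<^esub> \<noteq> \<one>\<^bsub>?Q\<^esub>" unfolding fr_one by (subst eq_commute, subst fr_eq_zero) auto
    fix x assume x: "x \<in> carrier ?Q" "x \<noteq> \<zero>\<^bsub>?Q\<^esub>"
    then obtain a s where a: "x = fr a s" "a \<in> carrier R" "s \<in> carrier R" "s \<noteq> \<zero>" by (auto simp: fr_carrier)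
    then have "a \<noteq> \<zero>" using x fr_eq_zero by auto
    then have "x \<otimes>\<^bsub>?Q\<^esub> fr s a = \<one>\<^bsub>?Q\<^esub>" "fr s a \<in> carrier ?Q"
      using a by (auto simp: fr_mult fr_one fr_eq_iff m m_comm)
    then show "\<exists>y\<in>carrier ?Q. x \<otimes>\<^bsub>?Q\<^esub> y = \<one>\<^bsub>?Q\<^esub>" by blast
  qed
qed

lemma fr_hom: "(\<lambda>a. fr a \<one>) \<in> ring_hom R (fraction_field R)"
  by (auto simp: ring_hom_def fr_add fr_mult fr_one fr_eq_iff)

lemma fr_inj: "inj_on (\<lambda>a. fr a \<one>) (carrier R)"
  by (auto simp: inj_on_def fr_eq_iff)

lemma fr_denominator: "a \<in> carrier R \<Longrightarrow> s \<in> nonzero \<Longrightarrow> fr a s \<otimes>\<^bsub>fraction_field R\<^esub> fr s \<one> = fr a \<one>"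
  by (auto simp: fr_mult fr_eq_iff m_assoc)

text \<open>This relates the description of a localization by equations inside the fraction field to
  the fractions a / s in which sections of the structure sheaf are given.\<close>

lemma fractions_at_fr:
  assumes P: "primeideal P R"
  shows "fractions_at R (fraction_field R) (\<lambda>a. fr a \<one>) P = {fr a s | a s. a \<in> carrier R \<and> s \<in> carrier R - P}" (is "?L = ?R")
proof -
  have sub: "carrier R - P \<subseteq> nonzero" using P
    by (metis Diff_mono additive_subgroup.zero_closed empty_subsetI ideal.axioms(1) insert_subset order_refl primeideal.axioms(1))
  interpret Q: field "fraction_field R" by (rule fraction_field_field)
  show ?thesis
  proof
    show "?R \<subseteq> ?L"
    proof
      fix x assume "x \<in> ?R"
      then obtain a s where x: "x = fr a s" "a \<in> carrier R" "s \<in> carrier R - P" by blast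
      then have "s \<in> nonzero" using sub by blast
      then show "x \<in> ?L" using x fr_denominator[of a s] by (auto simp: fractions_at_def)
    qed
    show "?L \<subseteq> ?R"
    proof
      fix x assume "x \<in> ?L"
      then obtain a s where x: "x \<in> carrier (fraction_field R)" "a \<in> carrier R" "s \<in> carrier R - P" "x \<otimes>\<^bsub>fraction_field R\<^esub> fr s \<one> = fr a \<one>"
        by (auto simp: fractions_at_def)
      have s: "s \<in> nonzero" using x sub by blast
      obtain b t where b: "x = fr b t" "b \<in> carrier R" "t \<in> nonzero" using x by (auto simp: fr_carrier)
      have "fr (b \<otimes> s) t = fr a \<one>" using x(4) b s by (simp add: fr_mult)
      then have "b \<otimes> s = a \<otimes> t" using b s x by (subst (asm) fr_eq_iff) auto
      then have "x = fr a s" using b s x by (subst b(1), subst fr_eq_iff) auto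
      then show "x \<in> ?R" using x by blast
    qed
  qed
qed

lemma zero_primeideal: "primeideal {\<zero>} R"
  using zeroprimeideal .

text \<open>The sets D(f) enter the topology only as generators. They are a basis because D(f) and
  D(g) intersect in D(f g); the induction follows this through intersections and unions.\<close>

lemma openin_Spec:
  assumes V: "openin (Spec R) V" and P: "P \<in> V"
  shows "primeideal P R \<and> (\<exists>f\<in>carrier R. f \<notin> P \<and> {Q. primeideal Q R \<and> f \<notin> Q} \<subseteq> V)"
proof -
  have "generate_topology_on {{P. primeideal P R \<and> f \<notin> P} | f. f \<in> carrier R} V"
    using V by (simp add: Spec_def openin_topology_generated_by_iff)
  then have "\<forall>P\<in>V. primeideal P R \<and> (\<exists>f\<in>carrier R. f \<notin> P \<and> {Q. primeideal Q R \<and> f \<notin> Q} \<subseteq> V)"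
  proof induction
    case (Int A B)
    show ?case
    proof
      fix P assume P: "P \<in> A \<inter> B"
      obtain f where f: "primeideal P R" "f \<in> carrier R" "f \<notin> P" "{Q. primeideal Q R \<and> f \<notin> Q} \<subseteq> A" using Int P by blast
      obtain g where g: "g \<in> carrier R" "g \<notin> P" "{Q. primeideal Q R \<and> g \<notin> Q} \<subseteq> B" using Int P by blast
      have 1: "f \<otimes> g \<notin> P" using primeideal.I_prime[OF f(1,2) g(1)] f(3) g(2) by blast
      have "f \<notin> Q \<and> g \<notin> Q" if "primeideal Q R" "f \<otimes> g \<notin> Q" for Q
        using ideal.I_l_closed[OF primeideal.axioms(1)[OF that(1)], of g f] ideal.I_r_closed[OF primeideal.axioms(1)[OF that(1)], of f g]
          that(2) f(2) g(1) by blast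
      then have "{Q. primeideal Q R \<and> f \<otimes> g \<notin> Q} \<subseteq> A \<inter> B" using f g by blast
      then show "primeideal P R \<and> (\<exists>f\<in>carrier R. f \<notin> P \<and> {Q. primeideal Q R \<and> f \<notin> Q} \<subseteq> A \<inter> B)"
        using f(1,2) g(1) 1 by blast
    qed
  next
    case (UN K)
    show ?case
    proof
      fix P assume "P \<in> \<Union> K"
      then obtain k where k: "k \<in> K" "P \<in> k" by blast
      have "primeideal P R \<and> (\<exists>f\<in>carrier R. f \<notin> P \<and> {Q. primeideal Q R \<and> f \<notin> Q} \<subseteq> k)" using UN k by blast
      then show "primeideal P R \<and> (\<exists>f\<in>carrier R. f \<notin> P \<and> {Q. primeideal Q R \<and> f \<notin> Q} \<subseteq> \<Union> K)" using k(1) by blast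
    qed
  qed auto
  then show ?thesis using P by blast
qed

lemma openin_basic: "f \<in> carrier R \<Longrightarrow> openin (Spec R) {Q. primeideal Q R \<and> f \<notin> Q}"
  unfolding Spec_def openin_topology_generated_by_iff by (rule generate_topology_on.Basis) blast

lemma topspace_Spec: "topspace (Spec R) = {P. primeideal P R}"
proof
  show "topspace (Spec R) \<subseteq> {P. primeideal P R}" using openin_Spec[of "topspace (Spec R)"] by auto
  have "P \<in> topspace (Spec R)" if "primeideal P R" for P
  proof -
    have "\<one> \<notin> P" using that by (metis ideal.one_imp_carrier primeideal.I_notcarr primeideal.axioms(1))
    then show ?thesis using openin_subset[OF openin_basic[OF one_closed]] that by blast
  qed
  then show "{P. primeideal P R} \<subseteq> topspace (Spec R)" by blast
qed

lemma prime_compl: "primeideal P R \<Longrightarrow> carrier R - P \<subseteq> carrier R - {\<zero>}"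
  using additive_subgroup.zero_closed ideal.axioms(1) primeideal.axioms(1) by blast

text \<open>A basic open set inside V belongs to some f outside a prime. Such an f is non-zero, so
  the zero ideal is in that set.\<close>

lemma zero_in_open:
  assumes V: "openin (Spec R) V" "V \<noteq> {}"
  shows "{\<zero>} \<in> V"
proof -
  obtain P where "P \<in> V" using V(2) by blast
  then obtain f where f: "primeideal P R" "f \<in> carrier R" "f \<notin> P" "{Q. primeideal Q R \<and> f \<notin> Q} \<subseteq> V"
    using openin_Spec[OF V(1)] by metis
  then have "f \<noteq> \<zero>" using prime_compl[of P] by blast
  then show ?thesis using f(4) zero_primeideal by blast
qed

text \<open>Every neighbourhood of P contains the zero ideal, so the fraction that represents the
  section near P also gives its value there. This is how a section comes to be determined by one
  element of the fraction field.\<close>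

lemma Spec_section_local:
  assumes V: "openin (Spec R) V" and \<sigma>: "\<sigma> \<in> carrier (sect (Spec_sheaf R) V)" and P: "P \<in> V"
  shows "\<exists>a\<in>carrier R. \<exists>f\<in>carrier R - P. \<sigma> P = loc_frac R (carrier R - P) a f \<and> \<sigma> {\<zero>} = fr a f"
proof -
  have "\<forall>P\<in>V. \<exists>W a f. openin (Spec R) W \<and> P \<in> W \<and> W \<subseteq> V \<and> a \<in> carrier R \<and> f \<in> carrier R \<and>
             (\<forall>Q\<in>W. f \<notin> Q \<and> \<sigma> Q = loc_frac R (carrier R - Q) a f)"
    using \<sigma> by (simp add: Spec_sheaf_def Let_def)
  from bspec[OF this P] obtain W a f where W: "openin (Spec R) W" "P \<in> W" "a \<in> carrier R" "f \<in> carrier R"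
    and f: "\<And>Q. Q \<in> W \<Longrightarrow> f \<notin> Q \<and> \<sigma> Q = loc_frac R (carrier R - Q) a f"
    by metis
  have "{\<zero>} \<in> W" using zero_in_open[OF W(1)] W(2) by blast
  then show ?thesis using W(3,4) f[of P] f[of "{\<zero>}"] W(2) by blast
qed

lemma Spec_section_eqI:
  assumes V: "openin (Spec R) V" and \<sigma>: "\<sigma> \<in> carrier (sect (Spec_sheaf R) V)" and \<tau>: "\<tau> \<in> carrier (sect (Spec_sheaf R) V)"
    and eq: "\<sigma> {\<zero>} = \<tau> {\<zero>}"
  shows "\<sigma> = \<tau>"
proof (rule extensionalityI[of _ V])
  show "\<sigma> \<in> extensional V" "\<tau> \<in> extensional V" using \<sigma> \<tau> by (auto simp: Spec_sheaf_def Let_def PiE_def)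
  fix P assume P: "P \<in> V"
  have pr: "primeideal P R" using openin_Spec[OF V P] by blast
  note sub = prime_compl[OF pr]
  obtain a f where a: "a \<in> carrier R" "f \<in> carrier R - P" "\<sigma> P = loc_frac R (carrier R - P) a f" "\<sigma> {\<zero>} = fr a f"
    using Spec_section_local[OF V \<sigma> P] by blast
  obtain b g where b: "b \<in> carrier R" "g \<in> carrier R - P" "\<tau> P = loc_frac R (carrier R - P) b g" "\<tau> {\<zero>} = fr b g"
    using Spec_section_local[OF V \<tau> P] by blast
  have "f \<in> nonzero" "g \<in> nonzero" using a b sub by auto
  then have "a \<otimes> g = b \<otimes> f" using a b eq fr_eq_iff[of a f b g] by simp
  then show "\<sigma> P = \<tau> P" using a b loc_frac_eq_iff[OF sub a(1,2) b(1,2)] by simp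
qed

lemma Spec_section_frac:
  assumes V: "openin (Spec R) V" and a: "a \<in> carrier R" "f \<in> carrier R" "\<And>Q. Q \<in> V \<Longrightarrow> f \<notin> Q"
  shows "(\<lambda>P\<in>V. loc_frac R (carrier R - P) a f) \<in> carrier (sect (Spec_sheaf R) V)"
proof -
  have "loc_frac R (carrier R - P) a f \<in> carrier (localization R (carrier R - P))" if "P \<in> V" for P
    using a that by (auto simp: localization_def)
  moreover have "\<forall>P\<in>V. \<exists>W b g. openin (Spec R) W \<and> P \<in> W \<and> W \<subseteq> V \<and> b \<in> carrier R \<and> g \<in> carrier R \<and>
             (\<forall>Q\<in>W. g \<notin> Q \<and> (\<lambda>P\<in>V. loc_frac R (carrier R - P) a f) Q = loc_frac R (carrier R - Q) b g)"
    using V a by (intro ballI exI[of _ V] exI[of _ a] exI[of _ f]) auto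
  ultimately show ?thesis by (simp add: Spec_sheaf_def Let_def)
qed

text \<open>Restriction, product and sum all act on local fractions by a formula \<open>p\<close>
  for the numerator and \<open>q\<close> for the denominator. On the intersection of the
  neighbourhoods belonging to the two sections both fractions are valid, and so is the resulting
  one.\<close>

lemma Spec_section_op:
  assumes V: "openin (Spec R) V" and V': "openin (Spec R) V'" "V' \<subseteq> V"
    and \<sigma>: "\<sigma> \<in> carrier (sect (Spec_sheaf R) V)" and \<tau>: "\<tau> \<in> carrier (sect (Spec_sheaf R) V)"
    and \<rho>: "\<rho> \<in> extensional V'"
    and op: "\<And>P a f b g. P \<in> V' \<Longrightarrow> a \<in> carrier R \<Longrightarrow> f \<in> carrier R - P \<Longrightarrow> b \<in> carrier R \<Longrightarrow> g \<in> carrier R - P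
      \<Longrightarrow> \<sigma> P = loc_frac R (carrier R - P) a f \<Longrightarrow> \<tau> P = loc_frac R (carrier R - P) b g
      \<Longrightarrow> \<rho> P = loc_frac R (carrier R - P) (p a f b g) (q f g)"
    and pq: "\<And>a f b g. a \<in> carrier R \<Longrightarrow> f \<in> carrier R \<Longrightarrow> b \<in> carrier R \<Longrightarrow> g \<in> carrier R \<Longrightarrow> p a f b g \<in> carrier R \<and> q f g \<in> carrier R"
    and q: "\<And>P f g. primeideal P R \<Longrightarrow> f \<in> carrier R - P \<Longrightarrow> g \<in> carrier R - P \<Longrightarrow> q f g \<notin> P"
  shows "\<rho> \<in> carrier (sect (Spec_sheaf R) V')"
proof -
  have loc: "\<exists>W b g. openin (Spec R) W \<and> P \<in> W \<and> W \<subseteq> V' \<and> b \<in> carrier R \<and> g \<in> carrier R \<and>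
             (\<forall>Q\<in>W. g \<notin> Q \<and> \<rho> Q = loc_frac R (carrier R - Q) b g)" if P: "P \<in> V'" for P
  proof -
    have "\<forall>P\<in>V. \<exists>W a f. openin (Spec R) W \<and> P \<in> W \<and> W \<subseteq> V \<and> a \<in> carrier R \<and> f \<in> carrier R \<and>
             (\<forall>Q\<in>W. f \<notin> Q \<and> \<sigma> Q = loc_frac R (carrier R - Q) a f)"
      using \<sigma> by (simp add: Spec_sheaf_def Let_def)
    from bspec[OF this, of P] obtain W a f where W: "openin (Spec R) W" "P \<in> W" "a \<in> carrier R" "f \<in> carrier R"
      and f: "\<And>Q. Q \<in> W \<Longrightarrow> f \<notin> Q \<and> \<sigma> Q = loc_frac R (carrier R - Q) a f"
      using P V'(2) by (metis subsetD)
    have "\<forall>P\<in>V. \<exists>W a f. openin (Spec R) W \<and> P \<in> W \<and> W \<subseteq> V \<and> a \<in> carrier R \<and> f \<in> carrier R \<and>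
             (\<forall>Q\<in>W. f \<notin> Q \<and> \<tau> Q = loc_frac R (carrier R - Q) a f)"
      using \<tau> by (simp add: Spec_sheaf_def Let_def)
    from bspec[OF this, of P] obtain W' b g where W': "openin (Spec R) W'" "P \<in> W'" "b \<in> carrier R" "g \<in> carrier R"
      and g: "\<And>Q. Q \<in> W' \<Longrightarrow> g \<notin> Q \<and> \<tau> Q = loc_frac R (carrier R - Q) b g"
      using P V'(2) by (metis subsetD)
    have "q f g \<notin> Q \<and> \<rho> Q = loc_frac R (carrier R - Q) (p a f b g) (q f g)" if "Q \<in> W \<inter> W' \<inter> V'" for Q
    proof -
      have "primeideal Q R" using openin_Spec[OF W(1)] that by blast
      then have "q f g \<notin> Q" using q[of Q f g] f[of Q] g[of Q] that W W' by blast
      moreover have "\<rho> Q = loc_frac R (carrier R - Q) (p a f b g) (q f g)"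
        by (rule op) (use f[of Q] g[of Q] that W W' in auto)
      ultimately show ?thesis by blast
    qed
    then show ?thesis
      using W W' V'(1) P pq[of a f b g] by (intro exI[of _ "W \<inter> W' \<inter> V'"] exI[of _ "p a f b g"] exI[of _ "q f g"]) auto
  qed
  have "\<rho> P \<in> carrier (localization R (carrier R - P))" if P: "P \<in> V'" for P
  proof -
    obtain W b g where "P \<in> W" "b \<in> carrier R" "g \<in> carrier R" "\<forall>Q\<in>W. g \<notin> Q \<and> \<rho> Q = loc_frac R (carrier R - Q) b g"
      using loc[OF P] by metis
    then show ?thesis by (auto simp: localization_def)
  qed
  then have "\<rho> \<in> (\<Pi>\<^sub>E P\<in>V'. carrier (localization R (carrier R - P)))" using \<rho> by (auto simp: PiE_def)
  then show ?thesis using loc by (simp add: Spec_sheaf_def Let_def)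
qed

lemma prime_compl_mult: "primeideal P R \<Longrightarrow> s \<in> carrier R - P \<Longrightarrow> t \<in> carrier R - P \<Longrightarrow> s \<otimes> t \<in> carrier R - P"
  using primeideal.I_prime[of P R s t] by auto

lemma Spec_section_restrict:
  assumes V: "openin (Spec R) V" and V': "openin (Spec R) V'" "V' \<subseteq> V" and \<sigma>: "\<sigma> \<in> carrier (sect (Spec_sheaf R) V)"
  shows "restrict \<sigma> V' \<in> carrier (sect (Spec_sheaf R) V')"
  by (rule Spec_section_op[OF V V' \<sigma> \<sigma>, of _ "\<lambda>a f b g. a" "\<lambda>f g. f"]) auto

lemma Spec_section_mult:
  assumes V: "openin (Spec R) V" and \<sigma>: "\<sigma> \<in> carrier (sect (Spec_sheaf R) V)" and \<tau>: "\<tau> \<in> carrier (sect (Spec_sheaf R) V)"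
  shows "\<sigma> \<otimes>\<^bsub>sect (Spec_sheaf R) V\<^esub> \<tau> \<in> carrier (sect (Spec_sheaf R) V)"
proof (rule Spec_section_op[OF V V subset_refl \<sigma> \<tau>, of _ "\<lambda>a f b g. a \<otimes> b" "\<lambda>f g. f \<otimes> g"])
  fix P a f b g assume h: "P \<in> V" "a \<in> carrier R" "f \<in> carrier R - P" "b \<in> carrier R" "g \<in> carrier R - P"
    "\<sigma> P = loc_frac R (carrier R - P) a f" "\<tau> P = loc_frac R (carrier R - P) b g"
  have pr: "primeideal P R" using openin_Spec[OF V h(1)] by blast
  show "(\<sigma> \<otimes>\<^bsub>sect (Spec_sheaf R) V\<^esub> \<tau>) P = loc_frac R (carrier R - P) (a \<otimes> b) (f \<otimes> g)"
    using loc_frac_mult[OF prime_compl[OF pr] prime_compl_mult[OF pr] h(2-5)] h by (simp add: Spec_sheaf_def Let_def)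
qed (use prime_compl_mult in \<open>auto simp: Spec_sheaf_def Let_def\<close>)

lemma Spec_section_add:
  assumes V: "openin (Spec R) V" and \<sigma>: "\<sigma> \<in> carrier (sect (Spec_sheaf R) V)" and \<tau>: "\<tau> \<in> carrier (sect (Spec_sheaf R) V)"
  shows "\<sigma> \<oplus>\<^bsub>sect (Spec_sheaf R) V\<^esub> \<tau> \<in> carrier (sect (Spec_sheaf R) V)"
proof (rule Spec_section_op[OF V V subset_refl \<sigma> \<tau>, of _ "\<lambda>a f b g. a \<otimes> g \<oplus> b \<otimes> f" "\<lambda>f g. f \<otimes> g"])
  fix P a f b g assume h: "P \<in> V" "a \<in> carrier R" "f \<in> carrier R - P" "b \<in> carrier R" "g \<in> carrier R - P"
    "\<sigma> P = loc_frac R (carrier R - P) a f" "\<tau> P = loc_frac R (carrier R - P) b g"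
  have pr: "primeideal P R" using openin_Spec[OF V h(1)] by blast
  show "(\<sigma> \<oplus>\<^bsub>sect (Spec_sheaf R) V\<^esub> \<tau>) P = loc_frac R (carrier R - P) (a \<otimes> g \<oplus> b \<otimes> f) (f \<otimes> g)"
    using loc_frac_add[OF prime_compl[OF pr] prime_compl_mult[OF pr] h(2-5)] h by (simp add: Spec_sheaf_def Let_def)
qed (use prime_compl_mult in \<open>auto simp: Spec_sheaf_def Let_def\<close>)

lemma Spec_section_one:
  assumes V: "openin (Spec R) V"
  shows "\<one>\<^bsub>sect (Spec_sheaf R) V\<^esub> \<in> carrier (sect (Spec_sheaf R) V)"
proof -
  have "\<one> \<notin> Q" if "Q \<in> V" for Q
    using openin_Spec[OF V that] by (metis ideal.one_imp_carrier primeideal.I_notcarr primeideal.axioms(1))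
  then have "(\<lambda>P\<in>V. loc_frac R (carrier R - P) \<one> \<one>) \<in> carrier (sect (Spec_sheaf R) V)"
    by (intro Spec_section_frac[OF V]) auto
  then show ?thesis by (simp add: Spec_sheaf_def Let_def localization_def)
qed

end

section \<open>Charts of Krull schemes\<close>

abbreviation to_frac :: "('r, 'm) ring_scheme \<Rightarrow> 'r \<Rightarrow> ('r \<times> 'r) set" where
  "to_frac A a \<equiv> loc_frac A (carrier A - {\<zero>\<^bsub>A\<^esub>}) a \<one>\<^bsub>A\<^esub>"

lemma krull_ring_family:
  assumes "krull_ring A"
  shows "\<exists>V. krull_family A (fraction_field A) (to_frac A) V"
proof -
  interpret domain A using assms by (simp add: krull_ring_def)
  obtain V where V: "\<forall>v\<in>V. discrete_valuation (fraction_field A) v"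
    "to_frac A ` carrier A = carrier (fraction_field A) \<inter> (\<Inter>v\<in>V. valuation_ring (fraction_field A) v)"
    "\<forall>f\<in>carrier (mult_of (fraction_field A)). finite {v \<in> V. v f \<noteq> 0}"
    using assms unfolding krull_ring_def by blast
  have frac: "\<exists>a\<in>carrier A. \<exists>s\<in>carrier A - {\<zero>\<^bsub>A\<^esub>}. x \<otimes>\<^bsub>fraction_field A\<^esub> to_frac A s = to_frac A a"
    if x: "x \<in> carrier (fraction_field A)" for x
  proof -
    obtain a s where "a \<in> carrier A" "s \<in> carrier A - {\<zero>\<^bsub>A\<^esub>}" "x = fr a s" using x unfolding fr_carrier by metis
    then show ?thesis using fr_denominator by metis
  qed
  show ?thesis
    by (rule exI[of _ V], intro krull_family.intro krull_family_axioms.intro domain_axioms fraction_field_field fr_hom fr_inj)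
      (use V frac in auto)
qed

locale krull_scheme_space =
  fixes X :: "'p topology" and \<O> :: "('p, 'r) ring_presheaf"
  assumes krull: "krull_scheme X \<O>"
begin

lemma sheaf: "ring_sheaf_on X \<O>"
  using krull by (simp add: krull_scheme_def integral_scheme_def scheme_def)

lemma presheaf: "ring_presheaf_on X \<O>"
  using sheaf by (simp add: ring_sheaf_on_def)

lemma res_hom: "openin X U \<Longrightarrow> openin X V \<Longrightarrow> V \<subseteq> U \<Longrightarrow> restr \<O> U V \<in> ring_hom (sect \<O> U) (sect \<O> V)"
  using presheaf by (auto simp: ring_presheaf_on_def)

lemma res_closed: "openin X U \<Longrightarrow> openin X V \<Longrightarrow> V \<subseteq> U \<Longrightarrow> s \<in> carrier (sect \<O> U) \<Longrightarrow> restr \<O> U V s \<in> carrier (sect \<O> V)"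
  using res_hom[of U V] by (rule ring_hom_closed)

lemma res_comp: "openin X U \<Longrightarrow> openin X V \<Longrightarrow> openin X W \<Longrightarrow> W \<subseteq> V \<Longrightarrow> V \<subseteq> U \<Longrightarrow> s \<in> carrier (sect \<O> U)
  \<Longrightarrow> restr \<O> V W (restr \<O> U V s) = restr \<O> U W s"
  using presheaf by (auto simp: ring_presheaf_on_def presheaf_on_def)

lemma sect_domain: "openin X U \<Longrightarrow> U \<noteq> {} \<Longrightarrow> domain (sect \<O> U)"
  using krull by (simp add: krull_scheme_def integral_scheme_def)

lemma glue:
  assumes "\<And>U. U \<in> C \<Longrightarrow> openin X U \<and> s U \<in> carrier (sect \<O> U)"
    and "\<And>U V. U \<in> C \<Longrightarrow> V \<in> C \<Longrightarrow> restr \<O> U (U \<inter> V) (s U) = restr \<O> V (U \<inter> V) (s V)"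
  shows "\<exists>!t. t \<in> carrier (sect \<O> (\<Union>C)) \<and> (\<forall>U\<in>C. restr \<O> (\<Union>C) U t = s U)"
proof -
  have "\<forall>C s. (\<forall>U\<in>C. openin X U \<and> s U \<in> carrier (sect \<O> U)) \<and>
            (\<forall>U\<in>C. \<forall>V\<in>C. restr \<O> U (U \<inter> V) (s U) = restr \<O> V (U \<inter> V) (s V))
        \<longrightarrow> (\<exists>!t. t \<in> carrier (sect \<O> (\<Union>C)) \<and> (\<forall>U\<in>C. restr \<O> (\<Union>C) U t = s U))"
    by (rule conjunct2[OF conjunct2[OF sheaf[unfolded ring_sheaf_on_def sheaf_on_def]]])
  from spec[OF spec[OF this, of C], of s] show ?thesis
  proof (rule mp, intro conjI ballI)
    fix U assume "U \<in> C"
    then show "openin X U" "s U \<in> carrier (sect \<O> U)" using assms(1) by simp_all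
    fix V assume "V \<in> C"
    with \<open>U \<in> C\<close> show "restr \<O> U (U \<inter> V) (s U) = restr \<O> V (U \<inter> V) (s V)" by (rule assms(2))
  qed
qed

lemma sect_eqI:
  assumes "\<And>U. U \<in> C \<Longrightarrow> openin X U" and s: "s \<in> carrier (sect \<O> (\<Union>C))" and t: "t \<in> carrier (sect \<O> (\<Union>C))"
    and eq: "\<And>U. U \<in> C \<Longrightarrow> restr \<O> (\<Union>C) U s = restr \<O> (\<Union>C) U t"
  shows "s = t"
proof -
  have o: "openin X (\<Union>C)" using assms by blast
  have "\<exists>!u. u \<in> carrier (sect \<O> (\<Union>C)) \<and> (\<forall>U\<in>C. restr \<O> (\<Union>C) U u = restr \<O> (\<Union>C) U s)"
  proof (rule glue)
    fix U assume "U \<in> C"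
    then show "openin X U \<and> restr \<O> (\<Union>C) U s \<in> carrier (sect \<O> U)" using assms(1) res_closed[OF o _ _ s, of U] by blast
  next
    fix U V assume UV: "U \<in> C" "V \<in> C"
    then have "openin X U" "openin X V" "openin X (U \<inter> V)" "U \<subseteq> \<Union>C" "V \<subseteq> \<Union>C" using assms(1) by auto
    then show "restr \<O> U (U \<inter> V) (restr \<O> (\<Union>C) U s) = restr \<O> V (U \<inter> V) (restr \<O> (\<Union>C) V s)"
      using res_comp[OF o _ _ _ _ s] by simp
  qed
  then show ?thesis using s t eq by metis
qed

text \<open>On a disjoint union of two non-empty open sets the sections (1, 0) and (0, 1) glue and
  have product zero, so the sections would not form a domain. This is irreducibility of X, on which
  all comparisons at the generic point rest.\<close>

lemma open_Int_nonempty: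
  assumes U: "openin X U" "U \<noteq> {}" and V: "openin X V" "V \<noteq> {}"
  shows "U \<inter> V \<noteq> {}"
proof
  assume dis: "U \<inter> V = {}"
  have UV: "U \<noteq> V" using dis U by auto
  interpret U: domain "sect \<O> U" using sect_domain[OF U] .
  interpret V: domain "sect \<O> V" using sect_domain[OF V] .
  interpret W: domain "sect \<O> (U \<union> V)" by (rule sect_domain) (use U V in auto)
  interpret E: cring "sect \<O> {}" using presheaf by (simp add: ring_presheaf_on_def)
  \<comment> \<open>The empty cover leaves exactly one section over the empty set, so sections over
    disjoint sets are automatically compatible.\<close>
  have "\<exists>!t. t \<in> carrier (sect \<O> (\<Union>{})) \<and> (\<forall>U\<in>{}. restr \<O> (\<Union>{}) U t = undefined)" by (rule glue) auto
  then have triv: "a = b" if "a \<in> carrier (sect \<O> {})" "b \<in> carrier (sect \<O> {})" for a b using that by auto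
  have ex: "\<exists>t. t \<in> carrier (sect \<O> (U \<union> V)) \<and> restr \<O> (U \<union> V) U t = a \<and> restr \<O> (U \<union> V) V t = b"
    if a: "a \<in> carrier (sect \<O> U)" and b: "b \<in> carrier (sect \<O> V)" for a b
  proof -
    have "\<exists>!t. t \<in> carrier (sect \<O> (\<Union>{U, V})) \<and> (\<forall>W\<in>{U, V}. restr \<O> (\<Union>{U, V}) W t = (if W = U then a else b))"
    proof (rule glue)
      fix W W' assume W: "W \<in> {U, V}" "W' \<in> {U, V}"
      show "restr \<O> W (W \<inter> W') (if W = U then a else b) = restr \<O> W' (W \<inter> W') (if W' = U then a else b)"
      proof (cases "W = W'")
        case False
        then have e: "W \<inter> W' = {}" using W dis by auto
        show ?thesis unfolding e by (rule triv; rule res_closed) (use W U V a b UV in auto)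
      qed simp
    qed (use U V a b UV in auto)
    then show ?thesis using UV by auto
  qed
  obtain s where s: "s \<in> carrier (sect \<O> (U \<union> V))" "restr \<O> (U \<union> V) U s = \<one>\<^bsub>sect \<O> U\<^esub>" "restr \<O> (U \<union> V) V s = \<zero>\<^bsub>sect \<O> V\<^esub>"
    using ex[of "\<one>\<^bsub>sect \<O> U\<^esub>" "\<zero>\<^bsub>sect \<O> V\<^esub>"] by auto
  obtain t where t: "t \<in> carrier (sect \<O> (U \<union> V))" "restr \<O> (U \<union> V) U t = \<zero>\<^bsub>sect \<O> U\<^esub>" "restr \<O> (U \<union> V) V t = \<one>\<^bsub>sect \<O> V\<^esub>"
    using ex[of "\<zero>\<^bsub>sect \<O> U\<^esub>" "\<one>\<^bsub>sect \<O> V\<^esub>"] by auto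
  have o: "openin X (U \<union> V)" using U V by auto
  have hU: "restr \<O> (U \<union> V) U \<in> ring_hom (sect \<O> (U \<union> V)) (sect \<O> U)" and hV: "restr \<O> (U \<union> V) V \<in> ring_hom (sect \<O> (U \<union> V)) (sect \<O> V)"
    by (rule res_hom; use o U V in auto)+
  have z: "restr \<O> (U \<union> V) U \<zero>\<^bsub>sect \<O> (U \<union> V)\<^esub> = \<zero>\<^bsub>sect \<O> U\<^esub>" "restr \<O> (U \<union> V) V \<zero>\<^bsub>sect \<O> (U \<union> V)\<^esub> = \<zero>\<^bsub>sect \<O> V\<^esub>"
    using ring_hom_zero[OF hU W.ring_axioms U.ring_axioms] ring_hom_zero[OF hV W.ring_axioms V.ring_axioms] by auto
  have "s \<otimes>\<^bsub>sect \<O> (U \<union> V)\<^esub> t = \<zero>\<^bsub>sect \<O> (U \<union> V)\<^esub>"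
  proof (rule sect_eqI[of "{U, V}"])
    fix W assume "W \<in> {U, V}"
    then show "restr \<O> (\<Union>{U, V}) W (s \<otimes>\<^bsub>sect \<O> (U \<union> V)\<^esub> t) = restr \<O> (\<Union>{U, V}) W \<zero>\<^bsub>sect \<O> (U \<union> V)\<^esub>"
      using s t z ring_hom_mult[OF hU s(1) t(1)] ring_hom_mult[OF hV s(1) t(1)] by auto
  qed (use U V s t in auto)
  then have "s = \<zero>\<^bsub>sect \<O> (U \<union> V)\<^esub> \<or> t = \<zero>\<^bsub>sect \<O> (U \<union> V)\<^esub>" using W.integral s t by blast
  then show False using s t z by auto
qed

end

text \<open>\<open>h\<close> identifies the chart \<open>U\<close> with \<open>Spec A\<close>, and \<open>val W s\<close> is the value of the section \<open>s\<close> of the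
  structure sheaf of \<open>Spec A\<close> at the zero ideal.\<close>

locale krull_chart = krull_scheme_space X \<O> +
  krull_family A "fraction_field A" "to_frac A" V
  for X :: "'p topology" and \<O> :: "('p, 'r) ring_presheaf" and A :: "'r ring" and V +
  fixes U :: "'p set" and h :: "'p \<Rightarrow> 'r set" and val :: "'p set \<Rightarrow> 'r \<Rightarrow> ('r \<times> 'r) set"
  assumes chart_open: "openin X U"
    and h_inj: "inj_on h U"
    and h_img: "h ` U = {P. primeideal P A}"
    and h_open: "W \<subseteq> U \<Longrightarrow> openin (Spec A) (h ` W) \<longleftrightarrow> openin X W"
    and val_hom: "openin X W \<Longrightarrow> W \<noteq> {} \<Longrightarrow> W \<subseteq> U \<Longrightarrow> val W \<in> ring_hom (sect \<O> W) (fraction_field A)"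
    and val_inj: "openin X W \<Longrightarrow> W \<noteq> {} \<Longrightarrow> W \<subseteq> U \<Longrightarrow> inj_on (val W) (carrier (sect \<O> W))"
    and val_restr: "openin X W \<Longrightarrow> openin X W' \<Longrightarrow> W' \<noteq> {} \<Longrightarrow> W' \<subseteq> W \<Longrightarrow> W \<subseteq> U \<Longrightarrow> s \<in> carrier (sect \<O> W)
      \<Longrightarrow> val W' (restr \<O> W W' s) = val W s"
    and val_local: "openin X W \<Longrightarrow> x \<in> W \<Longrightarrow> W \<subseteq> U \<Longrightarrow> s \<in> carrier (sect \<O> W) \<Longrightarrow> val W s \<in> loc (h x)"
    and val_ex: "x \<in> U \<Longrightarrow> z \<in> loc (h x) \<Longrightarrow> \<exists>W s. openin X W \<and> x \<in> W \<and> W \<subseteq> U \<and> s \<in> carrier (sect \<O> W) \<and> val W s = z"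

text \<open>The isomorphism with a spectrum is translated into values in the fraction field: a
  section is known by its value at the zero ideal, so the structure sheaf on the chart becomes a
  family of subrings of one field.\<close>

lemma (in krull_scheme_space) chart_exists:
  fixes A :: "'r ring"
  assumes A: "krull_ring A" and U: "openin X U" and iso: "ringed_space_iso (subtopology X U) \<O> (Spec A) (Spec_sheaf A)"
  shows "\<exists>V h val. krull_chart X \<O> A V U h val"
proof -
  interpret domain A using A by (simp add: krull_ring_def)
  obtain V where V: "krull_family A (fraction_field A) (to_frac A) V" using krull_ring_family[OF A] by blast
  have top: "topspace (subtopology X U) = U" using openin_subset[OF U] by (auto simp: topspace_subtopology)
  obtain h \<phi> where h\<phi>: "homeomorphic_map (subtopology X U) (Spec A) h \<and>
      (\<forall>V. openin (Spec A) V \<longrightarrow> \<phi> V \<in> ring_iso (sect (Spec_sheaf A) V) (sect \<O> {x \<in> U. h x \<in> V})) \<and>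
      (\<forall>V W s. openin (Spec A) V \<and> openin (Spec A) W \<and> W \<subseteq> V \<and> s \<in> carrier (sect (Spec_sheaf A) V) \<longrightarrow>
           \<phi> W (restr (Spec_sheaf A) V W s) = restr \<O> {x \<in> U. h x \<in> V} {x \<in> U. h x \<in> W} (\<phi> V s))"
    using iso unfolding ringed_space_iso_def top by (elim exE) (rule that, assumption)
  note hom = conjunct1[OF h\<phi>] and \<phi> = conjunct1[OF conjunct2[OF h\<phi>]] and \<phi>r = conjunct2[OF conjunct2[OF h\<phi>]]
  have inj: "inj_on h U" using homeomorphic_imp_injective_map[OF hom] top by simp
  have img: "h ` U = {P. primeideal P A}" using homeomorphic_imp_surjective_map[OF hom] top topspace_Spec by simp
  have opn: "openin (Spec A) (h ` W) \<longleftrightarrow> openin X W" if "W \<subseteq> U" for W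
    using homeomorphic_map_openness[OF hom, unfolded top, OF that] openin_open_subtopology[OF U, of W] that by simp
  have pre: "{x \<in> U. h x \<in> h ` W} = W" if "W \<subseteq> U" for W
    using that inj_on_image_mem_iff[OF inj _ that] by blast
  define S where "S W = sect (Spec_sheaf A) (h ` W)" for W
  have iso: "\<phi> (h ` W) \<in> ring_iso (S W) (sect \<O> W)" if "openin X W" "W \<subseteq> U" for W
  proof -
    have "openin (Spec A) (h ` W)" using opn that by simp
    from \<phi>[rule_format, OF this] show ?thesis using pre[OF that(2)] by (simp add: S_def)
  qed
  have bij: "bij_betw (\<phi> (h ` W)) (carrier (S W)) (carrier (sect \<O> W))" and rh: "\<phi> (h ` W) \<in> ring_hom (S W) (sect \<O> W)" if "openin X W" "W \<subseteq> U" for W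
    using iso[OF that] by (auto simp: ring_iso_def)
  define val where "val W s = inv_into (carrier (S W)) (\<phi> (h ` W)) s {\<zero>\<^bsub>A\<^esub>}" for W s
  have val: "val W (\<phi> (h ` W) \<sigma>) = \<sigma> {\<zero>\<^bsub>A\<^esub>}" if "openin X W" "W \<subseteq> U" "\<sigma> \<in> carrier (S W)" for W \<sigma>
    using bij[OF that(1,2)] that(3) by (simp add: val_def bij_betw_def)
  have ex: "\<exists>\<sigma>\<in>carrier (S W). s = \<phi> (h ` W) \<sigma>" if "openin X W" "W \<subseteq> U" "s \<in> carrier (sect \<O> W)" for W s
    using bij[OF that(1,2)] that(3) unfolding bij_betw_def by blast
  have zin: "{\<zero>\<^bsub>A\<^esub>} \<in> h ` W" if "openin X W" "W \<subseteq> U" "W \<noteq> {}" for W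
    using zero_in_open[of "h ` W"] opn[of W] that by auto
  have loc0: "localization A (carrier A - {\<zero>\<^bsub>A\<^esub>}) = fraction_field A" by (simp add: fraction_field_def)
  have Sops: "carrier (S W) = carrier (sect (Spec_sheaf A) (h ` W))"
     "\<sigma> \<in> carrier (S W) \<Longrightarrow> \<tau> \<in> carrier (S W) \<Longrightarrow> (\<sigma> \<otimes>\<^bsub>S W\<^esub> \<tau>) {\<zero>\<^bsub>A\<^esub>} = \<sigma> {\<zero>\<^bsub>A\<^esub>} \<otimes>\<^bsub>fraction_field A\<^esub> \<tau> {\<zero>\<^bsub>A\<^esub>}"
     "\<sigma> \<in> carrier (S W) \<Longrightarrow> \<tau> \<in> carrier (S W) \<Longrightarrow> (\<sigma> \<oplus>\<^bsub>S W\<^esub> \<tau>) {\<zero>\<^bsub>A\<^esub>} = \<sigma> {\<zero>\<^bsub>A\<^esub>} \<oplus>\<^bsub>fraction_field A\<^esub> \<tau> {\<zero>\<^bsub>A\<^esub>}"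
     "\<one>\<^bsub>S W\<^esub> {\<zero>\<^bsub>A\<^esub>} = \<one>\<^bsub>fraction_field A\<^esub>"
    if "{\<zero>\<^bsub>A\<^esub>} \<in> h ` W" for W \<sigma> \<tau>
    using that loc0 by (simp_all add: S_def Spec_sheaf_def Let_def)
  have Scr: "cring (sect \<O> W)" if "openin X W" for W using presheaf that by (simp add: ring_presheaf_on_def)
  have fa: "fractions_at A (fraction_field A) (to_frac A) P = {fr a s | a s. a \<in> carrier A \<and> s \<in> carrier A - P}" if "primeideal P A" for P
    using fractions_at_fr[OF that] .
  have local: "val W s \<in> fractions_at A (fraction_field A) (to_frac A) (h x)"
    if W: "openin X W" "x \<in> W" "W \<subseteq> U" "s \<in> carrier (sect \<O> W)" for W x s
  proof -
    obtain \<sigma> where \<sigma>: "\<sigma> \<in> carrier (S W)" "s = \<phi> (h ` W) \<sigma>" using ex W by blast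
    have o: "openin (Spec A) (h ` W)" using opn W by simp
    have "h x \<in> h ` W" using W by blast
    then obtain a f where "a \<in> carrier A" "f \<in> carrier A - h x" "\<sigma> {\<zero>\<^bsub>A\<^esub>} = fr a f"
      using Spec_section_local[OF o _ \<open>h x \<in> h ` W\<close>, of \<sigma>] \<sigma>(1) by (auto simp: S_def)
    moreover have "val W s = \<sigma> {\<zero>\<^bsub>A\<^esub>}" using val W \<sigma> by simp
    moreover have "primeideal (h x) A" using img W by auto
    ultimately show ?thesis using fa by auto
  qed
  have "krull_chart X \<O> A V U h val"
  proof (intro krull_chart.intro krull_chart_axioms.intro)
    show "krull_scheme_space X \<O>" by unfold_locales
    show "krull_family A (fraction_field A) (to_frac A) V" by fact
    show "openin X U" "inj_on h U" "h ` U = {P. primeideal P A}" by fact+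
    show "openin (Spec A) (h ` W) \<longleftrightarrow> openin X W" if "W \<subseteq> U" for W using opn that .
    show "val W s \<in> fractions_at A (fraction_field A) (to_frac A) (h x)"
      if "openin X W" "x \<in> W" "W \<subseteq> U" "s \<in> carrier (sect \<O> W)" for W x s using local that .
  next
    fix W assume W: "openin X W" "W \<noteq> {}" "W \<subseteq> U"
    note z = zin[OF W(1,3,2)]
    have o: "openin (Spec A) (h ` W)" using opn W by simp
    note vW = val[OF W(1,3)] and eW = ex[OF W(1,3)]
    interpret O: cring "sect \<O> W" using Scr W by simp
    note iso' = iso[OF W(1,3)] and rh' = rh[OF W(1,3)]
    obtain x where x: "x \<in> W" using W by blast
    have Sc: "\<sigma> \<otimes>\<^bsub>S W\<^esub> \<tau> \<in> carrier (S W)" "\<sigma> \<oplus>\<^bsub>S W\<^esub> \<tau> \<in> carrier (S W)"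
      if "\<sigma> \<in> carrier (S W)" "\<tau> \<in> carrier (S W)" for \<sigma> \<tau>
      using Spec_section_mult[OF o] Spec_section_add[OF o] that by (auto simp: S_def)
    show "val W \<in> ring_hom (sect \<O> W) (fraction_field A)"
    proof (rule ring_hom_memI)
      fix s assume "s \<in> carrier (sect \<O> W)"
      then show "val W s \<in> carrier (fraction_field A)" using local[OF W(1) x W(3)] by (auto simp: fractions_at_def)
    next
      fix s t assume "s \<in> carrier (sect \<O> W)" "t \<in> carrier (sect \<O> W)"
      then obtain \<sigma> \<tau> where \<sigma>: "\<sigma> \<in> carrier (S W)" "s = \<phi> (h ` W) \<sigma>" and \<tau>: "\<tau> \<in> carrier (S W)" "t = \<phi> (h ` W) \<tau>"
        using eW by metis
      have "s \<otimes>\<^bsub>sect \<O> W\<^esub> t = \<phi> (h ` W) (\<sigma> \<otimes>\<^bsub>S W\<^esub> \<tau>)" "s \<oplus>\<^bsub>sect \<O> W\<^esub> t = \<phi> (h ` W) (\<sigma> \<oplus>\<^bsub>S W\<^esub> \<tau>)"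
        using \<sigma> \<tau> ring_hom_mult[OF rh'] ring_hom_add[OF rh'] by auto
      then show "val W (s \<otimes>\<^bsub>sect \<O> W\<^esub> t) = val W s \<otimes>\<^bsub>fraction_field A\<^esub> val W t"
         "val W (s \<oplus>\<^bsub>sect \<O> W\<^esub> t) = val W s \<oplus>\<^bsub>fraction_field A\<^esub> val W t"
        using \<sigma> \<tau> vW Sc Sops[OF z] by auto
    next
      have "\<one>\<^bsub>S W\<^esub> \<in> carrier (S W)" using Spec_section_one[OF o] by (simp add: S_def)
      then show "val W \<one>\<^bsub>sect \<O> W\<^esub> = \<one>\<^bsub>fraction_field A\<^esub>"
        using vW[of "\<one>\<^bsub>S W\<^esub>"] ring_hom_one[OF rh'] Sops(4)[OF z] by simp
    qed
    show "inj_on (val W) (carrier (sect \<O> W))"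
    proof (rule inj_onI)
      fix s t assume "s \<in> carrier (sect \<O> W)" "t \<in> carrier (sect \<O> W)" and eq: "val W s = val W t"
      then obtain \<sigma> \<tau> where \<sigma>: "\<sigma> \<in> carrier (S W)" "s = \<phi> (h ` W) \<sigma>" and \<tau>: "\<tau> \<in> carrier (S W)" "t = \<phi> (h ` W) \<tau>"
        using eW by metis
      have "\<sigma> = \<tau>" by (rule Spec_section_eqI[OF o]) (use \<sigma> \<tau> eq vW in \<open>auto simp: S_def\<close>)
      then show "s = t" using \<sigma> \<tau> by simp
    qed
  next
    fix W W' s assume W: "openin X W" "openin X W'" "W' \<noteq> {}" "W' \<subseteq> W" "W \<subseteq> U" "s \<in> carrier (sect \<O> W)"
    have o: "openin (Spec A) (h ` W)" "openin (Spec A) (h ` W')" "h ` W' \<subseteq> h ` W" using opn[of W] opn[of W'] W by auto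
    obtain \<sigma> where \<sigma>: "\<sigma> \<in> carrier (S W)" "s = \<phi> (h ` W) \<sigma>" using ex W by blast
    have r: "restr (Spec_sheaf A) (h ` W) (h ` W') \<sigma> = restrict \<sigma> (h ` W')" by (simp add: Spec_sheaf_def Let_def)
    have rc: "restrict \<sigma> (h ` W') \<in> carrier (S W')"
      using Spec_section_restrict[OF o] \<sigma>(1) by (simp add: S_def)
    have "restr \<O> W W' s = \<phi> (h ` W') (restrict \<sigma> (h ` W'))"
      using \<phi>r[rule_format, of "h ` W" "h ` W'" \<sigma>] o \<sigma> r pre[of W] pre[of W'] W by (simp add: S_def)
    then show "val W' (restr \<O> W W' s) = val W s"
      using val[of W' "restrict \<sigma> (h ` W')"] val[of W \<sigma>] rc W \<sigma> zin[of W'] by auto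
  next
    fix x z assume x: "x \<in> U" "z \<in> fractions_at A (fraction_field A) (to_frac A) (h x)"
    have p: "primeideal (h x) A" using img x by auto
    obtain a f where af: "z = fr a f" "a \<in> carrier A" "f \<in> carrier A - h x" using x(2) fa[OF p] by blast
    \<comment> \<open>On the basic open set belonging to f the denominator is never in the prime, so
      a / f is a section given by a single fraction.\<close>
    define D where "D = {Q. primeideal Q A \<and> f \<notin> Q}"
    have D: "openin (Spec A) D" "h x \<in> D" using openin_basic[of f] af p by (auto simp: D_def)
    define W where "W = {y \<in> U. h y \<in> D}"
    have "h ` W = {Q \<in> h ` U. Q \<in> D}" by (auto simp: W_def)
    then have hW: "h ` W = D" unfolding img D_def by simp
    have W: "openin X W" "x \<in> W" "W \<subseteq> U" using opn[of W] hW D x by (auto simp: W_def)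
    define \<sigma> where "\<sigma> = (\<lambda>P\<in>D. loc_frac A (carrier A - P) a f)"
    have \<sigma>: "\<sigma> \<in> carrier (S W)" unfolding S_def hW \<sigma>_def
      by (rule Spec_section_frac[OF D(1)]) (use af in \<open>auto simp: D_def\<close>)
    have "val W (\<phi> (h ` W) \<sigma>) = z" using val[OF W(1,3) \<sigma>] zin[OF W(1,3)] W(2) af hW by (auto simp: \<sigma>_def)
    moreover have "\<phi> (h ` W) \<sigma> \<in> carrier (sect \<O> W)" using bij[OF W(1,3)] \<sigma> by (auto simp: bij_betw_def)
    ultimately show "\<exists>W s. openin X W \<and> x \<in> W \<and> W \<subseteq> U \<and> s \<in> carrier (sect \<O> W) \<and> val W s = z" using W by blast
  qed
  then show ?thesis by blast
qed

lemma (in krull_scheme_space) finite_charts: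
  "\<exists>C. finite C \<and> \<Union>C = topspace X \<and> (\<forall>U\<in>C. \<exists>A V h val. krull_chart X \<O> A V U h val)"
proof -
  obtain C where C: "finite C" "\<forall>U\<in>C. openin X U" "\<Union>C = topspace X"
    "\<forall>U\<in>C. \<exists>A :: 'r ring. krull_ring A \<and> ringed_space_iso (subtopology X U) \<O> (Spec A) (Spec_sheaf A)"
    using krull unfolding krull_scheme_def by blast
  have ex: "\<exists>A V h val. krull_chart X \<O> A V U h val" if U: "U \<in> C" for U
  proof -
    obtain A :: "'r ring" where A: "krull_ring A" "ringed_space_iso (subtopology X U) \<O> (Spec A) (Spec_sheaf A)"
      using C(4) U by blast
    show ?thesis using chart_exists[OF A(1) _ A(2)] C(2) U by blast
  qed
  show ?thesis by (rule exI[of _ C]) (simp add: C(1,3) ex)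
qed

section \<open>The function field of a Krull scheme and its essential valuations\<close>

lemma closure_of_singleton: "x \<in> X closure_of {y} \<longleftrightarrow> x \<in> topspace X \<and> (\<forall>T. openin X T \<and> x \<in> T \<longrightarrow> y \<in> T)"
  by (auto simp: in_closure_of)

lemma irreducible_closure: "y \<in> topspace X \<Longrightarrow> irreducible_closed X (X closure_of {y})"
  unfolding irreducible_closed_def
proof (intro conjI allI impI)
  assume y: "y \<in> topspace X"
  have yc: "y \<in> X closure_of {y}" using y by (simp add: closure_of_singleton)
  then show "X closure_of {y} \<noteq> {}" by blast
  fix A B assume AB: "closedin X A \<and> closedin X B \<and> X closure_of {y} \<subseteq> A \<union> B"
  then have "y \<in> A \<or> y \<in> B" using yc by blast
  then show "X closure_of {y} \<subseteq> A \<or> X closure_of {y} \<subseteq> B" using AB closure_of_minimal[of "{y}" A X] closure_of_minimal[of "{y}" B X] by auto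
qed simp

context krull_chart
begin

lemma chart_nonempty_open: "openin X W \<Longrightarrow> W \<noteq> {} \<Longrightarrow> W \<inter> U \<noteq> {}"
proof (rule open_Int_nonempty)
  have "{\<zero>\<^bsub>A\<^esub>} \<in> h ` U" using h_img A.zero_primeideal by simp
  then show "U \<noteq> {}" by blast
qed (use chart_open in auto)

text \<open>The point x over the zero ideal lies in every non-empty open set, because such a set
  meets the chart and its image there contains the zero ideal. Any other point y with dense closure
  lies in the basic open set of every non-zero f, so its prime contains no such f and y = x. This
  makes the definite description \<open>generic_point\<close> usable.\<close>

lemma generic_in_chart:
  "generic_point X \<in> U" "h (generic_point X) = {\<zero>\<^bsub>A\<^esub>}" "openin X W \<Longrightarrow> W \<noteq> {} \<Longrightarrow> generic_point X \<in> W"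
proof -
  obtain x where x: "x \<in> U" "h x = {\<zero>\<^bsub>A\<^esub>}" using h_img A.zero_primeideal by (metis (mono_tags, lifting) imageE mem_Collect_eq)
  have all: "x \<in> W" if W: "openin X W" "W \<noteq> {}" for W
  proof -
    have "openin (Spec A) (h ` (W \<inter> U))" "h ` (W \<inter> U) \<noteq> {}"
      using h_open[of "W \<inter> U"] W chart_open chart_nonempty_open[OF W] by auto
    then have "{\<zero>\<^bsub>A\<^esub>} \<in> h ` (W \<inter> U)" by (rule A.zero_in_open)
    then obtain y where "y \<in> W" "y \<in> U" "h y = h x" using x by auto
    then show ?thesis using x h_inj by (metis inj_onD)
  qed
  have cl: "x \<in> topspace X \<and> X closure_of {x} = topspace X"
  proof
    show "x \<in> topspace X" using x openin_subset[OF chart_open] by blast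
    show "X closure_of {x} = topspace X"
    proof (rule equalityI[OF closure_of_subset_topspace], rule subsetI)
      fix y assume "y \<in> topspace X"
      then show "y \<in> X closure_of {x}" using all unfolding closure_of_singleton by blast
    qed
  qed
  have uniq: "y = x" if y: "y \<in> topspace X \<and> X closure_of {y} = topspace X" for y
  proof -
    have ally: "y \<in> W" if W: "openin X W" "W \<noteq> {}" for W
    proof -
      obtain p where p: "p \<in> W" using W by blast
      then have "p \<in> X closure_of {y}" using y openin_subset[OF W(1)] by blast
      then show ?thesis using p W(1) unfolding closure_of_singleton by blast
    qed
    have yU: "y \<in> U" using ally[OF chart_open] x by blast
    have "f = \<zero>\<^bsub>A\<^esub>" if f: "f \<in> h y" for f
    proof (rule ccontr)
      assume f0: "f \<noteq> \<zero>\<^bsub>A\<^esub>"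
      have pr: "primeideal (h y) A" using h_img yU by blast
      have fA: "f \<in> carrier A" using f pr by (meson additive_subgroup.a_Hcarr ideal.axioms(1) primeideal.axioms(1))
      define W where "W = {z \<in> U. f \<notin> h z}"
      have "h ` W = {Q \<in> h ` U. f \<notin> Q}" by (auto simp: W_def)
    then have "h ` W = {Q. primeideal Q A \<and> f \<notin> Q}" unfolding h_img by simp
      then have "openin X W" using h_open[of W] A.openin_basic[OF fA] by (auto simp: W_def)
      moreover have "x \<in> W" using x f0 by (auto simp: W_def)
      ultimately have "y \<in> W" using ally by blast
      then show False using f by (simp add: W_def)
    qed
    moreover have "\<zero>\<^bsub>A\<^esub> \<in> h y" using h_img yU prime_zero by blast
    ultimately have "h y = {\<zero>\<^bsub>A\<^esub>}" by blast
    then have "h y = h x" using x by simp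
    then show ?thesis using h_inj yU x by (metis inj_onD)
  qed
  have "generic_point X = x" unfolding generic_point_def by (rule the_equality, rule cl, rule uniq)
  then show "generic_point X \<in> U" "h (generic_point X) = {\<zero>\<^bsub>A\<^esub>}" "openin X W \<Longrightarrow> W \<noteq> {} \<Longrightarrow> generic_point X \<in> W"
    using x all by auto
qed

end

context krull_scheme_space
begin

definition \<xi> where "\<xi> = generic_point X"

lemma chart_at: "x \<in> topspace X \<Longrightarrow> \<exists>A V U h val. krull_chart X \<O> A V U h val \<and> x \<in> U"
  using finite_charts by (metis UnionE)

lemma topspace_nonempty: "topspace X \<noteq> {}"
  using krull by (simp add: krull_scheme_def integral_scheme_def)

lemma generic_in_open: "openin X W \<Longrightarrow> W \<noteq> {} \<Longrightarrow> \<xi> \<in> W"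
  using chart_at topspace_nonempty krull_chart.generic_in_chart(3) unfolding \<xi>_def by (metis ex_in_conv)

sublocale pres: pointed_ring_presheaf X \<O> \<xi>
  by unfold_locales (use presheaf generic_in_open topspace_nonempty in auto)

lemma nbhd_iff: "pres.nbhd W \<longleftrightarrow> openin X W \<and> W \<noteq> {}"
  using generic_in_open by (auto simp: pres.nbhd_def)

abbreviation FF where "FF \<equiv> function_field X \<O>"

lemma FF_def: "FF = stalk X \<O> \<xi>"
  by (simp add: function_field_def \<xi>_def)

abbreviation gm where "gm \<equiv> germ X \<O> \<xi>"

text \<open>The stalk at x, viewed inside the function field; \<open>cospecialization_image\<close>
  identifies it with the subring that occurs in \<open>essential_valuation\<close>.\<close>

definition local_ring where "local_ring x = {gm W s | W s. openin X W \<and> x \<in> W \<and> s \<in> carrier (sect \<O> W)}"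

lemma local_ring_sub: "local_ring x \<subseteq> carrier FF"
  using nbhd_iff unfolding local_ring_def FF_def by (auto intro!: pres.germ_closed)

text \<open>Neighbourhoods of x contain the generic point, so two sections with the same germ at x
  have the same germ there, and the union in \<open>cospecialization\<close> is taken over equal
  sets.\<close>

lemma cospecialization_image:
  assumes x: "x \<in> topspace X"
  shows "cospecialization X \<O> (generic_point X) ` carrier (stalk X \<O> x) = local_ring x"
proof -
  interpret x: pointed_ring_presheaf X \<O> x by unfold_locales (use presheaf x in auto)
  have eq: "cospecialization X \<O> (generic_point X) (germ X \<O> x W s) = gm W s" if W: "openin X W" "x \<in> W" "s \<in> carrier (sect \<O> W)" for W s
  proof -
    have rep: "gm W' s' = gm W s" if m: "(W', s') \<in> germ X \<O> x W s" for W' s'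
    proof -
      obtain T where T: "x.nbhd W'" "s' \<in> carrier (sect \<O> W')" "x.nbhd T" "T \<subseteq> W \<inter> W'" "restr \<O> W T s = restr \<O> W' T s'"
        using m unfolding x.germ_mem by metis
      show ?thesis
        by (rule pres.germ_eqI[of _ _ _ _ T]) (use T W nbhd_iff in \<open>auto simp: x.nbhd_def\<close>)
    qed
    have self: "(W, s) \<in> germ X \<O> x W s" using W by (intro x.germ_self) (auto simp: x.nbhd_def)
    have "cospecialization X \<O> (generic_point X) (germ X \<O> x W s) = (\<Union>p\<in>germ X \<O> x W s. gm W s)"
      unfolding cospecialization_def \<xi>_def[symmetric] by (rule SUP_cong[OF refl]) (use rep in \<open>auto split: prod.split\<close>)
    then show ?thesis using self by auto
  qed
  show ?thesis
  proof
    show "cospecialization X \<O> (generic_point X) ` carrier (stalk X \<O> x) \<subseteq> local_ring x"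
    proof
      fix z assume "z \<in> cospecialization X \<O> (generic_point X) ` carrier (stalk X \<O> x)"
      then obtain W s where "openin X W" "x \<in> W" "s \<in> carrier (sect \<O> W)" "z = cospecialization X \<O> (generic_point X) (germ X \<O> x W s)"
        by (auto simp: x.stalk_carrier x.nbhd_def)
      then show "z \<in> local_ring x" using eq unfolding local_ring_def by auto
    qed
    show "local_ring x \<subseteq> cospecialization X \<O> (generic_point X) ` carrier (stalk X \<O> x)"
    proof
      fix z assume "z \<in> local_ring x"
      then obtain W s where W: "openin X W" "x \<in> W" "s \<in> carrier (sect \<O> W)" "z = gm W s" unfolding local_ring_def by auto
      have "germ X \<O> x W s \<in> carrier (stalk X \<O> x)" using W by (intro x.germ_closed) (auto simp: x.nbhd_def)
      then show "z \<in> cospecialization X \<O> (generic_point X) ` carrier (stalk X \<O> x)" using eq[OF W(1-3)] W(4) by (metis image_eqI)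
    qed
  qed
qed

end

context krull_chart
begin

lemma chart_subset: "U \<subseteq> topspace X"
  using chart_open openin_subset by blast

lemma chart_nbhd: "pres.nbhd W \<Longrightarrow> pres.nbhd (W \<inter> U) \<and> openin X W \<and> openin X (W \<inter> U) \<and> W \<inter> U \<noteq> {}"
  using chart_open chart_nonempty_open nbhd_iff by auto

text \<open>This is the isomorphism from the function field of X to the fraction field of A. A
  representative is picked from the germ and restricted to the chart; \<open>ev_germ\<close> shows
  that the choice does not matter.\<close>

definition ev where "ev c = (let p = (SOME p. p \<in> c) in val (fst p \<inter> U) (restr \<O> (fst p) (fst p \<inter> U) (snd p)))"

text \<open>Two representatives agree over some smaller neighbourhood T, and \<open>val\<close> is
  unaffected by restriction; both therefore evaluate like their common restriction to the part of T
  in the chart.\<close>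

lemma ev_germ:
  assumes W: "pres.nbhd W" "s \<in> carrier (sect \<O> W)"
  shows "ev (gm W s) = val (W \<inter> U) (restr \<O> W (W \<inter> U) s)"
proof -
  have eq: "val (W' \<inter> U) (restr \<O> W' (W' \<inter> U) s') = val (W \<inter> U) (restr \<O> W (W \<inter> U) s)" if m: "(W', s') \<in> gm W s" for W' s'
  proof -
    obtain T where T: "pres.nbhd W'" "s' \<in> carrier (sect \<O> W')" "pres.nbhd T" "T \<subseteq> W \<inter> W'" "restr \<O> W T s = restr \<O> W' T s'"
      using m unfolding pres.germ_mem by metis
    note n = chart_nbhd[OF W(1)] chart_nbhd[OF T(1)] chart_nbhd[OF T(3)]
    have "val (W \<inter> U) (restr \<O> W (W \<inter> U) s) = val (T \<inter> U) (restr \<O> (W \<inter> U) (T \<inter> U) (restr \<O> W (W \<inter> U) s))"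
      by (rule val_restr[symmetric]) (use n T W res_closed[of W "W \<inter> U" s] in auto)
    also have "restr \<O> (W \<inter> U) (T \<inter> U) (restr \<O> W (W \<inter> U) s) = restr \<O> W (T \<inter> U) s"
      by (rule res_comp) (use n T W in auto)
    also have "\<dots> = restr \<O> T (T \<inter> U) (restr \<O> W T s)"
      by (rule res_comp[symmetric]) (use n T W in auto)
    also have "\<dots> = restr \<O> T (T \<inter> U) (restr \<O> W' T s')" using T by simp
    also have "\<dots> = restr \<O> W' (T \<inter> U) s'"
      by (rule res_comp) (use n T W in auto)
    also have "\<dots> = restr \<O> (W' \<inter> U) (T \<inter> U) (restr \<O> W' (W' \<inter> U) s')"
      by (rule res_comp[symmetric]) (use n T W in auto)
    also have "val (T \<inter> U) \<dots> = val (W' \<inter> U) (restr \<O> W' (W' \<inter> U) s')"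
      by (rule val_restr) (use n T W res_closed[of W' "W' \<inter> U" s'] in auto)
    finally show ?thesis by simp
  qed
  have "(SOME p. p \<in> gm W s) \<in> gm W s" using pres.germ_self[OF W] by (rule someI)
  then show ?thesis unfolding ev_def Let_def using eq by (metis prod.collapse)
qed

lemma ev_germ': "pres.nbhd W \<Longrightarrow> W \<subseteq> U \<Longrightarrow> s \<in> carrier (sect \<O> W) \<Longrightarrow> ev (gm W s) = val W s"
  using ev_germ[of W s] pres.r_id[of W s] by (simp add: Int_absorb2 nbhd_iff)

lemma chart_rep:
  assumes "c \<in> carrier FF"
  shows "\<exists>W s. pres.nbhd W \<and> W \<subseteq> U \<and> s \<in> carrier (sect \<O> W) \<and> c = gm W s"
proof -
  obtain W s where W: "pres.nbhd W" "s \<in> carrier (sect \<O> W)" "c = gm W s"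
    using iffD1[OF pres.stalk_carrier assms[unfolded FF_def]] by (elim exE conjE) (rule that)
  note n = chart_nbhd[OF W(1)]
  show ?thesis
    by (rule exI[of _ "W \<inter> U"], rule exI[of _ "restr \<O> W (W \<inter> U) s"])
      (use n W pres.germ_restr[of W s "W \<inter> U"] res_closed[of W "W \<inter> U" s] in auto)
qed

lemma ev_ring_hom: "ev \<in> ring_hom FF (fraction_field A)"
proof (rule ring_hom_memI)
  fix c assume "c \<in> carrier FF"
  then obtain W s where W: "pres.nbhd W" "W \<subseteq> U" "s \<in> carrier (sect \<O> W)" "c = gm W s" using chart_rep by metis
  show "ev c \<in> carrier (fraction_field A)"
    using W ev_germ' val_hom[of W] nbhd_iff ring_hom_closed[of "val W"] by metis
next
  fix c d assume "c \<in> carrier FF" and d: "d \<in> carrier FF"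
  then obtain W s where W: "pres.nbhd W" "W \<subseteq> U" "s \<in> carrier (sect \<O> W)" "c = gm W s" using chart_rep by metis
  obtain W' s' where W': "pres.nbhd W'" "W' \<subseteq> U" "s' \<in> carrier (sect \<O> W')" "d = gm W' s'" using chart_rep d by metis
  have n: "pres.nbhd (W \<inter> W')" "W \<inter> W' \<subseteq> U" using W W' pres.nbhd_Int by auto
  have o: "openin X W" "openin X W'" "openin X (W \<inter> W')" "W \<inter> W' \<noteq> {}" using W W' n nbhd_iff by auto
  define t where "t = restr \<O> W (W \<inter> W') s"
  define t' where "t' = restr \<O> W' (W \<inter> W') s'"
  have t: "t \<in> carrier (sect \<O> (W \<inter> W'))" "t' \<in> carrier (sect \<O> (W \<inter> W'))"
    using o W W' res_closed by (auto simp: t_def t'_def)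
  have cd: "c = gm (W \<inter> W') t" "d = gm (W \<inter> W') t'" using W W' n pres.germ_restr by (auto simp: t_def t'_def)
  interpret O: cring "sect \<O> (W \<inter> W')" using pres.sect_cring o by blast
  note vh = val_hom[OF o(3,4) n(2)]
  show "ev (c \<otimes>\<^bsub>FF\<^esub> d) = ev c \<otimes>\<^bsub>fraction_field A\<^esub> ev d"
    unfolding cd FF_def using pres.germ_mult[OF n(1) t] ev_germ'[OF n] t ring_hom_mult[OF vh t] by simp
  show "ev (c \<oplus>\<^bsub>FF\<^esub> d) = ev c \<oplus>\<^bsub>fraction_field A\<^esub> ev d"
    unfolding cd FF_def using pres.germ_add[OF n(1) t] ev_germ'[OF n] t ring_hom_add[OF vh t] by simp
next
  have n: "pres.nbhd U" using nbhd_iff chart_open generic_in_chart(1) by blast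
  interpret O: cring "sect \<O> U" using pres.sect_cring chart_open by blast
  have "ev (gm U \<one>\<^bsub>sect \<O> U\<^esub>) = \<one>\<^bsub>fraction_field A\<^esub>"
    using ev_germ'[OF n] ring_hom_one[OF val_hom[of U]] n nbhd_iff by auto
  then show "ev \<one>\<^bsub>FF\<^esub> = \<one>\<^bsub>fraction_field A\<^esub>" using pres.germ_one[OF n] by (simp add: FF_def)
qed

lemma ev_inj: "inj_on ev (carrier FF)"
proof (rule inj_onI)
  fix c d assume "c \<in> carrier FF" and d: "d \<in> carrier FF" and eq: "ev c = ev d"
  then obtain W s where W: "pres.nbhd W" "W \<subseteq> U" "s \<in> carrier (sect \<O> W)" "c = gm W s" using chart_rep by metis
  obtain W' s' where W': "pres.nbhd W'" "W' \<subseteq> U" "s' \<in> carrier (sect \<O> W')" "d = gm W' s'" using chart_rep d by metis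
  have n: "pres.nbhd (W \<inter> W')" "W \<inter> W' \<subseteq> U" using W W' pres.nbhd_Int by auto
  have o: "openin X W" "openin X W'" "openin X (W \<inter> W')" "W \<inter> W' \<noteq> {}" using W W' n nbhd_iff by auto
  have t: "restr \<O> W (W \<inter> W') s \<in> carrier (sect \<O> (W \<inter> W'))" "restr \<O> W' (W \<inter> W') s' \<in> carrier (sect \<O> (W \<inter> W'))"
    using o W W' res_closed by auto
  have cd: "c = gm (W \<inter> W') (restr \<O> W (W \<inter> W') s)" "d = gm (W \<inter> W') (restr \<O> W' (W \<inter> W') s')"
    using W W' n pres.germ_restr by auto
  have "val (W \<inter> W') (restr \<O> W (W \<inter> W') s) = val (W \<inter> W') (restr \<O> W' (W \<inter> W') s')"
    using eq cd ev_germ'[OF n] t by simp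
  then have "restr \<O> W (W \<inter> W') s = restr \<O> W' (W \<inter> W') s'" using val_inj[OF o(3,4) n(2)] t by (meson inj_onD)
  then show "c = d" using cd by simp
qed

text \<open>For the converse, \<open>val_ex\<close> realizes the fraction by a section near x, and
  injectivity of \<open>ev\<close> identifies the germ of this section with c.\<close>

lemma local_ring_ev:
  assumes x: "x \<in> U" and c: "c \<in> carrier FF"
  shows "c \<in> local_ring x \<longleftrightarrow> ev c \<in> loc (h x)"
proof
  assume "c \<in> local_ring x"
  then obtain W s where W: "openin X W" "x \<in> W" "s \<in> carrier (sect \<O> W)" "c = gm W s" unfolding local_ring_def by auto
  have n: "pres.nbhd W" using W nbhd_iff by blast
  note n' = chart_nbhd[OF n]
  have "val (W \<inter> U) (restr \<O> W (W \<inter> U) s) \<in> loc (h x)"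
    by (rule val_local) (use n' x W res_closed[of W "W \<inter> U" s] in auto)
  then show "ev c \<in> loc (h x)" using ev_germ[OF n W(3)] W by simp
next
  assume "ev c \<in> loc (h x)"
  then obtain W s where W: "openin X W" "x \<in> W" "W \<subseteq> U" "s \<in> carrier (sect \<O> W)" "val W s = ev c" using val_ex[OF x] by metis
  have n: "pres.nbhd W" using W nbhd_iff by blast
  have "gm W s \<in> carrier FF" using n W by (simp add: FF_def)
  then have "gm W s = c" using ev_inj c ev_germ'[OF n W(3,4)] W(5) by (metis inj_onD)
  then show "c \<in> local_ring x" using W unfolding local_ring_def by blast
qed

text \<open>The localization at the zero ideal is the entire fraction field, so each of its elements
  is the value of a section near the generic point.\<close>

lemma ev_surj:
  assumes z: "z \<in> carrier (fraction_field A)"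
  shows "\<exists>c\<in>carrier FF. ev c = z"
proof -
  have "z \<in> loc (h \<xi>)" unfolding \<xi>_def generic_in_chart(2) fractions_at_def
    by (intro CollectI conjI z frac[OF z])
  then obtain W s where W: "openin X W" "\<xi> \<in> W" "W \<subseteq> U" "s \<in> carrier (sect \<O> W)" "val W s = z"
    using val_ex[of \<xi> z] generic_in_chart(1) unfolding \<xi>_def by metis
  have n: "pres.nbhd W" using W nbhd_iff by blast
  show ?thesis by (rule bexI[of _ "gm W s"]) (use ev_germ'[OF n W(3,4)] W n in \<open>auto simp: FF_def\<close>)
qed

text \<open>Basic open sets test both directions. An f in h y but not in h x would give a
  neighbourhood of x missing y; and a neighbourhood of x contains a basic one, whose f lies outside
  h x and hence outside h y.\<close>

lemma chart_closure:
  assumes "x \<in> U" "y \<in> U"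
  shows "x \<in> X closure_of {y} \<longleftrightarrow> h y \<subseteq> h x"
proof
  assume cl: "x \<in> X closure_of {y}"
  show "h y \<subseteq> h x"
  proof
    fix f assume f: "f \<in> h y"
    have pr: "primeideal (h y) A" using h_img assms by blast
    have fA: "f \<in> carrier A" using f pr by (meson additive_subgroup.a_Hcarr ideal.axioms(1) primeideal.axioms(1))
    define W where "W = {z \<in> U. f \<notin> h z}"
    have "h ` W = {Q \<in> h ` U. f \<notin> Q}" by (auto simp: W_def)
    then have "h ` W = {Q. primeideal Q A \<and> f \<notin> Q}" unfolding h_img by simp
    then have "openin X W" using h_open[of W] A.openin_basic[OF fA] by (auto simp: W_def)
    moreover have "y \<notin> W" using f by (simp add: W_def)
    ultimately have "x \<notin> W" using cl closure_of_singleton by metis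
    then show "f \<in> h x" using assms by (simp add: W_def)
  qed
next
  assume sub: "h y \<subseteq> h x"
  have "y \<in> T" if T: "openin X T" "x \<in> T" for T
  proof -
    have o: "openin (Spec A) (h ` (T \<inter> U))" using h_open[of "T \<inter> U"] T chart_open by auto
    have "h x \<in> h ` (T \<inter> U)" using T assms by auto
    then obtain f where f: "f \<notin> h x" "{Q. primeideal Q A \<and> f \<notin> Q} \<subseteq> h ` (T \<inter> U)" using A.openin_Spec[OF o] by metis
    have "primeideal (h y) A" using h_img assms by blast
    then have "h y \<in> h ` (T \<inter> U)" using f sub by blast
    then obtain y' where "y' \<in> T" "y' \<in> U" "h y' = h y" by auto
    then show ?thesis using h_inj assms by (metis inj_onD)
  qed
  then show "x \<in> X closure_of {y}" using assms chart_subset by (auto simp: closure_of_singleton)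
qed

end

section \<open>Prime divisors\<close>

context krull_scheme_space
begin

lemma xi_in: "\<xi> \<in> topspace X"
  using generic_in_open[of "topspace X"] topspace_nonempty by simp

lemma closure_xi: "X closure_of {\<xi>} = topspace X"
  using closure_of_singleton[of _ X \<xi>] generic_in_open by blast

lemma closure_mono_point: "x \<in> X closure_of {y} \<Longrightarrow> X closure_of {x} \<subseteq> X closure_of {y}"
  by (rule closure_of_minimal) auto

text \<open>Inverses are pulled back along \<open>ev\<close> from the fraction field of a
  chart.\<close>

lemma field_FF: "field FF"
proof -
  obtain A V U h val where "krull_chart X \<O> A V U h val" using chart_at[OF xi_in] by blast
  then interpret c: krull_chart X \<O> A V U h val .
  interpret S: cring FF using pres.stalk_cring by (simp add: FF_def)
  have z: "c.ev \<zero>\<^bsub>FF\<^esub> = \<zero>\<^bsub>fraction_field A\<^esub>" using ring_hom_zero[OF c.ev_ring_hom S.ring_axioms c.F.ring_axioms] .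
  have o: "c.ev \<one>\<^bsub>FF\<^esub> = \<one>\<^bsub>fraction_field A\<^esub>" using ring_hom_one[OF c.ev_ring_hom] .
  show ?thesis
  proof (rule S.cring_fieldI2)
    show "\<zero>\<^bsub>FF\<^esub> \<noteq> \<one>\<^bsub>FF\<^esub>" using z o c.F.zero_not_one by metis
    fix a assume a: "a \<in> carrier FF" "a \<noteq> \<zero>\<^bsub>FF\<^esub>"
    have ea: "c.ev a \<in> carrier (fraction_field A)" using ring_hom_closed[OF c.ev_ring_hom a(1)] .
    have "c.ev a \<noteq> \<zero>\<^bsub>fraction_field A\<^esub>" using a z c.ev_inj S.zero_closed by (metis inj_onD)
    then have u: "c.ev a \<in> Units (fraction_field A)" using ea c.F.field_Units by simp
    obtain b where b: "b \<in> carrier FF" "c.ev b = inv\<^bsub>fraction_field A\<^esub> (c.ev a)" using c.ev_surj[of "inv\<^bsub>fraction_field A\<^esub> (c.ev a)"] u by auto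
    have "c.ev (a \<otimes>\<^bsub>FF\<^esub> b) = c.ev \<one>\<^bsub>FF\<^esub>" using ring_hom_mult[OF c.ev_ring_hom a(1) b(1)] b(2) u o by simp
    then have "a \<otimes>\<^bsub>FF\<^esub> b = \<one>\<^bsub>FF\<^esub>" using c.ev_inj a b by (metis inj_onD S.m_closed S.one_closed)
    then show "\<exists>b\<in>carrier FF. a \<otimes>\<^bsub>FF\<^esub> b = \<one>\<^bsub>FF\<^esub>" using b by blast
  qed
qed

sublocale FF: field FF by (rule field_FF)

end

context krull_chart
begin

lemma ev_zero: "ev \<zero>\<^bsub>FF\<^esub> = \<zero>\<^bsub>fraction_field A\<^esub>"
  using ring_hom_zero[OF ev_ring_hom FF.ring_axioms F.ring_axioms] .

lemma ev_eq_zero: "c \<in> carrier FF \<Longrightarrow> ev c = \<zero>\<^bsub>fraction_field A\<^esub> \<longleftrightarrow> c = \<zero>\<^bsub>FF\<^esub>"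
  using ev_zero ev_inj FF.zero_closed by (metis inj_onD)

lemma chart_prime: "x \<in> U \<Longrightarrow> primeideal (h x) A"
  using h_img by blast

lemma chart_point: "primeideal Q A \<Longrightarrow> \<exists>y\<in>U. h y = Q"
  using h_img by (metis imageE mem_Collect_eq)

text \<open>If h x were zero, x would be generic and no chain could ascend from its closure. A prime
  strictly between zero and h x belongs to a point y of the chart and yields the chain formed by the
  closures of x, of y and of the generic point, which has length two.\<close>

lemma height_one_of_prime_divisor:
  assumes x: "x \<in> U" and cod: "codimension X (X closure_of {x}) = 1"
  shows "height_one A (h x)"
proof -
  define N where "N = {enat n | n. \<exists>c. c 0 = X closure_of {x} \<and> (\<forall>i\<le>n. irreducible_closed X (c i)) \<and> (\<forall>i<n. c i \<subset> c (Suc i))}"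
  have sup: "Sup N = 1" using cod by (simp add: codimension_def N_def)
  have "h x \<noteq> {\<zero>\<^bsub>A\<^esub>}"
  proof
    assume "h x = {\<zero>\<^bsub>A\<^esub>}"
    then have "x = \<xi>" using generic_in_chart(1,2) h_inj x unfolding \<xi>_def by (metis inj_onD)
    then have top: "X closure_of {x} = topspace X" using closure_xi by simp
    have "m \<le> 0" if mN: "m \<in> N" for m
    proof -
      obtain n c where m: "m = enat n" and c: "c 0 = X closure_of {x}" "\<forall>i\<le>n. irreducible_closed X (c i)" "\<forall>i<n. c i \<subset> c (Suc i)"
        using mN unfolding N_def by auto
      have "n = 0"
      proof (rule ccontr)
        assume "n \<noteq> 0"
        then have "c 0 \<subset> c 1" "irreducible_closed X (c 1)" using c(2,3) by auto
        then show False using c(1) top closedin_subset[of X "c 1"] by (auto simp: irreducible_closed_def)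
      qed
      then show ?thesis using m by (simp add: zero_enat_def)
    qed
    then have "Sup N \<le> 0" by (rule Sup_least)
    then show False using sup by simp
  qed
  moreover have "Q = {\<zero>\<^bsub>A\<^esub>}" if Q: "primeideal Q A" "Q \<subset> h x" for Q
  proof (rule ccontr)
    assume Q0: "Q \<noteq> {\<zero>\<^bsub>A\<^esub>}"
    obtain y where y: "y \<in> U" "h y = Q" using chart_point[OF Q(1)] by blast
    have xi: "\<xi> \<in> U" "h \<xi> = {\<zero>\<^bsub>A\<^esub>}" using generic_in_chart(1,2) by (auto simp: \<xi>_def)
    define c where "c i = (if i = 0 then X closure_of {x} else if i = 1 then X closure_of {y} else topspace X)" for i :: nat
    have 1: "X closure_of {x} \<subset> X closure_of {y}"
    proof
      show "X closure_of {x} \<subseteq> X closure_of {y}" using chart_closure[OF x y(1)] Q y by (intro closure_mono_point) auto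
      show "X closure_of {x} \<noteq> X closure_of {y}" using chart_closure[OF y(1) x] chart_closure[OF y(1) y(1)] Q y by auto
    qed
    have 2: "X closure_of {y} \<subset> topspace X"
    proof
      show "X closure_of {y} \<subseteq> topspace X" by (rule closure_of_subset_topspace)
      have "\<not> h y \<subseteq> h \<xi>" using Q0 y xi prime_zero[OF Q(1)] by auto
      then show "X closure_of {y} \<noteq> topspace X" using chart_closure[OF xi(1) y(1)] xi_in by auto
    qed
    have "irreducible_closed X (c i)" for i
      using irreducible_closure[of x X] irreducible_closure[of y X] irreducible_closure[OF xi_in] closure_xi x y chart_subset
      by (auto simp: c_def)
    moreover have "c i \<subset> c (Suc i)" if "i < 2" for i
    proof -
      have "i = 0 \<or> i = 1" using that by auto
      then show ?thesis using 1 2 by (auto simp: c_def)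
    qed
    ultimately have "enat 2 \<in> N" unfolding N_def by (intro CollectI exI[of _ 2] exI[of _ c] conjI) (auto simp: c_def)
    then have "enat 2 \<le> Sup N" by (rule Sup_upper)
    then show False using sup by (simp add: one_enat_def)
  qed
  ultimately show ?thesis using chart_prime[OF x] by (auto simp: height_one_def)
qed

text \<open>A chain of length two or more contains an irreducible closed set strictly between the
  closure of x and X. In place of a generic point of that set, the ideal of all functions vanishing
  on its part in the chart is used. This is a prime inside h x, and both of its possible values, h x
  and zero, are excluded.\<close>

lemma prime_divisor_of_height_one:
  assumes x: "x \<in> U" and P: "height_one A (h x)"
  shows "codimension X (X closure_of {x}) = 1"
proof -
  define N where "N = {enat n | n. \<exists>c. c 0 = X closure_of {x} \<and> (\<forall>i\<le>n. irreducible_closed X (c i)) \<and> (\<forall>i<n. c i \<subset> c (Suc i))}"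
  have xi: "\<xi> \<in> U" "h \<xi> = {\<zero>\<^bsub>A\<^esub>}" using generic_in_chart(1,2) by (auto simp: \<xi>_def)
  have xt: "x \<in> topspace X" using x chart_subset by blast
  have pr: "primeideal (h x) A" using chart_prime[OF x] .
  define c0 where "c0 i = (if i = 0 then X closure_of {x} else topspace X)" for i :: nat
  have "\<not> h x \<subseteq> h \<xi>" using P xi prime_zero[OF pr] by (auto simp: height_one_def)
  then have ss: "X closure_of {x} \<subset> topspace X"
    using chart_closure[OF xi(1) x] xi_in closure_of_subset_topspace[of X "{x}"] by blast
  have "irreducible_closed X (c0 i)" for i
    using irreducible_closure[OF xt] irreducible_closure[OF xi_in] closure_xi by (auto simp: c0_def)
  then have "enat 1 \<in> N" using ss unfolding N_def by (intro CollectI exI[of _ 1] exI[of _ c0] conjI) (auto simp: c0_def)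
  then have low: "1 \<le> Sup N" using Sup_upper by (metis one_enat_def)
  have "m \<le> 1" if mN: "m \<in> N" for m
  proof (rule ccontr)
    assume nm: "\<not> m \<le> 1"
    obtain n c where m: "m = enat n" and c: "c 0 = X closure_of {x}" "\<forall>i\<le>n. irreducible_closed X (c i)" "\<forall>i<n. c i \<subset> c (Suc i)"
      using mN unfolding N_def by auto
    have n: "1 < n" using nm m by (simp add: one_enat_def)
    have c1: "X closure_of {x} \<subset> c 1" "irreducible_closed X (c 1)" using c n by (auto simp flip: c(1))
    have "c 1 \<subset> c (Suc 1)" "irreducible_closed X (c (Suc 1))" using c(2,3) n by auto
    then have c1t: "c 1 \<subset> topspace X" using closedin_subset[of X "c (Suc 1)"] by (auto simp: irreducible_closed_def)
    have cl: "closedin X (c 1)" and irr: "\<And>A B. closedin X A \<Longrightarrow> closedin X B \<Longrightarrow> c 1 \<subseteq> A \<union> B \<Longrightarrow> c 1 \<subseteq> A \<or> c 1 \<subseteq> B"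
      using c1(2) by (auto simp: irreducible_closed_def)
    have xc: "x \<in> c 1" using c1(1) xt closure_of_singleton[of x X x] by blast
    define Q where "Q = (\<Inter>y\<in>c 1 \<inter> U. h y)"
    define D where "D f = {z \<in> U. f \<notin> h z}" for f
    have Dopen: "openin X (D f)" if "f \<in> carrier A" for f
    proof -
      have "h ` D f = {Q \<in> h ` U. f \<notin> Q}" by (auto simp: D_def)
      then have "h ` D f = {Q. primeideal Q A \<and> f \<notin> Q}" unfolding h_img by simp
      then show ?thesis using h_open[of "D f"] A.openin_basic[OF that] by (auto simp: D_def)
    qed
    have idl: "ideal (h y) A" if "y \<in> c 1 \<inter> U" for y using chart_prime[of y] that primeideal.axioms(1) by blast
    have "ideal Q A"
    proof -
      have "ideal (\<Inter>(h ` (c 1 \<inter> U))) A" by (rule A.i_Intersect) (use idl xc x in auto)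
      then show ?thesis by (simp add: Q_def)
    qed
    then have Qprime: "primeideal Q A"
    proof (rule primeidealI)
      show "cring A" by (rule A.is_cring)
      have "Q \<subseteq> h x" using xc x by (auto simp: Q_def)
      then show "carrier A \<noteq> Q" using prime_one[OF pr] by blast
      fix f g assume fg: "f \<in> carrier A" "g \<in> carrier A" "f \<otimes>\<^bsub>A\<^esub> g \<in> Q"
      \<comment> \<open>If f g vanishes on the part of c 1 in the chart, then c 1 is covered by the
        two closed sets where f, respectively g, vanishes, each enlarged by the complement of the
        chart. Irreducibility picks one of them.\<close>
      have "c 1 \<subseteq> (topspace X - D f) \<union> (topspace X - D g)"
      proof
        fix y assume y: "y \<in> c 1"
        have yt: "y \<in> topspace X" using closedin_subset[OF cl] y by blast
        show "y \<in> (topspace X - D f) \<union> (topspace X - D g)"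
        proof (cases "y \<in> U")
          case True
          then have "f \<otimes>\<^bsub>A\<^esub> g \<in> h y" using fg y by (auto simp: Q_def)
          then have "f \<in> h y \<or> g \<in> h y" using primeideal.I_prime[OF chart_prime[OF True] fg(1,2)] by blast
          then show ?thesis using yt by (auto simp: D_def)
        qed (use yt in \<open>auto simp: D_def\<close>)
      qed
      then have "c 1 \<subseteq> topspace X - D f \<or> c 1 \<subseteq> topspace X - D g"
        by (intro irr closedin_diff closedin_topspace Dopen fg(1,2)) auto
      then show "f \<in> Q \<or> g \<in> Q" by (auto simp: Q_def D_def)
    qed
    have Qx: "Q \<subseteq> h x" using xc x by (auto simp: Q_def)
    \<comment> \<open>Otherwise c 1 is covered by the closure of x and the complement of the chart.
      The latter does not contain x, so c 1 would be contained in the closure of x.\<close>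
    have "Q \<noteq> h x"
    proof
      assume e: "Q = h x"
      have "c 1 \<subseteq> X closure_of {x} \<union> (topspace X - U)"
      proof
        fix y assume y: "y \<in> c 1"
        show "y \<in> X closure_of {x} \<union> (topspace X - U)"
        proof (cases "y \<in> U")
          case True
          then have "h x \<subseteq> h y" using y by (auto simp: e[symmetric] Q_def)
          then show ?thesis using chart_closure[OF True x] by blast
        qed (use closedin_subset[OF cl] y in blast)
      qed
      then have "c 1 \<subseteq> X closure_of {x} \<or> c 1 \<subseteq> topspace X - U"
        by (intro irr closedin_diff closedin_topspace chart_open) auto
      then show False using c1(1) xc x by blast
    qed
    then have "Q = {\<zero>\<^bsub>A\<^esub>}" using P Qprime Qx by (auto simp: height_one_def)
    \<comment> \<open>Zero is excluded because the complement of c 1 is a neighbourhood of the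
      generic point: a basic open set inside it comes from a non-zero f that vanishes on all of c 1
      in the chart, so f would be in Q.\<close>
    have "openin X (topspace X - c 1)" "topspace X - c 1 \<noteq> {}" using cl c1t by (auto simp: closedin_def)
    then have "\<xi> \<in> topspace X - c 1" by (rule generic_in_open)
    define T where "T = (topspace X - c 1) \<inter> U"
    have T: "openin X T" "T \<subseteq> U" using chart_open \<open>openin X (topspace X - c 1)\<close> by (auto simp: T_def)
    have "h \<xi> \<in> h ` T" using \<open>\<xi> \<in> topspace X - c 1\<close> xi by (auto simp: T_def)
    then obtain f where f: "f \<in> carrier A" "f \<notin> h \<xi>" "{Q. primeideal Q A \<and> f \<notin> Q} \<subseteq> h ` T"
      using A.openin_Spec[of "h ` T" "h \<xi>"] h_open[OF T(2)] T(1) by metis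
    have "f \<in> h y" if y: "y \<in> c 1 \<inter> U" for y
    proof (rule ccontr)
      assume "f \<notin> h y"
      then have "h y \<in> h ` T" using f(3) chart_prime[of y] y by auto
      then obtain y' where "y' \<in> T" "h y' = h y" by auto
      then have "y \<in> T" using h_inj T(2) y by (metis IntD2 inj_onD subsetD)
      then show False using y by (auto simp: T_def)
    qed
    then have "f \<in> Q" by (auto simp: Q_def)
    then show False using f(2) xi \<open>Q = {\<zero>\<^bsub>A\<^esub>}\<close> by simp
  qed
  then have "Sup N \<le> 1" by (rule Sup_least)
  then show ?thesis using low by (simp add: codimension_def N_def)
qed

lemma prime_divisor_iff: "x \<in> U \<Longrightarrow> x \<in> prime_divisors X \<longleftrightarrow> height_one A (h x)"
  using height_one_of_prime_divisor prime_divisor_of_height_one chart_subset by (auto simp: prime_divisors_def)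

lemma discrete_valuation_ev:
  assumes v: "v \<in> V"
  shows "discrete_valuation FF (v \<circ> ev)"
proof -
  interpret v: discretely_valued_field "fraction_field A" v using V_field[OF v] .
  have cl: "ev a \<in> carrier (fraction_field A)" "ev a \<noteq> \<zero>\<^bsub>fraction_field A\<^esub>" if "a \<in> carrier (mult_of FF)" for a
    using that ev_eq_zero ring_hom_closed[OF ev_ring_hom] by auto
  have "v \<circ> ev \<in> hom (mult_of FF) integer_group"
  proof (rule homI)
    fix a b assume ab: "a \<in> carrier (mult_of FF)" "b \<in> carrier (mult_of FF)"
    then show "(v \<circ> ev) (a \<otimes>\<^bsub>mult_of FF\<^esub> b) = (v \<circ> ev) a \<otimes>\<^bsub>integer_group\<^esub> (v \<circ> ev) b"
      using cl[OF ab(1)] cl[OF ab(2)] ring_hom_mult[OF ev_ring_hom, of a b] by simp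
  qed simp
  moreover have "(v \<circ> ev) ` carrier (mult_of FF) = carrier integer_group"
  proof -
    have "n \<in> (v \<circ> ev) ` carrier (mult_of FF)" for n
    proof -
      obtain z where z: "z \<in> carrier (fraction_field A)" "z \<noteq> \<zero>\<^bsub>fraction_field A\<^esub>" "v z = n" using v.val_surj[of n] by blast
      obtain c where "c \<in> carrier FF" "ev c = z" using ev_surj[OF z(1)] by blast
      then show ?thesis using z ev_eq_zero by (intro image_eqI[of _ _ c]) auto
    qed
    then show ?thesis by auto
  qed
  moreover have "min ((v \<circ> ev) a) ((v \<circ> ev) b) \<le> (v \<circ> ev) (a \<oplus>\<^bsub>FF\<^esub> b)"
    if ab: "a \<in> carrier (mult_of FF)" "b \<in> carrier (mult_of FF)" "a \<oplus>\<^bsub>FF\<^esub> b \<noteq> \<zero>\<^bsub>FF\<^esub>" for a b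
  proof -
    have e: "ev (a \<oplus>\<^bsub>FF\<^esub> b) = ev a \<oplus>\<^bsub>fraction_field A\<^esub> ev b" using ab ring_hom_add[OF ev_ring_hom, of a b] by simp
    moreover have "ev (a \<oplus>\<^bsub>FF\<^esub> b) \<noteq> \<zero>\<^bsub>fraction_field A\<^esub>" using ab ev_eq_zero[of "a \<oplus>\<^bsub>FF\<^esub> b"] by simp
    ultimately show ?thesis using v.val_add[of "ev a" "ev b"] cl[OF ab(1)] cl[OF ab(2)] by simp
  qed
  ultimately show ?thesis by (auto simp: discrete_valuation_def epi_def)
qed

text \<open>The prime h x has height one, so its localization is the ring of a member of the family;
  composing this member with \<open>ev\<close> moves it to the function field.\<close>

lemma prime_divisor_valuation_exists:
  assumes x: "x \<in> U" "x \<in> prime_divisors X"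
  shows "\<exists>v. discrete_valuation FF v \<and> valuation_ring FF v = local_ring x"
proof -
  obtain v where v: "v \<in> V" "valuation_ring (fraction_field A) v = loc (h x)"
    using height_one_valuation prime_divisor_iff x by blast
  have "c \<in> valuation_ring FF (v \<circ> ev) \<longleftrightarrow> c \<in> local_ring x" if "c \<in> carrier FF" for c
    using local_ring_ev[OF x(1) that] v(2) ev_eq_zero[OF that] that ring_hom_closed[OF ev_ring_hom that]
    by (auto simp: valuation_ring_def)
  then have "valuation_ring FF (v \<circ> ev) = local_ring x" using local_ring_sub by (auto simp: valuation_ring_def)
  then show ?thesis using discrete_valuation_ev[OF v(1)] by blast
qed

text \<open>This is \<open>loc_height_one\<close> in geometric terms: the height one primes inside h
  x are the prime divisors of the chart whose closure contains x.\<close>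

lemma chart_local_ring_Inter:
  assumes x: "x \<in> U" and f: "f \<in> carrier FF" and Y: "\<And>Y. Y \<in> prime_divisors X \<Longrightarrow> x \<in> X closure_of {Y} \<Longrightarrow> f \<in> local_ring Y"
  shows "f \<in> local_ring x"
proof -
  have "ev f \<in> loc (h x)"
  proof (rule loc_height_one[OF chart_prime[OF x] ring_hom_closed[OF ev_ring_hom f]])
    fix Q assume Q: "height_one A Q" "Q \<subseteq> h x"
    then obtain y where y: "y \<in> U" "h y = Q" using chart_point[of Q] Q(1) unfolding height_one_def by metis
    then have "y \<in> prime_divisors X" "x \<in> X closure_of {y}" using Q prime_divisor_iff chart_closure[OF x y(1)] by auto
    then show "ev f \<in> loc Q" using Y local_ring_ev[OF y(1) f] y by blast
  qed
  then show ?thesis using local_ring_ev[OF x f] by blast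
qed

lemma chart_divisor_finite:
  assumes f: "f \<in> carrier FF"
  shows "finite {Y \<in> prime_divisors X. Y \<in> U \<and> f \<notin> local_ring Y}"
proof -
  have "h ` {Y \<in> prime_divisors X. Y \<in> U \<and> f \<notin> local_ring Y} \<subseteq> {P. height_one A P \<and> ev f \<notin> loc P}"
    using prime_divisor_iff local_ring_ev[OF _ f] by auto
  then have "finite (h ` {Y \<in> prime_divisors X. Y \<in> U \<and> f \<notin> local_ring Y})"
    using height_one_loc_finite[OF ring_hom_closed[OF ev_ring_hom f]] finite_subset by blast
  then show ?thesis by (rule finite_imageD) (use h_inj in \<open>auto intro: inj_on_subset\<close>)
qed

end

section \<open>Essential valuations and regular sections on the whole scheme\<close>

context krull_scheme_space
begin

abbreviation PD where "PD \<equiv> prime_divisors X"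
abbreviation \<nu> where "\<nu> \<equiv> essential_valuation X \<O>"

lemma PD_topspace: "Y \<in> PD \<Longrightarrow> Y \<in> topspace X"
  by (simp add: prime_divisors_def)

text \<open>A chart around Y supplies a witness for the choice operator; the ring to be matched is
  expressed without reference to the chart.\<close>

lemma essential_valuation:
  assumes Y: "Y \<in> PD"
  shows "discrete_valuation FF (\<nu> Y)" "valuation_ring FF (\<nu> Y) = local_ring Y"
proof -
  obtain A V U h val where c: "krull_chart X \<O> A V U h val" "Y \<in> U" using chart_at[OF PD_topspace[OF Y]] by blast
  have "\<exists>v. discrete_valuation FF v \<and> valuation_ring FF v = cospecialization X \<O> (generic_point X) ` carrier (stalk X \<O> Y)"
    using krull_chart.prime_divisor_valuation_exists[OF c Y] cospecialization_image[OF PD_topspace[OF Y]] by simp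
  then have "discrete_valuation FF (\<nu> Y) \<and> valuation_ring FF (\<nu> Y) = cospecialization X \<O> (generic_point X) ` carrier (stalk X \<O> Y)"
    unfolding essential_valuation_def by (rule someI_ex)
  then show "discrete_valuation FF (\<nu> Y)" "valuation_ring FF (\<nu> Y) = local_ring Y"
    using cospecialization_image[OF PD_topspace[OF Y]] by auto
qed

lemma \<nu>_field: "Y \<in> PD \<Longrightarrow> discretely_valued_field FF (\<nu> Y)"
  using essential_valuation(1) field_FF by (intro discretely_valued_field.intro) (auto simp: discretely_valued_field_axioms_def)

lemma local_ring_PD: "Y \<in> PD \<Longrightarrow> f \<in> local_ring Y \<longleftrightarrow> f \<in> carrier FF \<and> (f = \<zero>\<^bsub>FF\<^esub> \<or> 0 \<le> \<nu> Y f)"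
  using essential_valuation(2)[of Y] by (auto simp: valuation_ring_def)

text \<open>A non-zero value means a pole of f or of its inverse, and in each of the finitely many
  charts each of the two has poles along finitely many prime divisors only.\<close>

lemma \<nu>_finite:
  assumes f: "f \<in> carrier FF" "f \<noteq> \<zero>\<^bsub>FF\<^esub>"
  shows "finite {Y \<in> PD. \<nu> Y f \<noteq> 0}"
proof -
  obtain C where C: "finite C" "\<Union>C = topspace X" "\<forall>U\<in>C. \<exists>A V h val. krull_chart X \<O> A V U h val" using finite_charts by blast
  have fin: "finite {Y \<in> PD. g \<notin> local_ring Y}" if g: "g \<in> carrier FF" for g
  proof -
    have "finite {Y \<in> PD. Y \<in> U \<and> g \<notin> local_ring Y}" if "U \<in> C" for U
      using C(3) that krull_chart.chart_divisor_finite[OF _ g] by blast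
    then have "finite (\<Union>U\<in>C. {Y \<in> PD. Y \<in> U \<and> g \<notin> local_ring Y})" using C(1) by blast
    moreover have "{Y \<in> PD. g \<notin> local_ring Y} \<subseteq> (\<Union>U\<in>C. {Y \<in> PD. Y \<in> U \<and> g \<notin> local_ring Y})" using C(2) PD_topspace by blast
    ultimately show ?thesis using finite_subset by blast
  qed
  have inv: "inv\<^bsub>FF\<^esub> f \<in> carrier FF" using f FF.field_Units by simp
  have "{Y \<in> PD. \<nu> Y f \<noteq> 0} \<subseteq> {Y \<in> PD. f \<notin> local_ring Y} \<union> {Y \<in> PD. inv\<^bsub>FF\<^esub> f \<notin> local_ring Y}"
  proof
    fix Y assume Y: "Y \<in> {Y \<in> PD. \<nu> Y f \<noteq> 0}"
    interpret v: discretely_valued_field FF "\<nu> Y" using \<nu>_field Y by simp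
    have "\<nu> Y (inv\<^bsub>FF\<^esub> f) = - \<nu> Y f" using v.val_inv[OF f] .
    moreover have "inv\<^bsub>FF\<^esub> f \<noteq> \<zero>\<^bsub>FF\<^esub>" using f FF.Units_inv_Units[of f] FF.field_Units by auto
    ultimately show "Y \<in> {Y \<in> PD. f \<notin> local_ring Y} \<union> {Y \<in> PD. inv\<^bsub>FF\<^esub> f \<notin> local_ring Y}"
      using Y f local_ring_PD[of Y f] local_ring_PD[of Y "inv\<^bsub>FF\<^esub> f"] by auto
  qed
  then show ?thesis using fin[OF f(1)] fin[OF inv] by (meson finite_Un finite_subset)
qed

text \<open>In a chart a section is determined by its generic value; the equality then spreads over
  a cover of W by the sheaf property.\<close>

lemma gm_inj:
  assumes W: "openin X W" "W \<noteq> {}"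
  shows "inj_on (gm W) (carrier (sect \<O> W))"
proof (rule inj_onI)
  fix s t assume s: "s \<in> carrier (sect \<O> W)" and t: "t \<in> carrier (sect \<O> W)" and eq: "gm W s = gm W t"
  have ex: "\<exists>T. openin X T \<and> x \<in> T \<and> T \<subseteq> W \<and> restr \<O> W T s = restr \<O> W T t" if x: "x \<in> W" for x
  proof -
    have "x \<in> topspace X" using W x openin_subset by blast
    then obtain A V U h val where c: "krull_chart X \<O> A V U h val" and xU: "x \<in> U" using chart_at by blast
    interpret c: krull_chart X \<O> A V U h val using c .
    have n: "pres.nbhd W" using W nbhd_iff by blast
    note n' = c.chart_nbhd[OF n]
    have cl: "restr \<O> W (W \<inter> U) s \<in> carrier (sect \<O> (W \<inter> U))" "restr \<O> W (W \<inter> U) t \<in> carrier (sect \<O> (W \<inter> U))"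
      using n' W s t res_closed by auto
    have "val (W \<inter> U) (restr \<O> W (W \<inter> U) s) = val (W \<inter> U) (restr \<O> W (W \<inter> U) t)"
      using c.ev_germ[OF n s] c.ev_germ[OF n t] eq by simp
    then have "restr \<O> W (W \<inter> U) s = restr \<O> W (W \<inter> U) t" using c.val_inj[of "W \<inter> U"] n' cl by (auto dest: inj_onD)
    then show ?thesis using n' x xU by (intro exI[of _ "W \<inter> U"]) auto
  qed
  define C where "C = {T. openin X T \<and> T \<subseteq> W \<and> restr \<O> W T s = restr \<O> W T t}"
  have "\<Union>C = W" using ex by (auto simp: C_def)
  then show "s = t" using sect_eqI[of C s t] s t by (auto simp: C_def)
qed

text \<open>If x is in the open set W, so is every Y whose closure contains x. Hence a function
  without poles on W lies in the local ring of every x in W. Its local representatives agree on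
  overlaps by \<open>gm_inj\<close>, so they glue.\<close>

lemma sections_eq:
  assumes W: "openin X W" "W \<noteq> {}"
  shows "gm W ` carrier (sect \<O> W) = {f \<in> carrier FF. f = \<zero>\<^bsub>FF\<^esub> \<or> (\<forall>Y\<in>PD \<inter> W. 0 \<le> \<nu> Y f)}" (is "?L = ?R")
proof
  have n: "pres.nbhd W" using W nbhd_iff by blast
  show "?L \<subseteq> ?R"
  proof
    fix f assume "f \<in> ?L"
    then obtain s where s: "s \<in> carrier (sect \<O> W)" "f = gm W s" by blast
    have "f \<in> local_ring Y" if "Y \<in> W" for Y using s W that unfolding local_ring_def by blast
    moreover have "f \<in> carrier FF" using s n by (simp add: FF_def)
    ultimately show "f \<in> ?R" using local_ring_PD by auto
  qed
  show "?R \<subseteq> ?L"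
  proof
    fix f assume f: "f \<in> ?R"
    have ex: "\<exists>T s. openin X T \<and> x \<in> T \<and> T \<subseteq> W \<and> s \<in> carrier (sect \<O> T) \<and> gm T s = f" if x: "x \<in> W" for x
    proof -
      have "x \<in> topspace X" using W x openin_subset by blast
      then obtain A V U h val where c: "krull_chart X \<O> A V U h val" and xU: "x \<in> U" using chart_at by blast
      have "f \<in> local_ring x"
      proof (rule krull_chart.chart_local_ring_Inter[OF c xU])
        fix Y assume Y: "Y \<in> PD" "x \<in> X closure_of {Y}"
        then have "Y \<in> W" using W x closure_of_singleton by metis
        then show "f \<in> local_ring Y" using Y f local_ring_PD by auto
      qed (use f in auto)
      then obtain T s where T: "openin X T" "x \<in> T" "s \<in> carrier (sect \<O> T)" "f = gm T s" unfolding local_ring_def by auto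
      have "pres.nbhd T" "pres.nbhd (T \<inter> W)" using T W x nbhd_iff by auto
      then show ?thesis using T W x pres.germ_restr[of T s "T \<inter> W"] res_closed[of T "T \<inter> W" s]
        by (intro exI[of _ "T \<inter> W"] exI[of _ "restr \<O> T (T \<inter> W) s"]) auto
    qed
    define C where "C = {T. openin X T \<and> T \<noteq> {} \<and> T \<subseteq> W \<and> (\<exists>s. s \<in> carrier (sect \<O> T) \<and> gm T s = f)}"
    have UC: "\<Union>C = W" using ex unfolding C_def by blast
    define \<sigma> where "\<sigma> T = (SOME s. s \<in> carrier (sect \<O> T) \<and> gm T s = f)" for T
    have \<sigma>: "\<sigma> T \<in> carrier (sect \<O> T)" "gm T (\<sigma> T) = f" if "T \<in> C" for T
      using someI_ex[of "\<lambda>s. s \<in> carrier (sect \<O> T) \<and> gm T s = f"] that by (auto simp: C_def \<sigma>_def)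
    have "\<exists>!t. t \<in> carrier (sect \<O> (\<Union>C)) \<and> (\<forall>T\<in>C. restr \<O> (\<Union>C) T t = \<sigma> T)"
    proof (rule glue)
      fix T assume T: "T \<in> C" then show "openin X T \<and> \<sigma> T \<in> carrier (sect \<O> T)" using \<sigma> by (auto simp: C_def)
      fix T' assume T': "T' \<in> C"
      have o: "openin X T" "openin X T'" "openin X (T \<inter> T')" "T \<inter> T' \<noteq> {}" "pres.nbhd T" "pres.nbhd T'" "pres.nbhd (T \<inter> T')"
        using T T' open_Int_nonempty[of T T'] nbhd_iff by (auto simp: C_def)
      have "gm (T \<inter> T') (restr \<O> T (T \<inter> T') (\<sigma> T)) = gm (T \<inter> T') (restr \<O> T' (T \<inter> T') (\<sigma> T'))"
        using \<sigma>[OF T] \<sigma>[OF T'] pres.germ_restr o by auto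
      then show "restr \<O> T (T \<inter> T') (\<sigma> T) = restr \<O> T' (T \<inter> T') (\<sigma> T')"
        using gm_inj[OF o(3,4)] \<sigma>[OF T] \<sigma>[OF T'] o res_closed by (auto dest: inj_onD)
    qed
    then obtain t where t: "t \<in> carrier (sect \<O> W)" "\<forall>T\<in>C. restr \<O> W T t = \<sigma> T" unfolding UC by blast
    obtain T where T: "T \<in> C" using UC W by blast
    have "pres.nbhd T" "T \<subseteq> W" using T nbhd_iff by (auto simp: C_def)
    then have "gm W t = f" using pres.germ_restr[OF n t(1), of T] t(2) T \<sigma>(2) by simp
    then show "f \<in> ?L" using t by blast
  qed
qed

text \<open>The closures of the members of N are removed. In a chart, a prime divisor in the closure
  of another corresponds to an inclusion of height one primes, hence to an equality; the generic
  point has the zero prime, which contains no height one prime. So no further prime divisor is lost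
  and the remaining set is non-empty.\<close>

lemma avoid_divisors:
  assumes N: "finite N" "N \<subseteq> PD"
  shows "\<exists>W. openin X W \<and> W \<noteq> {} \<and> W \<inter> N = {} \<and> PD - N \<subseteq> W"
proof -
  define W where "W = topspace X - (\<Union>Y\<in>N. X closure_of {Y})"
  have "closedin X (\<Union>Y\<in>N. X closure_of {Y})" by (rule closedin_Union) (use N in auto)
  then have o: "openin X W" by (auto simp: W_def closedin_def)
  have sep: "Y' = Y" if Y: "Y \<in> PD" "Y' \<in> topspace X" "Y' \<in> X closure_of {Y}" "Y' \<in> PD \<or> Y' = \<xi>" for Y Y'
  proof -
    obtain A V U h val where c: "krull_chart X \<O> A V U h val" and xU: "Y' \<in> U" using chart_at[OF Y(2)] by blast
    interpret c: krull_chart X \<O> A V U h val using c .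
    have YU: "Y \<in> U" using Y(3) c.chart_open xU closure_of_singleton by metis
    have le: "h Y \<subseteq> h Y'" using c.chart_closure[OF xU YU] Y by blast
    have h1: "height_one A (h Y)" using c.prime_divisor_iff YU Y by blast
    have z: "\<zero>\<^bsub>A\<^esub> \<in> h Y" using c.prime_zero[OF c.chart_prime[OF YU]] .
    have "h Y' \<noteq> {\<zero>\<^bsub>A\<^esub>}" using h1 le z by (auto simp: height_one_def)
    then have "Y' \<in> PD" using Y(4) c.generic_in_chart(2) by (auto simp: \<xi>_def)
    then have "height_one A (h Y')" using c.prime_divisor_iff xU by blast
    then have "h Y = h Y'" using h1 le c.chart_prime[OF YU] unfolding height_one_def by blast
    then show ?thesis using c.h_inj YU xU by (metis inj_onD)
  qed
  have nxi: "\<xi> \<notin> PD"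
  proof
    assume "\<xi> \<in> PD"
    obtain A V U h val where c: "krull_chart X \<O> A V U h val" and xU: "\<xi> \<in> U" using chart_at[OF xi_in] by blast
    interpret c: krull_chart X \<O> A V U h val using c .
    have "height_one A (h \<xi>)" using c.prime_divisor_iff xU \<open>\<xi> \<in> PD\<close> by blast
    then show False using c.generic_in_chart(2) by (auto simp: height_one_def \<xi>_def)
  qed
  have "\<xi> \<in> W" using xi_in sep[of _ \<xi>] N nxi by (auto simp: W_def)
  moreover have "W \<inter> N = {}" using N PD_topspace closure_of_singleton by (fastforce simp: W_def)
  moreover have "PD - N \<subseteq> W" using sep N PD_topspace unfolding W_def by blast
  ultimately show ?thesis using o by blast
qed

end

section \<open>Graded rings\<close>

lemma (in abelian_monoid) finsum_superset:
  assumes "finite J" "I \<subseteq> J" "\<And>i. i \<in> J - I \<Longrightarrow> c i = \<zero>" "\<And>i. i \<in> I \<Longrightarrow> c i = d i" "\<And>i. i \<in> J \<Longrightarrow> c i \<in> carrier G"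
  shows "finsum G d I = finsum G c J"
proof -
  have "finsum G c I = finsum G c J"
    by (rule add.finprod_mono_neutral_cong_left) (use assms in auto)
  moreover have "finsum G d I = finsum G c I"
    by (rule finsum_cong') (use assms in auto)
  ultimately show ?thesis by simp
qed

locale graded = K: comm_group K + A: cring A for K :: "('k, 'n) monoid_scheme" (structure) and A :: "('a, 'm) ring_scheme" (structure) +
  fixes G :: "'k \<Rightarrow> 'a set"
  assumes graded_ring: "graded_ring K A G"
begin

lemma G_subgroup: "w \<in> carrier K \<Longrightarrow> additive_subgroup (G w) A"
  using graded_ring by (simp add: graded_ring_def)

lemma G_carrier: "w \<in> carrier K \<Longrightarrow> a \<in> G w \<Longrightarrow> a \<in> carrier A"
  using G_subgroup additive_subgroup.a_Hcarr by fastforce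

lemma G_zero [simp]: "w \<in> carrier K \<Longrightarrow> \<zero>\<^bsub>A\<^esub> \<in> G w"
  using G_subgroup additive_subgroup.zero_closed by fastforce

lemma G_add: "w \<in> carrier K \<Longrightarrow> a \<in> G w \<Longrightarrow> b \<in> G w \<Longrightarrow> a \<oplus>\<^bsub>A\<^esub> b \<in> G w"
  using G_subgroup additive_subgroup.a_closed by fastforce

lemma G_mult: "v \<in> carrier K \<Longrightarrow> w \<in> carrier K \<Longrightarrow> a \<in> G v \<Longrightarrow> b \<in> G w \<Longrightarrow> a \<otimes>\<^bsub>A\<^esub> b \<in> G (v \<otimes>\<^bsub>K\<^esub> w)"
  using graded_ring by (simp add: graded_ring_def)

definition comp where "comp a = (THE c. decomposition K A G a c)"

abbreviation supp where "supp a \<equiv> {w \<in> carrier K. comp a w \<noteq> \<zero>\<^bsub>A\<^esub>}"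

lemma comp_decomposition: "a \<in> carrier A \<Longrightarrow> decomposition K A G a (comp a)"
proof -
  assume "a \<in> carrier A"
  then have "\<exists>!c. decomposition K A G a c" using graded_ring unfolding graded_ring_def by blast
  then show ?thesis unfolding comp_def by (rule theI')
qed

lemma comp_unique:
  assumes "a \<in> carrier A" "decomposition K A G a c"
  shows "comp a = c"
proof -
  have "\<exists>!c. decomposition K A G a c" using assms(1) graded_ring unfolding graded_ring_def by blast
  then show ?thesis using assms(2) comp_decomposition[OF assms(1)] by blast
qed

lemma comp_in: "a \<in> carrier A \<Longrightarrow> w \<in> carrier K \<Longrightarrow> comp a w \<in> G w"
  using comp_decomposition[of a] by (auto simp: decomposition_def)

lemma comp_closed: "a \<in> carrier A \<Longrightarrow> w \<in> carrier K \<Longrightarrow> comp a w \<in> carrier A"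
  using comp_in G_carrier by blast

lemma supp_finite: "a \<in> carrier A \<Longrightarrow> finite (supp a)"
  using comp_decomposition[of a] by (auto simp: decomposition_def)

lemma comp_sum: "a \<in> carrier A \<Longrightarrow> a = finsum A (comp a) (supp a)"
  using comp_decomposition[of a] by (auto simp: decomposition_def)

lemma comp_sum_superset:
  assumes "a \<in> carrier A" "finite I" "supp a \<subseteq> I" "I \<subseteq> carrier K"
  shows "a = finsum A (comp a) I"
proof -
  have "finsum A (comp a) (supp a) = finsum A (comp a) I"
    by (rule A.finsum_superset) (use assms comp_closed in auto)
  then show ?thesis using comp_sum[OF assms(1)] by simp
qed

text \<open>Terms of the sum may be zero, whereas a decomposition is summed over its support only.
  The family is therefore padded by zero to all degrees and its support compared with I.\<close>

lemma comp_finsum: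
  assumes I: "finite I" "I \<subseteq> carrier K" and c: "\<And>w. w \<in> I \<Longrightarrow> c w \<in> G w" and v: "v \<in> carrier K"
  shows "comp (finsum A c I) v = (if v \<in> I then c v else \<zero>\<^bsub>A\<^esub>)"
proof -
  define d where "d = (\<lambda>w\<in>carrier K. if w \<in> I then c w else \<zero>\<^bsub>A\<^esub>)"
  have cA: "c w \<in> carrier A" if "w \<in> I" for w using c that I G_carrier by blast
  then have cl: "finsum A c I \<in> carrier A" by (intro A.finsum_closed) auto
  have dz: "{w \<in> carrier K. d w \<noteq> \<zero>\<^bsub>A\<^esub>} \<subseteq> I" by (auto simp: d_def)
  have "finsum A d {w \<in> carrier K. d w \<noteq> \<zero>\<^bsub>A\<^esub>} = finsum A c I"
    by (rule A.finsum_superset[OF I(1) dz]) (use I cA in \<open>auto simp: d_def\<close>)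
  then have "decomposition K A G (finsum A c I) d"
    unfolding decomposition_def using I c finite_subset[OF dz I(1)] by (auto simp: d_def)
  then have "comp (finsum A c I) = d" by (rule comp_unique[OF cl])
  then show ?thesis using v by (simp add: d_def)
qed

lemma comp_hom: "w \<in> carrier K \<Longrightarrow> a \<in> G w \<Longrightarrow> v \<in> carrier K \<Longrightarrow> comp a v = (if v = w then a else \<zero>\<^bsub>A\<^esub>)"
  using comp_finsum[of "{w}" "\<lambda>_. a" v] G_carrier[of w a] by auto

lemma comp_eqI:
  assumes "a \<in> carrier A" "b \<in> carrier A" "\<And>w. w \<in> carrier K \<Longrightarrow> comp a w = comp b w"
  shows "a = b"
proof -
  have s: "supp a = supp b" using assms(3) by auto
  have "finsum A (comp a) (supp a) = finsum A (comp b) (supp b)"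
    unfolding s by (rule A.finsum_cong') (use assms comp_closed in auto)
  then show ?thesis using comp_sum[OF assms(1)] comp_sum[OF assms(2)] by argo
qed

lemma comp_zero [simp]: "w \<in> carrier K \<Longrightarrow> comp \<zero>\<^bsub>A\<^esub> w = \<zero>\<^bsub>A\<^esub>"
  using comp_hom[of w "\<zero>\<^bsub>A\<^esub>" w] by simp

lemma comp_add:
  assumes a: "a \<in> carrier A" and b: "b \<in> carrier A" and w: "w \<in> carrier K"
  shows "comp (a \<oplus>\<^bsub>A\<^esub> b) w = comp a w \<oplus>\<^bsub>A\<^esub> comp b w"
proof -
  define I where "I = insert w (supp a \<union> supp b)"
  have I: "finite I" "I \<subseteq> carrier K" "w \<in> I" using supp_finite a b w by (auto simp: I_def)
  have "a = finsum A (comp a) I" "b = finsum A (comp b) I" using I a b by (auto intro!: comp_sum_superset simp: I_def)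
  then have eq: "a \<oplus>\<^bsub>A\<^esub> b = finsum A (\<lambda>w. comp a w \<oplus>\<^bsub>A\<^esub> comp b w) I"
    using A.finsum_addf[of "comp a" I "comp b"] I a b comp_closed by (auto simp: Pi_def subset_iff)
  show ?thesis unfolding eq by (subst comp_finsum) (use I a b comp_in G_add w in auto)
qed

lemma comp_minus:
  assumes a: "a \<in> carrier A" and w: "w \<in> carrier K"
  shows "comp (\<ominus>\<^bsub>A\<^esub> a) w = \<ominus>\<^bsub>A\<^esub> comp a w"
proof -
  have "comp (\<ominus>\<^bsub>A\<^esub> a) w \<oplus>\<^bsub>A\<^esub> comp a w = \<zero>\<^bsub>A\<^esub>"
    using comp_add[OF A.a_inv_closed[OF a] a w] A.l_neg[OF a] w by simp
  then show ?thesis using A.minus_equality comp_closed[OF a w] comp_closed[OF A.a_inv_closed[OF a] w] by metis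
qed

text \<open>Multiplication by a homogeneous a of degree v translates degrees by v, so it carries the
  decomposition of b to that of the product.\<close>

lemma comp_mult_hom:
  assumes v: "v \<in> carrier K" "a \<in> G v" and b: "b \<in> carrier A" and w: "w \<in> carrier K"
  shows "comp (a \<otimes>\<^bsub>A\<^esub> b) (v \<otimes>\<^bsub>K\<^esub> w) = a \<otimes>\<^bsub>A\<^esub> comp b w"
proof -
  define I where "I = insert w (supp b)"
  have I: "finite I" "I \<subseteq> carrier K" using supp_finite b w by (auto simp: I_def)
  have a: "a \<in> carrier A" using v G_carrier by blast
  have inj: "inj_on (\<lambda>w. v \<otimes>\<^bsub>K\<^esub> w) I" using I v by (auto simp: inj_on_def subset_iff)
  have "b = finsum A (comp b) I" by (rule comp_sum_superset[OF b I(1) _ I(2)]) (auto simp: I_def)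
  then have "a \<otimes>\<^bsub>A\<^esub> b = a \<otimes>\<^bsub>A\<^esub> finsum A (comp b) I" by (rule arg_cong)
  also have "\<dots> = finsum A (\<lambda>w. a \<otimes>\<^bsub>A\<^esub> comp b w) I" using I a b comp_closed by (intro A.finsum_rdistr) (auto simp: subset_iff)
  also have "\<dots> = finsum A (\<lambda>w. (\<lambda>u. a \<otimes>\<^bsub>A\<^esub> comp b (inv\<^bsub>K\<^esub> v \<otimes>\<^bsub>K\<^esub> u)) (v \<otimes>\<^bsub>K\<^esub> w)) I"
    using I a b v comp_closed by (intro A.finsum_cong') (auto simp: subset_iff K.m_assoc[symmetric])
  also have "\<dots> = finsum A (\<lambda>u. a \<otimes>\<^bsub>A\<^esub> comp b (inv\<^bsub>K\<^esub> v \<otimes>\<^bsub>K\<^esub> u)) ((\<lambda>w. v \<otimes>\<^bsub>K\<^esub> w) ` I)"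
    using I a b v comp_closed by (intro A.finsum_reindex[symmetric] inj) (auto simp: subset_iff)
  finally have eq: "a \<otimes>\<^bsub>A\<^esub> b = finsum A (\<lambda>u. a \<otimes>\<^bsub>A\<^esub> comp b (inv\<^bsub>K\<^esub> v \<otimes>\<^bsub>K\<^esub> u)) ((\<lambda>w. v \<otimes>\<^bsub>K\<^esub> w) ` I)" .
  have "comp (a \<otimes>\<^bsub>A\<^esub> b) (v \<otimes>\<^bsub>K\<^esub> w) = a \<otimes>\<^bsub>A\<^esub> comp b (inv\<^bsub>K\<^esub> v \<otimes>\<^bsub>K\<^esub> (v \<otimes>\<^bsub>K\<^esub> w))"
    unfolding eq
  proof (subst comp_finsum)
    fix u assume u: "u \<in> (\<lambda>w. v \<otimes>\<^bsub>K\<^esub> w) ` I"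
    then obtain x where x: "u = v \<otimes>\<^bsub>K\<^esub> x" "x \<in> carrier K" using I by blast
    have "inv\<^bsub>K\<^esub> v \<otimes>\<^bsub>K\<^esub> u = x" using x v by (simp add: K.m_assoc[symmetric])
    then show "a \<otimes>\<^bsub>A\<^esub> comp b (inv\<^bsub>K\<^esub> v \<otimes>\<^bsub>K\<^esub> u) \<in> G u" using G_mult[OF v(1) x(2) v(2) comp_in[OF b x(2)]] x by simp
  qed (use I v w in \<open>auto simp: I_def\<close>)
  then show ?thesis using v w by (simp add: K.m_assoc[symmetric])
qed

text \<open>The degree zero component e of 1 satisfies a e = a for homogeneous a, by comparing
  degrees in a 1 = a. Summing over the components of 1 gives 1 = 1 e = e.\<close>

lemma one_in_G: "\<one>\<^bsub>A\<^esub> \<in> G \<one>\<^bsub>K\<^esub>"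
proof -
  define e where "e = comp \<one>\<^bsub>A\<^esub> \<one>\<^bsub>K\<^esub>"
  have e: "e \<in> G \<one>\<^bsub>K\<^esub>" "e \<in> carrier A" using comp_in comp_closed by (auto simp: e_def)
  have id: "a \<otimes>\<^bsub>A\<^esub> e = a" if "v \<in> carrier K" "a \<in> G v" for a v
    using comp_mult_hom[OF that A.one_closed K.one_closed] comp_hom[OF that that(1)] that G_carrier by (simp add: e_def)
  have "\<one>\<^bsub>A\<^esub> = e"
  proof -
    have "\<one>\<^bsub>A\<^esub> \<otimes>\<^bsub>A\<^esub> e = finsum A (comp \<one>\<^bsub>A\<^esub>) (supp \<one>\<^bsub>A\<^esub>) \<otimes>\<^bsub>A\<^esub> e" using comp_sum[OF A.one_closed] by simp
    also have "\<dots> = finsum A (\<lambda>w. comp \<one>\<^bsub>A\<^esub> w \<otimes>\<^bsub>A\<^esub> e) (supp \<one>\<^bsub>A\<^esub>)" by (rule A.finsum_ldistr) (use e comp_closed supp_finite in auto)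
    also have "\<dots> = finsum A (comp \<one>\<^bsub>A\<^esub>) (supp \<one>\<^bsub>A\<^esub>)" by (rule A.finsum_cong') (use id comp_in comp_closed in auto)
    also have "\<dots> = \<one>\<^bsub>A\<^esub>" using comp_sum[OF A.one_closed] by simp
    finally show ?thesis using e by simp
  qed
  then show ?thesis using e by simp
qed

lemma homog_iff: "a \<in> homog K A G \<longleftrightarrow> a \<noteq> \<zero>\<^bsub>A\<^esub> \<and> (\<exists>w\<in>carrier K. a \<in> G w)"
  by (auto simp: homog_def)

lemma degree_unique: "v \<in> carrier K \<Longrightarrow> w \<in> carrier K \<Longrightarrow> a \<in> G v \<Longrightarrow> a \<in> G w \<Longrightarrow> a \<noteq> \<zero>\<^bsub>A\<^esub> \<Longrightarrow> v = w"
  using comp_hom[of v a w] comp_hom[of w a w] by (auto split: if_splits)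

lemma hdeg_eq: "w \<in> carrier K \<Longrightarrow> a \<in> G w \<Longrightarrow> a \<noteq> \<zero>\<^bsub>A\<^esub> \<Longrightarrow> hdeg K G a = w"
  unfolding hdeg_def by (rule the_equality) (use degree_unique in auto)

text \<open>In the product of a and its inverse, only the component of the inverse in the degree
  opposite to w contributes to degree zero. That component is therefore an inverse of a
  itself.\<close>

lemma inverse_degree:
  assumes w: "w \<in> carrier K" and a: "a \<in> G w" "a \<in> Units A"
  shows "inv\<^bsub>A\<^esub> a \<in> G (inv\<^bsub>K\<^esub> w)"
proof -
  have b: "inv\<^bsub>A\<^esub> a \<in> carrier A" using a by simp
  have c: "comp (inv\<^bsub>A\<^esub> a) (inv\<^bsub>K\<^esub> w) \<in> carrier A" using comp_closed b w by simp
  have "a \<otimes>\<^bsub>A\<^esub> comp (inv\<^bsub>A\<^esub> a) (inv\<^bsub>K\<^esub> w) = comp \<one>\<^bsub>A\<^esub> \<one>\<^bsub>K\<^esub>"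
    using comp_mult_hom[OF w a(1) b, of "inv\<^bsub>K\<^esub> w"] w a by simp
  also have "\<dots> = \<one>\<^bsub>A\<^esub>" using comp_hom[OF K.one_closed one_in_G K.one_closed] by simp
  finally have "inv\<^bsub>A\<^esub> a = comp (inv\<^bsub>A\<^esub> a) (inv\<^bsub>K\<^esub> w)"
    using A.inv_unique'[of a "comp (inv\<^bsub>A\<^esub> a) (inv\<^bsub>K\<^esub> w)"] a(2) c A.m_comm[of a "comp (inv\<^bsub>A\<^esub> a) (inv\<^bsub>K\<^esub> w)"] by auto
  then show ?thesis using comp_in[OF b, of "inv\<^bsub>K\<^esub> w"] w by simp
qed

end

lemma gradedI: "graded_ring K A G \<Longrightarrow> graded K A G"
  by (intro graded.intro graded_axioms.intro) (auto simp: graded_ring_def)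

text \<open>Uniqueness of decompositions is replaced by independence of finite sums, which is easier
  to check: two decompositions are compared by their differences over the union of the
  supports.\<close>

lemma graded_ringI:
  assumes K: "comm_group K" and A: "cring A" and G: "\<And>w. w \<in> carrier K \<Longrightarrow> additive_subgroup (G w) A"
    and mult: "\<And>v w a b. v \<in> carrier K \<Longrightarrow> w \<in> carrier K \<Longrightarrow> a \<in> G v \<Longrightarrow> b \<in> G w \<Longrightarrow> a \<otimes>\<^bsub>A\<^esub> b \<in> G (v \<otimes>\<^bsub>K\<^esub> w)"
    and span: "\<And>a. a \<in> carrier A \<Longrightarrow> \<exists>I c. finite I \<and> I \<subseteq> carrier K \<and> (\<forall>w\<in>I. c w \<in> G w) \<and> a = finsum A c I"
    and indep: "\<And>I c. finite I \<Longrightarrow> I \<subseteq> carrier K \<Longrightarrow> (\<And>w. w \<in> I \<Longrightarrow> c w \<in> G w) \<Longrightarrow> finsum A c I = \<zero>\<^bsub>A\<^esub> \<Longrightarrow> \<forall>w\<in>I. c w = \<zero>\<^bsub>A\<^esub>"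
  shows "graded_ring K A G"
proof -
  interpret A: cring A by fact
  have GA: "a \<in> carrier A" if "w \<in> carrier K" "a \<in> G w" for a w using G[OF that(1)] that(2) by (rule additive_subgroup.a_Hcarr)
  have G0: "\<zero>\<^bsub>A\<^esub> \<in> G w" if "w \<in> carrier K" for w using G[OF that] by (rule additive_subgroup.zero_closed)
  have Gm: "a \<ominus>\<^bsub>A\<^esub> b \<in> G w" if "w \<in> carrier K" "a \<in> G w" "b \<in> G w" for a b w
    unfolding a_minus_def using G[OF that(1)] that by (simp add: additive_subgroup.a_closed additive_subgroup.a_inv_closed A.abelian_group_axioms)
  have "\<exists>!c. decomposition K A G a c" if a: "a \<in> carrier A" for a
  proof (rule ex_ex1I)
    obtain I c where I: "finite I" "I \<subseteq> carrier K" "\<forall>w\<in>I. c w \<in> G w" "a = finsum A c I" using span[OF a] by metis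
    define d where "d = (\<lambda>w\<in>carrier K. if w \<in> I then c w else \<zero>\<^bsub>A\<^esub>)"
    have dz: "{w \<in> carrier K. d w \<noteq> \<zero>\<^bsub>A\<^esub>} \<subseteq> I" by (auto simp: d_def)
    have "finsum A d {w \<in> carrier K. d w \<noteq> \<zero>\<^bsub>A\<^esub>} = finsum A c I"
      by (rule A.finsum_superset[OF I(1) dz]) (use I GA in \<open>auto simp: d_def subset_iff\<close>)
    then have "decomposition K A G a d"
      unfolding decomposition_def using I G0 finite_subset[OF dz I(1)] by (auto simp: d_def)
    then show "\<exists>c. decomposition K A G a c" by blast
  next
    fix c d assume c: "decomposition K A G a c" and d: "decomposition K A G a d"
    define I where "I = {w \<in> carrier K. c w \<noteq> \<zero>\<^bsub>A\<^esub>} \<union> {w \<in> carrier K. d w \<noteq> \<zero>\<^bsub>A\<^esub>}"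
    have I: "finite I" "I \<subseteq> carrier K" using c d by (auto simp: I_def decomposition_def)
    have cd: "c w \<in> G w" "d w \<in> G w" if "w \<in> carrier K" for w using c d that by (auto simp: decomposition_def)
    then have cdA: "c w \<in> carrier A" "d w \<in> carrier A" if "w \<in> I" for w using that I GA by blast+
    have "a = finsum A c {w \<in> carrier K. c w \<noteq> \<zero>\<^bsub>A\<^esub>}" "a = finsum A d {w \<in> carrier K. d w \<noteq> \<zero>\<^bsub>A\<^esub>}" using c d by (auto simp: decomposition_def)
    moreover have "finsum A c {w \<in> carrier K. c w \<noteq> \<zero>\<^bsub>A\<^esub>} = finsum A c I" "finsum A d {w \<in> carrier K. d w \<noteq> \<zero>\<^bsub>A\<^esub>} = finsum A d I"
      by (rule A.finsum_superset; use I cdA in \<open>auto simp: I_def\<close>)+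
    ultimately have "finsum A c I = finsum A d I" by simp
    moreover have "finsum A (\<lambda>w. \<ominus>\<^bsub>A\<^esub> d w) I = \<ominus>\<^bsub>A\<^esub> finsum A d I"
    proof (rule A.minus_equality[symmetric])
      have "finsum A (\<lambda>w. \<ominus>\<^bsub>A\<^esub> d w) I \<oplus>\<^bsub>A\<^esub> finsum A d I = finsum A (\<lambda>w. \<ominus>\<^bsub>A\<^esub> d w \<oplus>\<^bsub>A\<^esub> d w) I"
        by (rule A.finsum_addf[symmetric]) (use cdA in auto)
      also have "\<dots> = finsum A (\<lambda>w. \<zero>\<^bsub>A\<^esub>) I" by (rule A.finsum_cong') (use cdA in \<open>auto simp: A.l_neg\<close>)
      finally show "finsum A (\<lambda>w. \<ominus>\<^bsub>A\<^esub> d w) I \<oplus>\<^bsub>A\<^esub> finsum A d I = \<zero>\<^bsub>A\<^esub>" by (simp add: A.finsum_zero)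
    qed (use cdA in \<open>auto intro!: A.finsum_closed\<close>)
    ultimately have "finsum A (\<lambda>w. c w \<ominus>\<^bsub>A\<^esub> d w) I = \<zero>\<^bsub>A\<^esub>"
      using A.finsum_addf[of c I "\<lambda>w. \<ominus>\<^bsub>A\<^esub> d w"] cdA A.finsum_closed[of d I] by (auto simp: a_minus_def Pi_def A.r_neg)
    then have "\<forall>w\<in>I. c w \<ominus>\<^bsub>A\<^esub> d w = \<zero>\<^bsub>A\<^esub>" by (intro indep[OF I]) (use cd I Gm in auto)
    then have eqI: "c w = d w" if "w \<in> I" for w using that cdA A.r_right_minus_eq by simp
    show "c = d"
    proof (rule extensionalityI[of _ "carrier K"])
      show "c \<in> extensional (carrier K)" "d \<in> extensional (carrier K)" using c d by (auto simp: decomposition_def PiE_def)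
      fix w assume "w \<in> carrier K" then show "c w = d w" using eqI by (cases "w \<in> I") (auto simp: I_def)
    qed
  qed
  then show ?thesis using K A G mult by (simp add: graded_ring_def)
qed

text \<open>\<open>span\<close> is an explicit form of the graded subring generated by \<open>B\<close>.\<close>

locale graded_subgroups = graded K A G for K (structure) and A (structure) and G +
  fixes B
  assumes B_sub: "w \<in> carrier K \<Longrightarrow> B w \<subseteq> G w"
    and B_zero: "w \<in> carrier K \<Longrightarrow> \<zero>\<^bsub>A\<^esub> \<in> B w"
    and B_add: "w \<in> carrier K \<Longrightarrow> a \<in> B w \<Longrightarrow> b \<in> B w \<Longrightarrow> a \<oplus>\<^bsub>A\<^esub> b \<in> B w"
    and B_minus: "w \<in> carrier K \<Longrightarrow> a \<in> B w \<Longrightarrow> \<ominus>\<^bsub>A\<^esub> a \<in> B w"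
    and B_mult: "v \<in> carrier K \<Longrightarrow> w \<in> carrier K \<Longrightarrow> a \<in> B v \<Longrightarrow> b \<in> B w \<Longrightarrow> a \<otimes>\<^bsub>A\<^esub> b \<in> B (v \<otimes>\<^bsub>K\<^esub> w)"
    and B_one: "\<one>\<^bsub>A\<^esub> \<in> B \<one>\<^bsub>K\<^esub>"
begin

definition span where "span = {a \<in> carrier A. \<forall>w\<in>carrier K. comp a w \<in> B w}"

lemma span_sub: "span \<subseteq> carrier A" by (auto simp: span_def)

lemma B_in_span:
  assumes "w \<in> carrier K" "b \<in> B w"
  shows "b \<in> span"
proof -
  have "b \<in> G w" using assms B_sub by blast
  then show ?thesis using assms B_zero comp_hom[OF assms(1) \<open>b \<in> G w\<close>] G_carrier by (simp add: span_def)
qed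

lemma span_add: "a \<in> span \<Longrightarrow> b \<in> span \<Longrightarrow> a \<oplus>\<^bsub>A\<^esub> b \<in> span"
  using comp_add B_add by (simp add: span_def)

lemma span_minus: "a \<in> span \<Longrightarrow> \<ominus>\<^bsub>A\<^esub> a \<in> span"
  using comp_minus B_minus by (simp add: span_def)

lemma span_zero: "\<zero>\<^bsub>A\<^esub> \<in> span"
  using B_zero by (simp add: span_def)

lemma span_finsum: "finite I \<Longrightarrow> (\<And>i. i \<in> I \<Longrightarrow> c i \<in> span) \<Longrightarrow> finsum A c I \<in> span"
proof (induction I rule: finite_induct)
  case (insert i I)
  then have "finsum A c (insert i I) = c i \<oplus>\<^bsub>A\<^esub> finsum A c I" using span_sub by (intro A.finsum_insert) auto
  then show ?case using insert span_add by simp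
qed (simp add: span_zero)

lemma span_mult:
  assumes a: "a \<in> span" and b: "b \<in> span" shows "a \<otimes>\<^bsub>A\<^esub> b \<in> span"
proof -
  have aA: "a \<in> carrier A" and bA: "b \<in> carrier A" using a b span_sub by auto
  have hom: "x \<otimes>\<^bsub>A\<^esub> b \<in> span" if x: "v \<in> carrier K" "x \<in> B v" for x v
  proof -
    have xA: "x \<in> carrier A" using x B_sub G_carrier by blast
    have "x \<otimes>\<^bsub>A\<^esub> b = x \<otimes>\<^bsub>A\<^esub> finsum A (comp b) (supp b)" using comp_sum[OF bA] by simp
    also have "\<dots> = finsum A (\<lambda>w. x \<otimes>\<^bsub>A\<^esub> comp b w) (supp b)" by (rule A.finsum_rdistr) (use supp_finite bA xA comp_closed in auto)
    finally have eq: "x \<otimes>\<^bsub>A\<^esub> b = finsum A (\<lambda>w. x \<otimes>\<^bsub>A\<^esub> comp b w) (supp b)" .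
    show ?thesis unfolding eq
    proof (rule span_finsum[OF supp_finite[OF bA]])
      fix w assume "w \<in> supp b"
      then have "w \<in> carrier K" "comp b w \<in> B w" using b by (auto simp: span_def)
      then show "x \<otimes>\<^bsub>A\<^esub> comp b w \<in> span" using B_in_span[OF _ B_mult[OF x(1) _ x(2)], of w "comp b w"] x(1) by simp
    qed
  qed
  have "a \<otimes>\<^bsub>A\<^esub> b = finsum A (comp a) (supp a) \<otimes>\<^bsub>A\<^esub> b" using comp_sum[OF aA] by simp
  also have "\<dots> = finsum A (\<lambda>w. comp a w \<otimes>\<^bsub>A\<^esub> b) (supp a)" by (rule A.finsum_ldistr) (use supp_finite aA bA comp_closed in auto)
  finally have eq: "a \<otimes>\<^bsub>A\<^esub> b = finsum A (\<lambda>w. comp a w \<otimes>\<^bsub>A\<^esub> b) (supp a)" .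
  show ?thesis unfolding eq
    by (rule span_finsum[OF supp_finite[OF aA]]) (use hom a in \<open>auto simp: span_def\<close>)
qed

lemma span_subring: "subring span A"
  using span_sub B_in_span[OF K.one_closed B_one] span_minus span_mult span_add by (rule A.subringI)

lemma span_decomposition:
  assumes "a \<in> span"
  shows "\<exists>c. decomposition K A (\<lambda>w. G w \<inter> span) a c"
proof -
  have a: "a \<in> carrier A" using assms span_sub by blast
  have "decomposition K A (\<lambda>w. G w \<inter> span) a (comp a)"
    using comp_decomposition[OF a] assms B_in_span unfolding decomposition_def by (auto simp: span_def PiE_def Pi_def)
  then show ?thesis by blast
qed

text \<open>T is closed under finite sums, and every element is the finite sum of its
  components.\<close>

lemma span_least:
  assumes T: "subring T A" and BT: "\<And>w. w \<in> carrier K \<Longrightarrow> B w \<subseteq> T"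
  shows "span \<subseteq> T"
proof
  fix a assume a: "a \<in> span"
  have aA: "a \<in> carrier A" using a span_sub by blast
  have TA: "T \<subseteq> carrier A" using T by (rule subringE(1))
  have fs: "finsum A c I \<in> T" if "finite I" "\<And>i. i \<in> I \<Longrightarrow> c i \<in> T" for c and I :: "'a set"
    using that
  proof (induction I rule: finite_induct)
    case (insert i I)
    then have "finsum A c (insert i I) = c i \<oplus>\<^bsub>A\<^esub> finsum A c I" using TA by (intro A.finsum_insert) auto
    then show ?case using insert subringE(7)[OF T] by simp
  qed (simp add: subringE(2)[OF T])
  have "finsum A (comp a) (supp a) \<in> T" by (rule fs) (use supp_finite[OF aA] a BT in \<open>auto simp: span_def\<close>)
  then show "a \<in> T" using comp_sum[OF aA] by simp
qed

end

section \<open>The generic sheaf and its valuation sheaves\<close>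

text \<open>Any two non-empty open sets meet, so compatible sections over the non-empty members of a
  cover are one and the same element. Only its membership over the union is left, and that is
  \<open>loc\<close>. The empty set is treated apart, as it may itself be a member of a
  cover.\<close>

lemma (in krull_scheme_space) const_subsheaf:
  assumes T0: "T {} = {\<zero>\<^bsub>Q\<^esub>}"
    and mono: "\<And>U V. openin X U \<Longrightarrow> openin X V \<Longrightarrow> V \<subseteq> U \<Longrightarrow> V \<noteq> {} \<Longrightarrow> T U \<subseteq> T V"
    and loc: "\<And>C a. (\<And>U. U \<in> C \<Longrightarrow> openin X U) \<Longrightarrow> \<Union>C \<noteq> {} \<Longrightarrow> (\<And>U. U \<in> C \<Longrightarrow> U \<noteq> {} \<Longrightarrow> a \<in> T U) \<Longrightarrow> a \<in> T (\<Union>C)"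
  shows "sheaf_on X T (const_restr Q)"
  unfolding sheaf_on_def
proof (intro conjI allI impI)
  show "presheaf_on X T (const_restr Q)"
    unfolding presheaf_on_def
  proof (intro conjI allI impI)
    fix U V assume "openin X U \<and> openin X V \<and> V \<subseteq> U"
    then show "const_restr Q U V \<in> T U \<rightarrow> T V"
    proof (cases "V = {}")
      case False
      then have "T U \<subseteq> T V" using mono[of U V] \<open>openin X U \<and> openin X V \<and> V \<subseteq> U\<close> by simp
      then show ?thesis using False by (simp add: const_restr_def Pi_def subset_eq)
    qed (simp add: const_restr_def T0)
  qed (auto simp: const_restr_def T0)
next
  fix C s assume H: "(\<forall>U\<in>C. openin X U \<and> s U \<in> T U) \<and> (\<forall>U\<in>C. \<forall>V\<in>C. const_restr Q U (U \<inter> V) (s U) = const_restr Q V (U \<inter> V) (s V))"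
  then have o: "openin X U" "s U \<in> T U" if "U \<in> C" for U using that by auto
  have s0: "s {} = \<zero>\<^bsub>Q\<^esub>" if "{} \<in> C" using o[OF that] T0 by simp
  show "\<exists>!t. t \<in> T (\<Union>C) \<and> (\<forall>U\<in>C. const_restr Q (\<Union>C) U t = s U)"
  proof (cases "\<Union>C = {}")
    case True
    then have "U = {}" if "U \<in> C" for U using that by blast
    then have "const_restr Q (\<Union>C) U \<zero>\<^bsub>Q\<^esub> = s U" if "U \<in> C" for U
      using s0 that by (metis const_restr_def)
    then show ?thesis unfolding True T0 by (intro ex1I[of _ "\<zero>\<^bsub>Q\<^esub>"]) auto
  next
    case False
    then obtain U0 where U0: "U0 \<in> C" "U0 \<noteq> {}" by blast
    have eq: "s U = s U0" if U: "U \<in> C" "U \<noteq> {}" for U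
    proof -
      have "U \<inter> U0 \<noteq> {}" using open_Int_nonempty[of U U0] o(1)[OF U(1)] o(1)[OF U0(1)] U U0 by blast
      moreover have "const_restr Q U (U \<inter> U0) (s U) = const_restr Q U0 (U \<inter> U0) (s U0)" using H U(1) U0(1) by blast
      ultimately show ?thesis by (simp add: const_restr_def)
    qed
    show ?thesis
    proof (rule ex1I[of _ "s U0"], intro conjI ballI)
      show "s U0 \<in> T (\<Union>C)" using loc[of C "s U0"] o eq False by metis
      show "const_restr Q (\<Union>C) U (s U0) = s U" if "U \<in> C" for U using eq[OF that] s0 that by (auto simp: const_restr_def)
      fix t assume "t \<in> T (\<Union>C) \<and> (\<forall>U\<in>C. const_restr Q (\<Union>C) U t = s U)"
      then have "const_restr Q (\<Union>C) U0 t = s U0" using U0(1) by blast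
      then show "t = s U0" using U0(2) by (simp add: const_restr_def)
    qed
  qed
qed

text \<open>The set \<open>N\<close> is arbitrary because a discrete value sheaf needs the property
  twice, for all integers and for the non-negative ones.\<close>

lemma sheaf_skyscraper:
  fixes N :: "int set"
  assumes N: "0 \<in> N"
  shows "sheaf_on X (\<lambda>U. if Y \<in> U then N else {0}) (\<lambda>U V z. if Y \<in> V then z else 0)"
  unfolding sheaf_on_def
proof (intro conjI allI impI)
  show "presheaf_on X (\<lambda>U. if Y \<in> U then N else {0}) (\<lambda>U V z. if Y \<in> V then z else 0)"
    unfolding presheaf_on_def using N by auto
next
  fix C and s :: "'a set \<Rightarrow> int" assume H: "(\<forall>U\<in>C. openin X U \<and> s U \<in> (if Y \<in> U then N else {0})) \<and>
      (\<forall>U\<in>C. \<forall>V\<in>C. (if Y \<in> U \<inter> V then s U else 0) = (if Y \<in> U \<inter> V then s V else 0))"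
  show "\<exists>!t. t \<in> (if Y \<in> \<Union>C then N else {0}) \<and> (\<forall>U\<in>C. (if Y \<in> U then t else 0) = s U)"
  proof (cases "Y \<in> \<Union>C")
    case True
    then obtain U0 where U0: "U0 \<in> C" "Y \<in> U0" by blast
    have eq: "s U = s U0" if U: "U \<in> C" "Y \<in> U" for U
    proof -
      have "(if Y \<in> U \<inter> U0 then s U else 0) = (if Y \<in> U \<inter> U0 then s U0 else 0)" using H U(1) U0(1) by blast
      then show ?thesis using U(2) U0(2) by simp
    qed
    have z: "s U = 0" if "U \<in> C" "Y \<notin> U" for U
    proof -
      have "s U \<in> (if Y \<in> U then N else {0})" using H that(1) by blast
      then show ?thesis using that(2) by simp
    qed
    have "s U0 \<in> (if Y \<in> U0 then N else {0})" using H U0(1) by blast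
    then have s0: "s U0 \<in> N" using U0(2) by simp
    show ?thesis
    proof (rule ex1I[of _ "s U0"], intro conjI ballI)
      show "s U0 \<in> (if Y \<in> \<Union>C then N else {0})" using True s0 by simp
      show "(if Y \<in> U then s U0 else 0) = s U" if "U \<in> C" for U using eq[OF that] z[OF that] by simp
      fix t assume "t \<in> (if Y \<in> \<Union>C then N else {0}) \<and> (\<forall>U\<in>C. (if Y \<in> U then t else 0) = s U)"
      then have "(if Y \<in> U0 then t else 0) = s U0" using U0(1) by blast
      then show "t = s U0" using U0(2) by simp
    qed
  next
    case False
    have "s U = 0" "Y \<notin> U" if "U \<in> C" for U
    proof -
      show n: "Y \<notin> U" using False that by blast
      have "s U \<in> (if Y \<in> U then N else {0})" using H that by blast
      then show "s U = 0" using n by simp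
    qed
    then show ?thesis using False by (intro ex1I[of _ 0]) auto
  qed
qed

lemma discrete_value_sheaf_skyscraper: "discrete_value_sheaf X (skyscraper Y)"
proof -
  have 1: "(\<lambda>U. carrier (vsect (skyscraper Y) U)) = (\<lambda>U. if Y \<in> U then UNIV else {0})"
    by (auto simp: skyscraper_def integer_group_def singleton_group_def fun_eq_iff)
  have 2: "vnonneg (skyscraper Y) = (\<lambda>U. if Y \<in> U then {0..} else {0})"
    by (auto simp: vnonneg_def skyscraper_def integer_group_def singleton_group_def fun_eq_iff)
  have 3: "vrestr (skyscraper Y) = (\<lambda>U V z. if Y \<in> V then z else 0)" by (simp add: skyscraper_def)
  have "vrestr (skyscraper Y) U V \<in> hom (vsect (skyscraper Y) U) (vsect (skyscraper Y) V)" if "V \<subseteq> U" for U V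
    using that by (auto simp: skyscraper_def hom_def integer_group_def singleton_group_def)
  then show ?thesis
    unfolding discrete_value_sheaf_def 1 2 using sheaf_skyscraper[of UNIV X Y] sheaf_skyscraper[of "{0..}" X Y]
    by (auto simp: 3) (auto simp: skyscraper_def)
qed

lemma vsect_skyscraper: "vsect (skyscraper Y) U = (if Y \<in> U then integer_group else singleton_group 0)"
  and vrestr_skyscraper: "vrestr (skyscraper Y) U V z = (if Y \<in> V then z else 0)"
  and vnonneg_skyscraper: "vnonneg (skyscraper Y) U = (if Y \<in> U then {0..} else {0})"
  by (auto simp: vnonneg_def skyscraper_def integer_group_def singleton_group_def)

locale graded_on_krull = krull_scheme_space X \<O>
  for X :: "'p topology" and \<O> :: "('p, 'r) ring_presheaf" +
  fixes K :: "'k monoid" and R :: "('p, 'a, 'k) graded_presheaf"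
  assumes K_comm: "comm_group K" and R_graded: "graded_sheaf_on X K R"
begin

sublocale K: comm_group K by (rule K_comm)

lemma R_presheaf: "ring_presheaf_on X R"
  using R_graded by (simp add: graded_sheaf_on_def graded_presheaf_on_def)

sublocale rp: pointed_ring_presheaf X R \<xi>
  by (unfold_locales) (use R_presheaf xi_in in auto)

lemma rp_nbhd_iff: "rp.nbhd W \<longleftrightarrow> openin X W \<and> W \<noteq> {}"
  using generic_in_open by (auto simp: rp.nbhd_def)

lemma R_comp: "openin X U \<Longrightarrow> graded K (sect R U) (hcomp R U)"
  using R_graded by (intro gradedI) (simp add: graded_sheaf_on_def graded_presheaf_on_def)

lemma R_hrestr: "openin X U \<Longrightarrow> openin X V \<Longrightarrow> V \<subseteq> U \<Longrightarrow> w \<in> carrier K \<Longrightarrow> s \<in> hcomp R U w \<Longrightarrow> restr R U V s \<in> hcomp R V w"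
  using R_graded unfolding graded_sheaf_on_def graded_presheaf_on_def by blast

lemma R_hcarrier: "openin X U \<Longrightarrow> w \<in> carrier K \<Longrightarrow> s \<in> hcomp R U w \<Longrightarrow> s \<in> carrier (sect R U)"
  using graded.G_carrier[OF R_comp] .

text \<open>Gluing along the empty cover gives exactly one section.\<close>

lemma R_empty: "a \<in> carrier (sect R {}) \<Longrightarrow> b \<in> carrier (sect R {}) \<Longrightarrow> a = b"
proof -
  have "\<forall>C s. (\<forall>U\<in>C. openin X U \<and> s U \<in> carrier (sect R U)) \<and>
            (\<forall>U\<in>C. \<forall>V\<in>C. restr R U (U \<inter> V) (s U) = restr R V (U \<inter> V) (s V))
        \<longrightarrow> (\<exists>!t. t \<in> carrier (sect R (\<Union>C)) \<and> (\<forall>U\<in>C. restr R (\<Union>C) U t = s U))"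
    by (rule conjunct2[OF conjunct2[OF conjunct2[OF R_graded[unfolded graded_sheaf_on_def ring_sheaf_on_def sheaf_on_def]]]])
  from spec[OF spec[OF this, of "{}"], of undefined]
  have "\<exists>!t. t \<in> carrier (sect R {})" by simp
  then show "a \<in> carrier (sect R {}) \<Longrightarrow> b \<in> carrier (sect R {}) \<Longrightarrow> a = b" by blast
qed

abbreviation Q where "Q \<equiv> stalk X R \<xi>"
abbreviation gr where "gr \<equiv> germ X R \<xi>"
abbreviation S where "S \<equiv> generic_sheaf X R"

definition SG where "SG w = {gr V s | V s. openin X V \<and> \<xi> \<in> V \<and> s \<in> hcomp R V w}"

lemma SG_mem: "c \<in> SG w \<longleftrightarrow> (\<exists>V s. rp.nbhd V \<and> s \<in> hcomp R V w \<and> c = gr V s)"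
  by (auto simp: SG_def rp.nbhd_def)

lemma SG_germ: "rp.nbhd V \<Longrightarrow> s \<in> hcomp R V w \<Longrightarrow> gr V s \<in> SG w"
  unfolding SG_mem by blast

lemma SG_rep2:
  assumes w: "v \<in> carrier K" "w \<in> carrier K" and a: "a \<in> SG v" and b: "b \<in> SG w"
  obtains V s t where "rp.nbhd V" "s \<in> hcomp R V v" "t \<in> hcomp R V w" "a = gr V s" "b = gr V t"
proof -
  obtain V s where V: "rp.nbhd V" "s \<in> hcomp R V v" "a = gr V s" using a unfolding SG_mem by metis
  obtain V' s' where V': "rp.nbhd V'" "s' \<in> hcomp R V' w" "b = gr V' s'" using b unfolding SG_mem by metis
  have n: "rp.nbhd (V \<inter> V')" using V V' rp.nbhd_Int by blast
  have o: "openin X V" "openin X V'" "openin X (V \<inter> V')" using V V' n by (auto simp: rp.nbhd_def)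
  show thesis
  proof (rule that[OF n])
    show "restr R V (V \<inter> V') s \<in> hcomp R (V \<inter> V') v" "restr R V' (V \<inter> V') s' \<in> hcomp R (V \<inter> V') w"
      using R_hrestr o w V V' by auto
    show "a = gr (V \<inter> V') (restr R V (V \<inter> V') s)" "b = gr (V \<inter> V') (restr R V' (V \<inter> V') s')"
      using rp.germ_restr V V' n o w R_hcarrier by auto
  qed
qed

text \<open>Restriction preserves degrees, so homogeneous representatives stay homogeneous when they
  are moved to one common open set.\<close>

lemma SG_finite_rep:
  assumes I: "finite I" "I \<subseteq> carrier K" and c: "\<And>w. w \<in> I \<Longrightarrow> c w \<in> SG w"
  shows "\<exists>V s. rp.nbhd V \<and> (\<forall>w\<in>I. s w \<in> hcomp R V w \<and> c w = gr V (s w))"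
proof -
  have "\<forall>w\<in>I. \<exists>V s. rp.nbhd V \<and> s \<in> hcomp R V w \<and> c w = gr V s" using c SG_mem by metis
  then obtain V s where V: "\<And>w. w \<in> I \<Longrightarrow> rp.nbhd (V w) \<and> s w \<in> hcomp R (V w) w \<and> c w = gr (V w) (s w)" by metis
  define W where "W = topspace X \<inter> (\<Inter>w\<in>I. V w)"
  have W: "rp.nbhd W"
  proof -
    have "openin X W" unfolding W_def
    proof (cases "I = {}")
      case False
      then show "openin X (topspace X \<inter> (\<Inter>w\<in>I. V w))" using V I by (intro openin_Int openin_INT) (auto simp: rp.nbhd_def)
    qed simp
    then show ?thesis using V xi_in by (auto simp: W_def rp.nbhd_def)
  qed
  have "restr R (V w) W (s w) \<in> hcomp R W w \<and> c w = gr W (restr R (V w) W (s w))" if w: "w \<in> I" for w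
  proof -
    have sub: "W \<subseteq> V w" using w by (auto simp: W_def)
    have o: "openin X (V w)" "openin X W" using V[OF w] W by (auto simp: rp.nbhd_def)
    have wK: "w \<in> carrier K" using w I by blast
    show ?thesis using R_hrestr[OF o sub wK] rp.germ_restr[of "V w" "s w" W] V[OF w] W sub R_hcarrier[OF o(1) wK] by simp
  qed
  then show ?thesis using W by (intro exI[of _ W] exI[of _ "\<lambda>w. restr R (V w) W (s w)"]) auto
qed

text \<open>All conditions concern finitely many germs and are checked in the graded ring R(V) of a
  common neighbourhood. For independence, a vanishing sum of germs vanishes as a section after
  shrinking to some W, where the grading of R(W) makes each summand zero.\<close>

lemma Q_graded: "graded_ring K Q SG"
proof (rule graded_ringI)
  show "comm_group K" by (rule K_comm)
  show "cring Q" by (rule rp.stalk_cring)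
next
  fix w assume w: "w \<in> carrier K"
  have Gr: "graded K (sect R V) (hcomp R V)" if "rp.nbhd V" for V using that R_comp by (simp add: rp.nbhd_def)
  have sub: "SG w \<subseteq> carrier Q" unfolding SG_mem subset_iff using graded.G_carrier[OF Gr w] rp.germ_closed by metis
  have "subgroup (SG w) (add_monoid Q)"
  proof (rule rp.S.add.subgroupI)
    show "SG w \<subseteq> carrier Q" by (rule sub)
    show "SG w \<noteq> {}" using SG_germ[OF rp.nbhd_topspace graded.G_zero[OF Gr[OF rp.nbhd_topspace] w]] by blast
    fix a b assume a: "a \<in> SG w" and b: "b \<in> SG w"
    obtain V s t where V: "rp.nbhd V" "s \<in> hcomp R V w" "t \<in> hcomp R V w" "a = gr V s" "b = gr V t"
      using SG_rep2[OF w w a b] by metis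
    interpret V: graded K "sect R V" "hcomp R V" using Gr[OF V(1)] .
    have st: "s \<in> carrier (sect R V)" "t \<in> carrier (sect R V)" using V w V.G_carrier by auto
    show "a \<oplus>\<^bsub>Q\<^esub> b \<in> SG w"
      using rp.germ_add[OF V(1) st] SG_germ[OF V(1) V.G_add[OF w V(2,3)]] V(4,5) by simp
  next
    fix a assume a: "a \<in> SG w"
    obtain V s where V: "rp.nbhd V" "s \<in> hcomp R V w" "a = gr V s"
      using SG_rep2[OF w w a a] by metis
    interpret V: graded K "sect R V" "hcomp R V" using Gr[OF V(1)] .
    have st: "s \<in> carrier (sect R V)" using V w V.G_carrier by auto
    have ms: "\<ominus>\<^bsub>sect R V\<^esub> s \<in> hcomp R V w"
      using additive_subgroup.a_inv_closed[OF V.G_subgroup[OF w] V(2)] .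
    have "gr V (\<ominus>\<^bsub>sect R V\<^esub> s) \<oplus>\<^bsub>Q\<^esub> gr V s = \<zero>\<^bsub>Q\<^esub>"
      using rp.germ_add[OF V(1) _ st, of "\<ominus>\<^bsub>sect R V\<^esub> s"] st V.A.l_neg rp.germ_zero[OF V(1)] by simp
    then have "\<ominus>\<^bsub>Q\<^esub> a = gr V (\<ominus>\<^bsub>sect R V\<^esub> s)" using rp.S.minus_equality V st by simp
    then show "\<ominus>\<^bsub>Q\<^esub> a \<in> SG w" using SG_germ[OF V(1) ms] by simp
  qed
  then show "additive_subgroup (SG w) Q" by (rule additive_subgroup.intro)
next
  fix v w a b assume vw: "v \<in> carrier K" "w \<in> carrier K" and a: "a \<in> SG v" and b: "b \<in> SG w"
  obtain V s t where V: "rp.nbhd V" "s \<in> hcomp R V v" "t \<in> hcomp R V w" "a = gr V s" "b = gr V t"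
    using SG_rep2[OF vw a b] by metis
  interpret V: graded K "sect R V" "hcomp R V" using R_comp V by (simp add: rp.nbhd_def)
  have st: "s \<in> carrier (sect R V)" "t \<in> carrier (sect R V)" using V vw V.G_carrier by auto
  show "a \<otimes>\<^bsub>Q\<^esub> b \<in> SG (v \<otimes>\<^bsub>K\<^esub> w)"
    using rp.germ_mult[OF V(1) st] SG_germ[OF V(1) V.G_mult[OF vw V(2,3)]] V(4,5) by simp
next
  fix a assume "a \<in> carrier Q"
  then obtain V s where V: "rp.nbhd V" "s \<in> carrier (sect R V)" "a = gr V s" unfolding rp.stalk_carrier by metis
  interpret V: graded K "sect R V" "hcomp R V" using R_comp V by (simp add: rp.nbhd_def)
  have "gr V (finsum (sect R V) (V.comp s) (V.supp s)) = finsum Q (\<lambda>w. gr V (V.comp s w)) (V.supp s)"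
    by (rule rp.germ_finsum) (use V V.supp_finite V.comp_closed in auto)
  then have "a = finsum Q (\<lambda>w. gr V (V.comp s w)) (V.supp s)" using V.comp_sum[OF V(2)] V(3) by simp
  then show "\<exists>I c. finite I \<and> I \<subseteq> carrier K \<and> (\<forall>w\<in>I. c w \<in> SG w) \<and> a = finsum Q c I"
    using V.supp_finite[OF V(2)] SG_germ[OF V(1) V.comp_in[OF V(2)]]
    by (intro exI[of _ "V.supp s"] exI[of _ "\<lambda>w. gr V (V.comp s w)"]) auto
next
  fix I c assume I: "finite I" "I \<subseteq> carrier K" and c: "\<And>w. w \<in> I \<Longrightarrow> c w \<in> SG w" and z: "finsum Q c I = \<zero>\<^bsub>Q\<^esub>"
  obtain V s where V: "rp.nbhd V" "\<And>w. w \<in> I \<Longrightarrow> s w \<in> hcomp R V w \<and> c w = gr V (s w)" using SG_finite_rep[OF I c] by metis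
  have oV: "openin X V" using V by (simp add: rp.nbhd_def)
  interpret V: graded K "sect R V" "hcomp R V" using R_comp[OF oV] .
  have sc: "s w \<in> carrier (sect R V)" if "w \<in> I" for w using V(2)[OF that] I that V.G_carrier by blast
  then have gc: "gr V (s w) \<in> carrier Q" if "w \<in> I" for w using V(1) that by simp
  have "gr V (finsum (sect R V) s I) = finsum Q (\<lambda>w. gr V (s w)) I" by (rule rp.germ_finsum[OF V(1) I(1) sc])
  also have "\<dots> = finsum Q c I" by (rule rp.S.finsum_cong') (use V(2) gc in auto)
  finally have "gr V (finsum (sect R V) s I) = \<zero>\<^bsub>Q\<^esub>" using z by simp
  then obtain W where W: "rp.nbhd W" "W \<subseteq> V" "restr R V W (finsum (sect R V) s I) = \<zero>\<^bsub>sect R W\<^esub>"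
    using rp.germ_eq_zero[OF V(1), of "finsum (sect R V) s I"] sc by (auto intro: V.A.finsum_closed)
  have oW: "openin X W" using W by (simp add: rp.nbhd_def)
  interpret W: graded K "sect R W" "hcomp R W" using R_comp[OF oW] .
  interpret h: ring_hom_cring "sect R V" "sect R W" "restr R V W" using rp.r_hom[OF oV oW W(2)] by unfold_locales
  have "finsum (sect R W) (restr R V W \<circ> s) I = \<zero>\<^bsub>sect R W\<^esub>" using h.hom_finsum[of s I] sc W(3) by auto
  moreover have "(restr R V W \<circ> s) w \<in> hcomp R W w" if "w \<in> I" for w using R_hrestr[OF oV oW W(2)] V(2)[OF that] that I by auto
  ultimately have "(restr R V W \<circ> s) w = \<zero>\<^bsub>sect R W\<^esub>" if "w \<in> I" for w
    using W.comp_finsum[OF I, of "restr R V W \<circ> s" w] that I by auto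
  then show "\<forall>w\<in>I. c w = \<zero>\<^bsub>Q\<^esub>"
    using V rp.germ_eq_zero[OF V(1) sc] W(1,2) by auto
qed

sublocale Q: graded K Q SG by (rule gradedI[OF Q_graded])

lemma S_sect: "sect S = const_sect Q" and S_restr: "restr S = const_restr Q"
  and S_hcomp: "hcomp S U w = (if U = {} then {\<zero>\<^bsub>Q\<^esub>} else SG w)"
  by (auto simp: generic_sheaf_def Let_def SG_def \<xi>_def)

lemma S_nonempty: "U \<noteq> {} \<Longrightarrow> sect S U = Q" "U \<noteq> {} \<Longrightarrow> hcomp S U = SG"
  by (auto simp: S_sect S_hcomp const_sect_def fun_eq_iff)

abbreviation H where "H \<equiv> homog K Q SG"

text \<open>The sections of the constant sheaf over the empty set. They form the zero ring, which is
  trivially graded but not simple, so it has to be handled separately from Q.\<close>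

definition Z where "Z = Q\<lparr>carrier := {\<zero>\<^bsub>Q\<^esub>}, one := \<zero>\<^bsub>Q\<^esub>\<rparr>"

lemma Z_simps [simp]: "carrier Z = {\<zero>\<^bsub>Q\<^esub>}" "\<one>\<^bsub>Z\<^esub> = \<zero>\<^bsub>Q\<^esub>" "\<zero>\<^bsub>Z\<^esub> = \<zero>\<^bsub>Q\<^esub>" "mult Z = mult Q" "add Z = add Q"
  by (auto simp: Z_def)

lemma S_empty: "sect S {} = Z" "hcomp S {} = (\<lambda>w. {\<zero>\<^bsub>Q\<^esub>})"
  by (auto simp: S_sect S_hcomp const_sect_def Z_def fun_eq_iff)

lemma Z_cring: "cring Z"
  by (intro cringI abelian_groupI comm_monoidI) auto

lemma Z_graded: "graded_ring K Z (\<lambda>w. {\<zero>\<^bsub>Q\<^esub>})"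
proof (rule graded_ringI[OF K_comm Z_cring])
  interpret Z: cring Z by (rule Z_cring)
  show "additive_subgroup {\<zero>\<^bsub>Q\<^esub>} Z" for w
    using Z.add.subgroup_self by (intro additive_subgroup.intro) simp
  show "\<exists>I c. finite I \<and> I \<subseteq> carrier K \<and> (\<forall>w\<in>I. c w \<in> {\<zero>\<^bsub>Q\<^esub>}) \<and> a = finsum Z c I" if "a \<in> carrier Z" for a
    using that by (intro exI[of _ "{}"]) simp
qed auto

lemma S_graded: "openin X U \<Longrightarrow> graded_ring K (sect S U) (hcomp S U)"
  using Z_graded Q_graded S_empty S_nonempty by (cases "U = {}") auto

lemma S_graded_sheaf: "graded_sheaf_on X K S"
proof -
  have c: "(\<lambda>U. carrier (sect S U)) = (\<lambda>U. if U = {} then {\<zero>\<^bsub>Q\<^esub>} else carrier Q)" by (auto simp: S_sect const_sect_def fun_eq_iff)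
  have sh: "sheaf_on X (\<lambda>U. carrier (sect S U)) (restr S)"
    unfolding c S_restr by (rule const_subsheaf) (auto split: if_splits)
  have hom: "restr S U V \<in> ring_hom (sect S U) (sect S V)" if "V \<subseteq> U" for U V
  proof (cases "V = {}")
    case True then show ?thesis by (auto simp: S_restr const_restr_def S_empty ring_hom_def)
  next
    case False
    then have "U \<noteq> {}" using that by blast
    then show ?thesis using False by (auto simp: S_restr const_restr_def S_nonempty ring_hom_def)
  qed
  have rp: "ring_presheaf_on X S"
    unfolding ring_presheaf_on_def using sh hom S_graded by (auto simp: sheaf_on_def graded_ring_def)
  have "restr S U V ` hcomp S U w \<subseteq> hcomp S V w" if "V \<subseteq> U" "w \<in> carrier K" for U V w
    using that by (auto simp: S_hcomp S_restr const_restr_def)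
  then show ?thesis using rp sh S_graded by (auto simp: graded_sheaf_on_def graded_presheaf_on_def ring_sheaf_on_def)
qed

lemma H_iff: "a \<in> H \<longleftrightarrow> a \<noteq> \<zero>\<^bsub>Q\<^esub> \<and> (\<exists>w\<in>carrier K. a \<in> SG w)"
  by (rule Q.homog_iff)

lemma hsect_S: "U \<noteq> {} \<Longrightarrow> hsect K S U = H"
  by (simp add: S_nonempty)

lemma H_carrier: "a \<in> H \<Longrightarrow> a \<in> carrier Q"
  using H_iff Q.G_carrier by blast

lemma to_generic_nonempty: "U \<noteq> {} \<Longrightarrow> to_generic X R U = gr U"
  by (auto simp: to_generic_def \<xi>_def fun_eq_iff)

lemma to_generic_empty: "to_generic X R {} s = \<zero>\<^bsub>Q\<^esub>"
  by (simp add: to_generic_def \<xi>_def)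

end

section \<open>Homogeneous units of the generic stalk and their valuations\<close>

locale graded_simple_krull = graded_on_krull +
  assumes simple: "graded_simple K Q SG"
begin

lemma H_unit: "a \<in> H \<Longrightarrow> a \<in> Units Q"
  using simple by (auto simp: graded_simple_def)

lemma one_not_zero: "\<one>\<^bsub>Q\<^esub> \<noteq> \<zero>\<^bsub>Q\<^esub>"
  using simple rp.S.one_zeroD by (auto simp: graded_simple_def)

lemma H_one: "\<one>\<^bsub>Q\<^esub> \<in> H"
  using one_not_zero Q.one_in_G H_iff by auto

lemma H_mult:
  assumes "a \<in> H" "b \<in> H" shows "a \<otimes>\<^bsub>Q\<^esub> b \<in> H"
proof -
  have "a \<otimes>\<^bsub>Q\<^esub> b \<in> Units Q" using assms H_unit by (simp add: rp.S.Units_m_closed)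
  then have "a \<otimes>\<^bsub>Q\<^esub> b \<noteq> \<zero>\<^bsub>Q\<^esub>" using one_not_zero rp.S.Units_r_inv rp.S.Units_inv_closed rp.S.l_null by metis
  moreover obtain v w where "v \<in> carrier K" "a \<in> SG v" "w \<in> carrier K" "b \<in> SG w" using assms H_iff by metis
  ultimately show ?thesis using Q.G_mult[of v w a b] K.m_closed[of v w] unfolding H_iff by blast
qed

lemma SG_H: "w \<in> carrier K \<Longrightarrow> a \<in> SG w \<Longrightarrow> a \<noteq> \<zero>\<^bsub>Q\<^esub> \<Longrightarrow> a \<in> H"
  by (auto simp: H_iff)

lemma H_inv:
  assumes "a \<in> H" shows "inv\<^bsub>Q\<^esub> a \<in> H"
proof -
  obtain w where w: "w \<in> carrier K" "a \<in> SG w" using assms H_iff by blast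
  have "inv\<^bsub>Q\<^esub> a \<noteq> \<zero>\<^bsub>Q\<^esub>" using H_unit[OF assms] one_not_zero rp.S.Units_l_inv rp.S.Units_closed rp.S.l_null by metis
  then show ?thesis using Q.inverse_degree[OF w H_unit[OF assms]] w by (auto simp: H_iff)
qed

lemma H_minus: "w \<in> carrier K \<Longrightarrow> a \<in> SG w \<Longrightarrow> \<ominus>\<^bsub>Q\<^esub> a \<in> SG w"
  using additive_subgroup.a_inv_closed[OF Q.G_subgroup] .

lemma H_minus_one: "\<ominus>\<^bsub>Q\<^esub> \<one>\<^bsub>Q\<^esub> \<in> H"
proof (rule SG_H[OF K.one_closed H_minus[OF K.one_closed Q.one_in_G]])
  have "\<ominus>\<^bsub>Q\<^esub> (\<ominus>\<^bsub>Q\<^esub> \<one>\<^bsub>Q\<^esub>) = \<one>\<^bsub>Q\<^esub>" by (rule rp.S.minus_minus) simp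
  then show "\<ominus>\<^bsub>Q\<^esub> \<one>\<^bsub>Q\<^esub> \<noteq> \<zero>\<^bsub>Q\<^esub>" using one_not_zero rp.S.minus_zero by metis
qed

lemma H_monoid: "comm_group (homog_monoid K Q SG)"
proof (rule comm_groupI)
  fix a assume a: "a \<in> carrier (homog_monoid K Q SG)"
  then have "a \<in> H" by (simp add: homog_monoid_def)
  then show "\<exists>y\<in>carrier (homog_monoid K Q SG). y \<otimes>\<^bsub>homog_monoid K Q SG\<^esub> a = \<one>\<^bsub>homog_monoid K Q SG\<^esub>"
    using H_inv[of a] H_unit[of a] by (intro bexI[of _ "inv\<^bsub>Q\<^esub> a"]) (auto simp: homog_monoid_def)
next
  fix a b assume ab: "a \<in> carrier (homog_monoid K Q SG)" "b \<in> carrier (homog_monoid K Q SG)"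
  then show "a \<otimes>\<^bsub>homog_monoid K Q SG\<^esub> b \<in> carrier (homog_monoid K Q SG)"
    by (simp add: homog_monoid_def H_mult)
  show "a \<otimes>\<^bsub>homog_monoid K Q SG\<^esub> b = b \<otimes>\<^bsub>homog_monoid K Q SG\<^esub> a"
    using ab rp.S.m_comm[of a b] H_carrier by (simp add: homog_monoid_def)
next
  fix a b c assume "a \<in> carrier (homog_monoid K Q SG)" "b \<in> carrier (homog_monoid K Q SG)" "c \<in> carrier (homog_monoid K Q SG)"
  then show "a \<otimes>\<^bsub>homog_monoid K Q SG\<^esub> b \<otimes>\<^bsub>homog_monoid K Q SG\<^esub> c = a \<otimes>\<^bsub>homog_monoid K Q SG\<^esub> (b \<otimes>\<^bsub>homog_monoid K Q SG\<^esub> c)"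
    using rp.S.m_assoc[of a b c] H_carrier by (simp add: homog_monoid_def)
qed (simp_all add: homog_monoid_def H_one H_carrier)

definition gval where "gval m \<longleftrightarrow> graded_valuation K Q SG m"

lemma gvalD:
  assumes "gval m"
  shows gval_mult: "\<And>a b. a \<in> H \<Longrightarrow> b \<in> H \<Longrightarrow> m (a \<otimes>\<^bsub>Q\<^esub> b) = m a + m b"
    and gval_add: "\<And>w a b. w \<in> carrier K \<Longrightarrow> a \<in> SG w \<Longrightarrow> b \<in> SG w \<Longrightarrow> a \<noteq> \<zero>\<^bsub>Q\<^esub> \<Longrightarrow> b \<noteq> \<zero>\<^bsub>Q\<^esub> \<Longrightarrow> a \<oplus>\<^bsub>Q\<^esub> b \<noteq> \<zero>\<^bsub>Q\<^esub>
      \<Longrightarrow> min (m a) (m b) \<le> m (a \<oplus>\<^bsub>Q\<^esub> b)"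
  using assms by (auto simp: gval_def graded_valuation_def epi_def hom_def homog_monoid_def)

lemma gval_one: assumes "gval m" shows "m \<one>\<^bsub>Q\<^esub> = 0"
  using gval_mult[OF assms H_one H_one] by simp

lemma gval_inv: assumes "gval m" "a \<in> H" shows "m (inv\<^bsub>Q\<^esub> a) = - m a"
  using gval_mult[OF assms H_inv[OF assms(2)]] gval_one[OF assms(1)] H_unit[OF assms(2)] by simp

lemma gval_minus: assumes "gval m" "a \<in> H" shows "m (\<ominus>\<^bsub>Q\<^esub> a) = m a"
proof -
  have "\<ominus>\<^bsub>Q\<^esub> \<one>\<^bsub>Q\<^esub> \<otimes>\<^bsub>Q\<^esub> \<ominus>\<^bsub>Q\<^esub> \<one>\<^bsub>Q\<^esub> = \<one>\<^bsub>Q\<^esub>" using rp.S.l_minus rp.S.r_minus by simp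
  then have "m (\<ominus>\<^bsub>Q\<^esub> \<one>\<^bsub>Q\<^esub>) = 0" using gval_mult[OF assms(1) H_minus_one H_minus_one] gval_one[OF assms(1)] by simp
  moreover have "\<ominus>\<^bsub>Q\<^esub> a = \<ominus>\<^bsub>Q\<^esub> \<one>\<^bsub>Q\<^esub> \<otimes>\<^bsub>Q\<^esub> a" using rp.S.l_minus H_carrier[OF assms(2)] by simp
  ultimately show ?thesis using gval_mult[OF assms(1) H_minus_one assms(2)] by simp
qed

definition nonneg where "nonneg m w = {a \<in> SG w. a = \<zero>\<^bsub>Q\<^esub> \<or> 0 \<le> m a}"

text \<open>The valuation inequality is available only for summands of equal degree, and closure
  under addition is required only within one degree.\<close>

lemma nonneg_subgroups:
  assumes m: "gval m"
  shows "graded_subgroups K Q SG (nonneg m)"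
proof (unfold_locales)
  fix w a b assume w: "w \<in> carrier K" and a: "a \<in> nonneg m w" and b: "b \<in> nonneg m w"
  show "a \<oplus>\<^bsub>Q\<^esub> b \<in> nonneg m w"
  proof (cases "a = \<zero>\<^bsub>Q\<^esub> \<or> b = \<zero>\<^bsub>Q\<^esub> \<or> a \<oplus>\<^bsub>Q\<^esub> b = \<zero>\<^bsub>Q\<^esub>")
    case True
    then show ?thesis using a b w Q.G_carrier[OF w] by (auto simp: nonneg_def)
  next
    case False
    then show ?thesis using a b w gval_add[OF m w, of a b] Q.G_add[OF w] by (auto simp: nonneg_def)
  qed
next
  fix w a assume w: "w \<in> carrier K" and a: "a \<in> nonneg m w"
  show "\<ominus>\<^bsub>Q\<^esub> a \<in> nonneg m w"
  proof (cases "a = \<zero>\<^bsub>Q\<^esub>")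
    case True then show ?thesis using w by (simp add: nonneg_def)
  next
    case False
    then show ?thesis using a gval_minus[OF m, of a] SG_H[OF w] H_minus[OF w] by (simp add: nonneg_def)
  qed
next
  fix v w a b assume vw: "v \<in> carrier K" "w \<in> carrier K" and a: "a \<in> nonneg m v" and b: "b \<in> nonneg m w"
  show "a \<otimes>\<^bsub>Q\<^esub> b \<in> nonneg m (v \<otimes>\<^bsub>K\<^esub> w)"
  proof (cases "a = \<zero>\<^bsub>Q\<^esub> \<or> b = \<zero>\<^bsub>Q\<^esub>")
    case True
    then show ?thesis using a b vw Q.G_carrier by (auto simp: nonneg_def)
  next
    case False
    then show ?thesis using a b vw gval_mult[OF m, of a b] SG_H Q.G_mult by (auto simp: nonneg_def)
  qed
qed (use gval_one[OF m] Q.one_in_G in \<open>auto simp: nonneg_def\<close>)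

lemma all_subgroups: "graded_subgroups K Q SG SG"
  by unfold_locales (auto simp: Q.G_add H_minus Q.G_mult Q.one_in_G)

text \<open>Over X the skyscraper group is the group of integers, and surjectivity onto it rules out
  the alternative that the map is zero. Compatibility with restriction then determines the whole
  morphism by its valuation over X.\<close>

lemma sheaf_graded_valuation_skyscraper:
  assumes v: "sheaf_graded_valuation X K S (skyscraper Y) \<mu>" and Y: "Y \<in> topspace X"
  shows sgv_gval: "gval (\<mu> (topspace X))"
    and sgv_restrict: "openin X U \<Longrightarrow> U \<noteq> {} \<Longrightarrow> a \<in> H \<Longrightarrow> \<mu> U a = (if Y \<in> U then \<mu> (topspace X) a else 0)"
proof -
  have t: "openin X (topspace X) \<and> topspace X \<noteq> {}" using topspace_nonempty by simp
  have 1: "\<mu> (topspace X) \<in> epi (homog_monoid K Q SG) integer_group"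
    "graded_valuation K Q SG (\<mu> (topspace X)) \<or> (\<forall>f\<in>H. \<mu> (topspace X) f = 0)"
    using v t Y unfolding sheaf_graded_valuation_def by (auto simp: S_nonempty vsect_skyscraper)
  have "\<not> (\<forall>f\<in>H. \<mu> (topspace X) f = 0)"
  proof
    assume 0: "\<forall>f\<in>H. \<mu> (topspace X) f = 0"
    have "\<mu> (topspace X) ` H = UNIV" using 1(1) by (simp add: epi_def homog_monoid_def)
    then obtain a where "a \<in> H" "\<mu> (topspace X) a = 1" by (metis UNIV_I imageE)
    then show False using 0 by simp
  qed
  then show "gval (\<mu> (topspace X))" using 1(2) unfolding gval_def by argo
  assume U: "openin X U" "U \<noteq> {}" "a \<in> H"
  have "\<mu> U (restr S (topspace X) U a) = vrestr (skyscraper Y) (topspace X) U (\<mu> (topspace X) a)"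
    using conjunct2[OF conjunct2[OF conjunct2[OF v[unfolded sheaf_graded_valuation_def]]], rule_format, of "topspace X" U a]
      t U openin_subset[OF U(1)] hsect_S[of "topspace X"] by simp
  then show "\<mu> U a = (if Y \<in> U then \<mu> (topspace X) a else 0)"
    using U by (simp add: S_restr const_restr_def vrestr_skyscraper)
qed

lemma sheaf_graded_valuationI:
  assumes m: "gval m"
  shows "sheaf_graded_valuation X K S (skyscraper Y) (\<lambda>U a. if Y \<in> U then m a else 0)"
proof -
  have "(\<lambda>a. if Y \<in> U then m a else 0) \<in> epi (homog_monoid K Q SG) (vsect (skyscraper Y) U)" for U
  proof (cases "Y \<in> U")
    case True
    then show ?thesis using m by (simp add: gval_def graded_valuation_def vsect_skyscraper)
  next
    case False
    then show ?thesis using H_one H_mult by (auto simp: vsect_skyscraper epi_def hom_def singleton_group_def homog_monoid_def)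
  qed
  moreover have "graded_valuation K Q SG (\<lambda>a. if Y \<in> U then m a else 0) \<or> (\<forall>f\<in>H. (if Y \<in> U then m f else 0) = 0)" for U
    using m by (auto simp: gval_def)
  ultimately show ?thesis
    unfolding sheaf_graded_valuation_def using S_graded_sheaf discrete_value_sheaf_skyscraper simple
    by (auto simp: S_nonempty S_restr const_restr_def vrestr_skyscraper)
qed

text \<open>Over an open set without Y all homogeneous elements have value 0, so all of them are
  generators and every section is obtained; over one containing Y the generators are the homogeneous
  elements of non-negative value. The subrings that these generate over the single open sets already
  form a graded subsheaf, so gluing adds nothing.\<close>

lemma valuation_sheaf_eq:
  assumes v: "sheaf_graded_valuation X K S (skyscraper Y) \<mu>" and Y: "Y \<in> topspace X"
    and U: "openin X U" "U \<noteq> {}"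
  shows "valuation_sheaf X K S (skyscraper Y) \<mu> U =
    {a \<in> carrier Q. \<forall>w\<in>carrier K. Y \<in> U \<longrightarrow> Q.comp a w = \<zero>\<^bsub>Q\<^esub> \<or> 0 \<le> \<mu> (topspace X) (Q.comp a w)}" (is "?V = ?E")
proof -
  define m where "m = \<mu> (topspace X)"
  have m: "gval m" and \<mu>: "\<And>U a. openin X U \<Longrightarrow> U \<noteq> {} \<Longrightarrow> a \<in> H \<Longrightarrow> \<mu> U a = (if Y \<in> U then m a else 0)"
    using sgv_gval[OF v Y] sgv_restrict[OF v Y] by (auto simp: m_def)
  interpret N: graded_subgroups K Q SG "nonneg m" by (rule nonneg_subgroups[OF m])
  interpret G: graded_subgroups K Q SG SG by (rule all_subgroups)
  have Gspan: "G.span = carrier Q" using Q.comp_in by (auto simp: G.span_def)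
  define E where "E U = (if U = {} then {\<zero>\<^bsub>Q\<^esub>} else if Y \<in> U then N.span else carrier Q)" for U
  have EU: "E U = ?E" unfolding m_def[symmetric]
  proof (cases "Y \<in> U")
    case True
    then show "E U = {a \<in> carrier Q. \<forall>w\<in>carrier K. Y \<in> U \<longrightarrow> Q.comp a w = \<zero>\<^bsub>Q\<^esub> \<or> 0 \<le> m (Q.comp a w)}"
      using U(2) Q.comp_in unfolding E_def N.span_def nonneg_def by (simp, blast)
  qed (use U(2) in \<open>simp add: E_def\<close>)
  have sub: "graded_subsheaf X K S E"
    unfolding graded_subsheaf_def
  proof (intro conjI allI impI)
    fix U assume "openin X U"
    show "subring (E U) (sect S U)"
    proof (cases "U = {}")
      case True
      interpret Z: cring Z by (rule Z_cring)
      have "subring (carrier Z) Z" by (rule Z.carrier_is_subring)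
      then show ?thesis using True by (simp add: E_def S_empty)
    next
      case False
      then show ?thesis using N.span_subring rp.S.carrier_is_subring by (simp add: E_def S_nonempty)
    qed
    show "\<forall>t\<in>E U. \<exists>c. decomposition K (sect S U) (\<lambda>w. hcomp S U w \<inter> E U) t c"
    proof (cases "U = {}")
      case True
      interpret Z: cring Z by (rule Z_cring)
      have "decomposition K Z (\<lambda>w. {\<zero>\<^bsub>Q\<^esub>}) \<zero>\<^bsub>Q\<^esub> (\<lambda>w\<in>carrier K. \<zero>\<^bsub>Q\<^esub>)"
      proof -
        have e: "{w \<in> carrier K. (\<lambda>w\<in>carrier K. \<zero>\<^bsub>Q\<^esub>) w \<noteq> \<zero>\<^bsub>Z\<^esub>} = {}" by auto
        show ?thesis unfolding decomposition_def e by simp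
      qed
      then show ?thesis using True by (auto simp: E_def S_empty)
    next
      case False
      then show ?thesis using N.span_decomposition G.span_decomposition Gspan by (auto simp: E_def S_nonempty)
    qed
  next
    show "sheaf_on X E (restr S)"
      unfolding S_restr
    proof (rule const_subsheaf)
      show "E U \<subseteq> E V" if "V \<subseteq> U" "V \<noteq> {}" for U V using that N.span_sub by (auto simp: E_def)
      fix C a assume "\<And>U. U \<in> C \<Longrightarrow> openin X U" and ne: "\<Union>C \<noteq> {}" and a: "\<And>U. U \<in> C \<Longrightarrow> U \<noteq> {} \<Longrightarrow> a \<in> E U"
      obtain U0 where U0: "U0 \<in> C" "U0 \<noteq> {}" using ne by blast
      have "a \<in> carrier Q" using a[OF U0] U0 N.span_sub by (auto simp: E_def split: if_splits)
      moreover have "a \<in> N.span" if "Y \<in> \<Union>C"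
      proof -
        obtain U where "U \<in> C" "Y \<in> U" using \<open>Y \<in> \<Union>C\<close> by blast
        then show ?thesis using a[of U] by (auto simp: E_def)
      qed
      ultimately show "a \<in> E (\<Union>C)" by (cases "Y \<in> \<Union>C") (simp_all only: E_def ne if_False if_True)
    qed (simp add: E_def)
  qed
  have vn: "vnonneg (skyscraper Y) W = (if Y \<in> W then {0..} else {0})" for W by (rule vnonneg_skyscraper)
  have gen: "{g \<in> hsect K S W. \<mu> W g \<in> vnonneg (skyscraper Y) W} \<subseteq> E W" if W: "openin X W" for W
  proof (cases "W = {}")
    case True then show ?thesis by (auto simp: S_empty homog_def)
  next
    case False
    show ?thesis
    proof
      fix g assume g: "g \<in> {g \<in> hsect K S W. \<mu> W g \<in> vnonneg (skyscraper Y) W}"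
      then have gH: "g \<in> H" "\<mu> W g \<in> vnonneg (skyscraper Y) W" using hsect_S[OF False] by auto
      obtain w where w: "w \<in> carrier K" "g \<in> SG w" using gH H_iff by blast
      show "g \<in> E W"
      proof (cases "Y \<in> W")
        case True
        then have "0 \<le> m g" using gH \<mu>[OF W False gH(1)] by (simp add: vn)
        then have "g \<in> N.span" using N.B_in_span[OF w(1)] w by (simp add: nonneg_def)
        then show ?thesis using False True by (simp add: E_def)
      qed (use False H_carrier gH in \<open>simp add: E_def\<close>)
    qed
  qed
  have "?V \<subseteq> E U" using sub gen unfolding valuation_sheaf_def by blast
  moreover have "E U \<subseteq> ?V"
  proof
    fix f assume f: "f \<in> E U"
    have "E U \<subseteq> T U" if T: "graded_subsheaf X K S T" and g: "\<forall>V. openin X V \<longrightarrow> {g \<in> hsect K S V. \<mu> V g \<in> vnonneg (skyscraper Y) V} \<subseteq> T V" for T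
    proof -
      have "subring (T U) (sect S U)" using T U(1) unfolding graded_subsheaf_def by blast
      then have sr: "subring (T U) Q" by (simp only: S_nonempty(1)[OF U(2)])
      have gU: "a \<in> T U" if "a \<in> H" "Y \<in> U \<Longrightarrow> 0 \<le> m a" for a
        using g[rule_format, OF U(1)] that \<mu>[OF U that(1)] hsect_S[OF U(2)] by (auto simp: vn)
      have 0: "\<zero>\<^bsub>Q\<^esub> \<in> T U" using subringE(2)[OF sr] .
      show ?thesis
      proof (cases "Y \<in> U")
        case True
        have "N.span \<subseteq> T U" by (rule N.span_least[OF sr]) (use gU 0 SG_H in \<open>auto simp: nonneg_def\<close>)
        then show ?thesis using True U by (simp add: E_def)
      next
        case False
        have "G.span \<subseteq> T U" by (rule G.span_least[OF sr]) (use gU 0 SG_H False in blast)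
        then show ?thesis using False U Gspan by (simp add: E_def)
      qed
    qed
    moreover have "f \<in> carrier (sect S U)" using f U N.span_sub by (auto simp: E_def S_nonempty split: if_splits)
    ultimately show "f \<in> ?V" using f unfolding valuation_sheaf_def by blast
  qed
  ultimately show ?thesis using EU by blast
qed

lemma valuation_sheaf_empty:
  "valuation_sheaf X K S (skyscraper Y) \<mu> {} = {\<zero>\<^bsub>Q\<^esub>}"
proof -
  have "\<zero>\<^bsub>Q\<^esub> \<in> T {}" if "graded_subsheaf X K S T" for T
  proof -
    have "subring (T {}) (sect S {})" using that openin_empty unfolding graded_subsheaf_def by blast
    then show ?thesis using subringE(2)[of "T {}" Z] by (simp add: S_empty)
  qed
  then show ?thesis unfolding valuation_sheaf_def by (auto simp: S_empty)
qed

lemma krull_subsheaf_eq: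
  assumes k: "krull_subsheaf X K S PD skyscraper \<mu> T" and U: "openin X U" "U \<noteq> {}"
  shows "T U = {a \<in> carrier Q. \<forall>w\<in>carrier K. \<forall>Y\<in>PD \<inter> U. Q.comp a w = \<zero>\<^bsub>Q\<^esub> \<or> 0 \<le> \<mu> Y (topspace X) (Q.comp a w)}"
proof -
  have "T U = carrier (sect S U) \<inter> (\<Inter>Y\<in>PD. valuation_sheaf X K S (skyscraper Y) (\<mu> Y) U)"
    using k U by (simp add: krull_subsheaf_def)
  moreover have vs: "valuation_sheaf X K S (skyscraper Y) (\<mu> Y) U =
    {a \<in> carrier Q. \<forall>w\<in>carrier K. Y \<in> U \<longrightarrow> Q.comp a w = \<zero>\<^bsub>Q\<^esub> \<or> 0 \<le> \<mu> Y (topspace X) (Q.comp a w)}" if "Y \<in> PD" for Y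
    by (rule valuation_sheaf_eq) (use k that U PD_topspace in \<open>auto simp: krull_subsheaf_def\<close>)
  ultimately have "T U = carrier (sect S U) \<inter> (\<Inter>Y\<in>PD. {a \<in> carrier Q. \<forall>w\<in>carrier K. Y \<in> U \<longrightarrow> Q.comp a w = \<zero>\<^bsub>Q\<^esub> \<or> 0 \<le> \<mu> Y (topspace X) (Q.comp a w)})"
    by (simp only: INF_cong[OF refl vs])
  then show ?thesis unfolding S_nonempty(1)[OF U(2)] by blast
qed

lemma krull_subsheafI:
  assumes m: "\<And>Y. Y \<in> PD \<Longrightarrow> gval (m Y)" and fin: "\<And>a. a \<in> H \<Longrightarrow> finite {Y \<in> PD. m Y a \<noteq> 0}"
    and T0: "T {} = {\<zero>\<^bsub>Q\<^esub>}"
    and T: "\<And>U. openin X U \<Longrightarrow> U \<noteq> {} \<Longrightarrow> T U = {a \<in> carrier Q. \<forall>w\<in>carrier K. \<forall>Y\<in>PD \<inter> U. Q.comp a w = \<zero>\<^bsub>Q\<^esub> \<or> 0 \<le> m Y (Q.comp a w)}"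
  shows "krull_subsheaf X K S PD skyscraper (\<lambda>Y U a. if Y \<in> U then m Y a else 0) T"
  unfolding krull_subsheaf_def
proof (intro conjI ballI allI impI)
  fix Y assume "Y \<in> PD"
  then show "sheaf_graded_valuation X K S (skyscraper Y) (\<lambda>U a. if Y \<in> U then m Y a else 0)" by (intro sheaf_graded_valuationI m)
next
  fix U assume U: "openin X U"
  show "T U = carrier (sect S U) \<inter> (\<Inter>Y\<in>PD. valuation_sheaf X K S (skyscraper Y) (\<lambda>U a. if Y \<in> U then m Y a else 0) U)"
  proof (cases "U = {}")
    case True
    then show ?thesis using T0 valuation_sheaf_empty by (auto simp: S_empty)
  next
    case False
    have vs: "valuation_sheaf X K S (skyscraper Y) (\<lambda>U a. if Y \<in> U then m Y a else 0) U =
      {a \<in> carrier Q. \<forall>w\<in>carrier K. Y \<in> U \<longrightarrow> Q.comp a w = \<zero>\<^bsub>Q\<^esub> \<or> 0 \<le> m Y (Q.comp a w)}" if "Y \<in> PD" for Y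
      using valuation_sheaf_eq[OF sheaf_graded_valuationI[OF m[OF that]] PD_topspace[OF that] U False] PD_topspace[OF that] by simp
    have "(\<Inter>Y\<in>PD. valuation_sheaf X K S (skyscraper Y) (\<lambda>U a. if Y \<in> U then m Y a else 0) U) =
      (\<Inter>Y\<in>PD. {a \<in> carrier Q. \<forall>w\<in>carrier K. Y \<in> U \<longrightarrow> Q.comp a w = \<zero>\<^bsub>Q\<^esub> \<or> 0 \<le> m Y (Q.comp a w)})"
      by (rule INF_cong[OF refl vs])
    then show ?thesis unfolding T[OF U False] S_nonempty(1)[OF False] by blast
  qed
next
  fix U f assume U: "openin X U \<and> U \<noteq> {}" and f: "f \<in> T U \<inter> hsect K S U"
  then have "f \<in> H" using hsect_S by auto
  then show "finite {Y \<in> PD. (if Y \<in> U then m Y f else 0) \<noteq> 0}" by (rule rev_finite_subset[OF fin]) auto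
qed

end

section \<open>Weil divisors and the class group\<close>

context krull_scheme_space
begin

abbreviation W where "W \<equiv> WDiv X (topspace X)"

lemma vsect_group: "group (vsect (skyscraper Y) U)"
  by (simp add: vsect_skyscraper)

text \<open>The direct sum runs over all prime divisors of X, with singleton summands outside U;
  restriction to U therefore shows up as vanishing entries.\<close>

lemma WDiv_carrier:
  "D \<in> carrier (WDiv X U) \<longleftrightarrow> D \<in> extensional PD \<and> finite {Y \<in> PD. D Y \<noteq> 0} \<and> (\<forall>Y\<in>PD - U. D Y = 0)"
proof -
  have "D \<in> carrier (WDiv X U) \<longleftrightarrow>
    D \<in> (\<Pi>\<^sub>E Y\<in>PD. carrier (vsect (skyscraper Y) U)) \<and> finite {Y \<in> PD. D Y \<noteq> \<one>\<^bsub>vsect (skyscraper Y) U\<^esub>}"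
    unfolding WDiv_def by (subst carrier_sum_group[OF vsect_group]) blast
  moreover have "\<one>\<^bsub>vsect (skyscraper Y) U\<^esub> = 0" for Y by (simp add: vsect_skyscraper singleton_group_def)
  ultimately show ?thesis by (auto simp: vsect_skyscraper PiE_def Pi_def split: if_splits)
qed

lemma W_carrier: "D \<in> carrier W \<longleftrightarrow> D \<in> extensional PD \<and> finite {Y \<in> PD. D Y \<noteq> 0}"
  using PD_topspace by (auto simp: WDiv_carrier)

lemma W_mult: "D \<otimes>\<^bsub>W\<^esub> E = (\<lambda>Y\<in>PD. D Y + E Y)"
  unfolding WDiv_def mult_sum_group using PD_topspace by (auto simp: vsect_skyscraper fun_eq_iff)

lemma W_one: "\<one>\<^bsub>W\<^esub> = (\<lambda>Y\<in>PD. 0)"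
  unfolding WDiv_def one_sum_group using PD_topspace by (auto simp: vsect_skyscraper fun_eq_iff)

lemma W_eqI: "D \<in> carrier W \<Longrightarrow> E \<in> carrier W \<Longrightarrow> (\<And>Y. Y \<in> PD \<Longrightarrow> D Y = E Y) \<Longrightarrow> D = E"
  unfolding W_carrier by (meson extensionalityI)

lemma W_comm: "comm_group W"
proof (rule group.group_comm_groupI)
  show "group W" unfolding WDiv_def using vsect_group by (intro sum_group)
  show "D \<otimes>\<^bsub>W\<^esub> E = E \<otimes>\<^bsub>W\<^esub> D" for D E unfolding W_mult by (simp add: add.commute)
qed

sublocale W: comm_group W by (rule W_comm)

lemma W_inv: "D \<in> carrier W \<Longrightarrow> inv\<^bsub>W\<^esub> D = (\<lambda>Y\<in>PD. - D Y)"
proof (rule W.inv_equality)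
  assume D: "D \<in> carrier W"
  show "(\<lambda>Y\<in>PD. - D Y) \<otimes>\<^bsub>W\<^esub> D = \<one>\<^bsub>W\<^esub>" unfolding W_mult W_one by (auto simp: fun_eq_iff)
  show "(\<lambda>Y\<in>PD. - D Y) \<in> carrier W" using D unfolding W_carrier by (auto elim!: rev_finite_subset)
qed

abbreviation divf where "divf \<equiv> div_sheaf X \<O> (topspace X)"

lemma divf_eq: "divf f = (\<lambda>Y\<in>PD. \<nu> Y f)"
  using PD_topspace by (auto simp: divisor_map_def sheaf_valuation_def fun_eq_iff)

lemma divf_closed: "f \<in> carrier FF \<Longrightarrow> f \<noteq> \<zero>\<^bsub>FF\<^esub> \<Longrightarrow> divf f \<in> carrier W"
  unfolding W_carrier divf_eq using \<nu>_finite[of f] by (auto elim!: rev_finite_subset)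

lemma divf_hom: "divf \<in> hom (mult_of FF) W"
proof (rule homI)
  show "divf f \<in> carrier W" if "f \<in> carrier (mult_of FF)" for f using divf_closed that by simp
  fix f g assume fg: "f \<in> carrier (mult_of FF)" "g \<in> carrier (mult_of FF)"
  have "\<nu> Y (f \<otimes>\<^bsub>FF\<^esub> g) = \<nu> Y f + \<nu> Y g" if "Y \<in> PD" for Y
    using discretely_valued_field.val_mult[OF \<nu>_field[OF that]] fg by simp
  then show "divf (f \<otimes>\<^bsub>mult_of FF\<^esub> g) = divf f \<otimes>\<^bsub>W\<^esub> divf g" unfolding W_mult divf_eq by (auto simp: fun_eq_iff)
qed

abbreviation P where "P \<equiv> principal_divisors X \<O> (topspace X)"

lemma rational_sect: "sect (rational_sheaf X \<O>) = const_sect FF" "restr (rational_sheaf X \<O>) = const_restr FF"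
  by (simp_all add: rational_sheaf_def)

lemma P_eq: "P = divf ` (carrier FF - {\<zero>\<^bsub>FF\<^esub>})"
  using topspace_nonempty by (simp add: principal_divisors_def rational_sect const_sect_def)

lemma P_subgroup: "subgroup P W"
proof -
  interpret h: group_hom "mult_of FF" W divf
    using divf_hom FF.field_mult_group W.is_group by (simp add: group_hom_def group_hom_axioms_def)
  show ?thesis unfolding P_eq using h.img_is_subgroup by simp
qed

lemma P_normal: "P \<lhd> W"
  using P_subgroup W.subgroup_imp_normal by blast

abbreviation Clg where "Clg \<equiv> Cl X \<O> (topspace X)"
abbreviation cls where "cls \<equiv> divisor_class X \<O> (topspace X)"

lemma Cl_eq: "Clg = W Mod P"
  by (simp add: Cl_def)

lemma cls_eq: "cls D = P #>\<^bsub>W\<^esub> D"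
  by (simp add: divisor_class_def)

lemma cls_hom: "cls \<in> hom W Clg"
proof -
  have "(\<lambda>D. P #>\<^bsub>W\<^esub> D) \<in> hom W (W Mod P)" by (rule normal.r_coset_hom_Mod[OF P_normal])
  moreover have "cls = (\<lambda>D. P #>\<^bsub>W\<^esub> D)" by (rule ext) (rule cls_eq)
  ultimately show ?thesis by (simp add: Cl_eq)
qed

lemma Cl_carrier: "carrier Clg = cls ` carrier W"
  unfolding Cl_eq by (auto simp: FactGroup_def RCOSETS_def cls_eq)

lemma Cl_group: "group Clg"
  unfolding Cl_eq by (rule normal.factorgroup_is_group[OF P_normal])

lemma Cl_comm: "comm_group Clg"
proof (rule group.group_comm_groupI[OF Cl_group])
  fix a b assume "a \<in> carrier Clg" "b \<in> carrier Clg"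
  then obtain D E where DE: "D \<in> carrier W" "E \<in> carrier W" "a = cls D" "b = cls E" unfolding Cl_carrier by auto
  have "cls D \<otimes>\<^bsub>Clg\<^esub> cls E = cls (D \<otimes>\<^bsub>W\<^esub> E)" "cls E \<otimes>\<^bsub>Clg\<^esub> cls D = cls (E \<otimes>\<^bsub>W\<^esub> D)"
    using hom_mult[OF cls_hom] DE by auto
  then show "a \<otimes>\<^bsub>Clg\<^esub> b = b \<otimes>\<^bsub>Clg\<^esub> a" using DE W.m_comm by simp
qed

lemma cls_cong:
  assumes D: "D \<in> carrier W" and E: "E \<in> carrier W"
  shows "cls D = cls E \<longleftrightarrow> (\<exists>f\<in>carrier FF - {\<zero>\<^bsub>FF\<^esub>}. \<forall>Y\<in>PD. D Y = \<nu> Y f + E Y)"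
proof
  assume "cls D = cls E"
  then have "D \<in> P #>\<^bsub>W\<^esub> E" using W.rcos_self[OF D P_subgroup] by (simp add: cls_eq)
  then obtain f where f: "f \<in> carrier FF - {\<zero>\<^bsub>FF\<^esub>}" "D = divf f \<otimes>\<^bsub>W\<^esub> E" unfolding r_coset_def P_eq by auto
  then show "\<exists>f\<in>carrier FF - {\<zero>\<^bsub>FF\<^esub>}. \<forall>Y\<in>PD. D Y = \<nu> Y f + E Y" by (intro bexI[of _ f]) (auto simp: W_mult divf_eq)
next
  assume "\<exists>f\<in>carrier FF - {\<zero>\<^bsub>FF\<^esub>}. \<forall>Y\<in>PD. D Y = \<nu> Y f + E Y"
  then obtain f where f: "f \<in> carrier FF - {\<zero>\<^bsub>FF\<^esub>}" "\<forall>Y\<in>PD. D Y = \<nu> Y f + E Y" by blast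
  have "divf f \<otimes>\<^bsub>W\<^esub> E \<in> carrier W" using f(1) E divf_closed[of f] by simp
  then have "D = divf f \<otimes>\<^bsub>W\<^esub> E" by (rule W_eqI[OF D]) (use f(2) in \<open>simp add: W_mult divf_eq\<close>)
  then have "D \<in> P #>\<^bsub>W\<^esub> E" using f unfolding r_coset_def P_eq by auto
  then show "cls D = cls E" unfolding cls_eq using W.repr_independence[OF _ E P_subgroup] by simp
qed

text \<open>For non-empty U these are the sections over U of the sheaf belonging to D, with D kept
  as a divisor on X: entries at Y outside U are not tested. This avoids restricting
  divisors.\<close>

definition DS where "DS D U = {f \<in> carrier FF. f = \<zero>\<^bsub>FF\<^esub> \<or> (\<forall>Y\<in>PD \<inter> U. 0 \<le> \<nu> Y f + D Y)}"

lemma divisor_sections_eq: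
  assumes "U \<noteq> {}"
  shows "divisor_sections X \<O> D U = DS D U"
proof -
  have 1: "sect (rational_sheaf X \<O>) U = FF" using assms by (simp add: rational_sect const_sect_def)
  have "(div_sheaf X \<O> U f \<otimes>\<^bsub>WDiv X U\<^esub> WDiv_restr X (topspace X) U D) Y = (if Y \<in> U then \<nu> Y f + D Y else 0)" if "Y \<in> PD" for Y f
    using that unfolding WDiv_def mult_sum_group
    by (simp add: divisor_map_def sheaf_valuation_def WDiv_restr_def vrestr_skyscraper vsect_skyscraper singleton_group_def)
  then show ?thesis unfolding divisor_sections_def DS_def 1 by auto
qed

lemma DS_zero: "\<zero>\<^bsub>FF\<^esub> \<in> DS D U"
  by (simp add: DS_def)

lemma DS_mono: "V \<subseteq> U \<Longrightarrow> DS D U \<subseteq> DS D V"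
  by (auto simp: DS_def)

end

section \<open>Transport of a grading along an isomorphism of grading groups\<close>

lemma graded_ring_iso:
  assumes A: "graded_ring K A G" and L: "comm_group L" and \<psi>: "\<psi> \<in> iso K L"
  shows "graded_ring L A (\<lambda>c. G (inv_into (carrier K) \<psi> c))"
proof -
  interpret A: graded K A G by (rule gradedI[OF A])
  interpret L: comm_group L by fact
  define \<phi> where "\<phi> = inv_into (carrier K) \<psi>"
  have \<phi>: "\<phi> \<in> iso L K" unfolding \<phi>_def by (rule A.K.iso_set_sym[OF \<psi>])
  have \<phi>c: "\<phi> c \<in> carrier K" if "c \<in> carrier L" for c using \<phi> that by (auto simp: iso_def hom_def)
  have bij: "bij_betw \<psi> (carrier K) (carrier L)" using \<psi> by (simp add: iso_def)
  have \<phi>\<psi>: "\<phi> (\<psi> w) = w" if "w \<in> carrier K" for w using bij that by (simp add: \<phi>_def bij_betw_def)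
  have \<psi>\<phi>: "\<psi> (\<phi> c) = c" if "c \<in> carrier L" for c using bij that by (simp add: \<phi>_def bij_betw_def f_inv_into_f)
  have inj: "inj_on \<phi> (carrier L)" by (metis \<psi>\<phi> inj_on_inverseI)
  have "graded_ring L A (\<lambda>c. G (\<phi> c))"
  proof (rule graded_ringI[OF L A.A.is_cring])
    show "additive_subgroup (G (\<phi> c)) A" if "c \<in> carrier L" for c using A.G_subgroup \<phi>c that by blast
    show "a \<otimes>\<^bsub>A\<^esub> b \<in> G (\<phi> (v \<otimes>\<^bsub>L\<^esub> w))" if "v \<in> carrier L" "w \<in> carrier L" "a \<in> G (\<phi> v)" "b \<in> G (\<phi> w)" for v w a b
      using A.G_mult[OF \<phi>c \<phi>c that(3,4)] that \<phi> hom_mult[of \<phi> L K v w] by (simp add: iso_def)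
    fix a assume a: "a \<in> carrier A"
    have im: "\<psi> ` A.supp a \<subseteq> carrier L" using bij by (auto simp: bij_betw_def)
    have "a = finsum A (\<lambda>w. A.comp a (\<phi> (\<psi> w))) (A.supp a)"
    proof -
      have "finsum A (\<lambda>w. A.comp a (\<phi> (\<psi> w))) (A.supp a) = finsum A (A.comp a) (A.supp a)"
        by (rule A.A.finsum_cong') (use \<phi>\<psi> A.comp_closed[OF a] in auto)
      then show ?thesis using A.comp_sum[OF a] by simp
    qed
    also have "\<dots> = finsum A (\<lambda>c. A.comp a (\<phi> c)) (\<psi> ` A.supp a)"
      by (rule A.A.finsum_reindex[symmetric]) (use \<phi>\<psi> A.comp_closed[OF a] bij in \<open>auto simp: bij_betw_def intro: inj_on_subset\<close>)
    finally show "\<exists>I c. finite I \<and> I \<subseteq> carrier L \<and> (\<forall>w\<in>I. c w \<in> G (\<phi> w)) \<and> a = finsum A c I"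
      using A.supp_finite[OF a] im A.comp_in[OF a] \<phi>c
      by (intro exI[of _ "\<psi> ` A.supp a"] exI[of _ "\<lambda>c. A.comp a (\<phi> c)"]) (auto simp: \<phi>\<psi>)
  next
    fix I c assume I: "finite I" "I \<subseteq> carrier L" and c: "\<And>w. w \<in> I \<Longrightarrow> c w \<in> G (\<phi> w)" and z: "finsum A c I = \<zero>\<^bsub>A\<^esub>"
    have cA: "c w \<in> carrier A" if "w \<in> I" for w using c[OF that] I that \<phi>c A.G_carrier by blast
    have "finsum A c I = finsum A (\<lambda>w. (c \<circ> \<psi>) (\<phi> w)) I"
      by (rule A.A.finsum_cong') (use \<psi>\<phi> I cA in auto)
    also have "\<dots> = finsum A (c \<circ> \<psi>) (\<phi> ` I)"
      by (rule A.A.finsum_reindex[symmetric]) (use \<psi>\<phi> I cA inj in \<open>auto intro: inj_on_subset\<close>)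
    finally have z': "finsum A (c \<circ> \<psi>) (\<phi> ` I) = \<zero>\<^bsub>A\<^esub>" using z by simp
    show "\<forall>w\<in>I. c w = \<zero>\<^bsub>A\<^esub>"
    proof
      fix w assume w: "w \<in> I"
      have "A.comp (finsum A (c \<circ> \<psi>) (\<phi> ` I)) (\<phi> w) = (if \<phi> w \<in> \<phi> ` I then (c \<circ> \<psi>) (\<phi> w) else \<zero>\<^bsub>A\<^esub>)"
        by (rule A.comp_finsum) (use I c \<psi>\<phi> \<phi>c w in auto)
      then show "c w = \<zero>\<^bsub>A\<^esub>" using w I \<psi>\<phi> \<phi>c z' by auto
    qed
  qed
  then show ?thesis by (simp add: \<phi>_def)
qed

lemma regrade_graded_sheaf:
  assumes F: "graded_sheaf_on X K F" and L: "comm_group L" and \<psi>: "\<psi> \<in> iso K L"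
  shows "graded_sheaf_on X L (regrade K \<psi> F)"
proof -
  have s: "sect (regrade K \<psi> F) = sect F" "restr (regrade K \<psi> F) = restr F" by (simp_all add: regrade_def)
  have "inv_into (carrier K) \<psi> c \<in> carrier K" if "c \<in> carrier L" for c
    using \<psi> that by (auto simp: iso_def bij_betw_def inv_into_into)
  moreover have "ring_presheaf_on X (regrade K \<psi> F) = ring_presheaf_on X F" "ring_sheaf_on X (regrade K \<psi> F) = ring_sheaf_on X F"
    by (simp_all add: ring_presheaf_on_def ring_sheaf_on_def s)
  moreover have "graded_ring L (sect F U) (\<lambda>c. hcomp F U (inv_into (carrier K) \<psi> c))" if "openin X U" for U
    using graded_ring_iso[OF _ L \<psi>, of "sect F U" "hcomp F U"] F that unfolding graded_sheaf_on_def graded_presheaf_on_def by blast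
  moreover have "hcomp (regrade K \<psi> F) U = (\<lambda>c. hcomp F U (inv_into (carrier K) \<psi> c))" for U by (simp add: regrade_def)
  ultimately show ?thesis
    using F unfolding graded_sheaf_on_def graded_presheaf_on_def s by simp
qed

section \<open>Homogeneous sections described by valuations\<close>

context graded_on_krull
begin

lemma comp_germ:
  assumes U: "openin X U" "U \<noteq> {}" and s: "s \<in> carrier (sect R U)" and v: "v \<in> carrier K"
  shows "Q.comp (gr U s) v = gr U (graded.comp K (sect R U) (hcomp R U) s v)"
proof -
  interpret U: graded K "sect R U" "hcomp R U" using R_comp[OF U(1)] .
  have n: "rp.nbhd U" using U rp_nbhd_iff by blast
  define I where "I = insert v (U.supp s)"
  have I: "finite I" "I \<subseteq> carrier K" using U.supp_finite[OF s] v by (auto simp: I_def)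
  have "s = finsum (sect R U) (U.comp s) I" by (rule U.comp_sum_superset[OF s I(1) _ I(2)]) (auto simp: I_def)
  then have "gr U s = gr U (finsum (sect R U) (U.comp s) I)" by (rule arg_cong)
  also have "\<dots> = finsum Q (\<lambda>w. gr U (U.comp s w)) I" by (rule rp.germ_finsum[OF n I(1)]) (use I U.comp_closed[OF s] in auto)
  finally have eq: "gr U s = finsum Q (\<lambda>w. gr U (U.comp s w)) I" .
  have "Q.comp (finsum Q (\<lambda>w. gr U (U.comp s w)) I) v = (if v \<in> I then gr U (U.comp s v) else \<zero>\<^bsub>Q\<^esub>)"
    by (rule Q.comp_finsum[OF I]) (use I U.comp_in[OF s] n v in \<open>auto intro: SG_germ\<close>)
  then show ?thesis unfolding eq by (simp add: I_def)
qed

end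

text \<open>This is the common ground of both implications: in one direction \<open>m\<close> is
  read off from the given valuations over X, in the other it is constructed from monomials. Only
  values over X occur, since those over smaller open sets are restrictions of them.\<close>

locale krull_sheaf = graded_simple_krull +
  fixes m
  assumes m_gval: "Y \<in> PD \<Longrightarrow> gval (m Y)"
    and gr_inj: "openin X U \<Longrightarrow> U \<noteq> {} \<Longrightarrow> inj_on (gr U) (carrier (sect R U))"
    and gr_image: "openin X U \<Longrightarrow> U \<noteq> {} \<Longrightarrow> gr U ` carrier (sect R U) =
      {a \<in> carrier Q. \<forall>w\<in>carrier K. \<forall>Y\<in>PD \<inter> U. Q.comp a w = \<zero>\<^bsub>Q\<^esub> \<or> 0 \<le> m Y (Q.comp a w)}"
begin

lemma hom_section:
  assumes U: "openin X U" "U \<noteq> {}" and w: "w \<in> carrier K"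
  shows "gr U ` hcomp R U w = {a \<in> SG w. a = \<zero>\<^bsub>Q\<^esub> \<or> (\<forall>Y\<in>PD \<inter> U. 0 \<le> m Y a)}" (is "?L = ?R")
proof
  interpret U: graded K "sect R U" "hcomp R U" using R_comp[OF U(1)] .
  have n: "rp.nbhd U" using U rp_nbhd_iff by blast
  show "?L \<subseteq> ?R"
  proof
    fix a assume "a \<in> ?L"
    then obtain s where s: "s \<in> hcomp R U w" "a = gr U s" by blast
    have a: "a \<in> SG w" using SG_germ[OF n s(1)] s(2) by simp
    have "a \<in> gr U ` carrier (sect R U)" using s U.G_carrier[OF w] by blast
    then have "Q.comp a w = \<zero>\<^bsub>Q\<^esub> \<or> (\<forall>Y\<in>PD \<inter> U. 0 \<le> m Y (Q.comp a w))" unfolding gr_image[OF U] using w by blast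
    then show "a \<in> ?R" using a Q.comp_hom[OF w a w] by simp
  qed
  show "?R \<subseteq> ?L"
  proof
    fix a assume a: "a \<in> ?R"
    then have aS: "a \<in> SG w" by blast
    have "a \<in> gr U ` carrier (sect R U)" unfolding gr_image[OF U]
    proof (intro CollectI conjI ballI)
      show "a \<in> carrier Q" using Q.G_carrier[OF w aS] .
      fix v Y assume v: "v \<in> carrier K" "Y \<in> PD \<inter> U"
      have "a = \<zero>\<^bsub>Q\<^esub> \<or> 0 \<le> m Y a" using a v(2) by blast
      then show "Q.comp a v = \<zero>\<^bsub>Q\<^esub> \<or> 0 \<le> m Y (Q.comp a v)" using Q.comp_hom[OF w aS v(1)] by simp
    qed
    then obtain s where s: "s \<in> carrier (sect R U)" "a = gr U s" by blast
    \<comment> \<open>The preimage s need not be homogeneous a priori. Its components in other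
      degrees have germ zero, hence vanish by injectivity of \<open>gr U\<close>.\<close>
    have sv: "U.comp s v = \<zero>\<^bsub>sect R U\<^esub>" if v: "v \<in> carrier K" "v \<noteq> w" for v
    proof -
      have "gr U (U.comp s v) = \<zero>\<^bsub>Q\<^esub>" using comp_germ[OF U s(1) v(1)] Q.comp_hom[OF w aS v(1)] s(2) v(2) by simp
      then have "gr U (U.comp s v) = gr U \<zero>\<^bsub>sect R U\<^esub>" using rp.germ_zero[OF n] by simp
      then show ?thesis using gr_inj[OF U] U.comp_closed[OF s(1) v(1)] by (auto dest: inj_onD)
    qed
    have "s = U.comp s w"
    proof (rule U.comp_eqI[OF s(1) U.comp_closed[OF s(1) w]])
      show "U.comp s v = U.comp (U.comp s w) v" if "v \<in> carrier K" for v
        using U.comp_hom[OF w U.comp_in[OF s(1) w] that] sv[OF that] by simp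
    qed
    then have "s \<in> hcomp R U w" using U.comp_in[OF s(1) w] by simp
    then show "a \<in> ?L" using s(2) by blast
  qed
qed

text \<open>A unit and its inverse are both sections over X, so their values are non-negative; they
  add up to zero and hence vanish. Conversely, if all values of a are zero, then a and its inverse
  both satisfy the criterion of \<open>hom_section\<close>.\<close>

lemma unit_section:
  assumes a: "a \<in> H"
  shows "a \<in> gr (topspace X) ` (hsect K R (topspace X) \<inter> Units (sect R (topspace X))) \<longleftrightarrow> (\<forall>Y\<in>PD. m Y a = 0)"
proof -
  let ?T = "topspace X"
  have U: "openin X ?T" "?T \<noteq> {}" using topspace_nonempty by auto
  have n: "rp.nbhd ?T" using U rp_nbhd_iff by blast
  interpret U: graded K "sect R ?T" "hcomp R ?T" using R_comp[OF U(1)] .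
  have gh: "gr ?T \<in> ring_hom (sect R ?T) Q" by (rule rp.germ_hom[OF n])
  have PDT: "PD \<inter> ?T = PD" using PD_topspace by auto
  obtain w where w: "w \<in> carrier K" "a \<in> SG w" "a \<noteq> \<zero>\<^bsub>Q\<^esub>" using a H_iff by blast
  show ?thesis
  proof
    assume "a \<in> gr ?T ` (hsect K R ?T \<inter> Units (sect R ?T))"
    then obtain s where s: "s \<in> hsect K R ?T" "s \<in> Units (sect R ?T)" "a = gr ?T s" by blast
    obtain v where v: "v \<in> carrier K" "s \<in> hcomp R ?T v" using s(1) U.homog_iff by blast
    define s' where "s' = inv\<^bsub>sect R ?T\<^esub> s"
    have s': "s' \<in> hcomp R ?T (inv\<^bsub>K\<^esub> v)" using U.inverse_degree[OF v s(2)] by (simp add: s'_def)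
    have vi: "inv\<^bsub>K\<^esub> v \<in> carrier K" using v by simp
    have ss: "s \<otimes>\<^bsub>sect R ?T\<^esub> s' = \<one>\<^bsub>sect R ?T\<^esub>" using U.A.Units_r_inv[OF s(2)] by (simp add: s'_def)
    have aa: "a \<otimes>\<^bsub>Q\<^esub> gr ?T s' = \<one>\<^bsub>Q\<^esub>"
      using ring_hom_mult[OF gh U.G_carrier[OF v] U.G_carrier[OF vi s']] ss ring_hom_one[OF gh] s(3) by simp
    have a'0: "gr ?T s' \<noteq> \<zero>\<^bsub>Q\<^esub>" using aa one_not_zero H_carrier[OF a] by (metis rp.S.r_null)
    have m1: "0 \<le> m Y a" if "Y \<in> PD" for Y
      using hom_section[OF U v(1)] v(2) s(3) w(3) that unfolding PDT by blast
    have a'S: "gr ?T s' \<in> SG (inv\<^bsub>K\<^esub> v)" using SG_germ[OF n s'] .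
    have m2: "0 \<le> m Y (gr ?T s')" if "Y \<in> PD" for Y
      using hom_section[OF U vi] s' a'0 that unfolding PDT by blast
    show "\<forall>Y\<in>PD. m Y a = 0"
    proof
      fix Y assume Y: "Y \<in> PD"
      have "m Y a + m Y (gr ?T s') = 0"
        using gval_mult[OF m_gval[OF Y] a SG_H[OF vi a'S a'0]] aa gval_one[OF m_gval[OF Y]] by simp
      then show "m Y a = 0" using m1[OF Y] m2[OF Y] by simp
    qed
  next
    assume 0: "\<forall>Y\<in>PD. m Y a = 0"
    have wi: "inv\<^bsub>K\<^esub> w \<in> carrier K" using w by simp
    have ai: "inv\<^bsub>Q\<^esub> a \<in> SG (inv\<^bsub>K\<^esub> w)" using Q.inverse_degree[OF w(1,2) H_unit[OF a]] .
    have "a \<in> gr ?T ` hcomp R ?T w" unfolding hom_section[OF U w(1)] using w 0 by simp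
    then obtain s where s: "s \<in> hcomp R ?T w" "a = gr ?T s" by blast
    have "inv\<^bsub>Q\<^esub> a \<in> gr ?T ` hcomp R ?T (inv\<^bsub>K\<^esub> w)" unfolding hom_section[OF U wi]
      using ai 0 gval_inv[OF m_gval a] by simp
    then obtain s' where s': "s' \<in> hcomp R ?T (inv\<^bsub>K\<^esub> w)" "inv\<^bsub>Q\<^esub> a = gr ?T s'" by blast
    have c: "s \<in> carrier (sect R ?T)" "s' \<in> carrier (sect R ?T)" using U.G_carrier[OF w(1) s(1)] U.G_carrier[OF wi s'(1)] by simp_all
    have "gr ?T (s \<otimes>\<^bsub>sect R ?T\<^esub> s') = gr ?T \<one>\<^bsub>sect R ?T\<^esub>"
      using ring_hom_mult[OF gh c] ring_hom_one[OF gh] s(2) s'(2) rp.S.Units_r_inv[OF H_unit[OF a]] by metis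
    then have "s \<otimes>\<^bsub>sect R ?T\<^esub> s' = \<one>\<^bsub>sect R ?T\<^esub>" using gr_inj[OF U] c by (auto dest: inj_onD)
    then have "s \<in> Units (sect R ?T)" using c U.A.m_comm[OF c] unfolding Units_def by force
    moreover have "s \<noteq> \<zero>\<^bsub>sect R ?T\<^esub>" using rp.germ_zero[OF n] s(2) w(3) by auto
    ultimately show "a \<in> gr ?T ` (hsect K R ?T \<inter> Units (sect R ?T))" using s w(1) U.homog_iff by blast
  qed
qed

end

section \<open>The divisorial algebra\<close>

lemma (in abelian_monoid) finsum_swap:
  assumes I: "finite I" and J: "finite J" and f: "\<And>i j. i \<in> I \<Longrightarrow> j \<in> J \<Longrightarrow> f i j \<in> carrier G"
  shows "finsum G (\<lambda>i. finsum G (f i) J) I = finsum G (\<lambda>j. finsum G (\<lambda>i. f i j) I) J"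
  using I f
proof (induction I rule: finite_induct)
  case empty
  then show ?case by (simp add: finsum_zero)
next
  case (insert i I)
  have c: "finsum G (f k) J \<in> carrier G" if "k \<in> insert i I" for k using insert.prems that by (intro finsum_closed) auto
  have d: "finsum G (\<lambda>i. f i j) I \<in> carrier G" if "j \<in> J" for j using insert.prems that by (intro finsum_closed) auto
  have "finsum G (\<lambda>i. finsum G (f i) J) (insert i I) = finsum G (f i) J \<oplus> finsum G (\<lambda>i. finsum G (f i) J) I"
    by (rule finsum_insert) (use insert.hyps c in auto)
  also have "\<dots> = finsum G (f i) J \<oplus> finsum G (\<lambda>j. finsum G (\<lambda>i. f i j) I) J" using insert by simp
  also have "\<dots> = finsum G (\<lambda>j. f i j \<oplus> finsum G (\<lambda>i. f i j) I) J"
    by (rule finsum_addf[symmetric]) (use insert.prems d in auto)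
  also have "\<dots> = finsum G (\<lambda>j. finsum G (\<lambda>i. f i j) (insert i I)) J"
    by (rule finsum_cong') (use insert d in auto)
  finally show ?case .
qed

context krull_scheme_space
begin

abbreviation DA where "DA \<equiv> divisorial_algebra X \<O> (carrier W)"

lemma W_update: "W\<lparr>carrier := carrier W\<rparr> = W"
  by simp

lemma DA_sect: "sect DA U = (group_algebra (const_sect FF U) W)
    \<lparr>carrier := {p \<in> carrier (group_algebra (const_sect FF U) W). \<forall>D\<in>carrier W. p D \<in> divisor_sections X \<O> D U}\<rparr>"
  by (simp add: divisorial_algebra_def Let_def W_update rational_sect)

text \<open>Over the empty set the constant sheaf is the zero ring, so all coefficients vanish
  there, whereas \<open>DS D {}\<close> would be the entire function field; hence the case
  distinction.\<close>

lemma DA_carrier: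
  "p \<in> carrier (sect DA U) \<longleftrightarrow> p \<in> extensional (carrier W) \<and> finite {D \<in> carrier W. p D \<noteq> \<zero>\<^bsub>FF\<^esub>} \<and>
    (\<forall>D\<in>carrier W. p D \<in> (if U = {} then {\<zero>\<^bsub>FF\<^esub>} else DS D U))"
proof (cases "U = {}")
  case True
  then show ?thesis unfolding DA_sect
    by (auto simp: group_algebra_def const_sect_def divisor_sections_def rational_sect PiE_def Pi_def fun_eq_iff extensional_def)
next
  case False
  then show ?thesis unfolding DA_sect
    by (auto simp: group_algebra_def const_sect_def divisor_sections_eq DS_def PiE_def Pi_def)
qed

lemma DA_hcomp: "p \<in> hcomp DA U D \<longleftrightarrow> p \<in> carrier (sect DA U) \<and> (\<forall>E\<in>carrier W. E \<noteq> D \<longrightarrow> p E = \<zero>\<^bsub>FF\<^esub>)"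
  by (auto simp: divisorial_algebra_def Let_def rational_sect const_sect_def)

lemma DA_add: "p \<oplus>\<^bsub>sect DA U\<^esub> q = (\<lambda>D\<in>carrier W. p D \<oplus>\<^bsub>FF\<^esub> q D)"
  by (auto simp: DA_sect group_algebra_def const_sect_def)

lemma DA_mult: "U \<noteq> {} \<Longrightarrow> p \<otimes>\<^bsub>sect DA U\<^esub> q = (\<lambda>l\<in>carrier W. \<Oplus>\<^bsub>FF\<^esub>D\<in>{D \<in> carrier W. p D \<noteq> \<zero>\<^bsub>FF\<^esub>}. p D \<otimes>\<^bsub>FF\<^esub> q (inv\<^bsub>W\<^esub> D \<otimes>\<^bsub>W\<^esub> l))"
  by (auto simp: DA_sect group_algebra_def const_sect_def)

lemma DA_one: "U \<noteq> {} \<Longrightarrow> \<one>\<^bsub>sect DA U\<^esub> = (\<lambda>D\<in>carrier W. if D = \<one>\<^bsub>W\<^esub> then \<one>\<^bsub>FF\<^esub> else \<zero>\<^bsub>FF\<^esub>)"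
  by (auto simp: DA_sect group_algebra_def const_sect_def)

lemma DA_restr: "restr DA U V p = (\<lambda>D\<in>carrier W. if V = {} then \<zero>\<^bsub>FF\<^esub> else p D)"
  by (simp add: divisorial_algebra_def Let_def rational_sect const_restr_def)

text \<open>\<open>mono f D\<close> is \<open>f \<chi>\<^sup>D\<close>.\<close>

definition mono where "mono f D = (\<lambda>E\<in>carrier W. if E = D then f else \<zero>\<^bsub>FF\<^esub>)"

lemma mono_in: "U \<noteq> {} \<Longrightarrow> D \<in> carrier W \<Longrightarrow> f \<in> DS D U \<Longrightarrow> mono f D \<in> hcomp DA U D"
proof -
  assume U: "U \<noteq> {}" and D: "D \<in> carrier W" and f: "f \<in> DS D U"
  have "{E \<in> carrier W. mono f D E \<noteq> \<zero>\<^bsub>FF\<^esub>} \<subseteq> {D}" by (auto simp: mono_def)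
  then have fin: "finite {E \<in> carrier W. mono f D E \<noteq> \<zero>\<^bsub>FF\<^esub>}" by (rule finite_subset) simp
  have "mono f D E \<in> DS E U" if "E \<in> carrier W" for E using that f DS_zero by (simp add: mono_def)
  then show ?thesis unfolding DA_hcomp DA_carrier using U fin by (simp add: mono_def)
qed

lemma DA_hcomp_mono:
  assumes U: "U \<noteq> {}" and D: "D \<in> carrier W" and p: "p \<in> hcomp DA U D"
  shows "p = mono (p D) D" "p D \<in> DS D U"
proof -
  have e: "p \<in> extensional (carrier W)" and z: "\<And>E. E \<in> carrier W \<Longrightarrow> E \<noteq> D \<Longrightarrow> p E = \<zero>\<^bsub>FF\<^esub>" and "p D \<in> DS D U"
    using p U D unfolding DA_hcomp DA_carrier by auto
  show "p = mono (p D) D"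
    by (rule extensionalityI[OF e, of "mono (p D) D"]) (use z in \<open>auto simp: mono_def\<close>)
  show "p D \<in> DS D U" by fact
qed

end

section \<open>Sheaves satisfying the conditions are Cox sheaves\<close>

text \<open>Condition (iii) is left out, because the identification of the degree zero part with the
  structure sheaf is to follow from (i) and (ii) alone.\<close>

locale cox_conditions = graded_on_krull X \<O> K R
  for X :: "'p topology" and \<O> :: "('p, 'r) ring_presheaf" and K :: "'k monoid" and R :: "('p, 'a, 'k) graded_presheaf" +
  fixes \<theta> \<mu>
  assumes generic: "cox_generic_condition X \<O> K R \<theta>"
    and krull_condition: "cox_krull_condition X \<O> K R \<theta> \<mu>"
begin

lemma generic_simple: "graded_simple K Q SG" and degree_surj: "hdeg K SG ` H = carrier K"
  and \<theta>_iso: "ring_sheaf_iso X (rational_sheaf X \<O>) (degree_zero_part K S) \<theta>"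
proof -
  have t: "openin X (topspace X) \<and> topspace X \<noteq> {}" using topspace_nonempty by simp
  have "(\<forall>U. openin X U \<and> U \<noteq> {} \<longrightarrow> graded_simple K (sect S U) (hcomp S U) \<and> hdeg K (hcomp S U) ` hsect K S U = carrier K) \<and>
      ring_sheaf_iso X (rational_sheaf X \<O>) (degree_zero_part K S) \<theta>"
    using generic unfolding cox_generic_condition_def Let_def .
  then show "graded_simple K Q SG" "hdeg K SG ` H = carrier K" "ring_sheaf_iso X (rational_sheaf X \<O>) (degree_zero_part K S) \<theta>"
    using t S_nonempty[OF topspace_nonempty] by metis+
qed

sublocale graded_simple_krull X \<O> K R
  by unfold_locales (rule generic_simple)

abbreviation m where "m Y \<equiv> \<mu> Y (topspace X)"
abbreviation t where "t \<equiv> \<theta> (topspace X)"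

lemma krull_parts:
  shows "openin X U \<Longrightarrow> inj_on (to_generic X R U) (carrier (sect R U))"
    and krull_sub: "krull_subsheaf X K S PD skyscraper \<mu> (\<lambda>U. to_generic X R U ` carrier (sect R U))"
    and \<mu>_\<theta>: "Y \<in> PD \<Longrightarrow> openin X U \<Longrightarrow> U \<noteq> {} \<Longrightarrow> f \<in> carrier FF \<Longrightarrow> f \<noteq> \<zero>\<^bsub>FF\<^esub> \<Longrightarrow> \<mu> Y U (\<theta> U f) = (if Y \<in> U then \<nu> Y f else 0)"
  using krull_condition unfolding cox_krull_condition_def
  by (auto simp: rational_sect const_sect_def sheaf_valuation_def)

lemma sgv: "Y \<in> PD \<Longrightarrow> sheaf_graded_valuation X K S (skyscraper Y) (\<mu> Y)"
  using krull_sub by (simp add: krull_subsheaf_def)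

sublocale krull_sheaf X \<O> K R "\<lambda>Y. \<mu> Y (topspace X)"
proof
  show "gval (m Y)" if "Y \<in> PD" for Y by (rule sgv_gval[OF sgv[OF that] PD_topspace[OF that]])
  fix U assume U: "openin X U" "U \<noteq> {}"
  show "inj_on (gr U) (carrier (sect R U))" using krull_parts(1)[OF U(1)] by (simp add: to_generic_nonempty[OF U(2)])
  show "gr U ` carrier (sect R U) = {a \<in> carrier Q. \<forall>w\<in>carrier K. \<forall>Y\<in>PD \<inter> U. Q.comp a w = \<zero>\<^bsub>Q\<^esub> \<or> 0 \<le> m Y (Q.comp a w)}"
    using krull_subsheaf_eq[OF krull_sub U] by (simp add: to_generic_nonempty[OF U(2)])
qed

lemma t_iso: "t \<in> ring_iso FF (Q\<lparr>carrier := SG \<one>\<^bsub>K\<^esub>\<rparr>)"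
proof -
  have "t \<in> ring_iso (sect (rational_sheaf X \<O>) (topspace X)) (sect (degree_zero_part K S) (topspace X))"
    using \<theta>_iso unfolding ring_sheaf_iso_def by simp
  then show ?thesis using topspace_nonempty by (simp add: rational_sect const_sect_def degree_zero_part_def S_nonempty)
qed

lemma t_bij: "bij_betw t (carrier FF) (SG \<one>\<^bsub>K\<^esub>)"
  using t_iso by (simp add: ring_iso_def)

lemma t_in: "f \<in> carrier FF \<Longrightarrow> t f \<in> SG \<one>\<^bsub>K\<^esub>"
  using t_bij by (auto simp: bij_betw_def)

lemma t_closed: "f \<in> carrier FF \<Longrightarrow> t f \<in> carrier Q"
  using t_in Q.G_carrier by blast

lemma t_add: "f \<in> carrier FF \<Longrightarrow> g \<in> carrier FF \<Longrightarrow> t (f \<oplus>\<^bsub>FF\<^esub> g) = t f \<oplus>\<^bsub>Q\<^esub> t g"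
  and t_mult: "f \<in> carrier FF \<Longrightarrow> g \<in> carrier FF \<Longrightarrow> t (f \<otimes>\<^bsub>FF\<^esub> g) = t f \<otimes>\<^bsub>Q\<^esub> t g"
  and t_one: "t \<one>\<^bsub>FF\<^esub> = \<one>\<^bsub>Q\<^esub>"
  using t_iso by (auto simp: ring_iso_def ring_hom_def)

lemma t_zero: "t \<zero>\<^bsub>FF\<^esub> = \<zero>\<^bsub>Q\<^esub>"
proof -
  have "t \<zero>\<^bsub>FF\<^esub> \<oplus>\<^bsub>Q\<^esub> t \<zero>\<^bsub>FF\<^esub> = t \<zero>\<^bsub>FF\<^esub>" using t_add[of "\<zero>\<^bsub>FF\<^esub>" "\<zero>\<^bsub>FF\<^esub>"] by simp
  then show ?thesis using t_closed[of "\<zero>\<^bsub>FF\<^esub>"] rp.S.add.l_cancel_one by simp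
qed

lemma t_eq_zero: "f \<in> carrier FF \<Longrightarrow> t f = \<zero>\<^bsub>Q\<^esub> \<longleftrightarrow> f = \<zero>\<^bsub>FF\<^esub>"
  using t_zero t_bij FF.zero_closed unfolding bij_betw_def by (metis inj_onD)

lemma t_H: "f \<in> carrier FF \<Longrightarrow> f \<noteq> \<zero>\<^bsub>FF\<^esub> \<Longrightarrow> t f \<in> H"
  using t_in t_eq_zero SG_H[OF K.one_closed] by blast

lemma t_surj: "a \<in> SG \<one>\<^bsub>K\<^esub> \<Longrightarrow> \<exists>f\<in>carrier FF. t f = a"
  using t_bij unfolding bij_betw_def by (metis imageE)

lemma m_t: "Y \<in> PD \<Longrightarrow> f \<in> carrier FF \<Longrightarrow> f \<noteq> \<zero>\<^bsub>FF\<^esub> \<Longrightarrow> m Y (t f) = \<nu> Y f"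
  using \<mu>_\<theta>[of Y "topspace X" f] topspace_nonempty PD_topspace by simp

text \<open>Both the rational sheaf and the generic sheaf are constant, so compatibility with
  restriction leaves just the map over X.\<close>

lemma \<theta>_t: "openin X U \<Longrightarrow> U \<noteq> {} \<Longrightarrow> f \<in> carrier FF \<Longrightarrow> \<theta> U f = t f"
proof -
  assume U: "openin X U" "U \<noteq> {}" and f: "f \<in> carrier FF"
  have "\<theta> U (restr (rational_sheaf X \<O>) (topspace X) U f) = restr (degree_zero_part K S) (topspace X) U (t f)"
    using \<theta>_iso U openin_subset[OF U(1)] f topspace_nonempty unfolding ring_sheaf_iso_def by (simp add: rational_sect const_sect_def)
  then show ?thesis using U by (simp add: rational_sect const_restr_def degree_zero_part_def S_restr)
qed

text \<open>Over a non-empty U both sides are the images of the rational functions with non-negative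
  values along the prime divisors in U: on the left by \<open>hom_section\<close>, since the given
  valuations restrict to the essential ones, on the right by \<open>sections_eq\<close>.\<close>

lemma degree_zero: "degree_zero_is_structure_sheaf X \<O> K R \<theta>"
  unfolding degree_zero_is_structure_sheaf_def
proof (intro allI impI)
  fix U assume U: "openin X U"
  have c: "carrier (sect (degree_zero_part K R) U) = hcomp R U \<one>\<^bsub>K\<^esub>" by (simp add: degree_zero_part_def)
  show "to_generic X R U ` carrier (sect (degree_zero_part K R) U) = \<theta> U ` to_generic X \<O> U ` carrier (sect \<O> U)"
  proof (cases "U = {}")
    case True
    interpret U: graded K "sect R U" "hcomp R U" using R_comp[OF U] .
    interpret O: cring "sect \<O> U" using pres.sect_cring[OF U] .
    have "\<theta> {} \<in> ring_iso (sect (rational_sheaf X \<O>) {}) (sect (degree_zero_part K S) {})"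
      using \<theta>_iso unfolding ring_sheaf_iso_def by simp
    then have "\<theta> {} \<zero>\<^bsub>FF\<^esub> = \<zero>\<^bsub>Q\<^esub>"
      by (auto simp: ring_iso_def ring_hom_def rational_sect const_sect_def degree_zero_part_def S_hcomp)
    moreover have "to_generic X \<O> U s = \<zero>\<^bsub>FF\<^esub>" "to_generic X R U s' = \<zero>\<^bsub>Q\<^esub>" for s s'
      using True by (simp_all add: to_generic_def FF_def \<xi>_def)
    moreover have "hcomp R U \<one>\<^bsub>K\<^esub> \<noteq> {}" "carrier (sect \<O> U) \<noteq> {}" using U.G_zero[OF K.one_closed] O.one_closed by blast+
    ultimately show ?thesis unfolding c True[symmetric] by (simp add: image_constant_conv image_image True)
  next
    case False
    have g: "to_generic X \<O> U = gm U" using False by (auto simp: to_generic_def \<xi>_def fun_eq_iff)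
    have "gr U ` hcomp R U \<one>\<^bsub>K\<^esub> = t ` {f \<in> carrier FF. f = \<zero>\<^bsub>FF\<^esub> \<or> (\<forall>Y\<in>PD \<inter> U. 0 \<le> \<nu> Y f)}"
      unfolding hom_section[OF U False K.one_closed]
    proof (intro equalityI subsetI)
      fix a assume a: "a \<in> {a \<in> SG \<one>\<^bsub>K\<^esub>. a = \<zero>\<^bsub>Q\<^esub> \<or> (\<forall>Y\<in>PD \<inter> U. 0 \<le> m Y a)}"
      then obtain f where f: "f \<in> carrier FF" "t f = a" using t_surj by blast
      have "f = \<zero>\<^bsub>FF\<^esub> \<or> (\<forall>Y\<in>PD \<inter> U. 0 \<le> \<nu> Y f)"
      proof (cases "f = \<zero>\<^bsub>FF\<^esub>")
        case False
        have "\<forall>Y\<in>PD \<inter> U. 0 \<le> m Y (t f)" using a f(2) t_eq_zero[OF f(1)] False by blast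
        then show ?thesis using m_t[OF _ f(1) False] by simp
      qed simp
      then show "a \<in> t ` {f \<in> carrier FF. f = \<zero>\<^bsub>FF\<^esub> \<or> (\<forall>Y\<in>PD \<inter> U. 0 \<le> \<nu> Y f)}" using f by blast
    next
      fix a assume "a \<in> t ` {f \<in> carrier FF. f = \<zero>\<^bsub>FF\<^esub> \<or> (\<forall>Y\<in>PD \<inter> U. 0 \<le> \<nu> Y f)}"
      then obtain f where f: "f \<in> carrier FF" "a = t f" "f = \<zero>\<^bsub>FF\<^esub> \<or> (\<forall>Y\<in>PD \<inter> U. 0 \<le> \<nu> Y f)" by blast
      have "a = \<zero>\<^bsub>Q\<^esub> \<or> (\<forall>Y\<in>PD \<inter> U. 0 \<le> m Y a)"
      proof (cases "f = \<zero>\<^bsub>FF\<^esub>")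
        case False
        then show ?thesis using f m_t[OF _ f(1) False] by simp
      qed (simp add: f(2) t_zero)
      then show "a \<in> {a \<in> SG \<one>\<^bsub>K\<^esub>. a = \<zero>\<^bsub>Q\<^esub> \<or> (\<forall>Y\<in>PD \<inter> U. 0 \<le> m Y a)}" using t_in[OF f(1)] f(2) by simp
    qed
    moreover have "\<theta> U ` gm U ` carrier (sect \<O> U) = t ` {f \<in> carrier FF. f = \<zero>\<^bsub>FF\<^esub> \<or> (\<forall>Y\<in>PD \<inter> U. 0 \<le> \<nu> Y f)}"
      unfolding sections_eq[OF U False] by (rule image_cong[OF refl]) (use \<theta>_t[OF U False] in auto)
    ultimately show ?thesis unfolding c g to_generic_nonempty[OF False] by simp
  qed
qed

end

locale cox_divisor_conditions = cox_conditions +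
  assumes divisor: "cox_divisor_condition X K R \<mu>"
begin

abbreviation dv where "dv \<equiv> divisor_map X \<mu> (topspace X)"

lemma dv_image: "dv ` H = carrier W"
proof -
  have "divisor_map X \<mu> (topspace X) ` hsect K S (topspace X) = carrier W"
    using divisor topspace_nonempty unfolding cox_divisor_condition_def Let_def by simp
  then show ?thesis by (simp add: hsect_S[OF topspace_nonempty])
qed

lemma dv_at: "Y \<in> PD \<Longrightarrow> dv a Y = m Y a"
  by (simp add: divisor_map_def)

lemma dv_closed: "a \<in> H \<Longrightarrow> dv a \<in> carrier W"
  using dv_image by blast

text \<open>By \<open>unit_section\<close> such an element comes from a homogeneous unit of R(X),
  and (iii) says that these have degree zero.\<close>

lemma dv_kernel:
  assumes a: "a \<in> H" "\<And>Y. Y \<in> PD \<Longrightarrow> m Y a = 0"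
  shows "a \<in> SG \<one>\<^bsub>K\<^esub>"
proof -
  let ?T = "topspace X"
  have T: "openin X ?T" "?T \<noteq> {}" using topspace_nonempty by auto
  have e: "hsect K R ?T \<inter> Units (sect R ?T) = Units (sect (degree_zero_part K R) ?T)"
    using divisor unfolding cox_divisor_condition_def Let_def by blast
  have "a \<in> gr ?T ` (hsect K R ?T \<inter> Units (sect R ?T))" using unit_section[OF a(1)] a(2) by blast
  then obtain s where "s \<in> Units (sect (degree_zero_part K R) ?T)" "a = gr ?T s" unfolding e by blast
  then have "s \<in> hcomp R ?T \<one>\<^bsub>K\<^esub>" "a = gr ?T s" by (auto simp: Units_def degree_zero_part_def)
  then show ?thesis using SG_germ[of ?T s] T rp_nbhd_iff by blast
qed

text \<open>The quotient of a by b has degree zero, and (i) identifies the elements of degree zero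
  with the rational functions.\<close>

lemma same_degree:
  assumes w: "w \<in> carrier K" and a: "a \<in> SG w" "a \<noteq> \<zero>\<^bsub>Q\<^esub>" and b: "b \<in> SG w" "b \<noteq> \<zero>\<^bsub>Q\<^esub>"
  shows "\<exists>f\<in>carrier FF - {\<zero>\<^bsub>FF\<^esub>}. a = t f \<otimes>\<^bsub>Q\<^esub> b"
proof -
  have aH: "a \<in> H" "b \<in> H" using SG_H w a b by auto
  have "inv\<^bsub>Q\<^esub> b \<in> SG (inv\<^bsub>K\<^esub> w)" using Q.inverse_degree[OF w b(1) H_unit[OF aH(2)]] .
  then have "a \<otimes>\<^bsub>Q\<^esub> inv\<^bsub>Q\<^esub> b \<in> SG \<one>\<^bsub>K\<^esub>" using Q.G_mult[OF w K.inv_closed[OF w] a(1), of "inv\<^bsub>Q\<^esub> b"] K.r_inv[OF w] by simp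
  then obtain f where f: "f \<in> carrier FF" "t f = a \<otimes>\<^bsub>Q\<^esub> inv\<^bsub>Q\<^esub> b" using t_surj by blast
  have bi: "inv\<^bsub>Q\<^esub> b \<in> carrier Q" using H_carrier[OF H_inv[OF aH(2)]] .
  have "t f \<otimes>\<^bsub>Q\<^esub> b = a"
    unfolding f(2) using rp.S.m_assoc[OF H_carrier[OF aH(1)] bi H_carrier[OF aH(2)]] rp.S.Units_l_inv[OF H_unit[OF aH(2)]] H_carrier[OF aH(1)] by simp
  moreover have "f \<noteq> \<zero>\<^bsub>FF\<^esub>"
    using H_mult[OF aH(1) H_inv[OF aH(2)]] f(2) t_zero H_iff by metis
  ultimately show ?thesis using f(1) by blast
qed

text \<open>Some non-zero element of degree w is chosen; \<open>\<psi>_eq\<close> shows that its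
  divisor class depends only on w, as elements of the same degree differ by a rational
  function.\<close>

definition \<psi> where "\<psi> w = cls (dv (SOME a. a \<in> SG w \<and> a \<noteq> \<zero>\<^bsub>Q\<^esub>))"

lemma \<psi>_eq:
  assumes w: "w \<in> carrier K" and a: "a \<in> SG w" "a \<noteq> \<zero>\<^bsub>Q\<^esub>"
  shows "\<psi> w = cls (dv a)"
proof -
  define b where "b = (SOME a. a \<in> SG w \<and> a \<noteq> \<zero>\<^bsub>Q\<^esub>)"
  have b: "b \<in> SG w" "b \<noteq> \<zero>\<^bsub>Q\<^esub>" using someI[of "\<lambda>a. a \<in> SG w \<and> a \<noteq> \<zero>\<^bsub>Q\<^esub>" a] a by (auto simp only: b_def)
  have H: "a \<in> H" "b \<in> H" using SG_H w a b by auto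
  obtain f where f: "f \<in> carrier FF - {\<zero>\<^bsub>FF\<^esub>}" "b = t f \<otimes>\<^bsub>Q\<^esub> a" using same_degree[OF w b a] by blast
  have "dv b Y = \<nu> Y f + dv a Y" if "Y \<in> PD" for Y
    using gval_mult[OF m_gval[OF that] t_H[of f] H(1)] m_t[OF that, of f] f that by (simp add: dv_at)
  then have "cls (dv b) = cls (dv a)" using cls_cong[OF dv_closed[OF H(2)] dv_closed[OF H(1)]] f(1) by blast
  then show ?thesis by (simp add: \<psi>_def b_def)
qed

lemma degree_inhabited: "w \<in> carrier K \<Longrightarrow> \<exists>a. a \<in> SG w \<and> a \<noteq> \<zero>\<^bsub>Q\<^esub>"
proof -
  assume "w \<in> carrier K"
  then obtain a where a: "a \<in> H" "w = hdeg K SG a" using degree_surj by (metis imageE)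
  then obtain v where v: "v \<in> carrier K" "a \<in> SG v" "a \<noteq> \<zero>\<^bsub>Q\<^esub>" using H_iff by blast
  then show ?thesis using Q.hdeg_eq[OF v] a by blast
qed

lemma dv_mult: "a \<in> H \<Longrightarrow> b \<in> H \<Longrightarrow> dv (a \<otimes>\<^bsub>Q\<^esub> b) = dv a \<otimes>\<^bsub>W\<^esub> dv b"
  unfolding W_mult divisor_map_def by (rule restrict_ext) (simp add: gval_mult[OF m_gval])

lemma \<psi>_iso: "\<psi> \<in> iso K Clg"
proof (rule isoI)
  show "\<psi> \<in> hom K Clg"
  proof (rule homI)
    fix w assume w: "w \<in> carrier K"
    obtain a where a: "a \<in> SG w" "a \<noteq> \<zero>\<^bsub>Q\<^esub>" using degree_inhabited[OF w] by blast
    show "\<psi> w \<in> carrier Clg" using \<psi>_eq[OF w a] dv_closed[OF SG_H[OF w a]] by (simp add: Cl_carrier)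
    fix v assume v: "v \<in> carrier K"
    obtain b where b: "b \<in> SG v" "b \<noteq> \<zero>\<^bsub>Q\<^esub>" using degree_inhabited[OF v] by blast
    have H: "a \<in> H" "b \<in> H" using SG_H[OF w a] SG_H[OF v b] by auto
    have ab: "a \<otimes>\<^bsub>Q\<^esub> b \<in> SG (w \<otimes>\<^bsub>K\<^esub> v)" "a \<otimes>\<^bsub>Q\<^esub> b \<noteq> \<zero>\<^bsub>Q\<^esub>" using Q.G_mult[OF w v a(1) b(1)] H_mult[OF H] H_iff by blast+
    show "\<psi> (w \<otimes>\<^bsub>K\<^esub> v) = \<psi> w \<otimes>\<^bsub>Clg\<^esub> \<psi> v"
      using \<psi>_eq[OF _ ab] \<psi>_eq[OF w a] \<psi>_eq[OF v b] w v dv_mult[OF H] hom_mult[OF cls_hom dv_closed[OF H(1)] dv_closed[OF H(2)]] by simp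
  qed
  show "bij_betw \<psi> (carrier K) (carrier Clg)"
  proof (rule bij_betwI')
    fix w v assume w: "w \<in> carrier K" and v: "v \<in> carrier K"
    obtain a where a: "a \<in> SG w" "a \<noteq> \<zero>\<^bsub>Q\<^esub>" using degree_inhabited[OF w] by blast
    obtain b where b: "b \<in> SG v" "b \<noteq> \<zero>\<^bsub>Q\<^esub>" using degree_inhabited[OF v] by blast
    have H: "a \<in> H" "b \<in> H" using SG_H[OF w a] SG_H[OF v b] by auto
    show "\<psi> w = \<psi> v \<longleftrightarrow> w = v"
    proof
      assume "\<psi> w = \<psi> v"
      then have "cls (dv a) = cls (dv b)" using \<psi>_eq[OF w a] \<psi>_eq[OF v b] by simp
      then obtain f where f: "f \<in> carrier FF - {\<zero>\<^bsub>FF\<^esub>}" "\<forall>Y\<in>PD. dv a Y = \<nu> Y f + dv b Y"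
        using cls_cong[OF dv_closed[OF H(1)] dv_closed[OF H(2)]] by blast
      have tf: "t f \<in> H" "t f \<in> SG \<one>\<^bsub>K\<^esub>" "t f \<noteq> \<zero>\<^bsub>Q\<^esub>" using t_H t_in t_eq_zero f by auto
      \<comment> \<open>Now a and d have the same divisor. Their quotient c has divisor zero, so its
        degree is trivial by \<open>dv_kernel\<close>, while by construction it is the quotient of w
        by v.\<close>
      define d where "d = t f \<otimes>\<^bsub>Q\<^esub> b"
      have dH: "d \<in> H" using H_mult[OF tf(1) H(2)] by (simp add: d_def)
      have dS: "d \<in> SG v" using Q.G_mult[OF K.one_closed v tf(2) b(1)] v by (simp add: d_def)
      define c where "c = a \<otimes>\<^bsub>Q\<^esub> inv\<^bsub>Q\<^esub> d"
      have cH: "c \<in> H" using H_mult[OF H(1) H_inv[OF dH]] by (simp add: c_def)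
      have "m Y c = 0" if Y: "Y \<in> PD" for Y
      proof -
        have "m Y c = m Y a - m Y d" using gval_mult[OF m_gval[OF Y] H(1) H_inv[OF dH]] gval_inv[OF m_gval[OF Y] dH] by (simp add: c_def)
        also have "m Y d = \<nu> Y f + m Y b" using gval_mult[OF m_gval[OF Y] tf(1) H(2)] m_t[OF Y, of f] f(1) by (simp add: d_def)
        finally show ?thesis using f(2) Y by (simp add: dv_at)
      qed
      then have "c \<in> SG \<one>\<^bsub>K\<^esub>" by (rule dv_kernel[OF cH])
      moreover have "c \<in> SG (w \<otimes>\<^bsub>K\<^esub> inv\<^bsub>K\<^esub> v)" using Q.G_mult[OF w _ a(1) Q.inverse_degree[OF v dS H_unit[OF dH]]] v by (simp add: c_def)
      ultimately have "w \<otimes>\<^bsub>K\<^esub> inv\<^bsub>K\<^esub> v = \<one>\<^bsub>K\<^esub>" using Q.degree_unique[of "w \<otimes>\<^bsub>K\<^esub> inv\<^bsub>K\<^esub> v" "\<one>\<^bsub>K\<^esub>" c] w v cH H_iff by simp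
      then show "w = v" using w v K.inv_equality[of w "inv\<^bsub>K\<^esub> v"] by simp
    qed simp
  next
    fix w assume w: "w \<in> carrier K"
    obtain a where a: "a \<in> SG w" "a \<noteq> \<zero>\<^bsub>Q\<^esub>" using degree_inhabited[OF w] by blast
    show "\<psi> w \<in> carrier Clg" using \<psi>_eq[OF w a] dv_closed[OF SG_H[OF w a]] by (simp add: Cl_carrier)
  next
    fix c assume "c \<in> carrier Clg"
    then obtain D where D: "D \<in> carrier W" "c = cls D" unfolding Cl_carrier by blast
    obtain a where a: "a \<in> H" "dv a = D" using D(1) dv_image by (metis imageE)
    then obtain w where w: "w \<in> carrier K" "a \<in> SG w" "a \<noteq> \<zero>\<^bsub>Q\<^esub>" using H_iff by blast
    show "\<exists>w\<in>carrier K. c = \<psi> w" using \<psi>_eq[OF w] a D w(1) by (intro bexI[of _ w]) auto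
  qed
qed

end

section \<open>The homomorphism from the divisorial algebra to the sheaf\<close>

context cox_divisor_conditions
begin

sublocale HM: comm_group "homog_monoid K Q SG" by (rule H_monoid)

abbreviation HM where "HM \<equiv> homog_monoid K Q SG"

lemma HM_simps: "carrier HM = H" "mult HM = mult Q" "\<one>\<^bsub>HM\<^esub> = \<one>\<^bsub>Q\<^esub>"
  by (simp_all add: homog_monoid_def)

definition \<tau> where "\<tau> Y = (SOME a. a \<in> H \<and> dv a = (\<lambda>Y'\<in>PD. if Y' = Y then 1 else 0))"

lemma \<tau>: assumes Y: "Y \<in> PD" shows "\<tau> Y \<in> H" "Y' \<in> PD \<Longrightarrow> m Y' (\<tau> Y) = (if Y' = Y then 1 else 0)"
proof -
  define d where "d = (\<lambda>Y'\<in>PD. if Y' = Y then 1 else 0 :: int)"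
  have "{Y' \<in> PD. d Y' \<noteq> 0} \<subseteq> {Y}" by (auto simp: d_def)
  then have "d \<in> carrier W" unfolding W_carrier using finite_subset by (auto simp: d_def)
  then have "d \<in> dv ` H" using dv_image by simp
  then have "\<exists>a. a \<in> H \<and> dv a = d" by (metis imageE)
  then have "\<tau> Y \<in> H \<and> dv (\<tau> Y) = d" unfolding \<tau>_def d_def by (rule someI_ex)
  then show "\<tau> Y \<in> H" "Y' \<in> PD \<Longrightarrow> m Y' (\<tau> Y) = (if Y' = Y then 1 else 0)"
    using dv_at[of Y' "\<tau> Y"] by (auto simp: d_def)
qed

text \<open>A splitting of the surjection of the homogeneous units onto the free group of divisors.\<close>

definition \<sigma> where "\<sigma> D = finprod HM (\<lambda>Y. \<tau> Y [^]\<^bsub>HM\<^esub> (D Y :: int)) {Y \<in> PD. D Y \<noteq> 0}"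

lemma \<tau>_pow: "Y \<in> PD \<Longrightarrow> \<tau> Y [^]\<^bsub>HM\<^esub> (n::int) \<in> carrier HM"
  using \<tau>(1) HM.int_pow_closed[of "\<tau> Y" n] by (simp add: HM_simps)

text \<open>Factors with exponent 0 are trivial. The index set must be allowed to grow because
  divisors with different supports are to be multiplied.\<close>

lemma \<sigma>_superset:
  assumes "finite J" "J \<subseteq> PD" "{Y \<in> PD. D Y \<noteq> 0} \<subseteq> J"
  shows "\<sigma> D = finprod HM (\<lambda>Y. \<tau> Y [^]\<^bsub>HM\<^esub> D Y) J"
  unfolding \<sigma>_def
  by (rule HM.finprod_mono_neutral_cong_left) (use assms \<tau>_pow in auto)

lemma \<sigma>_H: "\<sigma> D \<in> H"
proof -
  have "\<sigma> D \<in> carrier HM" unfolding \<sigma>_def by (rule HM.finprod_closed) (use \<tau>_pow in auto)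
  then show ?thesis by (simp add: HM_simps)
qed

lemma \<sigma>_one: "\<sigma> \<one>\<^bsub>W\<^esub> = \<one>\<^bsub>Q\<^esub>"
proof -
  have e: "{Y \<in> PD. \<one>\<^bsub>W\<^esub> Y \<noteq> 0} = {}" unfolding W_one by auto
  show ?thesis unfolding \<sigma>_def e by (simp add: HM_simps)
qed

lemma \<sigma>_mult:
  assumes D: "D \<in> carrier W" and E: "E \<in> carrier W"
  shows "\<sigma> (D \<otimes>\<^bsub>W\<^esub> E) = \<sigma> D \<otimes>\<^bsub>Q\<^esub> \<sigma> E"
proof -
  define J where "J = {Y \<in> PD. D Y \<noteq> 0} \<union> {Y \<in> PD. E Y \<noteq> 0}"
  have J: "finite J" "J \<subseteq> PD" using D E by (auto simp: J_def W_carrier)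
  have "\<sigma> (D \<otimes>\<^bsub>W\<^esub> E) = finprod HM (\<lambda>Y. \<tau> Y [^]\<^bsub>HM\<^esub> (D \<otimes>\<^bsub>W\<^esub> E) Y) J"
    by (rule \<sigma>_superset[OF J]) (auto simp: J_def W_mult)
  also have "\<dots> = finprod HM (\<lambda>Y. \<tau> Y [^]\<^bsub>HM\<^esub> D Y \<otimes>\<^bsub>HM\<^esub> \<tau> Y [^]\<^bsub>HM\<^esub> E Y) J"
  proof (rule HM.finprod_cong'[OF refl])
    show "(\<lambda>Y. \<tau> Y [^]\<^bsub>HM\<^esub> D Y \<otimes>\<^bsub>HM\<^esub> \<tau> Y [^]\<^bsub>HM\<^esub> E Y) \<in> J \<rightarrow> carrier HM"
      using J \<tau>_pow HM.m_closed by blast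
    fix Y assume "Y \<in> J"
    then have Y: "Y \<in> PD" using J by blast
    then show "\<tau> Y [^]\<^bsub>HM\<^esub> (D \<otimes>\<^bsub>W\<^esub> E) Y = \<tau> Y [^]\<^bsub>HM\<^esub> D Y \<otimes>\<^bsub>HM\<^esub> \<tau> Y [^]\<^bsub>HM\<^esub> E Y"
      using HM.int_pow_mult[of "\<tau> Y" "D Y" "E Y"] \<tau>(1)[OF Y] by (simp add: W_mult HM_simps)
  qed
  also have "\<dots> = finprod HM (\<lambda>Y. \<tau> Y [^]\<^bsub>HM\<^esub> D Y) J \<otimes>\<^bsub>HM\<^esub> finprod HM (\<lambda>Y. \<tau> Y [^]\<^bsub>HM\<^esub> E Y) J"
    by (rule HM.finprod_multf) (use J \<tau>_pow in auto)
  also have "\<dots> = \<sigma> D \<otimes>\<^bsub>HM\<^esub> \<sigma> E"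
    using \<sigma>_superset[OF J, of D] \<sigma>_superset[OF J, of E] by (simp add: J_def)
  finally show ?thesis by (simp add: HM_simps)
qed

text \<open>In the product the factor \<open>\<tau> Y\<close> has exponent D Y, and m Y is 1 on this
  factor and 0 on all others.\<close>

lemma m_\<sigma>:
  assumes Y: "Y \<in> PD" and D: "D \<in> carrier W"
  shows "m Y (\<sigma> D) = D Y"
proof -
  have hom: "m Y \<in> hom HM integer_group"
    by (rule homI) (auto simp: HM_simps gval_mult[OF m_gval[OF Y]])
  interpret h: group_hom HM integer_group "m Y" by (intro group_hom.intro group_hom_axioms.intro HM.is_group group_integer_group hom)
  have pow: "m Y (\<tau> Y' [^]\<^bsub>HM\<^esub> n) = (if Y' = Y then n else 0)" if "Y' \<in> PD" for Y' and n :: int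
    using h.hom_int_pow[of "\<tau> Y'" n] \<tau>[OF that] Y by (simp add: HM_simps)
  have fp: "m Y (finprod HM f J) = (\<Sum>j\<in>J. m Y (f j))" if "finite J" "f \<in> J \<rightarrow> carrier HM" for f J
    using that
  proof (induction J rule: finite_induct)
    case empty
    then show ?case using h.hom_one by simp
  next
    case (insert j J)
    then have "finprod HM f (insert j J) = f j \<otimes>\<^bsub>HM\<^esub> finprod HM f J" by (intro HM.finprod_insert) auto
    moreover have "f j \<in> carrier HM" "finprod HM f J \<in> carrier HM" using insert by auto
    ultimately show ?case using insert h.hom_mult[of "f j" "finprod HM f J"] by simp
  qed
  \<comment> \<open>Y is inserted so that the sum has a term at Y even if D Y = 0.\<close>
  define J where "J = insert Y {Y \<in> PD. D Y \<noteq> 0}"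
  have J: "finite J" "J \<subseteq> PD" using D Y by (auto simp: J_def W_carrier)
  have \<sigma>J: "\<sigma> D = finprod HM (\<lambda>j. \<tau> j [^]\<^bsub>HM\<^esub> D j) J" by (rule \<sigma>_superset[OF J]) (auto simp: J_def)
  have "m Y (\<sigma> D) = (\<Sum>j\<in>J. m Y (\<tau> j [^]\<^bsub>HM\<^esub> D j))"
    unfolding \<sigma>J by (rule fp[OF J(1)]) (use J \<tau>_pow in auto)
  also have "\<dots> = (\<Sum>j\<in>J. if j = Y then D j else 0)" by (rule sum.cong) (use pow J in auto)
  also have "\<dots> = D Y" using J(1) by (simp add: sum.delta J_def)
  finally show ?thesis .
qed

text \<open>The element \<open>\<sigma> D\<close> is non-zero and homogeneous, so its degree is
  determined; by \<open>\<psi>_dg\<close> it is the preimage in K of the class of D.\<close>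

definition dg where "dg D = hdeg K SG (\<sigma> D)"

lemma dg: "dg D \<in> carrier K" "\<sigma> D \<in> SG (dg D)" "\<sigma> D \<noteq> \<zero>\<^bsub>Q\<^esub>"
proof -
  obtain w where w: "w \<in> carrier K" "\<sigma> D \<in> SG w" "\<sigma> D \<noteq> \<zero>\<^bsub>Q\<^esub>" using \<sigma>_H H_iff by metis
  have "dg D = w" unfolding dg_def by (rule Q.hdeg_eq[OF w])
  then show "dg D \<in> carrier K" "\<sigma> D \<in> SG (dg D)" "\<sigma> D \<noteq> \<zero>\<^bsub>Q\<^esub>" using w by simp_all
qed

lemma \<psi>_dg:
  assumes D: "D \<in> carrier W"
  shows "\<psi> (dg D) = cls D" "inv_into (carrier K) \<psi> (cls D) = dg D"
proof -
  have "dv (\<sigma> D) = D" by (rule W_eqI[OF dv_closed[OF \<sigma>_H] D]) (simp add: dv_at m_\<sigma>[OF _ D])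
  then show e: "\<psi> (dg D) = cls D" using \<psi>_eq[OF dg] by simp
  have "inj_on \<psi> (carrier K)" using \<psi>_iso by (simp add: iso_def bij_betw_def)
  from inv_into_f_f[OF this dg(1), of D] show "inv_into (carrier K) \<psi> (cls D) = dg D" unfolding e .
qed

text \<open>The value of the product along Y is \<open>\<nu> Y f + D Y\<close>, so the criterion of
  \<open>hom_section\<close> turns into the inequality that defines \<open>DS D U\<close>.\<close>

lemma term_section:
  assumes U: "openin X U" "U \<noteq> {}" and D: "D \<in> carrier W" and f: "f \<in> carrier FF"
  shows "t f \<otimes>\<^bsub>Q\<^esub> \<sigma> D \<in> gr U ` hcomp R U (dg D) \<longleftrightarrow> f \<in> DS D U"
proof -
  have S: "t f \<otimes>\<^bsub>Q\<^esub> \<sigma> D \<in> SG (dg D)" using Q.G_mult[OF K.one_closed dg(1) t_in[OF f] dg(2)] dg(1) by simp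
  show ?thesis
  proof (cases "f = \<zero>\<^bsub>FF\<^esub>")
    case True
    have "t f \<otimes>\<^bsub>Q\<^esub> \<sigma> D = \<zero>\<^bsub>Q\<^esub>" using True t_zero H_carrier[OF \<sigma>_H] by simp
    then show ?thesis unfolding hom_section[OF U dg(1)] using True DS_zero dg(1) by simp
  next
    case False
    have tH: "t f \<in> H" using t_H f False by blast
    have nz: "t f \<otimes>\<^bsub>Q\<^esub> \<sigma> D \<noteq> \<zero>\<^bsub>Q\<^esub>" using H_mult[OF tH \<sigma>_H] H_iff by blast
    have "m Y (t f \<otimes>\<^bsub>Q\<^esub> \<sigma> D) = \<nu> Y f + D Y" if "Y \<in> PD" for Y
      using gval_mult[OF m_gval[OF that] tH \<sigma>_H] m_t[OF that f False] m_\<sigma>[OF that D] by simp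
    then show ?thesis unfolding hom_section[OF U dg(1)] DS_def using S nz f False by simp
  qed
qed

abbreviation dsupp where "dsupp p \<equiv> {D \<in> carrier W. p D \<noteq> \<zero>\<^bsub>FF\<^esub>}"

text \<open>Coefficient families as in the group algebra of the function field over WDiv(X), with no
  condition relative to an open set. The map \<open>\<Phi>\<close> is studied on all of them and
  related to sections only afterwards.\<close>

definition fs where "fs p \<longleftrightarrow> (\<forall>D\<in>carrier W. p D \<in> carrier FF) \<and> finite (dsupp p)"

definition trm where "trm p D = t (p D) \<otimes>\<^bsub>Q\<^esub> \<sigma> D"

definition \<Phi> where "\<Phi> p = finsum Q (trm p) (dsupp p)"

lemma term_closed: "fs p \<Longrightarrow> D \<in> carrier W \<Longrightarrow> trm p D \<in> carrier Q"
  using t_closed H_carrier[OF \<sigma>_H] by (simp add: trm_def fs_def)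

lemma term_zero: "p D = \<zero>\<^bsub>FF\<^esub> \<Longrightarrow> trm p D = \<zero>\<^bsub>Q\<^esub>"
  using H_carrier[OF \<sigma>_H] by (simp add: trm_def t_zero)

lemma \<Phi>_superset:
  assumes "fs p" "finite J" "J \<subseteq> carrier W" "dsupp p \<subseteq> J"
  shows "\<Phi> p = finsum Q (trm p) J"
  unfolding \<Phi>_def by (rule rp.S.finsum_superset[OF assms(2,4)]) (use assms term_closed term_zero in auto)

lemma \<Phi>_closed: "fs p \<Longrightarrow> \<Phi> p \<in> carrier Q"
  unfolding \<Phi>_def by (rule rp.S.finsum_closed) (use term_closed in auto)

lemma \<Phi>_add:
  assumes p: "fs p" and q: "fs q"
  shows "\<Phi> (\<lambda>D\<in>carrier W. p D \<oplus>\<^bsub>FF\<^esub> q D) = \<Phi> p \<oplus>\<^bsub>Q\<^esub> \<Phi> q" (is "\<Phi> ?r = _")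
proof -
  define J where "J = dsupp p \<union> dsupp q"
  have J: "finite J" "J \<subseteq> carrier W" using p q by (auto simp: J_def fs_def)
  have pq: "p D \<in> carrier FF" "q D \<in> carrier FF" if "D \<in> carrier W" for D using p q that by (auto simp: fs_def)
  have sub: "dsupp ?r \<subseteq> J"
  proof
    fix D assume "D \<in> dsupp ?r"
    then show "D \<in> J" unfolding J_def using FF.r_zero[OF FF.zero_closed] by fastforce
  qed
  have r: "fs ?r" using pq finite_subset[OF sub J(1)] by (simp add: fs_def)
  have "\<Phi> ?r = finsum Q (trm ?r) J" by (rule \<Phi>_superset[OF r J sub])
  also have "\<dots> = finsum Q (\<lambda>D. trm p D \<oplus>\<^bsub>Q\<^esub> trm q D) J"
  proof (rule rp.S.finsum_cong'[OF refl])
    show "(\<lambda>D. trm p D \<oplus>\<^bsub>Q\<^esub> trm q D) \<in> J \<rightarrow> carrier Q" using J term_closed[OF p] term_closed[OF q] by blast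
    fix D assume "D \<in> J"
    then have D: "D \<in> carrier W" using J by blast
    show "trm ?r D = trm p D \<oplus>\<^bsub>Q\<^esub> trm q D"
      using D t_add[OF pq[OF D]] rp.S.l_distr[OF t_closed[OF pq(1)[OF D]] t_closed[OF pq(2)[OF D]] H_carrier[OF \<sigma>_H]] by (simp add: trm_def)
  qed
  also have "\<dots> = finsum Q (trm p) J \<oplus>\<^bsub>Q\<^esub> finsum Q (trm q) J"
    by (rule rp.S.finsum_addf) (use J term_closed[OF p] term_closed[OF q] in auto)
  also have "\<dots> = \<Phi> p \<oplus>\<^bsub>Q\<^esub> \<Phi> q" using \<Phi>_superset[OF p J] \<Phi>_superset[OF q J] by (simp add: J_def)
  finally show ?thesis .
qed

lemma t_ring_hom: "t \<in> ring_hom FF Q"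
  by (rule ring_hom_memI) (auto simp: t_closed t_mult t_add t_one)

text \<open>Since \<open>\<sigma>\<close> and \<open>t\<close> are multiplicative, the term of the
  convolution at l is the sum over D of the products of the terms of p at D and of q at l - D.
  Exchanging the two summations and shifting l by D, for fixed D, leaves the product of the two
  sums.\<close>

lemma \<Phi>_mult:
  assumes p: "fs p" and q: "fs q"
  shows "\<Phi> (\<lambda>l\<in>carrier W. \<Oplus>\<^bsub>FF\<^esub>D\<in>dsupp p. p D \<otimes>\<^bsub>FF\<^esub> q (inv\<^bsub>W\<^esub> D \<otimes>\<^bsub>W\<^esub> l)) = \<Phi> p \<otimes>\<^bsub>Q\<^esub> \<Phi> q" (is "\<Phi> ?r = _")
proof -
  interpret th: ring_hom_cring FF Q t using t_ring_hom by unfold_locales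
  define M where "M = dsupp p"
  \<comment> \<open>\<open>L\<close> consists of all sums of a divisor in the support of p and one
    in that of q. It contains the support of the convolution and, after a shift by -D for D in
    \<open>M\<close>, also that of q, so one index set serves for both summations.\<close>
  define L where "L = (\<lambda>(D, E). D \<otimes>\<^bsub>W\<^esub> E) ` (M \<times> dsupp q)"
  have M: "finite M" "M \<subseteq> carrier W" using p by (auto simp: M_def fs_def)
  have L: "finite L" "L \<subseteq> carrier W" using M q by (auto simp: L_def fs_def)
  have pq: "p D \<in> carrier FF" "q D \<in> carrier FF" if "D \<in> carrier W" for D using p q that by (auto simp: fs_def)
  have cancel: "D \<otimes>\<^bsub>W\<^esub> (inv\<^bsub>W\<^esub> D \<otimes>\<^bsub>W\<^esub> l) = l" "inv\<^bsub>W\<^esub> D \<otimes>\<^bsub>W\<^esub> (D \<otimes>\<^bsub>W\<^esub> l) = l" if "D \<in> carrier W" "l \<in> carrier W" for D l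
    using that by (simp_all add: W.m_assoc[symmetric])
  have rl: "?r l = (\<Oplus>\<^bsub>FF\<^esub>D\<in>M. p D \<otimes>\<^bsub>FF\<^esub> q (inv\<^bsub>W\<^esub> D \<otimes>\<^bsub>W\<^esub> l))" if "l \<in> carrier W" for l using that by (simp add: M_def)
  have prod: "p D \<otimes>\<^bsub>FF\<^esub> q (inv\<^bsub>W\<^esub> D \<otimes>\<^bsub>W\<^esub> l) \<in> carrier FF" if "D \<in> M" "l \<in> carrier W" for D l
    using pq M that by (meson FF.m_closed W.inv_closed W.m_closed subsetD)
  have sub: "dsupp ?r \<subseteq> L"
  proof
    fix l assume l: "l \<in> dsupp ?r"
    then have lW: "l \<in> carrier W" by blast
    show "l \<in> L"
    proof (rule ccontr)
      assume nL: "l \<notin> L"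
      have "p D \<otimes>\<^bsub>FF\<^esub> q (inv\<^bsub>W\<^esub> D \<otimes>\<^bsub>W\<^esub> l) = \<zero>\<^bsub>FF\<^esub>" if D: "D \<in> M" for D
      proof -
        have DW: "D \<in> carrier W" using D M by blast
        have "inv\<^bsub>W\<^esub> D \<otimes>\<^bsub>W\<^esub> l \<notin> dsupp q"
        proof
          assume "inv\<^bsub>W\<^esub> D \<otimes>\<^bsub>W\<^esub> l \<in> dsupp q"
          then have "(\<lambda>(D, E). D \<otimes>\<^bsub>W\<^esub> E) (D, inv\<^bsub>W\<^esub> D \<otimes>\<^bsub>W\<^esub> l) \<in> L" unfolding L_def using D by blast
          then show False using nL cancel(1)[OF DW lW] by simp
        qed
        then have "q (inv\<^bsub>W\<^esub> D \<otimes>\<^bsub>W\<^esub> l) = \<zero>\<^bsub>FF\<^esub>" using DW lW by simp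
        then show ?thesis using pq(1)[OF DW] by simp
      qed
      then have "?r l = (\<Oplus>\<^bsub>FF\<^esub>D\<in>M. \<zero>\<^bsub>FF\<^esub>)" unfolding rl[OF lW] by (intro FF.finsum_cong') auto
      then show False using l by (simp add: FF.finsum_zero)
    qed
  qed
  have r: "fs ?r"
    using finite_subset[OF sub L(1)] prod rl unfolding fs_def by (auto intro!: FF.finsum_closed)
  have tm: "trm ?r l = (\<Oplus>\<^bsub>Q\<^esub>D\<in>M. trm p D \<otimes>\<^bsub>Q\<^esub> trm q (inv\<^bsub>W\<^esub> D \<otimes>\<^bsub>W\<^esub> l))" if l: "l \<in> carrier W" for l
  proof -
    have "t (?r l) = finsum Q (t \<circ> (\<lambda>D. p D \<otimes>\<^bsub>FF\<^esub> q (inv\<^bsub>W\<^esub> D \<otimes>\<^bsub>W\<^esub> l))) M"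
      unfolding rl[OF l] by (rule th.hom_finsum) (use prod l in auto)
    then have "trm ?r l = finsum Q (t \<circ> (\<lambda>D. p D \<otimes>\<^bsub>FF\<^esub> q (inv\<^bsub>W\<^esub> D \<otimes>\<^bsub>W\<^esub> l))) M \<otimes>\<^bsub>Q\<^esub> \<sigma> l"
      by (simp only: trm_def)
    also have "\<dots> = (\<Oplus>\<^bsub>Q\<^esub>D\<in>M. (t \<circ> (\<lambda>D. p D \<otimes>\<^bsub>FF\<^esub> q (inv\<^bsub>W\<^esub> D \<otimes>\<^bsub>W\<^esub> l))) D \<otimes>\<^bsub>Q\<^esub> \<sigma> l)"
      by (rule rp.S.finsum_ldistr) (use M H_carrier[OF \<sigma>_H] prod l t_closed in auto)
    also have "\<dots> = (\<Oplus>\<^bsub>Q\<^esub>D\<in>M. trm p D \<otimes>\<^bsub>Q\<^esub> trm q (inv\<^bsub>W\<^esub> D \<otimes>\<^bsub>W\<^esub> l))"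
    proof (rule rp.S.finsum_cong'[OF refl])
      show "(\<lambda>D. trm p D \<otimes>\<^bsub>Q\<^esub> trm q (inv\<^bsub>W\<^esub> D \<otimes>\<^bsub>W\<^esub> l)) \<in> M \<rightarrow> carrier Q"
        using M l term_closed[OF p] term_closed[OF q] by (auto simp: subset_iff)
      fix D assume D: "D \<in> M"
      have DW: "D \<in> carrier W" using D M by blast
      define E where "E = inv\<^bsub>W\<^esub> D \<otimes>\<^bsub>W\<^esub> l"
      have EW: "E \<in> carrier W" using DW l by (simp add: E_def)
      have c: "t (p D) \<in> carrier Q" "t (q E) \<in> carrier Q" "\<sigma> D \<in> carrier Q" "\<sigma> E \<in> carrier Q"
        using t_closed pq DW EW H_carrier[OF \<sigma>_H] by auto
      have sl: "\<sigma> l = \<sigma> D \<otimes>\<^bsub>Q\<^esub> \<sigma> E" using \<sigma>_mult[OF DW EW] cancel(1)[OF DW l] by (simp add: E_def)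
      have "t (p D \<otimes>\<^bsub>FF\<^esub> q E) \<otimes>\<^bsub>Q\<^esub> \<sigma> l = (t (p D) \<otimes>\<^bsub>Q\<^esub> t (q E)) \<otimes>\<^bsub>Q\<^esub> (\<sigma> D \<otimes>\<^bsub>Q\<^esub> \<sigma> E)"
        using t_mult[OF pq(1)[OF DW] pq(2)[OF EW]] sl by simp
      also have "\<dots> = (t (p D) \<otimes>\<^bsub>Q\<^esub> \<sigma> D) \<otimes>\<^bsub>Q\<^esub> (t (q E) \<otimes>\<^bsub>Q\<^esub> \<sigma> E)" using c by (simp add: rp.S.m_ac)
      finally show "(t \<circ> (\<lambda>D. p D \<otimes>\<^bsub>FF\<^esub> q (inv\<^bsub>W\<^esub> D \<otimes>\<^bsub>W\<^esub> l))) D \<otimes>\<^bsub>Q\<^esub> \<sigma> l = trm p D \<otimes>\<^bsub>Q\<^esub> trm q (inv\<^bsub>W\<^esub> D \<otimes>\<^bsub>W\<^esub> l)"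
        by (simp add: trm_def E_def)
    qed
    finally show ?thesis .
  qed
  have cl: "trm p D \<otimes>\<^bsub>Q\<^esub> trm q (inv\<^bsub>W\<^esub> D \<otimes>\<^bsub>W\<^esub> l) \<in> carrier Q" if "D \<in> M" "l \<in> L" for D l
    using M L that term_closed[OF p] term_closed[OF q] by (meson W.inv_closed W.m_closed rp.S.m_closed subsetD)
  have "\<Phi> ?r = finsum Q (trm ?r) L" by (rule \<Phi>_superset[OF r L sub])
  also have "\<dots> = (\<Oplus>\<^bsub>Q\<^esub>l\<in>L. \<Oplus>\<^bsub>Q\<^esub>D\<in>M. trm p D \<otimes>\<^bsub>Q\<^esub> trm q (inv\<^bsub>W\<^esub> D \<otimes>\<^bsub>W\<^esub> l))"
  proof (rule rp.S.finsum_cong'[OF refl])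
    show "(\<lambda>l. \<Oplus>\<^bsub>Q\<^esub>D\<in>M. trm p D \<otimes>\<^bsub>Q\<^esub> trm q (inv\<^bsub>W\<^esub> D \<otimes>\<^bsub>W\<^esub> l)) \<in> L \<rightarrow> carrier Q" using cl by (auto intro!: rp.S.finsum_closed)
    show "trm ?r l = (\<Oplus>\<^bsub>Q\<^esub>D\<in>M. trm p D \<otimes>\<^bsub>Q\<^esub> trm q (inv\<^bsub>W\<^esub> D \<otimes>\<^bsub>W\<^esub> l))" if "l \<in> L" for l
      using tm L that by blast
  qed
  also have "\<dots> = (\<Oplus>\<^bsub>Q\<^esub>D\<in>M. \<Oplus>\<^bsub>Q\<^esub>l\<in>L. trm p D \<otimes>\<^bsub>Q\<^esub> trm q (inv\<^bsub>W\<^esub> D \<otimes>\<^bsub>W\<^esub> l))"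
    by (rule rp.S.finsum_swap[OF L(1) M(1)]) (use cl in blast)
  also have "\<dots> = (\<Oplus>\<^bsub>Q\<^esub>D\<in>M. trm p D \<otimes>\<^bsub>Q\<^esub> \<Phi> q)"
  proof (rule rp.S.finsum_cong'[OF refl])
    show "(\<lambda>D. trm p D \<otimes>\<^bsub>Q\<^esub> \<Phi> q) \<in> M \<rightarrow> carrier Q" using M term_closed[OF p] \<Phi>_closed[OF q] by auto
    fix D assume D: "D \<in> M"
    have DW: "D \<in> carrier W" using D M by blast
    have tc: "trm q (inv\<^bsub>W\<^esub> D \<otimes>\<^bsub>W\<^esub> l) \<in> carrier Q" if "l \<in> L" for l using term_closed[OF q] DW L that by auto
    have inj: "inj_on (\<lambda>l. inv\<^bsub>W\<^esub> D \<otimes>\<^bsub>W\<^esub> l) L"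
      by (rule inj_on_inverseI[of _ "\<lambda>l. D \<otimes>\<^bsub>W\<^esub> l"]) (use cancel(1)[OF DW] L in auto)
    have "\<Phi> q = finsum Q (trm q) ((\<lambda>l. inv\<^bsub>W\<^esub> D \<otimes>\<^bsub>W\<^esub> l) ` L)"
    proof (rule \<Phi>_superset[OF q])
      show "finite ((\<lambda>l. inv\<^bsub>W\<^esub> D \<otimes>\<^bsub>W\<^esub> l) ` L)" using L by simp
      show "(\<lambda>l. inv\<^bsub>W\<^esub> D \<otimes>\<^bsub>W\<^esub> l) ` L \<subseteq> carrier W" using L DW by auto
      show "dsupp q \<subseteq> (\<lambda>l. inv\<^bsub>W\<^esub> D \<otimes>\<^bsub>W\<^esub> l) ` L"
      proof
        fix E assume E: "E \<in> dsupp q"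
        have "(\<lambda>(D, E). D \<otimes>\<^bsub>W\<^esub> E) (D, E) \<in> L" unfolding L_def using D E by blast
        moreover have "E = inv\<^bsub>W\<^esub> D \<otimes>\<^bsub>W\<^esub> (D \<otimes>\<^bsub>W\<^esub> E)" using cancel(2)[OF DW, of E] E by simp
        ultimately show "E \<in> (\<lambda>l. inv\<^bsub>W\<^esub> D \<otimes>\<^bsub>W\<^esub> l) ` L" by auto
      qed
    qed
    also have "\<dots> = (\<Oplus>\<^bsub>Q\<^esub>l\<in>L. trm q (inv\<^bsub>W\<^esub> D \<otimes>\<^bsub>W\<^esub> l))"
      by (rule rp.S.finsum_reindex[OF _ inj]) (use tc in auto)
    finally have \<Phi>q: "\<Phi> q = (\<Oplus>\<^bsub>Q\<^esub>l\<in>L. trm q (inv\<^bsub>W\<^esub> D \<otimes>\<^bsub>W\<^esub> l))" .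
    show "(\<Oplus>\<^bsub>Q\<^esub>l\<in>L. trm p D \<otimes>\<^bsub>Q\<^esub> trm q (inv\<^bsub>W\<^esub> D \<otimes>\<^bsub>W\<^esub> l)) = trm p D \<otimes>\<^bsub>Q\<^esub> \<Phi> q"
      unfolding \<Phi>q by (rule rp.S.finsum_rdistr[symmetric]) (use L tc term_closed[OF p DW] in auto)
  qed
  also have "\<dots> = finsum Q (trm p) M \<otimes>\<^bsub>Q\<^esub> \<Phi> q"
    by (rule rp.S.finsum_ldistr[symmetric]) (use M term_closed[OF p] \<Phi>_closed[OF q] in auto)
  finally show ?thesis by (simp add: \<Phi>_def M_def)
qed

lemma \<Phi>_mono:
  assumes D: "D \<in> carrier W" and f: "f \<in> carrier FF"
  shows "\<Phi> (mono f D) = t f \<otimes>\<^bsub>Q\<^esub> \<sigma> D" "fs (mono f D)"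
proof -
  have sub: "dsupp (mono f D) \<subseteq> {D}" by (auto simp: mono_def)
  then have "finite (dsupp (mono f D))" by (rule finite_subset) simp
  then show fs: "fs (mono f D)" using f by (simp add: fs_def mono_def)
  have "\<Phi> (mono f D) = finsum Q (trm (mono f D)) {D}" by (rule \<Phi>_superset[OF fs]) (use sub D in auto)
  then show "\<Phi> (mono f D) = t f \<otimes>\<^bsub>Q\<^esub> \<sigma> D" using D f t_closed H_carrier[OF \<sigma>_H] by (simp add: trm_def mono_def)
qed

lemma DA_fs:
  assumes "p \<in> carrier (sect DA U)"
  shows "fs p"
proof -
  have "p D \<in> carrier FF" if "D \<in> carrier W" for D
    using assms that unfolding DA_carrier by (cases "U = {}") (auto simp: DS_def)
  then show ?thesis using assms by (simp add: fs_def DA_carrier)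
qed

text \<open>Each of the finitely many terms is the germ of a homogeneous section over the given U by
  \<open>term_section\<close>, so the lifts can be added over U without shrinking it.\<close>

lemma \<Phi>_section:
  assumes U: "openin X U" "U \<noteq> {}" and p: "p \<in> carrier (sect DA U)"
  shows "\<Phi> p \<in> gr U ` carrier (sect R U)"
proof -
  have n: "rp.nbhd U" using U rp_nbhd_iff by blast
  have "\<forall>D\<in>dsupp p. \<exists>s. s \<in> carrier (sect R U) \<and> trm p D = gr U s"
  proof
    fix D assume "D \<in> dsupp p"
    then have "D \<in> carrier W" "p D \<in> DS D U" "p D \<in> carrier FF" using p U DA_fs[OF p] unfolding DA_carrier fs_def by auto
    then have "trm p D \<in> gr U ` hcomp R U (dg D)" using term_section[OF U] by (simp add: trm_def)
    then show "\<exists>s. s \<in> carrier (sect R U) \<and> trm p D = gr U s" using R_hcarrier[OF U(1) dg(1)] by blast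
  qed
  from bchoice[OF this] obtain s where s': "\<forall>D\<in>dsupp p. s D \<in> carrier (sect R U) \<and> trm p D = gr U (s D)"
    by (elim exE) (rule that)
  note s = bspec[OF s']
  interpret U: graded K "sect R U" "hcomp R U" using R_comp[OF U(1)] .
  have "gr U (finsum (sect R U) s (dsupp p)) = finsum Q (\<lambda>D. gr U (s D)) (dsupp p)"
    by (rule rp.germ_finsum[OF n]) (use s DA_fs[OF p] in \<open>auto simp: fs_def\<close>)
  also have "\<dots> = \<Phi> p" unfolding \<Phi>_def by (rule rp.S.finsum_cong') (use s term_closed[OF DA_fs[OF p]] in auto)
  finally have "\<Phi> p = gr U (finsum (sect R U) s (dsupp p))" by simp
  moreover have "finsum (sect R U) s (dsupp p) \<in> carrier (sect R U)" by (rule U.A.finsum_closed) (use s in auto)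
  ultimately show ?thesis by blast
qed

text \<open>The section with germ \<open>\<Phi> p\<close>, unique by injectivity of
  \<open>gr U\<close>. The empty set gets its value separately, as it does not contain the generic
  point.\<close>

definition \<pi> where "\<pi> U p = (if U = {} then \<zero>\<^bsub>sect R {}\<^esub> else inv_into (carrier (sect R U)) (gr U) (\<Phi> p))"

lemma \<pi>_eqI:
  assumes U: "openin X U" "U \<noteq> {}" and s: "s \<in> carrier (sect R U)" "gr U s = \<Phi> p"
  shows "\<pi> U p = s"
  using inv_into_f_f[OF gr_inj[OF U] s(1)] U s(2) by (simp add: \<pi>_def)

lemma \<pi>_gr:
  assumes U: "openin X U" "U \<noteq> {}" and p: "p \<in> carrier (sect DA U)"
  shows "\<pi> U p \<in> carrier (sect R U)" "gr U (\<pi> U p) = \<Phi> p"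
  using \<Phi>_section[OF assms] inv_into_into[of "\<Phi> p" "gr U" "carrier (sect R U)"] f_inv_into_f[of "\<Phi> p" "gr U" "carrier (sect R U)"] U(2)
  by (simp_all add: \<pi>_def)

lemma \<pi>_ring_hom:
  assumes U: "openin X U"
  shows "\<pi> U \<in> ring_hom (sect DA U) (sect R U)"
proof (cases "U = {}")
  case True
  interpret E: cring "sect R {}" using rp.sect_cring[of "{}"] by simp
  show ?thesis unfolding True
    by (rule ring_hom_memI) (auto simp: \<pi>_def intro: R_empty)
next
  case False
  note U = U False
  have n: "rp.nbhd U" using U rp_nbhd_iff by blast
  interpret U: cring "sect R U" using rp.sect_cring[OF U(1)] .
  have gh: "gr U \<in> ring_hom (sect R U) Q" by (rule rp.germ_hom[OF n])
  show ?thesis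
  proof (rule ring_hom_memI)
    fix p assume p: "p \<in> carrier (sect DA U)"
    show "\<pi> U p \<in> carrier (sect R U)" by (rule \<pi>_gr[OF U p])
    fix q assume q: "q \<in> carrier (sect DA U)"
    note pc = \<pi>_gr[OF U p] and qc = \<pi>_gr[OF U q]
    show "\<pi> U (p \<otimes>\<^bsub>sect DA U\<^esub> q) = \<pi> U p \<otimes>\<^bsub>sect R U\<^esub> \<pi> U q"
      by (rule \<pi>_eqI[OF U]) (use pc qc ring_hom_mult[OF gh pc(1) qc(1)] \<Phi>_mult[OF DA_fs[OF p] DA_fs[OF q]] DA_mult[OF U(2), of p q] in simp_all)
    show "\<pi> U (p \<oplus>\<^bsub>sect DA U\<^esub> q) = \<pi> U p \<oplus>\<^bsub>sect R U\<^esub> \<pi> U q"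
      by (rule \<pi>_eqI[OF U]) (use pc qc ring_hom_add[OF gh pc(1) qc(1)] \<Phi>_add[OF DA_fs[OF p] DA_fs[OF q]] DA_add[of U p q] in simp_all)
  next
    have "\<one>\<^bsub>sect DA U\<^esub> = mono \<one>\<^bsub>FF\<^esub> \<one>\<^bsub>W\<^esub>" unfolding DA_one[OF U(2)] mono_def ..
    then have "\<Phi> \<one>\<^bsub>sect DA U\<^esub> = \<one>\<^bsub>Q\<^esub>" using \<Phi>_mono(1)[OF W.one_closed FF.one_closed] by (simp add: t_one \<sigma>_one)
    then show "\<pi> U \<one>\<^bsub>sect DA U\<^esub> = \<one>\<^bsub>sect R U\<^esub>" using rp.germ_one[OF n] by (intro \<pi>_eqI[OF U]) auto
  qed
qed

text \<open>Multiplication by the unit \<open>\<sigma> D\<close> is injective. A section of degree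
  \<open>dg D\<close> divided by \<open>\<sigma> D\<close> has degree zero, hence is a rational
  function f, and \<open>term_section\<close> says that f chi^D is a section of the divisorial
  algebra over U.\<close>

lemma \<pi>_bij:
  assumes U: "openin X U" and D: "D \<in> carrier W"
  shows "bij_betw (\<pi> U) (hcomp DA U D) (hcomp R U (dg D))"
proof (cases "U = {}")
  case True
  interpret E: graded K "sect R {}" "hcomp R {}" using R_comp[of "{}"] by simp
  have 1: "hcomp R {} (dg D) = {\<zero>\<^bsub>sect R {}\<^esub>}"
    using E.G_zero[OF dg(1)] R_empty E.G_carrier[OF dg(1)] by blast
  have "p = mono \<zero>\<^bsub>FF\<^esub> D" if "p \<in> hcomp DA {} D" for p
    by (rule extensionalityI[of _ "carrier W"]) (use that in \<open>auto simp: DA_hcomp DA_carrier mono_def\<close>)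
  moreover have "mono \<zero>\<^bsub>FF\<^esub> D \<in> hcomp DA {} D" by (simp add: DA_hcomp DA_carrier mono_def)
  ultimately have 2: "hcomp DA {} D = {mono \<zero>\<^bsub>FF\<^esub> D}" by blast
  show ?thesis unfolding True 1 2 by (simp add: bij_betw_def \<pi>_def)
next
  case False
  note U = U False
  have \<Phi>p: "\<Phi> p = t (p D) \<otimes>\<^bsub>Q\<^esub> \<sigma> D" "p D \<in> carrier FF" "p D \<in> DS D U" if "p \<in> hcomp DA U D" for p
  proof -
    have p: "p = mono (p D) D" "p D \<in> DS D U" using DA_hcomp_mono[OF U(2) D that] .
    then show "p D \<in> carrier FF" "p D \<in> DS D U" by (auto simp: DS_def)
    then show "\<Phi> p = t (p D) \<otimes>\<^bsub>Q\<^esub> \<sigma> D" using \<Phi>_mono(1)[OF D, of "p D"] p(1) by simp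
  qed
  have pc: "p \<in> carrier (sect DA U)" if "p \<in> hcomp DA U D" for p using that by (simp add: DA_hcomp)
  show ?thesis
  proof (rule bij_betwI')
    fix p q assume p: "p \<in> hcomp DA U D" and q: "q \<in> hcomp DA U D"
    show "\<pi> U p = \<pi> U q \<longleftrightarrow> p = q"
    proof
      assume "\<pi> U p = \<pi> U q"
      then have "\<Phi> p = \<Phi> q" using \<pi>_gr(2)[OF U pc[OF p]] \<pi>_gr(2)[OF U pc[OF q]] by simp
      then have "t (p D) \<otimes>\<^bsub>Q\<^esub> \<sigma> D = t (q D) \<otimes>\<^bsub>Q\<^esub> \<sigma> D" using \<Phi>p[OF p] \<Phi>p[OF q] by simp
      then have "\<sigma> D \<otimes>\<^bsub>Q\<^esub> t (p D) = \<sigma> D \<otimes>\<^bsub>Q\<^esub> t (q D)"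
        using rp.S.m_comm[OF H_carrier[OF \<sigma>_H] t_closed[OF \<Phi>p(2)[OF p]]] rp.S.m_comm[OF H_carrier[OF \<sigma>_H] t_closed[OF \<Phi>p(2)[OF q]]] by simp
      then have "t (p D) = t (q D)" using rp.S.Units_l_cancel[OF H_unit[OF \<sigma>_H] t_closed[OF \<Phi>p(2)[OF p]] t_closed[OF \<Phi>p(2)[OF q]]] by blast
      then have "p D = q D" using t_bij \<Phi>p(2)[OF p] \<Phi>p(2)[OF q] unfolding bij_betw_def by (meson inj_onD)
      then show "p = q" using DA_hcomp_mono(1)[OF U(2) D p] DA_hcomp_mono(1)[OF U(2) D q] by simp
    qed simp
  next
    fix p assume p: "p \<in> hcomp DA U D"
    have "\<Phi> p \<in> gr U ` hcomp R U (dg D)" using term_section[OF U D \<Phi>p(2)[OF p]] \<Phi>p[OF p] by simp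
    then obtain s where s: "s \<in> hcomp R U (dg D)" "gr U s = \<Phi> p" by (metis imageE)
    then show "\<pi> U p \<in> hcomp R U (dg D)" using \<pi>_eqI[OF U R_hcarrier[OF U(1) dg(1) s(1)] s(2)] by simp
  next
    fix s assume s: "s \<in> hcomp R U (dg D)"
    have n: "rp.nbhd U" using U rp_nbhd_iff by blast
    have a: "gr U s \<in> SG (dg D)" by (rule SG_germ[OF n s])
    have si: "inv\<^bsub>Q\<^esub> \<sigma> D \<in> SG (inv\<^bsub>K\<^esub> dg D)" by (rule Q.inverse_degree[OF dg(1,2) H_unit[OF \<sigma>_H]])
    have "gr U s \<otimes>\<^bsub>Q\<^esub> inv\<^bsub>Q\<^esub> \<sigma> D \<in> SG \<one>\<^bsub>K\<^esub>" using Q.G_mult[OF dg(1) K.inv_closed[OF dg(1)] a si] K.r_inv[OF dg(1)] by simp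
    then obtain f where f: "f \<in> carrier FF" "t f = gr U s \<otimes>\<^bsub>Q\<^esub> inv\<^bsub>Q\<^esub> \<sigma> D" using t_surj by blast
    have aQ: "gr U s \<in> carrier Q" using Q.G_carrier[OF dg(1) a] .
    have eq: "t f \<otimes>\<^bsub>Q\<^esub> \<sigma> D = gr U s"
      unfolding f(2) using rp.S.m_assoc[OF aQ H_carrier[OF H_inv[OF \<sigma>_H]] H_carrier[OF \<sigma>_H]] rp.S.Units_l_inv[OF H_unit[OF \<sigma>_H]] aQ by simp
    then have "f \<in> DS D U" using term_section[OF U D f(1)] s by (metis image_eqI)
    then have mh: "mono f D \<in> hcomp DA U D" by (rule mono_in[OF U(2) D])
    have "\<pi> U (mono f D) = s" by (rule \<pi>_eqI[OF U R_hcarrier[OF U(1) dg(1) s]]) (simp add: eq \<Phi>_mono(1)[OF D f(1)])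
    then show "\<exists>p\<in>hcomp DA U D. s = \<pi> U p" using mh by blast
  qed
qed

text \<open>Sections are compared through their germs, and the germ \<open>\<Phi> p\<close> does not
  depend on the open set.\<close>

lemma \<pi>_restr:
  assumes U: "openin X U" and V: "openin X V" "V \<subseteq> U" and p: "p \<in> carrier (sect DA U)"
  shows "\<pi> V (restr DA U V p) = restr R U V (\<pi> U p)"
proof (cases "V = {}")
  case True
  interpret E: cring "sect R {}" using rp.sect_cring[of "{}"] by simp
  have "\<pi> U p \<in> carrier (sect R U)" by (rule ring_hom_closed[OF \<pi>_ring_hom[OF U] p])
  then have "restr R U {} (\<pi> U p) \<in> carrier (sect R {})" by (intro rp.r_closed U) auto
  then show ?thesis unfolding True by (intro R_empty) (simp_all add: \<pi>_def)
next
  case False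
  have Une: "U \<noteq> {}" using V(2) False by blast
  have n: "rp.nbhd U" "rp.nbhd V" using U V Une False rp_nbhd_iff by auto
  have "restr DA U V p = p"
    unfolding DA_restr by (rule extensionalityI[of _ "carrier W"]) (use p False in \<open>auto simp: DA_carrier\<close>)
  moreover have "\<pi> V p = restr R U V (\<pi> U p)"
  proof (rule \<pi>_eqI[OF V(1) False])
    show "restr R U V (\<pi> U p) \<in> carrier (sect R V)" using rp.r_closed[OF U V] \<pi>_gr[OF U Une p] by simp
    show "gr V (restr R U V (\<pi> U p)) = \<Phi> p" using rp.germ_restr[OF n(1) _ n(2) V(2)] \<pi>_gr[OF U Une p] by simp
  qed
  ultimately show ?thesis by simp
qed

theorem regrade_cox: "cox_sheaf X \<O> (regrade K \<psi> R)"
proof -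
  let ?R = "regrade K \<psi> R"
  have s: "sect ?R = sect R" "restr ?R = restr R" "hcomp ?R U c = hcomp R U (inv_into (carrier K) \<psi> c)" for U c
    by (simp_all add: regrade_def)
  have h: "hcomp ?R U (cls D) = hcomp R U (dg D)" if "D \<in> carrier W" for U D using \<psi>_dg(2)[OF that] by (simp add: s)
  have "cie X W DA Clg ?R cls \<pi>"
    unfolding cie_def graded_morphism_def s(1,2)
  proof (intro conjI allI impI)
    show "cls \<in> hom W Clg" by (rule cls_hom)
    show "cls \<in> epi W Clg" using cls_hom Cl_carrier by (simp add: epi_def)
    show "\<pi> U \<in> ring_hom (sect DA U) (sect R U)" if "openin X U" for U using \<pi>_ring_hom[OF that] .
    show "\<pi> V (restr DA U V p) = restr R U V (\<pi> U p)" if "openin X U \<and> openin X V \<and> V \<subseteq> U \<and> p \<in> carrier (sect DA U)" for U V p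
      using \<pi>_restr that by blast
    show b: "bij_betw (\<pi> U) (hcomp DA U D) (hcomp ?R U (cls D))" if "openin X U \<and> D \<in> carrier W" for U D
      using \<pi>_bij h that by simp
    show "\<pi> U ` hcomp DA U D \<subseteq> hcomp ?R U (cls D)" if "openin X U \<and> D \<in> carrier W" for U D
      using b[OF that] by (simp add: bij_betw_def)
  qed
  moreover have "graded_sheaf_on X Clg ?R" by (rule regrade_graded_sheaf[OF R_graded Cl_comm \<psi>_iso])
  ultimately show ?thesis unfolding cox_sheaf_def by blast
qed

end

section \<open>Cox sheaves satisfy the conditions\<close>

context krull_scheme_space
begin

lemma DS_carrier: "f \<in> DS D U \<Longrightarrow> f \<in> carrier FF"
  by (simp add: DS_def)

lemma DS_add:
  assumes f: "f \<in> DS D U" and g: "g \<in> DS D U"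
  shows "f \<oplus>\<^bsub>FF\<^esub> g \<in> DS D U"
proof (cases "f = \<zero>\<^bsub>FF\<^esub> \<or> g = \<zero>\<^bsub>FF\<^esub> \<or> f \<oplus>\<^bsub>FF\<^esub> g = \<zero>\<^bsub>FF\<^esub>")
  case True
  then show ?thesis using f g DS_carrier[OF f] DS_carrier[OF g] DS_zero by auto
next
  case False
  have "0 \<le> \<nu> Y (f \<oplus>\<^bsub>FF\<^esub> g) + D Y" if Y: "Y \<in> PD \<inter> U" for Y
  proof -
    interpret v: discretely_valued_field FF "\<nu> Y" using \<nu>_field Y by blast
    have "min (\<nu> Y f) (\<nu> Y g) \<le> \<nu> Y (f \<oplus>\<^bsub>FF\<^esub> g)" using v.val_add[of f g] False DS_carrier[OF f] DS_carrier[OF g] by blast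
    moreover have "0 \<le> \<nu> Y f + D Y" "0 \<le> \<nu> Y g + D Y" using f g False Y unfolding DS_def by blast+
    ultimately show ?thesis by linarith
  qed
  then show ?thesis using DS_carrier[OF f] DS_carrier[OF g] unfolding DS_def by blast
qed

lemma DS_mult:
  assumes f: "f \<in> DS D U" and g: "g \<in> DS E U"
  shows "f \<otimes>\<^bsub>FF\<^esub> g \<in> DS (D \<otimes>\<^bsub>W\<^esub> E) U"
proof (cases "f = \<zero>\<^bsub>FF\<^esub> \<or> g = \<zero>\<^bsub>FF\<^esub>")
  case True
  then have "f \<otimes>\<^bsub>FF\<^esub> g = \<zero>\<^bsub>FF\<^esub>" using DS_carrier[OF f] DS_carrier[OF g] by auto
  then show ?thesis using DS_zero by simp
next
  case False
  have "0 \<le> \<nu> Y (f \<otimes>\<^bsub>FF\<^esub> g) + (D \<otimes>\<^bsub>W\<^esub> E) Y" if Y: "Y \<in> PD \<inter> U" for Y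
  proof -
    interpret v: discretely_valued_field FF "\<nu> Y" using \<nu>_field Y by blast
    have "\<nu> Y (f \<otimes>\<^bsub>FF\<^esub> g) = \<nu> Y f + \<nu> Y g" using v.val_mult[of f g] False DS_carrier[OF f] DS_carrier[OF g] by blast
    moreover have "0 \<le> \<nu> Y f + D Y" "0 \<le> \<nu> Y g + E Y" using f g False Y unfolding DS_def by blast+
    ultimately show ?thesis using Y by (simp add: W_mult)
  qed
  then show ?thesis using DS_carrier[OF f] DS_carrier[OF g] unfolding DS_def by blast
qed

text \<open>The inequality defining \<open>DS\<close> fails at finitely many prime divisors only,
  and these are removed with \<open>avoid_divisors\<close>. The last clause makes it possible to
  keep inside V a prescribed Y at which the inequality holds.\<close>

lemma DS_exists:
  assumes D: "D \<in> carrier W" and f: "f \<in> carrier FF"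
  shows "\<exists>V. openin X V \<and> V \<noteq> {} \<and> f \<in> DS D V \<and> (\<forall>Y\<in>PD. 0 \<le> \<nu> Y f + D Y \<longrightarrow> Y \<in> V)"
proof (cases "f = \<zero>\<^bsub>FF\<^esub>")
  case True
  then show ?thesis using topspace_nonempty DS_zero PD_topspace by (intro exI[of _ "topspace X"]) simp
next
  case False
  define N where "N = {Y \<in> PD. \<nu> Y f + D Y < 0}"
  have "N \<subseteq> {Y \<in> PD. \<nu> Y f \<noteq> 0} \<union> {Y \<in> PD. D Y \<noteq> 0}" by (auto simp: N_def)
  then have "finite N" using \<nu>_finite[OF f False] D unfolding W_carrier by (meson finite_Un finite_subset)
  moreover have "N \<subseteq> PD" by (auto simp: N_def)
  ultimately obtain V where V: "openin X V" "V \<noteq> {}" "V \<inter> N = {}" "PD - N \<subseteq> V" by (metis avoid_divisors)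
  have "0 \<le> \<nu> Y f + D Y" if "Y \<in> PD \<inter> V" for Y using V(3) that by (force simp: N_def)
  then have "f \<in> DS D V" using f by (simp add: DS_def)
  moreover have "Y \<in> V" if "Y \<in> PD" "0 \<le> \<nu> Y f + D Y" for Y using V(4) that by (force simp: N_def)
  ultimately show ?thesis using V by blast
qed

lemma inv_FF:
  assumes f: "f \<in> carrier FF" "f \<noteq> \<zero>\<^bsub>FF\<^esub>"
  shows "inv\<^bsub>FF\<^esub> f \<in> carrier FF \<and> inv\<^bsub>FF\<^esub> f \<noteq> \<zero>\<^bsub>FF\<^esub> \<and> f \<otimes>\<^bsub>FF\<^esub> inv\<^bsub>FF\<^esub> f = \<one>\<^bsub>FF\<^esub>"
proof -
  have u: "f \<in> Units FF" using f by (simp add: FF.field_Units)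
  then have "inv\<^bsub>FF\<^esub> f \<in> Units FF" by (rule FF.Units_inv_Units)
  then have "inv\<^bsub>FF\<^esub> f \<in> carrier FF" "inv\<^bsub>FF\<^esub> f \<noteq> \<zero>\<^bsub>FF\<^esub>" by (simp_all add: FF.field_Units)
  then show ?thesis using FF.Units_r_inv[OF u] by simp
qed

end

text \<open>\<open>q D f U\<close> is the image of \<open>f \<chi>\<^sup>D\<close> in \<open>R(U)\<close>, and \<open>c D\<close> is its degree.\<close>

locale monomials = graded_on_krull X \<O> K R
  for X :: "'p topology" and \<O> :: "('p, 'r) ring_presheaf" and K :: "'k monoid" and R :: "('p, 'a, 'k) graded_presheaf" +
  fixes c :: "('p \<Rightarrow> int) \<Rightarrow> 'k" and q :: "('p \<Rightarrow> int) \<Rightarrow> ('p set \<times> 'r) set \<Rightarrow> 'p set \<Rightarrow> 'a"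
  assumes c_hom: "c \<in> hom W K" and c_surj: "c ` carrier W = carrier K"
    and c_ker: "D \<in> carrier W \<Longrightarrow> c D = \<one>\<^bsub>K\<^esub> \<longleftrightarrow> (\<exists>f\<in>carrier FF - {\<zero>\<^bsub>FF\<^esub>}. \<forall>Y\<in>PD. D Y = \<nu> Y f)"
    and q_bij: "openin X U \<Longrightarrow> U \<noteq> {} \<Longrightarrow> D \<in> carrier W \<Longrightarrow> bij_betw (\<lambda>f. q D f U) (DS D U) (hcomp R U (c D))"
    and q_add: "openin X U \<Longrightarrow> U \<noteq> {} \<Longrightarrow> D \<in> carrier W \<Longrightarrow> f \<in> DS D U \<Longrightarrow> g \<in> DS D U
      \<Longrightarrow> q D (f \<oplus>\<^bsub>FF\<^esub> g) U = q D f U \<oplus>\<^bsub>sect R U\<^esub> q D g U"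
    and q_mult: "openin X U \<Longrightarrow> U \<noteq> {} \<Longrightarrow> D \<in> carrier W \<Longrightarrow> E \<in> carrier W \<Longrightarrow> f \<in> DS D U \<Longrightarrow> g \<in> DS E U
      \<Longrightarrow> q (D \<otimes>\<^bsub>W\<^esub> E) (f \<otimes>\<^bsub>FF\<^esub> g) U = q D f U \<otimes>\<^bsub>sect R U\<^esub> q E g U"
    and q_one: "openin X U \<Longrightarrow> U \<noteq> {} \<Longrightarrow> q \<one>\<^bsub>W\<^esub> \<one>\<^bsub>FF\<^esub> U = \<one>\<^bsub>sect R U\<^esub>"
    and q_restr: "openin X U \<Longrightarrow> openin X V \<Longrightarrow> V \<noteq> {} \<Longrightarrow> V \<subseteq> U \<Longrightarrow> D \<in> carrier W \<Longrightarrow> f \<in> DS D U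
      \<Longrightarrow> restr R U V (q D f U) = q D f V"
begin

lemma c_closed: "D \<in> carrier W \<Longrightarrow> c D \<in> carrier K"
  using c_surj by blast

lemma c_one: "c \<one>\<^bsub>W\<^esub> = \<one>\<^bsub>K\<^esub>"
  using hom_one[OF c_hom W.is_group K.is_group] .

lemma q_in: "openin X U \<Longrightarrow> U \<noteq> {} \<Longrightarrow> D \<in> carrier W \<Longrightarrow> f \<in> DS D U \<Longrightarrow> q D f U \<in> hcomp R U (c D)"
  using q_bij[of U D] unfolding bij_betw_def by blast

lemma q_carrier: "openin X U \<Longrightarrow> U \<noteq> {} \<Longrightarrow> D \<in> carrier W \<Longrightarrow> f \<in> DS D U \<Longrightarrow> q D f U \<in> carrier (sect R U)"
  using q_in R_hcarrier c_closed by blast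

lemma q_surj: "openin X U \<Longrightarrow> U \<noteq> {} \<Longrightarrow> D \<in> carrier W \<Longrightarrow> s \<in> hcomp R U (c D) \<Longrightarrow> \<exists>f\<in>DS D U. s = q D f U"
  using q_bij[of U D] unfolding bij_betw_def by (metis imageE)

definition dom where "dom D f = (SOME V. openin X V \<and> V \<noteq> {} \<and> f \<in> DS D V)"

definition \<tau> where "\<tau> D f = gr (dom D f) (q D f (dom D f))"

text \<open>Two open sets on which the monomial is defined meet, and over the intersection both
  versions restrict to the same section.\<close>

lemma \<tau>_eq:
  assumes D: "D \<in> carrier W" and V: "openin X V" "V \<noteq> {}" "f \<in> DS D V"
  shows "\<tau> D f = gr V (q D f V)"
proof -
  define V' where "V' = dom D f"
  have V': "openin X V' \<and> V' \<noteq> {} \<and> f \<in> DS D V'" unfolding V'_def dom_def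
    by (rule someI[of "\<lambda>V. openin X V \<and> V \<noteq> {} \<and> f \<in> DS D V" V]) (use V in blast)
  define T where "T = V \<inter> V'"
  have T: "openin X T" "T \<noteq> {}" "T \<subseteq> V" "T \<subseteq> V'" using V V' open_Int_nonempty[of V V'] by (auto simp: T_def)
  have n: "rp.nbhd V" "rp.nbhd V'" "rp.nbhd T" using V V' T rp_nbhd_iff by blast+
  have "gr V (q D f V) = gr T (restr R V T (q D f V))"
    using rp.germ_restr[OF n(1) _ n(3) T(3)] q_carrier[OF V(1,2) D V(3)] by simp
  also have "restr R V T (q D f V) = q D f T" using q_restr[OF V(1) T(1,2,3) D V(3)] .
  also have "q D f T = restr R V' T (q D f V')" using q_restr[OF _ T(1,2,4) D] V' by simp
  also have "gr T \<dots> = gr V' (q D f V')"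
    using rp.germ_restr[OF n(2) _ n(3) T(4)] q_carrier[OF _ _ D] V' by simp
  finally show ?thesis by (simp add: \<tau>_def V'_def)
qed

lemma \<tau>_in:
  assumes D: "D \<in> carrier W" and f: "f \<in> carrier FF"
  shows "\<tau> D f \<in> SG (c D)"
proof -
  obtain V where V: "openin X V" "V \<noteq> {}" "f \<in> DS D V" using DS_exists[OF D f] by blast
  then show ?thesis using \<tau>_eq[OF D V] SG_germ[of V "q D f V"] q_in[OF V(1,2) D V(3)] rp_nbhd_iff by simp
qed

lemma \<tau>_closed: "D \<in> carrier W \<Longrightarrow> f \<in> carrier FF \<Longrightarrow> \<tau> D f \<in> carrier Q"
  using \<tau>_in c_closed Q.G_carrier by blast

lemma \<tau>_surj:
  assumes D: "D \<in> carrier W" and a: "a \<in> SG (c D)"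
  shows "\<exists>f\<in>carrier FF. a = \<tau> D f"
proof -
  obtain V s where V: "rp.nbhd V" "s \<in> hcomp R V (c D)" "a = gr V s" using a unfolding SG_mem by metis
  have o: "openin X V" "V \<noteq> {}" using V rp_nbhd_iff by blast+
  obtain f where f: "f \<in> DS D V" "s = q D f V" using q_surj[OF o D V(2)] by metis
  then show ?thesis using \<tau>_eq[OF D o f(1)] V(3) DS_carrier[OF f(1)] by (intro bexI[of _ f]) simp_all
qed

lemma \<tau>_common:
  assumes D: "D \<in> carrier W" "f \<in> carrier FF" and E: "E \<in> carrier W" "g \<in> carrier FF"
  obtains V where "openin X V" "V \<noteq> {}" "f \<in> DS D V" "g \<in> DS E V"
proof -
  obtain V where V: "openin X V" "V \<noteq> {}" "f \<in> DS D V" using DS_exists[OF D] by blast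
  obtain V' where V': "openin X V'" "V' \<noteq> {}" "g \<in> DS E V'" using DS_exists[OF E] by blast
  show thesis
    by (rule that[of "V \<inter> V'"]) (use V V' open_Int_nonempty[OF V(1,2) V'(1,2)] DS_mono[of "V \<inter> V'"] in auto)
qed

lemma \<tau>_add:
  assumes D: "D \<in> carrier W" and f: "f \<in> carrier FF" and g: "g \<in> carrier FF"
  shows "\<tau> D (f \<oplus>\<^bsub>FF\<^esub> g) = \<tau> D f \<oplus>\<^bsub>Q\<^esub> \<tau> D g"
proof -
  obtain V where V: "openin X V" "V \<noteq> {}" "f \<in> DS D V" "g \<in> DS D V" using \<tau>_common[OF D f D g] by metis
  have n: "rp.nbhd V" using V rp_nbhd_iff by blast
  show ?thesis
    using \<tau>_eq[OF D V(1,2) DS_add[OF V(3,4)]] \<tau>_eq[OF D V(1,2,3)] \<tau>_eq[OF D V(1,2,4)] q_add[OF V(1,2) D V(3,4)]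
      rp.germ_add[OF n q_carrier[OF V(1,2) D V(3)] q_carrier[OF V(1,2) D V(4)]] by simp
qed

lemma \<tau>_mult:
  assumes D: "D \<in> carrier W" "f \<in> carrier FF" and E: "E \<in> carrier W" "g \<in> carrier FF"
  shows "\<tau> (D \<otimes>\<^bsub>W\<^esub> E) (f \<otimes>\<^bsub>FF\<^esub> g) = \<tau> D f \<otimes>\<^bsub>Q\<^esub> \<tau> E g"
proof -
  obtain V where V: "openin X V" "V \<noteq> {}" "f \<in> DS D V" "g \<in> DS E V" using \<tau>_common[OF D E] by metis
  have n: "rp.nbhd V" using V rp_nbhd_iff by blast
  show ?thesis
    using \<tau>_eq[OF W.m_closed[OF D(1) E(1)] V(1,2) DS_mult[OF V(3,4)]] \<tau>_eq[OF D(1) V(1,2,3)] \<tau>_eq[OF E(1) V(1,2,4)] q_mult[OF V(1,2) D(1) E(1) V(3,4)]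
      rp.germ_mult[OF n q_carrier[OF V(1,2) D(1) V(3)] q_carrier[OF V(1,2) E(1) V(4)]] by simp
qed

lemma \<tau>_one: "\<tau> \<one>\<^bsub>W\<^esub> \<one>\<^bsub>FF\<^esub> = \<one>\<^bsub>Q\<^esub>"
proof -
  obtain V where V: "openin X V" "V \<noteq> {}" "\<one>\<^bsub>FF\<^esub> \<in> DS \<one>\<^bsub>W\<^esub> V" using DS_exists[OF W.one_closed FF.one_closed] by blast
  then show ?thesis using \<tau>_eq[OF W.one_closed V] q_one[OF V(1,2)] rp.germ_one[of V] rp_nbhd_iff by simp
qed

text \<open>Equal germs come from sections that are equal over some non-empty open set, where
  \<open>q_bij\<close> applies.\<close>

lemma \<tau>_inj:
  assumes D: "D \<in> carrier W" and f: "f \<in> carrier FF" and g: "g \<in> carrier FF" and eq: "\<tau> D f = \<tau> D g"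
  shows "f = g"
proof -
  obtain V where V: "openin X V" "V \<noteq> {}" "f \<in> DS D V" "g \<in> DS D V" using \<tau>_common[OF D f D g] by metis
  have n: "rp.nbhd V" using V rp_nbhd_iff by blast
  have "gr V (q D f V) = gr V (q D g V)" using eq \<tau>_eq[OF D V(1,2,3)] \<tau>_eq[OF D V(1,2,4)] by simp
  then obtain T where T: "rp.nbhd T" "T \<subseteq> V \<inter> V" "restr R V T (q D f V) = restr R V T (q D g V)"
    using rp.germ_eq_iff[OF n q_carrier[OF V(1,2) D V(3)] n q_carrier[OF V(1,2) D V(4)]] by metis
  have o: "openin X T" "T \<noteq> {}" "T \<subseteq> V" using T rp_nbhd_iff by auto
  have "q D f T = q D g T" using T(3) q_restr[OF V(1) o D V(3)] q_restr[OF V(1) o D V(4)] by simp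
  moreover have "f \<in> DS D T" "g \<in> DS D T" using DS_mono[OF o(3)] V by auto
  ultimately show ?thesis using q_bij[OF o(1,2) D] unfolding bij_betw_def by (meson inj_onD)
qed

lemma \<tau>_zero: assumes D: "D \<in> carrier W" shows "\<tau> D \<zero>\<^bsub>FF\<^esub> = \<zero>\<^bsub>Q\<^esub>"
proof -
  have "\<tau> D \<zero>\<^bsub>FF\<^esub> \<oplus>\<^bsub>Q\<^esub> \<tau> D \<zero>\<^bsub>FF\<^esub> = \<tau> D \<zero>\<^bsub>FF\<^esub>"
    using \<tau>_add[OF D FF.zero_closed FF.zero_closed] unfolding FF.r_zero[OF FF.zero_closed] by (rule sym)
  then show ?thesis using \<tau>_closed[OF D FF.zero_closed] rp.S.add.l_cancel_one by simp
qed

lemma \<tau>_eq_zero: "D \<in> carrier W \<Longrightarrow> f \<in> carrier FF \<Longrightarrow> \<tau> D f = \<zero>\<^bsub>Q\<^esub> \<longleftrightarrow> f = \<zero>\<^bsub>FF\<^esub>"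
  using \<tau>_inj[of D f "\<zero>\<^bsub>FF\<^esub>"] \<tau>_zero[of D] FF.zero_closed by metis

lemma \<tau>_inv:
  assumes D: "D \<in> carrier W" and f: "f \<in> carrier FF" "f \<noteq> \<zero>\<^bsub>FF\<^esub>"
  shows "\<tau> D f \<otimes>\<^bsub>Q\<^esub> \<tau> (inv\<^bsub>W\<^esub> D) (inv\<^bsub>FF\<^esub> f) = \<one>\<^bsub>Q\<^esub>"
  using \<tau>_mult[OF D f(1) W.inv_closed[OF D], of "inv\<^bsub>FF\<^esub> f"] inv_FF[OF f] by (simp only: W.r_inv[OF D] \<tau>_one)

lemma H_\<tau>: "a \<in> H \<Longrightarrow> \<exists>D f. D \<in> carrier W \<and> f \<in> carrier FF \<and> f \<noteq> \<zero>\<^bsub>FF\<^esub> \<and> a = \<tau> D f"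
proof -
  assume a: "a \<in> H"
  then obtain w where w: "w \<in> carrier K" "a \<in> SG w" "a \<noteq> \<zero>\<^bsub>Q\<^esub>" using H_iff by metis
  obtain D where D: "D \<in> carrier W" "w = c D" using w(1) c_surj by (metis imageE)
  obtain f where f: "f \<in> carrier FF" "a = \<tau> D f" using \<tau>_surj[OF D(1)] w(2) D(2) by metis
  then have "f \<noteq> \<zero>\<^bsub>FF\<^esub>" using w(3) \<tau>_zero[OF D(1)] by metis
  then show ?thesis using D f by metis
qed

text \<open>By \<open>H_\<tau>\<close> every non-zero homogeneous element is a monomial f chi^D with
  f non-zero, and the monomial formed from the inverse of f and from -D inverts it.\<close>

lemma simple: "graded_simple K Q SG"
  unfolding graded_simple_def
proof (intro conjI)
  show "graded_ring K Q SG" by (rule Q_graded)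
  have "\<one>\<^bsub>Q\<^esub> \<noteq> \<zero>\<^bsub>Q\<^esub>" using \<tau>_eq_zero[OF W.one_closed FF.one_closed] \<tau>_one by simp
  then show "carrier Q \<noteq> {\<zero>\<^bsub>Q\<^esub>}" using rp.S.one_closed by blast
  show "H \<subseteq> Units Q"
  proof
    fix a assume "a \<in> H"
    then obtain D f where D: "D \<in> carrier W" "f \<in> carrier FF" "f \<noteq> \<zero>\<^bsub>FF\<^esub>" "a = \<tau> D f" using H_\<tau> by metis
    have c1: "a \<in> carrier Q" "\<tau> (inv\<^bsub>W\<^esub> D) (inv\<^bsub>FF\<^esub> f) \<in> carrier Q" using \<tau>_closed D inv_FF[OF D(2,3)] by simp_all
    have "a \<otimes>\<^bsub>Q\<^esub> \<tau> (inv\<^bsub>W\<^esub> D) (inv\<^bsub>FF\<^esub> f) = \<one>\<^bsub>Q\<^esub>" using \<tau>_inv[OF D(1,2,3)] D(4) by simp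
    then show "a \<in> Units Q" using c1 rp.S.m_comm[OF c1] unfolding Units_def by force
  qed
qed

sublocale graded_simple_krull X \<O> K R
  by unfold_locales (rule simple)

lemma \<tau>_H: "D \<in> carrier W \<Longrightarrow> f \<in> carrier FF \<Longrightarrow> f \<noteq> \<zero>\<^bsub>FF\<^esub> \<Longrightarrow> \<tau> D f \<in> H"
  using SG_H[OF c_closed \<tau>_in, of D f] \<tau>_eq_zero[of D f] by simp

text \<open>A rational function \<open>h\<close> with a simple pole along \<open>Y\<close> shows that \<open>f \<chi>\<^sup>D\<close>, if it becomes \<open>1\<close>,
  does not vanish along \<open>Y\<close>: otherwise \<open>h = h f \<chi>\<^sup>D\<close> would be regular at \<open>Y\<close>.\<close>

lemma trivial_monomial_le:
  assumes D: "D \<in> carrier W" and f: "f \<in> carrier FF" "f \<noteq> \<zero>\<^bsub>FF\<^esub>" and one: "\<tau> D f = \<one>\<^bsub>Q\<^esub>" and Y: "Y \<in> PD"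
  shows "\<nu> Y f + D Y \<le> 0"
proof (rule ccontr)
  assume n: "\<not> \<nu> Y f + D Y \<le> 0"
  interpret v: discretely_valued_field FF "\<nu> Y" using \<nu>_field[OF Y] .
  obtain h where h: "h \<in> carrier FF" "h \<noteq> \<zero>\<^bsub>FF\<^esub>" "\<nu> Y h = - 1" using v.val_surj[of "-1"] by blast
  have fh: "f \<otimes>\<^bsub>FF\<^esub> h \<in> carrier FF" "\<nu> Y (f \<otimes>\<^bsub>FF\<^esub> h) = \<nu> Y f - 1" using f h v.val_mult[of f h] by auto
  \<comment> \<open>As \<open>\<nu> Y f + D Y\<close> is at least 1, there is room for one more
    pole: f h still satisfies the inequality at Y, so V can be taken to contain Y.\<close>
  obtain V where V: "openin X V" "V \<noteq> {}" "f \<otimes>\<^bsub>FF\<^esub> h \<in> DS D V" and YV: "Y \<in> V"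
    using DS_exists[OF D fh(1)] Y n fh(2) by force
  have nb: "rp.nbhd V" using V rp_nbhd_iff by blast
  have "c D = \<one>\<^bsub>K\<^esub>"
    using Q.degree_unique[OF c_closed[OF D] K.one_closed _ Q.one_in_G one_not_zero] \<tau>_in[OF D f(1)] one by simp
  \<comment> \<open>The monomial f h chi^D has degree zero, so over V it is also of the form g
    chi^0. Comparing germs gives g = h, although h has a pole along Y and g has none.\<close>
  then have "q D (f \<otimes>\<^bsub>FF\<^esub> h) V \<in> hcomp R V (c \<one>\<^bsub>W\<^esub>)" using q_in[OF V(1,2) D V(3)] c_one by simp
  then obtain g where g: "g \<in> DS \<one>\<^bsub>W\<^esub> V" "q D (f \<otimes>\<^bsub>FF\<^esub> h) V = q \<one>\<^bsub>W\<^esub> g V" using q_surj[OF V(1,2) W.one_closed] by metis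
  have "\<tau> \<one>\<^bsub>W\<^esub> g = \<tau> D (f \<otimes>\<^bsub>FF\<^esub> h)" using \<tau>_eq[OF D V] \<tau>_eq[OF W.one_closed V(1,2) g(1)] g(2) by simp
  also have "\<dots> = \<tau> D f \<otimes>\<^bsub>Q\<^esub> \<tau> \<one>\<^bsub>W\<^esub> h" using \<tau>_mult[OF D f(1) W.one_closed h(1)] D by simp
  also have "\<dots> = \<tau> \<one>\<^bsub>W\<^esub> h" using one \<tau>_closed[OF W.one_closed h(1)] by simp
  finally have "g = h" by (rule \<tau>_inj[OF W.one_closed DS_carrier[OF g(1)] h(1)])
  then have "0 \<le> \<nu> Y h + \<one>\<^bsub>W\<^esub> Y" using g(1) h(2) Y YV unfolding DS_def by blast
  then show False using h(3) Y by (simp add: W_one)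
qed

text \<open>The inverse monomial becomes 1 as well, and the inequality for it is the reverse
  one.\<close>

lemma trivial_monomial:
  assumes D: "D \<in> carrier W" and f: "f \<in> carrier FF" "f \<noteq> \<zero>\<^bsub>FF\<^esub>" and one: "\<tau> D f = \<one>\<^bsub>Q\<^esub>" and Y: "Y \<in> PD"
  shows "\<nu> Y f + D Y = 0"
proof -
  interpret v: discretely_valued_field FF "\<nu> Y" using \<nu>_field[OF Y] .
  have i: "inv\<^bsub>FF\<^esub> f \<in> carrier FF" "inv\<^bsub>FF\<^esub> f \<noteq> \<zero>\<^bsub>FF\<^esub>" using inv_FF[OF f] by auto
  have "\<tau> (inv\<^bsub>W\<^esub> D) (inv\<^bsub>FF\<^esub> f) = \<one>\<^bsub>Q\<^esub>" using \<tau>_inv[OF D f] one \<tau>_closed[OF W.inv_closed[OF D] i(1)] by simp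
  then have "\<nu> Y (inv\<^bsub>FF\<^esub> f) + (inv\<^bsub>W\<^esub> D) Y \<le> 0" by (rule trivial_monomial_le[OF W.inv_closed[OF D] i _ Y])
  then show ?thesis using trivial_monomial_le[OF D f one Y] v.val_inv[OF f] Y by (simp add: W_inv[OF D])
qed

text \<open>An element has many presentations as a monomial, so one is chosen;
  \<open>m_\<tau>\<close> shows that the value is independent of it.\<close>

definition m where "m Y a = (let p = SOME p. fst p \<in> carrier W \<and> snd p \<in> carrier FF \<and> snd p \<noteq> \<zero>\<^bsub>FF\<^esub> \<and> a = \<tau> (fst p) (snd p)
   in \<nu> Y (snd p) + fst p Y)"

text \<open>The quotient of two presentations of the same element becomes 1, and
  \<open>trivial_monomial\<close> then equates the values computed from them.\<close>

lemma m_\<tau>: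
  assumes D: "D \<in> carrier W" and f: "f \<in> carrier FF" "f \<noteq> \<zero>\<^bsub>FF\<^esub>" and Y: "Y \<in> PD"
  shows "m Y (\<tau> D f) = \<nu> Y f + D Y"
proof -
  interpret v: discretely_valued_field FF "\<nu> Y" using \<nu>_field[OF Y] .
  define p where "p = (SOME p. fst p \<in> carrier W \<and> snd p \<in> carrier FF \<and> snd p \<noteq> \<zero>\<^bsub>FF\<^esub> \<and> \<tau> D f = \<tau> (fst p) (snd p))"
  define E g where "E = fst p" and "g = snd p"
  have "fst p \<in> carrier W \<and> snd p \<in> carrier FF \<and> snd p \<noteq> \<zero>\<^bsub>FF\<^esub> \<and> \<tau> D f = \<tau> (fst p) (snd p)"
    unfolding p_def by (rule someI[of _ "(D, f)"]) (use D f in simp)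
  then have E: "E \<in> carrier W" and g: "g \<in> carrier FF" "g \<noteq> \<zero>\<^bsub>FF\<^esub>" and eq: "\<tau> D f = \<tau> E g" by (simp_all add: E_def g_def)
  have i: "inv\<^bsub>FF\<^esub> g \<in> carrier FF" "inv\<^bsub>FF\<^esub> g \<noteq> \<zero>\<^bsub>FF\<^esub>" using inv_FF[OF g] by auto
  have nz: "f \<otimes>\<^bsub>FF\<^esub> inv\<^bsub>FF\<^esub> g \<noteq> \<zero>\<^bsub>FF\<^esub>" using FF.integral[of f "inv\<^bsub>FF\<^esub> g"] f i by blast
  have "\<tau> (D \<otimes>\<^bsub>W\<^esub> inv\<^bsub>W\<^esub> E) (f \<otimes>\<^bsub>FF\<^esub> inv\<^bsub>FF\<^esub> g) = \<one>\<^bsub>Q\<^esub>"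
    using \<tau>_mult[OF D f(1) W.inv_closed[OF E] i(1)] \<tau>_inv[OF E g] eq by simp
  then have "\<nu> Y (f \<otimes>\<^bsub>FF\<^esub> inv\<^bsub>FF\<^esub> g) + (D \<otimes>\<^bsub>W\<^esub> inv\<^bsub>W\<^esub> E) Y = 0"
    using trivial_monomial[OF W.m_closed[OF D W.inv_closed[OF E]] FF.m_closed[OF f(1) i(1)] nz _ Y] by blast
  moreover have "\<nu> Y (f \<otimes>\<^bsub>FF\<^esub> inv\<^bsub>FF\<^esub> g) = \<nu> Y f - \<nu> Y g" using v.val_mult[OF f i] v.val_inv[OF g] by simp
  ultimately have "\<nu> Y f + D Y = \<nu> Y g + E Y" using Y by (simp add: W_mult W_inv[OF E])
  then show ?thesis unfolding m_def Let_def p_def[symmetric] by (simp add: E_def g_def)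
qed

lemma gval_m: assumes Y: "Y \<in> PD" shows "gval (m Y)"
proof -
  interpret v: discretely_valued_field FF "\<nu> Y" using \<nu>_field[OF Y] .
  have hom: "m Y (a \<otimes>\<^bsub>Q\<^esub> b) = m Y a + m Y b" if ab: "a \<in> H" "b \<in> H" for a b
  proof -
    obtain D f where D: "D \<in> carrier W" "f \<in> carrier FF" "f \<noteq> \<zero>\<^bsub>FF\<^esub>" "a = \<tau> D f" using H_\<tau>[OF ab(1)] by metis
    obtain E g where E: "E \<in> carrier W" "g \<in> carrier FF" "g \<noteq> \<zero>\<^bsub>FF\<^esub>" "b = \<tau> E g" using H_\<tau>[OF ab(2)] by metis
    have nz: "f \<otimes>\<^bsub>FF\<^esub> g \<noteq> \<zero>\<^bsub>FF\<^esub>" using FF.integral[of f g] D E by blast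
    have "m Y (\<tau> (D \<otimes>\<^bsub>W\<^esub> E) (f \<otimes>\<^bsub>FF\<^esub> g)) = \<nu> Y f + \<nu> Y g + (D Y + E Y)"
      using m_\<tau>[OF W.m_closed[OF D(1) E(1)] FF.m_closed[OF D(2) E(2)] nz Y] v.val_mult[OF D(2,3) E(2,3)] Y by (simp add: W_mult)
    then show ?thesis using \<tau>_mult[OF D(1,2) E(1,2)] m_\<tau>[OF D(1,2,3) Y] m_\<tau>[OF E(1,2,3) Y] D(4) E(4) by simp
  qed
  have surj: "\<exists>a\<in>H. m Y a = n" for n
  proof -
    obtain h where h: "h \<in> carrier FF" "h \<noteq> \<zero>\<^bsub>FF\<^esub>" "\<nu> Y h = n" using v.val_surj[of n] by blast
    have "m Y (\<tau> \<one>\<^bsub>W\<^esub> h) = n" using m_\<tau>[OF W.one_closed h(1,2) Y] h(3) Y by (simp add: W_one)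
    then show ?thesis using \<tau>_H[OF W.one_closed h(1,2)] by blast
  qed
  \<comment> \<open>Elements of the same degree can be written with the same D. Their sum is then a
    monomial with this D, and the inequality reduces to that of \<open>\<nu> Y\<close>.\<close>
  have add: "min (m Y a) (m Y b) \<le> m Y (a \<oplus>\<^bsub>Q\<^esub> b)"
    if w: "w \<in> carrier K" and a: "a \<in> SG w" "a \<noteq> \<zero>\<^bsub>Q\<^esub>" and b: "b \<in> SG w" "b \<noteq> \<zero>\<^bsub>Q\<^esub>" and ab: "a \<oplus>\<^bsub>Q\<^esub> b \<noteq> \<zero>\<^bsub>Q\<^esub>" for w a b
  proof -
    obtain D where D: "D \<in> carrier W" "w = c D" using w c_surj by (metis imageE)
    obtain f where f: "f \<in> carrier FF" "a = \<tau> D f" using \<tau>_surj[OF D(1)] a D(2) by metis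
    obtain g where g: "g \<in> carrier FF" "b = \<tau> D g" using \<tau>_surj[OF D(1)] b D(2) by metis
    have s: "a \<oplus>\<^bsub>Q\<^esub> b = \<tau> D (f \<oplus>\<^bsub>FF\<^esub> g)" using \<tau>_add[OF D(1) f(1) g(1)] f g by simp
    have nz: "f \<noteq> \<zero>\<^bsub>FF\<^esub>" "g \<noteq> \<zero>\<^bsub>FF\<^esub>" "f \<oplus>\<^bsub>FF\<^esub> g \<noteq> \<zero>\<^bsub>FF\<^esub>" using \<tau>_zero[OF D(1)] f g a b ab s by metis+
    have "min (\<nu> Y f) (\<nu> Y g) \<le> \<nu> Y (f \<oplus>\<^bsub>FF\<^esub> g)" by (rule v.val_add[OF f(1) nz(1) g(1) nz(2,3)])
    then show ?thesis
      using m_\<tau>[OF D(1) f(1) nz(1) Y] m_\<tau>[OF D(1) g(1) nz(2) Y] m_\<tau>[OF D(1) FF.a_closed[OF f(1) g(1)] nz(3) Y] s f(2) g(2) by simp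
  qed
  have "m Y \<in> hom (homog_monoid K Q SG) integer_group" by (rule homI) (simp_all add: homog_monoid_def hom)
  moreover have "m Y ` H = UNIV" using surj by (metis UNIV_eq_I image_eqI)
  ultimately show ?thesis unfolding gval_def graded_valuation_def epi_def
    using add by (simp add: homog_monoid_def)
qed

lemma gr_hcomp:
  assumes U: "openin X U" "U \<noteq> {}" and D: "D \<in> carrier W" and f: "f \<in> carrier FF"
  shows "\<tau> D f \<in> gr U ` hcomp R U (c D) \<longleftrightarrow> f \<in> DS D U"
proof
  assume "\<tau> D f \<in> gr U ` hcomp R U (c D)"
  then obtain s where s: "s \<in> hcomp R U (c D)" "\<tau> D f = gr U s" by (metis imageE)
  then obtain g where g: "g \<in> DS D U" "s = q D g U" using q_surj[OF U D] by metis
  then have "\<tau> D f = \<tau> D g" using s(2) \<tau>_eq[OF D U g(1)] by simp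
  then have "f = g" by (rule \<tau>_inj[OF D f DS_carrier[OF g(1)]])
  then show "f \<in> DS D U" using g(1) by simp
next
  assume fD: "f \<in> DS D U"
  then show "\<tau> D f \<in> gr U ` hcomp R U (c D)" unfolding \<tau>_eq[OF D U fD] using q_in[OF U D fD] by blast
qed

text \<open>Written for a = f chi^D, the condition on the right is the inequality that defines
  \<open>DS D U\<close>.\<close>

lemma nonneg_iff:
  assumes U: "openin X U" "U \<noteq> {}" and w: "w \<in> carrier K" and a: "a \<in> SG w"
  shows "a \<in> gr U ` hcomp R U w \<longleftrightarrow> (\<forall>Y\<in>PD \<inter> U. a = \<zero>\<^bsub>Q\<^esub> \<or> 0 \<le> m Y a)"
proof -
  obtain D where D: "D \<in> carrier W" "w = c D" using w c_surj by (metis imageE)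
  obtain f where f: "f \<in> carrier FF" "a = \<tau> D f" using \<tau>_surj[OF D(1)] a D(2) by metis
  have "f \<in> DS D U \<longleftrightarrow> (\<forall>Y\<in>PD \<inter> U. a = \<zero>\<^bsub>Q\<^esub> \<or> 0 \<le> m Y a)"
  proof (cases "f = \<zero>\<^bsub>FF\<^esub>")
    case True
    then have "a = \<zero>\<^bsub>Q\<^esub>" using f(2) \<tau>_zero[OF D(1)] by simp
    then show ?thesis using True DS_zero by simp
  next
    case False
    then have "a \<noteq> \<zero>\<^bsub>Q\<^esub>" using f \<tau>_eq_zero[OF D(1) f(1)] by simp
    then show ?thesis using False f m_\<tau>[OF D(1) f(1) False] by (simp add: DS_def)
  qed
  then show ?thesis using gr_hcomp[OF U D(1) f(1)] f(2) D(2) by simp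
qed

sublocale krull_sheaf X \<O> K R m
proof
  show "gval (m Y)" if "Y \<in> PD" for Y using gval_m[OF that] .
  fix U assume U: "openin X U" "U \<noteq> {}"
  interpret U: graded K "sect R U" "hcomp R U" using R_comp[OF U(1)] .
  have n: "rp.nbhd U" using U rp_nbhd_iff by blast
  \<comment> \<open>Within one degree sections are monomials for a common D and
    \<open>\<tau>_inj\<close> applies; arbitrary sections are then compared component by
    component.\<close>
  have hinj: "s = s'" if w: "w \<in> carrier K" and s: "s \<in> hcomp R U w" "s' \<in> hcomp R U w" and eq: "gr U s = gr U s'" for w s s'
  proof -
    obtain D where D: "D \<in> carrier W" "w = c D" using w c_surj by (metis imageE)
    obtain f where f: "f \<in> DS D U" "s = q D f U" using q_surj[OF U D(1)] s D(2) by metis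
    obtain g where g: "g \<in> DS D U" "s' = q D g U" using q_surj[OF U D(1)] s D(2) by metis
    have "\<tau> D f = \<tau> D g" using eq f g \<tau>_eq[OF D(1) U f(1)] \<tau>_eq[OF D(1) U g(1)] by simp
    then have "f = g" by (rule \<tau>_inj[OF D(1) DS_carrier[OF f(1)] DS_carrier[OF g(1)]])
    then show ?thesis using f g by simp
  qed
  show "inj_on (gr U) (carrier (sect R U))"
  proof (rule inj_onI)
    fix s s' assume s: "s \<in> carrier (sect R U)" "s' \<in> carrier (sect R U)" and eq: "gr U s = gr U s'"
    show "s = s'"
    proof (rule U.comp_eqI[OF s])
      fix v assume v: "v \<in> carrier K"
      show "U.comp s v = U.comp s' v"
        by (rule hinj[OF v U.comp_in[OF s(1) v] U.comp_in[OF s(2) v]]) (use comp_germ[OF U s(1) v] comp_germ[OF U s(2) v] eq in simp)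
    qed
  qed
  show "gr U ` carrier (sect R U) = {a \<in> carrier Q. \<forall>w\<in>carrier K. \<forall>Y\<in>PD \<inter> U. Q.comp a w = \<zero>\<^bsub>Q\<^esub> \<or> 0 \<le> m Y (Q.comp a w)}" (is "?L = ?R")
  proof (intro equalityI subsetI)
    fix a assume "a \<in> ?L"
    then obtain s where s: "s \<in> carrier (sect R U)" "a = gr U s" by (metis imageE)
    have aQ: "a \<in> carrier Q" using s n by simp
    have "\<forall>Y\<in>PD \<inter> U. Q.comp a w = \<zero>\<^bsub>Q\<^esub> \<or> 0 \<le> m Y (Q.comp a w)" if w: "w \<in> carrier K" for w
    proof -
      have "Q.comp a w \<in> gr U ` hcomp R U w" using comp_germ[OF U s(1) w] U.comp_in[OF s(1) w] s(2) by simp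
      then show ?thesis using nonneg_iff[OF U w Q.comp_in[OF aQ w]] by blast
    qed
    then show "a \<in> ?R" using aQ by blast
  next
    fix a assume a: "a \<in> ?R"
    then have aQ: "a \<in> carrier Q" by blast
    \<comment> \<open>Each component lifts to a homogeneous section over U by
      \<open>nonneg_iff\<close>, and the finitely many lifts are added.\<close>
    have "\<forall>w\<in>Q.supp a. \<exists>s. s \<in> hcomp R U w \<and> Q.comp a w = gr U s"
    proof
      fix w assume "w \<in> Q.supp a"
      then have w: "w \<in> carrier K" by blast
      have "Q.comp a w \<in> gr U ` hcomp R U w" unfolding nonneg_iff[OF U w Q.comp_in[OF aQ w]] using a w by blast
      then show "\<exists>s. s \<in> hcomp R U w \<and> Q.comp a w = gr U s" by (metis imageE)
    qed
    from bchoice[OF this] obtain s where s': "\<forall>w\<in>Q.supp a. s w \<in> hcomp R U w \<and> Q.comp a w = gr U (s w)"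
      by (elim exE) (rule that)
    note s = bspec[OF s']
    have sc: "s w \<in> carrier (sect R U)" if "w \<in> Q.supp a" for w using s[OF that] U.G_carrier[of w "s w"] that by simp
    have "gr U (finsum (sect R U) s (Q.supp a)) = finsum Q (\<lambda>w. gr U (s w)) (Q.supp a)"
      by (rule rp.germ_finsum[OF n Q.supp_finite[OF aQ] sc])
    also have "\<dots> = finsum Q (Q.comp a) (Q.supp a)"
    proof (rule rp.S.finsum_cong')
      show "Q.comp a \<in> Q.supp a \<rightarrow> carrier Q" using Q.comp_closed[OF aQ] by blast
      show "gr U (s w) = Q.comp a w" if "w \<in> Q.supp a" for w using s[OF that] by simp
    qed simp
    also have "\<dots> = a" using Q.comp_sum[OF aQ] by simp
    finally have "a = gr U (finsum (sect R U) s (Q.supp a))" by simp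
    moreover have "finsum (sect R U) s (Q.supp a) \<in> carrier (sect R U)" by (rule U.A.finsum_closed) (use sc in blast)
    ultimately show "a \<in> ?L" by blast
  qed
qed

text \<open>A rational function f is identified with the monomial f chi^0; over the empty set zero
  is the only possible value.\<close>

definition \<theta> where "\<theta> U f = (if U = {} then \<zero>\<^bsub>Q\<^esub> else \<tau> \<one>\<^bsub>W\<^esub> f)"

definition \<mu> where "\<mu> Y U a = (if Y \<in> U then m Y a else 0)"

lemma generic_condition: "cox_generic_condition X \<O> K R \<theta>"
  unfolding cox_generic_condition_def Let_def
proof (intro conjI allI impI)
  fix U assume U: "openin X U \<and> U \<noteq> {}"
  show "graded_simple K (sect S U) (hcomp S U)" using simple U by (simp add: S_nonempty)
  have "hdeg K SG ` H = carrier K"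
  proof (intro equalityI subsetI)
    fix w assume "w \<in> hdeg K SG ` H"
    then obtain a where a: "a \<in> H" "w = hdeg K SG a" by (metis imageE)
    then obtain v where v: "v \<in> carrier K" "a \<in> SG v" "a \<noteq> \<zero>\<^bsub>Q\<^esub>" using H_iff by metis
    then show "w \<in> carrier K" using Q.hdeg_eq[OF v] a by simp
  next
    fix w assume w: "w \<in> carrier K"
    then obtain D where D: "D \<in> carrier W" "w = c D" using c_surj by (metis imageE)
    have aH: "\<tau> D \<one>\<^bsub>FF\<^esub> \<in> H" using \<tau>_H[OF D(1)] by simp
    have "hdeg K SG (\<tau> D \<one>\<^bsub>FF\<^esub>) = w" using Q.hdeg_eq[of w "\<tau> D \<one>\<^bsub>FF\<^esub>"] w \<tau>_in[OF D(1) FF.one_closed] D(2) aH H_iff by simp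
    then show "w \<in> hdeg K SG ` H" using aH by (metis image_eqI)
  qed
  then show "hdeg K (hcomp S U) ` hsect K S U = carrier K" using U by (simp add: S_nonempty)
next
  show "ring_sheaf_iso X (rational_sheaf X \<O>) (degree_zero_part K S) \<theta>"
    unfolding ring_sheaf_iso_def
  proof (intro conjI allI impI)
    fix U assume "openin X U"
    show "\<theta> U \<in> ring_iso (sect (rational_sheaf X \<O>) U) (sect (degree_zero_part K S) U)"
    proof (cases "U = {}")
      case True
      then show ?thesis by (auto simp: ring_iso_def ring_hom_def rational_sect const_sect_def degree_zero_part_def S_hcomp S_empty \<theta>_def bij_betw_def)
    next
      case False
      have "\<tau> \<one>\<^bsub>W\<^esub> \<in> ring_iso FF (Q\<lparr>carrier := SG \<one>\<^bsub>K\<^esub>\<rparr>)"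
      proof (rule ring_iso_memI)
        fix f g assume f: "f \<in> carrier FF" "g \<in> carrier FF"
        show "\<tau> \<one>\<^bsub>W\<^esub> (f \<otimes>\<^bsub>FF\<^esub> g) = \<tau> \<one>\<^bsub>W\<^esub> f \<otimes>\<^bsub>Q\<lparr>carrier := SG \<one>\<^bsub>K\<^esub>\<rparr>\<^esub> \<tau> \<one>\<^bsub>W\<^esub> g"
          using \<tau>_mult[OF W.one_closed f(1) W.one_closed f(2)] by simp
        show "\<tau> \<one>\<^bsub>W\<^esub> (f \<oplus>\<^bsub>FF\<^esub> g) = \<tau> \<one>\<^bsub>W\<^esub> f \<oplus>\<^bsub>Q\<lparr>carrier := SG \<one>\<^bsub>K\<^esub>\<rparr>\<^esub> \<tau> \<one>\<^bsub>W\<^esub> g"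
          using \<tau>_add[OF W.one_closed f] by simp
      next
        show "\<tau> \<one>\<^bsub>W\<^esub> f \<in> carrier (Q\<lparr>carrier := SG \<one>\<^bsub>K\<^esub>\<rparr>)" if "f \<in> carrier FF" for f using \<tau>_in[OF W.one_closed that] c_one by simp
        show "\<tau> \<one>\<^bsub>W\<^esub> \<one>\<^bsub>FF\<^esub> = \<one>\<^bsub>Q\<lparr>carrier := SG \<one>\<^bsub>K\<^esub>\<rparr>\<^esub>" by (simp add: \<tau>_one)
        show "bij_betw (\<tau> \<one>\<^bsub>W\<^esub>) (carrier FF) (carrier (Q\<lparr>carrier := SG \<one>\<^bsub>K\<^esub>\<rparr>))"
        proof (rule bij_betwI')
          show "(\<tau> \<one>\<^bsub>W\<^esub> f = \<tau> \<one>\<^bsub>W\<^esub> g) = (f = g)" if "f \<in> carrier FF" "g \<in> carrier FF" for f g using \<tau>_inj[OF W.one_closed that] by blast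
          show "\<tau> \<one>\<^bsub>W\<^esub> f \<in> carrier (Q\<lparr>carrier := SG \<one>\<^bsub>K\<^esub>\<rparr>)" if "f \<in> carrier FF" for f using \<tau>_in[OF W.one_closed that] c_one by simp
          show "\<exists>f\<in>carrier FF. a = \<tau> \<one>\<^bsub>W\<^esub> f" if "a \<in> carrier (Q\<lparr>carrier := SG \<one>\<^bsub>K\<^esub>\<rparr>)" for a using \<tau>_surj[OF W.one_closed, of a] that c_one by simp
        qed
      qed
      moreover have "\<theta> U = \<tau> \<one>\<^bsub>W\<^esub>" using False by (simp add: \<theta>_def fun_eq_iff)
      ultimately show ?thesis using False by (simp add: rational_sect const_sect_def degree_zero_part_def S_nonempty)
    qed
  next
    fix U V s assume UV: "openin X U \<and> openin X V \<and> V \<subseteq> U \<and> s \<in> carrier (sect (rational_sheaf X \<O>) U)"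
    then have "V \<noteq> {} \<Longrightarrow> U \<noteq> {}" by blast
    then show "\<theta> V (restr (rational_sheaf X \<O>) U V s) = restr (degree_zero_part K S) U V (\<theta> U s)"
      by (cases "V = {}") (simp_all add: rational_sect const_restr_def degree_zero_part_def S_restr \<theta>_def)
  qed
qed

lemma m_finite: assumes a: "a \<in> H" shows "finite {Y \<in> PD. m Y a \<noteq> 0}"
proof -
  obtain D f where D: "D \<in> carrier W" "f \<in> carrier FF" "f \<noteq> \<zero>\<^bsub>FF\<^esub>" "a = \<tau> D f" using H_\<tau>[OF a] by metis
  have "{Y \<in> PD. m Y a \<noteq> 0} \<subseteq> {Y \<in> PD. \<nu> Y f \<noteq> 0} \<union> {Y \<in> PD. D Y \<noteq> 0}" using m_\<tau>[OF D(1,2,3)] D(4) by auto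
  then show ?thesis using \<nu>_finite[OF D(2,3)] D(1) unfolding W_carrier by (meson finite_Un finite_subset)
qed

lemma krull_condition: "cox_krull_condition X \<O> K R \<theta> \<mu>"
  unfolding cox_krull_condition_def
proof (intro conjI allI ballI impI)
  fix U assume U: "openin X U"
  show "inj_on (to_generic X R U) (carrier (sect R U))"
  proof (cases "U = {}")
    case True then show ?thesis using R_empty by (simp add: inj_on_def)
  next
    case False then show ?thesis using gr_inj[OF U] by (simp add: to_generic_nonempty)
  qed
next
  interpret E: cring "sect R {}" using rp.sect_cring[of "{}"] by simp
  have "krull_subsheaf X K S PD skyscraper (\<lambda>Y U a. if Y \<in> U then m Y a else 0) (\<lambda>U. to_generic X R U ` carrier (sect R U))"
  proof (rule krull_subsheafI)
    show "gval (m Y)" if "Y \<in> PD" for Y by (rule gval_m[OF that])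
    show "finite {Y \<in> PD. m Y a \<noteq> 0}" if "a \<in> H" for a by (rule m_finite[OF that])
    show "to_generic X R {} ` carrier (sect R {}) = {\<zero>\<^bsub>Q\<^esub>}" unfolding to_generic_empty using E.one_closed by blast
    show "to_generic X R U ` carrier (sect R U) = {a \<in> carrier Q. \<forall>w\<in>carrier K. \<forall>Y\<in>PD \<inter> U. Q.comp a w = \<zero>\<^bsub>Q\<^esub> \<or> 0 \<le> m Y (Q.comp a w)}"
      if "openin X U" "U \<noteq> {}" for U using gr_image[OF that] by (simp only: to_generic_nonempty[OF that(2)])
  qed
  moreover have "\<mu> = (\<lambda>Y U a. if Y \<in> U then m Y a else 0)" by (simp add: \<mu>_def fun_eq_iff)
  ultimately show "krull_subsheaf X K S PD skyscraper \<mu> (\<lambda>U. to_generic X R U ` carrier (sect R U))" by simp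
next
  fix Y U f assume Y: "Y \<in> PD" and U: "openin X U \<and> U \<noteq> {}" and f: "f \<in> carrier (mult_of (sect (rational_sheaf X \<O>) U))"
  have f': "f \<in> carrier FF" "f \<noteq> \<zero>\<^bsub>FF\<^esub>" using f U by (simp_all add: rational_sect const_sect_def)
  show "\<mu> Y U (\<theta> U f) = sheaf_valuation X \<O> Y U f"
    using U Y m_\<tau>[OF W.one_closed f' Y] by (simp add: \<mu>_def \<theta>_def sheaf_valuation_def W_one)
qed

lemma divisor_condition: "cox_divisor_condition X K R \<mu>"
  unfolding cox_divisor_condition_def Let_def
proof (intro conjI allI impI)
  fix U assume U: "openin X U \<and> U \<noteq> {}"
  have "divisor_map X \<mu> U ` H = carrier (WDiv X U)"
  proof (intro equalityI subsetI)
    fix D assume "D \<in> divisor_map X \<mu> U ` H"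
    then obtain a where a: "a \<in> H" "D = divisor_map X \<mu> U a" by (metis imageE)
    have "{Y \<in> PD. D Y \<noteq> 0} \<subseteq> {Y \<in> PD. m Y a \<noteq> 0}" by (auto simp: a(2) divisor_map_def \<mu>_def)
    then have "finite {Y \<in> PD. D Y \<noteq> 0}" using m_finite[OF a(1)] finite_subset by blast
    then show "D \<in> carrier (WDiv X U)" unfolding WDiv_carrier by (simp add: a(2) divisor_map_def \<mu>_def)
  next
    fix D assume D: "D \<in> carrier (WDiv X U)"
    then have DW: "D \<in> carrier W" and D0: "\<And>Y. Y \<in> PD - U \<Longrightarrow> D Y = 0" and ext: "D \<in> extensional PD"
      using PD_topspace by (auto simp: WDiv_carrier W_carrier)
    have one: "\<nu> Y \<one>\<^bsub>FF\<^esub> = 0" if "Y \<in> PD" for Y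
      using discretely_valued_field.val_one[OF \<nu>_field[OF that]] .
    \<comment> \<open>A divisor on U is regarded as one on X with zero entries outside U, and the
      monomial 1 chi^D has it as its divisor.\<close>
    have "D = divisor_map X \<mu> U (\<tau> D \<one>\<^bsub>FF\<^esub>)"
    proof (rule extensionalityI[OF ext])
      show "divisor_map X \<mu> U (\<tau> D \<one>\<^bsub>FF\<^esub>) \<in> extensional PD" by (simp add: divisor_map_def)
      fix Y assume Y: "Y \<in> PD"
      then show "D Y = divisor_map X \<mu> U (\<tau> D \<one>\<^bsub>FF\<^esub>) Y"
        using D0[of Y] one[OF Y] m_\<tau>[OF DW FF.one_closed FF.one_not_zero Y] by (simp add: divisor_map_def \<mu>_def)
    qed
    then show "D \<in> divisor_map X \<mu> U ` H" using \<tau>_H[OF DW FF.one_closed FF.one_not_zero] by (metis image_eqI)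
  qed
  then show "divisor_map X \<mu> U ` hsect K S U = carrier (WDiv X U)" using U by (simp add: S_nonempty)
next
  let ?T = "topspace X"
  have T: "openin X ?T" "?T \<noteq> {}" using topspace_nonempty by auto
  have n: "rp.nbhd ?T" using T rp_nbhd_iff by blast
  interpret T: graded K "sect R ?T" "hcomp R ?T" using R_comp[OF T(1)] .
  have d1: "divisor_map X \<mu> ?T a = \<one>\<^bsub>W\<^esub> \<longleftrightarrow> (\<forall>Y\<in>PD. m Y a = 0)" for a
    using PD_topspace by (auto simp: W_one divisor_map_def \<mu>_def fun_eq_iff)
  have uH: "gr ?T ` (hsect K R ?T \<inter> Units (sect R ?T)) \<subseteq> H"
  proof
    fix a assume "a \<in> gr ?T ` (hsect K R ?T \<inter> Units (sect R ?T))"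
    then obtain s where s: "s \<in> hsect K R ?T" "a = gr ?T s" by blast
    then obtain w where w: "w \<in> carrier K" "s \<in> hcomp R ?T w" "s \<noteq> \<zero>\<^bsub>sect R ?T\<^esub>" using T.homog_iff by blast
    have "gr ?T s \<noteq> gr ?T \<zero>\<^bsub>sect R ?T\<^esub>" using w gr_inj[OF T] T.G_carrier[OF w(1,2)] by (meson T.A.zero_closed inj_onD)
    then show "a \<in> H" using SG_H[OF w(1) SG_germ[OF n w(2)]] rp.germ_zero[OF n] s(2) by simp
  qed
  show "kernel (hsect_monoid K S ?T) W (divisor_map X \<mu> ?T) = to_generic X R ?T ` (hsect K R ?T \<inter> Units (sect R ?T))"
    unfolding to_generic_nonempty[OF T(2)]
  proof (intro equalityI subsetI)
    fix a assume "a \<in> kernel (hsect_monoid K S ?T) W (divisor_map X \<mu> ?T)"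
    then have "a \<in> H" "\<forall>Y\<in>PD. m Y a = 0" using d1 by (simp_all add: kernel_def homog_monoid_def S_nonempty[OF T(2)])
    then show "a \<in> gr ?T ` (hsect K R ?T \<inter> Units (sect R ?T))" using unit_section by blast
  next
    fix a assume a: "a \<in> gr ?T ` (hsect K R ?T \<inter> Units (sect R ?T))"
    then have "a \<in> H" using uH by blast
    then show "a \<in> kernel (hsect_monoid K S ?T) W (divisor_map X \<mu> ?T)"
      using unit_section a d1 by (simp add: kernel_def homog_monoid_def S_nonempty[OF T(2)])
  qed
  show "hsect K R ?T \<inter> Units (sect R ?T) = Units (sect (degree_zero_part K R) ?T)"
  proof (intro equalityI subsetI)
    fix u assume u: "u \<in> hsect K R ?T \<inter> Units (sect R ?T)"
    then have gH: "gr ?T u \<in> H" using uH by blast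
    have m0: "\<forall>Y\<in>PD. m Y (gr ?T u) = 0" using unit_section[OF gH] u by blast
    obtain w where w: "w \<in> carrier K" "u \<in> hcomp R ?T w" using u T.homog_iff by blast
    obtain D where D: "D \<in> carrier W" "w = c D" using w(1) c_surj by (metis imageE)
    have gS: "gr ?T u \<in> SG (c D)" using SG_germ[OF n w(2)] D(2) by simp
    obtain f where f: "f \<in> carrier FF" "gr ?T u = \<tau> D f" using \<tau>_surj[OF D(1) gS] by metis
    have f0: "f \<noteq> \<zero>\<^bsub>FF\<^esub>" using f gH H_iff \<tau>_zero[OF D(1)] by metis
    have i: "inv\<^bsub>FF\<^esub> f \<in> carrier FF" "inv\<^bsub>FF\<^esub> f \<noteq> \<zero>\<^bsub>FF\<^esub>" using inv_FF[OF f(1) f0] by auto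
    \<comment> \<open>A homogeneous unit is a monomial f chi^D with divisor zero, so D is the
      divisor of the inverse of f. It is principal, and the degree of the unit is trivial by
      \<open>c_ker\<close>.\<close>
    have "D Y = \<nu> Y (inv\<^bsub>FF\<^esub> f)" if Y: "Y \<in> PD" for Y
      using m_\<tau>[OF D(1) f(1) f0 Y] m0 Y f(2) discretely_valued_field.val_inv[OF \<nu>_field[OF Y] f(1) f0] by simp
    then have "c D = \<one>\<^bsub>K\<^esub>" using c_ker[OF D(1)] i by blast
    then have w1: "w = \<one>\<^bsub>K\<^esub>" using D(2) by simp
    have uu: "u \<in> Units (sect R ?T)" using u by blast
    have "inv\<^bsub>sect R ?T\<^esub> u \<in> hcomp R ?T \<one>\<^bsub>K\<^esub>" using T.inverse_degree[OF w uu] w1 by simp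
    then show "u \<in> Units (sect (degree_zero_part K R) ?T)"
      using w(2) w1 T.A.Units_r_inv[OF uu] T.A.Units_l_inv[OF uu] unfolding Units_def degree_zero_part_def by force
  next
    fix u assume "u \<in> Units (sect (degree_zero_part K R) ?T)"
    then obtain v where u: "u \<in> hcomp R ?T \<one>\<^bsub>K\<^esub>" "v \<in> hcomp R ?T \<one>\<^bsub>K\<^esub>" "v \<otimes>\<^bsub>sect R ?T\<^esub> u = \<one>\<^bsub>sect R ?T\<^esub>" "u \<otimes>\<^bsub>sect R ?T\<^esub> v = \<one>\<^bsub>sect R ?T\<^esub>"
      by (auto simp: Units_def degree_zero_part_def)
    have cu: "u \<in> carrier (sect R ?T)" "v \<in> carrier (sect R ?T)" using u T.G_carrier[OF K.one_closed] by blast+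
    then have uu: "u \<in> Units (sect R ?T)" using u unfolding Units_def by blast
    have "\<one>\<^bsub>sect R ?T\<^esub> \<noteq> \<zero>\<^bsub>sect R ?T\<^esub>" using rp.germ_one[OF n] rp.germ_zero[OF n] one_not_zero by metis
    then have "u \<noteq> \<zero>\<^bsub>sect R ?T\<^esub>" using u(4) cu by auto
    then show "u \<in> hsect K R ?T \<inter> Units (sect R ?T)" using uu u(1) T.homog_iff by blast
  qed
qed

end

section \<open>Monomials of the divisorial algebra and their images under a Cox sheaf\<close>

context krull_scheme_space
begin

lemma mono_add: "D \<in> carrier W \<Longrightarrow> mono (f \<oplus>\<^bsub>FF\<^esub> g) D = mono f D \<oplus>\<^bsub>sect DA U\<^esub> mono g D"
  unfolding DA_add by (simp add: mono_def fun_eq_iff restrict_def)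

lemma mono_one: "U \<noteq> {} \<Longrightarrow> mono \<one>\<^bsub>FF\<^esub> \<one>\<^bsub>W\<^esub> = \<one>\<^bsub>sect DA U\<^esub>"
  by (simp add: DA_one mono_def)

lemma mono_restr: "V \<noteq> {} \<Longrightarrow> restr DA U V (mono f D) = mono f D"
  by (simp add: DA_restr mono_def fun_eq_iff restrict_def)

text \<open>The convolution runs over the support of \<open>mono f D\<close>, which is empty for f =
  0; enlarging it to {D} treats all f alike.\<close>

lemma mono_mult:
  assumes U: "U \<noteq> {}" and D: "D \<in> carrier W" and f: "f \<in> carrier FF" and E: "E \<in> carrier W" and g: "g \<in> carrier FF"
  shows "mono (f \<otimes>\<^bsub>FF\<^esub> g) (D \<otimes>\<^bsub>W\<^esub> E) = mono f D \<otimes>\<^bsub>sect DA U\<^esub> mono g E"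
  unfolding DA_mult[OF U] mono_def[of "f \<otimes>\<^bsub>FF\<^esub> g"]
proof (rule restrict_ext)
  fix l assume l: "l \<in> carrier W"
  have iff: "inv\<^bsub>W\<^esub> D \<otimes>\<^bsub>W\<^esub> l = E \<longleftrightarrow> l = D \<otimes>\<^bsub>W\<^esub> E"
    using W.inv_solve_left'[OF E D l] D E l W.inv_solve_left by metis
  have mg: "mono g E (inv\<^bsub>W\<^esub> D \<otimes>\<^bsub>W\<^esub> l) = (if l = D \<otimes>\<^bsub>W\<^esub> E then g else \<zero>\<^bsub>FF\<^esub>)"
    using iff D l by (simp add: mono_def)
  have mf: "mono f D F \<otimes>\<^bsub>FF\<^esub> mono g E (inv\<^bsub>W\<^esub> F \<otimes>\<^bsub>W\<^esub> l) \<in> carrier FF" if "F \<in> carrier W" for F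
    using f g that l by (simp add: mono_def)
  have sub: "{F \<in> carrier W. mono f D F \<noteq> \<zero>\<^bsub>FF\<^esub>} \<subseteq> {D}" by (auto simp: mono_def)
  have "finsum FF (\<lambda>F. mono f D F \<otimes>\<^bsub>FF\<^esub> mono g E (inv\<^bsub>W\<^esub> F \<otimes>\<^bsub>W\<^esub> l)) {F \<in> carrier W. mono f D F \<noteq> \<zero>\<^bsub>FF\<^esub>}
      = finsum FF (\<lambda>F. mono f D F \<otimes>\<^bsub>FF\<^esub> mono g E (inv\<^bsub>W\<^esub> F \<otimes>\<^bsub>W\<^esub> l)) {D}"
  proof (rule FF.add.finprod_mono_neutral_cong_left)
    show "finite {D}" by simp
    show "{F \<in> carrier W. mono f D F \<noteq> \<zero>\<^bsub>FF\<^esub>} \<subseteq> {D}" by (rule sub)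
    show "mono f D F \<otimes>\<^bsub>FF\<^esub> mono g E (inv\<^bsub>W\<^esub> F \<otimes>\<^bsub>W\<^esub> l) = \<zero>\<^bsub>FF\<^esub>"
      if "F \<in> {D} - {F \<in> carrier W. mono f D F \<noteq> \<zero>\<^bsub>FF\<^esub>}" for F
    proof -
      have "F = D" "mono f D F = \<zero>\<^bsub>FF\<^esub>" using that D by auto
      then show ?thesis using mg g by simp
    qed
    show "(\<lambda>F. mono f D F \<otimes>\<^bsub>FF\<^esub> mono g E (inv\<^bsub>W\<^esub> F \<otimes>\<^bsub>W\<^esub> l)) \<in> {D} \<rightarrow> carrier FF" using mf D by simp
  qed simp
  also have "\<dots> = mono f D D \<otimes>\<^bsub>FF\<^esub> mono g E (inv\<^bsub>W\<^esub> D \<otimes>\<^bsub>W\<^esub> l)" using mf[OF D] by simp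
  also have "\<dots> = (if l = D \<otimes>\<^bsub>W\<^esub> E then f \<otimes>\<^bsub>FF\<^esub> g else \<zero>\<^bsub>FF\<^esub>)" unfolding mg using D f g by (simp add: mono_def)
  finally show "(if l = D \<otimes>\<^bsub>W\<^esub> E then f \<otimes>\<^bsub>FF\<^esub> g else \<zero>\<^bsub>FF\<^esub>) =
    finsum FF (\<lambda>F. mono f D F \<otimes>\<^bsub>FF\<^esub> mono g E (inv\<^bsub>W\<^esub> F \<otimes>\<^bsub>W\<^esub> l)) {F \<in> carrier W. mono f D F \<noteq> \<zero>\<^bsub>FF\<^esub>}" by (rule sym)
qed

lemma mono_bij:
  assumes U: "U \<noteq> {}" and D: "D \<in> carrier W"
  shows "bij_betw (\<lambda>f. mono f D) (DS D U) (hcomp DA U D)"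
proof (rule bij_betw_imageI)
  have at: "mono f D D = f" for f using D by (simp add: mono_def)
  show "inj_on (\<lambda>f. mono f D) (DS D U)" by (rule inj_on_inverseI[of _ "\<lambda>p. p D"]) (rule at)
  show "(\<lambda>f. mono f D) ` DS D U = hcomp DA U D"
  proof (intro equalityI subsetI)
    fix p assume "p \<in> (\<lambda>f. mono f D) ` DS D U"
    then show "p \<in> hcomp DA U D" using mono_in[OF U D] by (elim imageE) simp
  next
    fix p assume "p \<in> hcomp DA U D"
    then show "p \<in> (\<lambda>f. mono f D) ` DS D U" using DA_hcomp_mono[OF U D] by (intro image_eqI)
  qed
qed

lemma cls_one_iff:
  assumes D: "D \<in> carrier W"
  shows "cls D = \<one>\<^bsub>Clg\<^esub> \<longleftrightarrow> (\<exists>f\<in>carrier FF - {\<zero>\<^bsub>FF\<^esub>}. \<forall>Y\<in>PD. D Y = \<nu> Y f)"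
proof -
  have "cls \<one>\<^bsub>W\<^esub> = \<one>\<^bsub>Clg\<^esub>" by (rule hom_one[OF cls_hom W.is_group Cl_group])
  then show ?thesis using cls_cong[OF D W.one_closed] by (simp add: W_one)
qed

end

context graded_on_krull
begin

text \<open>The image of f chi^D under the component-wise isomorphic epimorphism is pulled back
  along the isomorphism from R. Bijectivity of both in each degree gives \<open>q_bij\<close>, and
  the kernel of the resulting degree map consists of the principal divisors.\<close>

lemma monomials_if_cox:
  assumes cox: "cox_sheaf X \<O> R'" and iso: "graded_isomorphism X K R Clg R' \<phi> \<rho>"
  shows "\<exists>c q. monomials X \<O> K R c q"
proof -
  obtain \<pi> where cie: "cie X W DA Clg R' cls \<pi>" using cox unfolding cox_sheaf_def by blast
  have \<pi>_hom: "\<pi> U \<in> ring_hom (sect DA U) (sect R' U)" if "openin X U" for U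
    using cie that by (simp add: cie_def graded_morphism_def)
  have \<pi>_restr: "\<pi> V (restr DA U V s) = restr R' U V (\<pi> U s)"
    if "openin X U" "openin X V" "V \<subseteq> U" "s \<in> carrier (sect DA U)" for U V s
    using cie that by (simp add: cie_def graded_morphism_def)
  have \<pi>_bij: "bij_betw (\<pi> U) (hcomp DA U D) (hcomp R' U (cls D))" if "openin X U" "D \<in> carrier W" for U D
    using cie that by (simp add: cie_def)
  have \<phi>: "\<phi> \<in> iso K Clg" using iso by (simp add: graded_isomorphism_def)
  have \<rho>_iso: "\<rho> U \<in> ring_iso (sect R U) (sect R' U)" if "openin X U" for U using iso that by (simp add: graded_isomorphism_def)
  have \<rho>_restr: "\<rho> V (restr R U V s) = restr R' U V (\<rho> U s)"
    if "openin X U" "openin X V" "V \<subseteq> U" "s \<in> carrier (sect R U)" for U V s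
    using iso that by (simp add: graded_isomorphism_def graded_morphism_def)
  have \<rho>_hcomp: "\<rho> U ` hcomp R U w = hcomp R' U (\<phi> w)" if "openin X U" "w \<in> carrier K" for U w
    using iso that by (simp add: graded_isomorphism_def)
  have \<rho>_bij: "bij_betw (\<rho> U) (carrier (sect R U)) (carrier (sect R' U))" if "openin X U" for U
    using \<rho>_iso[OF that] by (simp add: ring_iso_def)
  have \<rho>_hom: "\<rho> U \<in> ring_hom (sect R U) (sect R' U)" if "openin X U" for U
    using \<rho>_iso[OF that] by (simp add: ring_iso_def)
  define c where "c D = inv_into (carrier K) \<phi> (cls D)" for D
  define q where "q D f U = inv_into (carrier (sect R U)) (\<rho> U) (\<pi> U (mono f D))" for D f U
  have \<phi>i: "inv_into (carrier K) \<phi> \<in> iso Clg K" by (rule K.iso_set_sym[OF \<phi>])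
  have \<phi>_bij: "bij_betw \<phi> (carrier K) (carrier Clg)" using \<phi> by (simp add: iso_def)
  have cls_in: "cls D \<in> carrier Clg" if "D \<in> carrier W" for D using that unfolding Cl_carrier by blast
  have c: "c D \<in> carrier K" "\<phi> (c D) = cls D" if "D \<in> carrier W" for D
    using \<phi>_bij cls_in[OF that] unfolding c_def bij_betw_def by (metis inv_into_into, metis f_inv_into_f)
  have q\<rho>: "\<rho> U (q D f U) = \<pi> U (mono f D)" "q D f U \<in> carrier (sect R U)"
    and m_in: "mono f D \<in> carrier (sect DA U)"
    if U: "openin X U" "U \<noteq> {}" and D: "D \<in> carrier W" and f: "f \<in> DS D U" for U D f
  proof -
    show m: "mono f D \<in> carrier (sect DA U)" using mono_in[OF U(2) D f] unfolding DA_hcomp by simp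
    have "\<pi> U (mono f D) \<in> \<rho> U ` carrier (sect R U)"
      using ring_hom_closed[OF \<pi>_hom[OF U(1)] m] \<rho>_bij[OF U(1)] by (simp add: bij_betw_def)
    then show "\<rho> U (q D f U) = \<pi> U (mono f D)" "q D f U \<in> carrier (sect R U)"
      unfolding q_def by (rule f_inv_into_f, rule inv_into_into)
  qed
  have q_eqI: "q D f U = s"
    if U: "openin X U" "U \<noteq> {}" and D: "D \<in> carrier W" and f: "f \<in> DS D U" and s: "s \<in> carrier (sect R U)" "\<rho> U s = \<pi> U (mono f D)" for U D f s
    using \<rho>_bij[OF U(1)] q\<rho>[OF U D f] s unfolding bij_betw_def by (metis inj_onD)
  have "monomials X \<O> K R c q"
  proof (unfold_locales)
    have "inv_into (carrier K) \<phi> \<circ> cls \<in> hom W K" using \<phi>i by (intro hom_compose[OF cls_hom]) (simp add: iso_def)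
    moreover have "c = inv_into (carrier K) \<phi> \<circ> cls" by (simp add: c_def fun_eq_iff)
    ultimately show "c \<in> hom W K" by simp
    show "c ` carrier W = carrier K"
    proof (intro equalityI subsetI)
      fix w assume "w \<in> c ` carrier W" then show "w \<in> carrier K" using c by blast
    next
      fix w assume w: "w \<in> carrier K"
      then have "\<phi> w \<in> cls ` carrier W" using \<phi>_bij unfolding bij_betw_def Cl_carrier by blast
      then obtain D where D: "D \<in> carrier W" "\<phi> w = cls D" by (metis imageE)
      have "c D = w" unfolding c_def D(2)[symmetric] using \<phi>_bij w by (simp add: bij_betw_def)
      then show "w \<in> c ` carrier W" using D(1) by blast
    qed
    fix D assume D: "D \<in> carrier W"
    have "\<phi> \<one>\<^bsub>K\<^esub> = \<one>\<^bsub>Clg\<^esub>" using \<phi> by (intro hom_one[OF _ K.is_group Cl_group]) (simp add: iso_def)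
    then have "c D = \<one>\<^bsub>K\<^esub> \<longleftrightarrow> cls D = \<one>\<^bsub>Clg\<^esub>"
      using c[OF D] \<phi>_bij K.one_closed unfolding bij_betw_def by (metis inj_onD)
    then show "c D = \<one>\<^bsub>K\<^esub> \<longleftrightarrow> (\<exists>f\<in>carrier FF - {\<zero>\<^bsub>FF\<^esub>}. \<forall>Y\<in>PD. D Y = \<nu> Y f)" using cls_one_iff[OF D] by simp
    fix U assume U: "openin X U" "U \<noteq> {}"
    have "bij_betw (inv_into (carrier (sect R U)) (\<rho> U)) (hcomp R' U (cls D)) (hcomp R U (c D))"
      using bij_betw_inv_into_subset[OF \<rho>_bij[OF U(1)], of "hcomp R U (c D)" "hcomp R' U (cls D)"] \<rho>_hcomp[OF U(1) c(1)[OF D]] c(2)[OF D]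
        R_hcarrier[OF U(1) c(1)[OF D]] by auto
    then have "bij_betw (inv_into (carrier (sect R U)) (\<rho> U) \<circ> (\<pi> U \<circ> (\<lambda>f. mono f D))) (DS D U) (hcomp R U (c D))"
      by (intro bij_betw_trans[OF bij_betw_trans[OF mono_bij[OF U(2) D] \<pi>_bij[OF U(1) D]]])
    moreover have "inv_into (carrier (sect R U)) (\<rho> U) \<circ> (\<pi> U \<circ> (\<lambda>f. mono f D)) = (\<lambda>f. q D f U)" by (simp add: q_def fun_eq_iff)
    ultimately show "bij_betw (\<lambda>f. q D f U) (DS D U) (hcomp R U (c D))" by simp
  next
    fix U D f g assume U: "openin X U" "U \<noteq> {}" and D: "D \<in> carrier W" and f: "f \<in> DS D U" and g: "g \<in> DS D U"
    show "q D (f \<oplus>\<^bsub>FF\<^esub> g) U = q D f U \<oplus>\<^bsub>sect R U\<^esub> q D g U"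
    proof (rule q_eqI[OF U D DS_add[OF f g]])
      interpret A: cring "sect R U" using rp.sect_cring[OF U(1)] .
      show "q D f U \<oplus>\<^bsub>sect R U\<^esub> q D g U \<in> carrier (sect R U)" using q\<rho>(2)[OF U D f] q\<rho>(2)[OF U D g] by simp
      show "\<rho> U (q D f U \<oplus>\<^bsub>sect R U\<^esub> q D g U) = \<pi> U (mono (f \<oplus>\<^bsub>FF\<^esub> g) D)"
        unfolding ring_hom_add[OF \<rho>_hom[OF U(1)] q\<rho>(2)[OF U D f] q\<rho>(2)[OF U D g]] q\<rho>(1)[OF U D f] q\<rho>(1)[OF U D g] mono_add[OF D, of f g U]
        using ring_hom_add[OF \<pi>_hom[OF U(1)] m_in[OF U D f] m_in[OF U D g]] by simp
    qed
  next
    fix U D E f g assume U: "openin X U" "U \<noteq> {}" and D: "D \<in> carrier W" and E: "E \<in> carrier W" and f: "f \<in> DS D U" and g: "g \<in> DS E U"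
    show "q (D \<otimes>\<^bsub>W\<^esub> E) (f \<otimes>\<^bsub>FF\<^esub> g) U = q D f U \<otimes>\<^bsub>sect R U\<^esub> q E g U"
    proof (rule q_eqI[OF U W.m_closed[OF D E] DS_mult[OF f g]])
      interpret A: cring "sect R U" using rp.sect_cring[OF U(1)] .
      show "q D f U \<otimes>\<^bsub>sect R U\<^esub> q E g U \<in> carrier (sect R U)" using q\<rho>(2)[OF U D f] q\<rho>(2)[OF U E g] by simp
      show "\<rho> U (q D f U \<otimes>\<^bsub>sect R U\<^esub> q E g U) = \<pi> U (mono (f \<otimes>\<^bsub>FF\<^esub> g) (D \<otimes>\<^bsub>W\<^esub> E))"
        unfolding ring_hom_mult[OF \<rho>_hom[OF U(1)] q\<rho>(2)[OF U D f] q\<rho>(2)[OF U E g]] q\<rho>(1)[OF U D f] q\<rho>(1)[OF U E g]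
          mono_mult[OF U(2) D DS_carrier[OF f] E DS_carrier[OF g]]
        using ring_hom_mult[OF \<pi>_hom[OF U(1)] m_in[OF U D f] m_in[OF U E g]] by simp
    qed
  next
    fix U assume U: "openin X U" "U \<noteq> {}"
    interpret A: cring "sect R U" using rp.sect_cring[OF U(1)] .
    have one: "\<one>\<^bsub>FF\<^esub> \<in> DS \<one>\<^bsub>W\<^esub> U"
      using discretely_valued_field.val_one[OF \<nu>_field] by (simp add: DS_def W_one)
    show "q \<one>\<^bsub>W\<^esub> \<one>\<^bsub>FF\<^esub> U = \<one>\<^bsub>sect R U\<^esub>"
      by (rule q_eqI[OF U W.one_closed one A.one_closed])
        (simp only: mono_one[OF U(2)] ring_hom_one[OF \<rho>_hom[OF U(1)]] ring_hom_one[OF \<pi>_hom[OF U(1)]])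
  next
    fix U V D f assume U: "openin X U" and V: "openin X V" "V \<noteq> {}" "V \<subseteq> U" and D: "D \<in> carrier W" and f: "f \<in> DS D U"
    have Une: "U \<noteq> {}" using V by blast
    have fV: "f \<in> DS D V" using f DS_mono[OF V(3)] by blast
    show "restr R U V (q D f U) = q D f V"
    proof (rule q_eqI[OF V(1,2) D fV, symmetric])
      show "restr R U V (q D f U) \<in> carrier (sect R V)" using rp.r_closed[OF U V(1,3)] q\<rho>(2)[OF U Une D f] by simp
      show "\<rho> V (restr R U V (q D f U)) = \<pi> V (mono f D)"
        using \<rho>_restr[OF U V(1,3) q\<rho>(2)[OF U Une D f]] q\<rho>(1)[OF U Une D f] \<pi>_restr[OF U V(1,3) m_in[OF U Une D f]] mono_restr[OF V(2)] by simp
    qed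
  qed
  then show ?thesis by blast
qed

end

context cox_divisor_conditions
begin

text \<open>Regrading changes only the names of the degrees, so the identity on sections is the
  required isomorphism.\<close>

lemma isomorphic_to_cox: "isomorphic_to_cox_sheaf X \<O> K R"
proof -
  let ?R = "regrade K \<psi> R"
  have s: "sect ?R = sect R" "restr ?R = restr R" "hcomp ?R U c = hcomp R U (inv_into (carrier K) \<psi> c)" for U c
    by (simp_all add: regrade_def)
  have h: "hcomp ?R U (\<psi> w) = hcomp R U w" if "w \<in> carrier K" for U w
    using \<psi>_iso that by (simp add: s(3) iso_def bij_betw_def)
  have id_iso: "(\<lambda>s. s) \<in> ring_iso (sect R U) (sect R U)" for U by (simp add: ring_iso_def ring_hom_def bij_betw_def)
  have "graded_isomorphism X K R Clg ?R \<psi> (\<lambda>U s. s)"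
    unfolding graded_isomorphism_def graded_morphism_def s(1,2)
    using \<psi>_iso id_iso h by (simp add: iso_def ring_iso_def)
  then show ?thesis using regrade_cox unfolding isomorphic_to_cox_sheaf_def by blast
qed

end

theorem theorem1:
  fixes X :: "'p topology"
    and \<O> :: "('p, 'r) ring_presheaf"
    and K :: "'k monoid"
    and R :: "('p, 'a, 'k) graded_presheaf"
  assumes "krull_scheme X \<O>"
    and "comm_group K"
    and "graded_sheaf_on X K R"
  shows
    "(isomorphic_to_cox_sheaf X \<O> K R \<longleftrightarrow>
       (\<exists>\<theta> \<mu>. cox_generic_condition X \<O> K R \<theta> \<and>
              cox_krull_condition X \<O> K R \<theta> \<mu> \<and>
              cox_divisor_condition X K R \<mu>)) \<and>
     (\<forall>\<theta> \<mu>. cox_generic_condition X \<O> K R \<theta> \<and> cox_krull_condition X \<O> K R \<theta> \<mu>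
        \<longrightarrow> degree_zero_is_structure_sheaf X \<O> K R \<theta>) \<and>
     (\<forall>\<theta> \<mu>. cox_generic_condition X \<O> K R \<theta> \<and>
            cox_krull_condition X \<O> K R \<theta> \<mu> \<and>
            cox_divisor_condition X K R \<mu>
        \<longrightarrow> (\<exists>\<psi> \<in> iso K (Cl X \<O> (topspace X)).
              (\<forall>f \<in> hsect K (generic_sheaf X R) (topspace X).
                 \<psi> (hdeg K (hcomp (generic_sheaf X R) (topspace X)) f) =
                 divisor_class X \<O> (topspace X) (divisor_map X \<mu> (topspace X) f)) \<and>
              cox_sheaf X \<O> (regrade K \<psi> R)))"
proof -
  interpret graded_on_krull X \<O> K R using assms
    by (simp add: graded_on_krull_def graded_on_krull_axioms_def krull_scheme_space_def)
  have locale_conditions: "cox_divisor_conditions X \<O> K R \<theta> \<mu>"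
    if "cox_generic_condition X \<O> K R \<theta>" "cox_krull_condition X \<O> K R \<theta> \<mu>" "cox_divisor_condition X K R \<mu>" for \<theta> \<mu>
    using that by unfold_locales
  show ?thesis
  proof (intro conjI allI impI iffI)
    assume "isomorphic_to_cox_sheaf X \<O> K R"
    then obtain c q where "monomials X \<O> K R c q" unfolding isomorphic_to_cox_sheaf_def using monomials_if_cox by metis
    then interpret M: monomials X \<O> K R c q .
    show "\<exists>\<theta> \<mu>. cox_generic_condition X \<O> K R \<theta> \<and> cox_krull_condition X \<O> K R \<theta> \<mu> \<and> cox_divisor_condition X K R \<mu>"
      using M.generic_condition M.krull_condition M.divisor_condition by blast
  next
    assume "\<exists>\<theta> \<mu>. cox_generic_condition X \<O> K R \<theta> \<and> cox_krull_condition X \<O> K R \<theta> \<mu> \<and> cox_divisor_condition X K R \<mu>"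
    then show "isomorphic_to_cox_sheaf X \<O> K R" using cox_divisor_conditions.isomorphic_to_cox[OF locale_conditions] by blast
  next
    fix \<theta> \<mu> assume "cox_generic_condition X \<O> K R \<theta> \<and> cox_krull_condition X \<O> K R \<theta> \<mu>"
    then interpret C: cox_conditions X \<O> K R \<theta> \<mu> by unfold_locales auto
    show "degree_zero_is_structure_sheaf X \<O> K R \<theta>" by (rule C.degree_zero)
  next
    fix \<theta> \<mu> assume "cox_generic_condition X \<O> K R \<theta> \<and> cox_krull_condition X \<O> K R \<theta> \<mu> \<and> cox_divisor_condition X K R \<mu>"
    then interpret C: cox_divisor_conditions X \<O> K R \<theta> \<mu> using locale_conditions by blast
    show "\<exists>\<psi> \<in> iso K Clg. (\<forall>f \<in> hsect K S (topspace X).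
        \<psi> (hdeg K (hcomp S (topspace X)) f) = cls (divisor_map X \<mu> (topspace X) f)) \<and> cox_sheaf X \<O> (regrade K \<psi> R)"
    proof (intro bexI[OF _ C.\<psi>_iso] conjI ballI C.regrade_cox)
      fix f assume "f \<in> hsect K S (topspace X)"
      then have "f \<in> H" by (simp add: hsect_S[OF topspace_nonempty])
      then obtain w where w: "w \<in> carrier K" "f \<in> SG w" "f \<noteq> \<zero>\<^bsub>Q\<^esub>" using H_iff by metis
      have "hdeg K (hcomp S (topspace X)) f = w" using Q.hdeg_eq[OF w] by (simp add: S_nonempty[OF topspace_nonempty])
      then show "C.\<psi> (hdeg K (hcomp S (topspace X)) f) = cls (divisor_map X \<mu> (topspace X) f)" using C.\<psi>_eq[OF w] by simp
    qed
  qed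
qed

end
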